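(* Let $G_1$ and $G_2$ be two nontrivial countable discrete groups, at least one of which has more than two elements, and assume that $G_1$ and $G_2$ are both amenable. Let $G = G_1 * G_2$ be their free product. Then the full group $C^*$-algebra $C^*(G)$ is primitive.
   Context: For a countable discrete group $G$, $C^*(G)$ denotes its full (universal) group $C^*$-algebra. A $C^*$-algebra is primitive if it has a faithful irreducible representation on a Hilbert space. "Countable" includes finite. *)

theory Defs
  imports Complex_Main "HOL-Library.Countable_Set" "HOL-Algebra.Module"
begin

text \<open>The elements of a free product are the reduced words: lists of nontrivial letters, taken alternately from the
  two factors. Left multiplication of a reduced word by a letter merges the letter with the head
  of the word if both come from the same factor.\<close>

fun letter :: "('a, 'm) monoid_scheme \<Rightarrow> ('b, 'n) monoid_scheme \<Rightarrow> 'a + 'b \<Rightarrow> bool" where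
  "letter G H (Inl x) \<longleftrightarrow> x \<in> carrier G \<and> x \<noteq> \<one>\<^bsub>G\<^esub>"
| "letter G H (Inr y) \<longleftrightarrow> y \<in> carrier H \<and> y \<noteq> \<one>\<^bsub>H\<^esub>"

definition reduced_word ::
    "('a, 'm) monoid_scheme \<Rightarrow> ('b, 'n) monoid_scheme \<Rightarrow> ('a + 'b) list \<Rightarrow> bool" where
  "reduced_word G H w \<longleftrightarrow>
     (\<forall>l\<in>set w. letter G H l) \<and> successively (\<lambda>l l'. isl l \<noteq> isl l') w"

fun letter_mult ::
    "('a, 'm) monoid_scheme \<Rightarrow> ('b, 'n) monoid_scheme \<Rightarrow> 'a + 'b \<Rightarrow> ('a + 'b) list \<Rightarrow> ('a + 'b) list"
where
  "letter_mult G H (Inl x) (Inl y # w) =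
     (if x \<otimes>\<^bsub>G\<^esub> y = \<one>\<^bsub>G\<^esub> then w else Inl (x \<otimes>\<^bsub>G\<^esub> y) # w)"
| "letter_mult G H (Inr x) (Inr y # w) =
     (if x \<otimes>\<^bsub>H\<^esub> y = \<one>\<^bsub>H\<^esub> then w else Inr (x \<otimes>\<^bsub>H\<^esub> y) # w)"
| "letter_mult G H l w = l # w"

definition free_product ::
    "('a, 'm) monoid_scheme \<Rightarrow> ('b, 'n) monoid_scheme \<Rightarrow> ('a + 'b) list monoid" where
  "free_product G H =
     \<lparr>carrier = {w. reduced_word G H w},
      monoid.mult = (\<lambda>u v. foldr (letter_mult G H) u v),
      one = []\<rparr>"

text \<open>Amenability: a left invariant mean on the bounded real functions on the group. Positivity and
  additivity force the mean to depend only on the values on the carrier.\<close>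

definition bounded_fun_on :: "'a set \<Rightarrow> ('a \<Rightarrow> real) \<Rightarrow> bool" where
  "bounded_fun_on S f \<longleftrightarrow> (\<exists>B. \<forall>x\<in>S. \<bar>f x\<bar> \<le> B)"

definition amenable :: "('a, 'm) monoid_scheme \<Rightarrow> bool" where
  "amenable G \<longleftrightarrow> (\<exists>m :: ('a \<Rightarrow> real) \<Rightarrow> real.
     (\<forall>f h. bounded_fun_on (carrier G) f \<and> bounded_fun_on (carrier G) h \<longrightarrow>
        m (\<lambda>x. f x + h x) = m f + m h) \<and>
     (\<forall>c f. bounded_fun_on (carrier G) f \<longrightarrow> m (\<lambda>x. c * f x) = c * m f) \<and>
     (\<forall>f. bounded_fun_on (carrier G) f \<and> (\<forall>x\<in>carrier G. 0 \<le> f x) \<longrightarrow> 0 \<le> m f) \<and>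
     m (\<lambda>x. 1) = 1 \<and>
     (\<forall>g\<in>carrier G. \<forall>f. bounded_fun_on (carrier G) f \<longrightarrow>
        m (\<lambda>x. f (inv\<^bsub>G\<^esub> g \<otimes>\<^bsub>G\<^esub> x)) = m f))"

definition complex_ring :: "complex ring" where
  "complex_ring = \<lparr>carrier = UNIV, monoid.mult = (*), one = 1, zero = 0, add = (+)\<rparr>"

definition norm_cauchy :: "('a, 'm) ring_scheme \<Rightarrow> ('a \<Rightarrow> real) \<Rightarrow> (nat \<Rightarrow> 'a) \<Rightarrow> bool" where
  "norm_cauchy M p s \<longleftrightarrow> range s \<subseteq> carrier M \<and>
     (\<forall>e>0. \<exists>N. \<forall>m\<ge>N. \<forall>n\<ge>N. p (s m \<ominus>\<^bsub>M\<^esub> s n) < e)"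

definition norm_converges ::
    "('a, 'm) ring_scheme \<Rightarrow> ('a \<Rightarrow> real) \<Rightarrow> (nat \<Rightarrow> 'a) \<Rightarrow> 'a \<Rightarrow> bool" where
  "norm_converges M p s x \<longleftrightarrow> (\<lambda>n. p (s n \<ominus>\<^bsub>M\<^esub> x)) \<longlonglongrightarrow> 0"

definition norm_complete :: "('a, 'm) ring_scheme \<Rightarrow> ('a \<Rightarrow> real) \<Rightarrow> bool" where
  "norm_complete M p \<longleftrightarrow>
     (\<forall>s. norm_cauchy M p s \<longrightarrow> (\<exists>x\<in>carrier M. norm_converges M p s x))"

text \<open>The fields \<open>mult\<close> and \<open>one\<close> inherited from the library's module record are not used for
  Hilbert spaces. The inner product is linear in its first argument.\<close>

record 'h hilbert = "(complex, 'h) module" +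
  ip :: "'h \<Rightarrow> 'h \<Rightarrow> complex"

definition vnorm :: "('h, 'm) hilbert_scheme \<Rightarrow> 'h \<Rightarrow> real" where
  "vnorm H x = sqrt (Re (ip H x x))"

locale hilbert_space = Module.module complex_ring H for H (structure) +
  assumes ip_cnj: "\<lbrakk>x \<in> carrier H; y \<in> carrier H\<rbrakk> \<Longrightarrow> ip H y x = cnj (ip H x y)"
    and ip_add_left: "\<lbrakk>x \<in> carrier H; y \<in> carrier H; z \<in> carrier H\<rbrakk> \<Longrightarrow>
      ip H (x \<oplus> y) z = ip H x z + ip H y z"
    and ip_smult_left: "\<lbrakk>x \<in> carrier H; y \<in> carrier H\<rbrakk> \<Longrightarrow> ip H (c \<odot> x) y = c * ip H x y"
    and ip_ge_0: "x \<in> carrier H \<Longrightarrow> 0 \<le> Re (ip H x x)"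
    and ip_eq_0: "\<lbrakk>x \<in> carrier H; ip H x x = 0\<rbrakk> \<Longrightarrow> x = \<zero>"
    and complete: "norm_complete H (vnorm H)"

definition bounded_operator :: "('h, 'm) hilbert_scheme \<Rightarrow> ('h \<Rightarrow> 'h) \<Rightarrow> bool" where
  "bounded_operator H T \<longleftrightarrow>
     T \<in> carrier H \<rightarrow> carrier H \<and>
     (\<forall>x\<in>carrier H. \<forall>y\<in>carrier H. T (x \<oplus>\<^bsub>H\<^esub> y) = T x \<oplus>\<^bsub>H\<^esub> T y) \<and>
     (\<forall>c. \<forall>x\<in>carrier H. T (c \<odot>\<^bsub>H\<^esub> x) = c \<odot>\<^bsub>H\<^esub> T x) \<and>
     (\<exists>K. \<forall>x\<in>carrier H. vnorm H (T x) \<le> K * vnorm H x)"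

definition op_norm :: "('h, 'm) hilbert_scheme \<Rightarrow> ('h \<Rightarrow> 'h) \<Rightarrow> real" where
  "op_norm H T = (SUP x\<in>carrier H. vnorm H (T x) / vnorm H x)"

definition closed_subspace :: "('h, 'm) hilbert_scheme \<Rightarrow> 'h set \<Rightarrow> bool" where
  "closed_subspace H W \<longleftrightarrow>
     submodule W complex_ring H \<and>
     (\<forall>s. \<forall>x\<in>carrier H. range s \<subseteq> W \<and> norm_converges H (vnorm H) s x \<longrightarrow> x \<in> W)"

record 'a star_algebra = "(complex, 'a) module" +
  star :: "'a \<Rightarrow> 'a"

record 'a cstar = "'a star_algebra" +
  cnorm :: "'a \<Rightarrow> real"

text \<open>All algebras are unital, as is the full C*-algebra of any discrete group, and so are the
  representations. Unital representations of the group algebra are the same as unitary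
  representations of the group.\<close>

locale star_algebra = Module.module complex_ring A + ring A for A (structure) +
  assumes smult_mult_left: "\<lbrakk>x \<in> carrier A; y \<in> carrier A\<rbrakk> \<Longrightarrow> (c \<odot> x) \<otimes> y = c \<odot> (x \<otimes> y)"
    and smult_mult_right: "\<lbrakk>x \<in> carrier A; y \<in> carrier A\<rbrakk> \<Longrightarrow> x \<otimes> (c \<odot> y) = c \<odot> (x \<otimes> y)"
    and star_closed [simp, intro]: "x \<in> carrier A \<Longrightarrow> star A x \<in> carrier A"
    and star_star [simp]: "x \<in> carrier A \<Longrightarrow> star A (star A x) = x"
    and star_add: "\<lbrakk>x \<in> carrier A; y \<in> carrier A\<rbrakk> \<Longrightarrow> star A (x \<oplus> y) = star A x \<oplus> star A y"
    and star_smult: "x \<in> carrier A \<Longrightarrow> star A (c \<odot> x) = cnj c \<odot> star A x"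
    and star_mult: "\<lbrakk>x \<in> carrier A; y \<in> carrier A\<rbrakk> \<Longrightarrow> star A (x \<otimes> y) = star A y \<otimes> star A x"

locale c_star_algebra = star_algebra A for A (structure) +
  assumes cnorm_ge_0: "x \<in> carrier A \<Longrightarrow> 0 \<le> cnorm A x"
    and cnorm_eq_0: "x \<in> carrier A \<Longrightarrow> cnorm A x = 0 \<longleftrightarrow> x = \<zero>"
    and cnorm_add: "\<lbrakk>x \<in> carrier A; y \<in> carrier A\<rbrakk> \<Longrightarrow> cnorm A (x \<oplus> y) \<le> cnorm A x + cnorm A y"
    and cnorm_smult: "x \<in> carrier A \<Longrightarrow> cnorm A (c \<odot> x) = cmod c * cnorm A x"
    and cnorm_mult: "\<lbrakk>x \<in> carrier A; y \<in> carrier A\<rbrakk> \<Longrightarrow> cnorm A (x \<otimes> y) \<le> cnorm A x * cnorm A y"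
    and cnorm_star_mult: "x \<in> carrier A \<Longrightarrow> cnorm A (star A x \<otimes> x) = (cnorm A x)\<^sup>2"
    and complete: "norm_complete A (cnorm A)"

definition star_representation ::
    "('a, 'm) star_algebra_scheme \<Rightarrow> ('h, 'n) hilbert_scheme \<Rightarrow> ('a \<Rightarrow> 'h \<Rightarrow> 'h) \<Rightarrow> bool" where
  "star_representation A H \<pi> \<longleftrightarrow>
     hilbert_space H \<and>
     (\<forall>a\<in>carrier A. bounded_operator H (\<pi> a)) \<and>
     (\<forall>a\<in>carrier A. \<forall>b\<in>carrier A. \<forall>x\<in>carrier H.
        \<pi> (a \<oplus>\<^bsub>A\<^esub> b) x = \<pi> a x \<oplus>\<^bsub>H\<^esub> \<pi> b x \<and> \<pi> (a \<otimes>\<^bsub>A\<^esub> b) x = \<pi> a (\<pi> b x)) \<and>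
     (\<forall>c. \<forall>a\<in>carrier A. \<forall>x\<in>carrier H. \<pi> (c \<odot>\<^bsub>A\<^esub> a) x = c \<odot>\<^bsub>H\<^esub> \<pi> a x) \<and>
     (\<forall>x\<in>carrier H. \<pi> \<one>\<^bsub>A\<^esub> x = x) \<and>
     (\<forall>a\<in>carrier A. \<forall>x\<in>carrier H. \<forall>y\<in>carrier H. ip H (\<pi> a x) y = ip H x (\<pi> (star A a) y))"

definition faithful_representation ::
    "('a, 'm) star_algebra_scheme \<Rightarrow> ('h, 'n) hilbert_scheme \<Rightarrow> ('a \<Rightarrow> 'h \<Rightarrow> 'h) \<Rightarrow> bool" where
  "faithful_representation A H \<pi> \<longleftrightarrow> star_representation A H \<pi> \<and>
     (\<forall>a\<in>carrier A. (\<forall>x\<in>carrier H. \<pi> a x = \<zero>\<^bsub>H\<^esub>) \<longrightarrow> a = \<zero>\<^bsub>A\<^esub>)"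

definition irreducible_representation ::
    "('a, 'm) star_algebra_scheme \<Rightarrow> ('h, 'n) hilbert_scheme \<Rightarrow> ('a \<Rightarrow> 'h \<Rightarrow> 'h) \<Rightarrow> bool" where
  "irreducible_representation A H \<pi> \<longleftrightarrow> star_representation A H \<pi> \<and>
     carrier H \<noteq> {\<zero>\<^bsub>H\<^esub>} \<and>
     (\<forall>W. closed_subspace H W \<and> (\<forall>a\<in>carrier A. \<forall>x\<in>W. \<pi> a x \<in> W) \<longrightarrow>
        W = {\<zero>\<^bsub>H\<^esub>} \<or> W = carrier H)"

text \<open>HOL cannot quantify over all Hilbert spaces of all types. The type \<open>nat \<Rightarrow> 'a\<close> is large
  enough: if \<open>x\<close> is a cyclic vector for a representation \<open>\<pi>\<close> of \<open>A\<close>, every vector is the limit of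
  \<open>\<pi> (a n) x\<close> for some sequence \<open>a\<close> in \<open>A\<close>, so the Hilbert space has at most as many elements as
  there are such sequences, and it can be transported to a subset of \<open>nat \<Rightarrow> 'a\<close>. Irreducible
  representations are cyclic, and cyclic representations suffice to compute the universal norm
  below.\<close>

definition primitive_c_star_algebra :: "('a, 'm) cstar_scheme \<Rightarrow> bool" where
  "primitive_c_star_algebra A \<longleftrightarrow> c_star_algebra A \<and>
     (\<exists>(H :: (nat \<Rightarrow> 'a) hilbert) \<pi>.
        faithful_representation A H \<pi> \<and> irreducible_representation A H \<pi>)"

definition group_algebra :: "('g, 'm) monoid_scheme \<Rightarrow> ('g \<Rightarrow> complex) star_algebra" where
  "group_algebra G =
     \<lparr>carrier = {f. finite {x. f x \<noteq> 0} \<and> {x. f x \<noteq> 0} \<subseteq> carrier G},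
      monoid.mult = (\<lambda>f h x. if x \<in> carrier G
        then \<Sum>y | f y \<noteq> 0. f y * h (inv\<^bsub>G\<^esub> y \<otimes>\<^bsub>G\<^esub> x) else 0),
      one = (\<lambda>x. if x = \<one>\<^bsub>G\<^esub> then 1 else 0),
      zero = (\<lambda>x. 0),
      add = (\<lambda>f h x. f x + h x),
      smult = (\<lambda>c f x. c * f x),
      star = (\<lambda>f x. if x \<in> carrier G then cnj (f (inv\<^bsub>G\<^esub> x)) else 0)\<rparr>"

definition universal_norm :: "('a, 'm) star_algebra_scheme \<Rightarrow> 'a \<Rightarrow> real" where
  "universal_norm A a =
     Sup {op_norm H (\<pi> a) | (H :: (nat \<Rightarrow> 'a) hilbert) \<pi>. star_representation A H \<pi>}"

text \<open>The completion with respect to a seminorm \<open>p\<close>, as Cauchy sequences modulo null sequences.\<close>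

definition cauchy_class ::
    "('a, 'm) ring_scheme \<Rightarrow> ('a \<Rightarrow> real) \<Rightarrow> (nat \<Rightarrow> 'a) \<Rightarrow> (nat \<Rightarrow> 'a) set" where
  "cauchy_class A p s =
     {t. norm_cauchy A p t \<and> (\<lambda>n. p (s n \<ominus>\<^bsub>A\<^esub> t n)) \<longlonglongrightarrow> 0}"

definition class_rep :: "(nat \<Rightarrow> 'a) set \<Rightarrow> nat \<Rightarrow> 'a" where
  "class_rep X = (SOME s. s \<in> X)"

definition completion ::
    "('a, 'm) star_algebra_scheme \<Rightarrow> ('a \<Rightarrow> real) \<Rightarrow> (nat \<Rightarrow> 'a) set cstar" where
  "completion A p =
     \<lparr>carrier = cauchy_class A p ` {s. norm_cauchy A p s},
      monoid.mult = (\<lambda>X Y. cauchy_class A p (\<lambda>n. class_rep X n \<otimes>\<^bsub>A\<^esub> class_rep Y n)),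
      one = cauchy_class A p (\<lambda>n. \<one>\<^bsub>A\<^esub>),
      zero = cauchy_class A p (\<lambda>n. \<zero>\<^bsub>A\<^esub>),
      add = (\<lambda>X Y. cauchy_class A p (\<lambda>n. class_rep X n \<oplus>\<^bsub>A\<^esub> class_rep Y n)),
      smult = (\<lambda>c X. cauchy_class A p (\<lambda>n. c \<odot>\<^bsub>A\<^esub> class_rep X n)),
      star = (\<lambda>X. cauchy_class A p (\<lambda>n. star A (class_rep X n))),
      cnorm = (\<lambda>X. lim (\<lambda>n. p (class_rep X n)))\<rparr>"

definition full_group_c_star_algebra ::
    "('g, 'm) monoid_scheme \<Rightarrow> (nat \<Rightarrow> 'g \<Rightarrow> complex) set cstar" where
  "full_group_c_star_algebra G = completion (group_algebra G) (universal_norm (group_algebra G))"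

text \<open>The rest of this theory checks that the constructions are meaningful: free products of groups
  are groups, and the full group C*-algebra of a group is a C*-algebra.\<close>

lemma reduced_word_Nil [simp]: "reduced_word G H []"
  by (simp add: reduced_word_def)

lemma reduced_word_Cons:
  "reduced_word G H (l # w) \<longleftrightarrow>
     letter G H l \<and> reduced_word G H w \<and> (w = [] \<or> isl l \<noteq> isl (hd w))"
  by (auto simp: reduced_word_def successively_Cons)

context
  fixes G :: "('a, 'm) monoid_scheme" and H :: "('b, 'n) monoid_scheme"
  assumes G: "group G" and H: "group H"
begin

interpretation G: group G by (rule G)
interpretation H: group H by (rule H)

lemma reduced_letter_mult:
  assumes "letter G H l" "reduced_word G H w"
  shows "reduced_word G H (letter_mult G H l w)"
  using assms
  by (cases "(G, H, l, w)" rule: letter_mult.cases) (auto simp: reduced_word_Cons)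

lemma reduced_foldr:
  assumes "\<forall>l\<in>set u. letter G H l" "reduced_word G H w"
  shows "reduced_word G H (foldr (letter_mult G H) u w)"
  using assms by (induction u) (auto intro: reduced_letter_mult)

lemma letter_mult_Inl:
  assumes "x \<in> carrier G" "y \<in> carrier G" "x \<noteq> \<one>\<^bsub>G\<^esub>" "y \<noteq> \<one>\<^bsub>G\<^esub>" "reduced_word G H w"
  shows "letter_mult G H (Inl x) (letter_mult G H (Inl y) w) =
    (if x \<otimes>\<^bsub>G\<^esub> y = \<one>\<^bsub>G\<^esub> then w else letter_mult G H (Inl (x \<otimes>\<^bsub>G\<^esub> y)) w)"
proof (cases "\<exists>z v. w = Inl z # v")
  case False
  then show ?thesis
    by (cases w; cases "hd w") auto
next
  case True
  then obtain z v where w: "w = Inl z # v" by blast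
  have z: "z \<in> carrier G" "z \<noteq> \<one>\<^bsub>G\<^esub>" and v: "v = [] \<or> \<not> isl (hd v)"
    using assms(5) by (auto simp: w reduced_word_Cons)
  have *: "letter_mult G H (Inl x) v = Inl x # v" for x
    using v by (cases v; cases "hd v") auto
  have e: "x \<otimes>\<^bsub>G\<^esub> (y \<otimes>\<^bsub>G\<^esub> z) = x \<otimes>\<^bsub>G\<^esub> y \<otimes>\<^bsub>G\<^esub> z"
    using assms z by (simp add: G.m_assoc)
  show ?thesis
  proof (cases "y \<otimes>\<^bsub>G\<^esub> z = \<one>\<^bsub>G\<^esub>")
    case True
    then have "x \<otimes>\<^bsub>G\<^esub> y \<otimes>\<^bsub>G\<^esub> z = x" using e assms by simp
    moreover have "x \<otimes>\<^bsub>G\<^esub> y = \<one>\<^bsub>G\<^esub> \<Longrightarrow> x = z"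
      using calculation z by simp
    ultimately show ?thesis
      using True assms by (auto simp: w *)
  next
    case False
    then show ?thesis
      using assms z by (auto simp: w e)
  qed
qed

lemma letter_mult_Inr:
  assumes "x \<in> carrier H" "y \<in> carrier H" "x \<noteq> \<one>\<^bsub>H\<^esub>" "y \<noteq> \<one>\<^bsub>H\<^esub>" "reduced_word G H w"
  shows "letter_mult G H (Inr x) (letter_mult G H (Inr y) w) =
    (if x \<otimes>\<^bsub>H\<^esub> y = \<one>\<^bsub>H\<^esub> then w else letter_mult G H (Inr (x \<otimes>\<^bsub>H\<^esub> y)) w)"
proof (cases "\<exists>z v. w = Inr z # v")
  case False
  then show ?thesis
    by (cases w; cases "hd w") auto
next
  case True
  then obtain z v where w: "w = Inr z # v" by blast
  have z: "z \<in> carrier H" "z \<noteq> \<one>\<^bsub>H\<^esub>" and v: "v = [] \<or> isl (hd v)"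
    using assms(5) by (auto simp: w reduced_word_Cons)
  have *: "letter_mult G H (Inr x) v = Inr x # v" for x
    using v by (cases v; cases "hd v") auto
  have e: "x \<otimes>\<^bsub>H\<^esub> (y \<otimes>\<^bsub>H\<^esub> z) = x \<otimes>\<^bsub>H\<^esub> y \<otimes>\<^bsub>H\<^esub> z"
    using assms z by (simp add: H.m_assoc)
  show ?thesis
  proof (cases "y \<otimes>\<^bsub>H\<^esub> z = \<one>\<^bsub>H\<^esub>")
    case True
    then have "x \<otimes>\<^bsub>H\<^esub> y \<otimes>\<^bsub>H\<^esub> z = x" using e assms by simp
    moreover have "x \<otimes>\<^bsub>H\<^esub> y = \<one>\<^bsub>H\<^esub> \<Longrightarrow> x = z"
      using calculation z by simp
    ultimately show ?thesis
      using True assms by (auto simp: w *)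
  next
    case False
    then show ?thesis
      using assms z by (auto simp: w e)
  qed
qed

lemma foldr_letter_mult:
  assumes "letter G H l" "reduced_word G H v" "reduced_word G H w"
  shows "foldr (letter_mult G H) (letter_mult G H l v) w =
    letter_mult G H l (foldr (letter_mult G H) v w)"
proof -
  have r: "reduced_word G H (foldr (letter_mult G H) u w)" if "reduced_word G H u" for u
    using that assms(3) by (intro reduced_foldr) (auto simp: reduced_word_def)
  show ?thesis
    using assms(1,2)
    by (cases "(G, H, l, v)" rule: letter_mult.cases)
      (auto simp: letter_mult_Inl letter_mult_Inr reduced_word_Cons r)
qed

theorem group_free_product: "group (free_product G H)"
proof (rule groupI)
  fix u v assume "u \<in> carrier (free_product G H)" "v \<in> carrier (free_product G H)"
  then show "u \<otimes>\<^bsub>free_product G H\<^esub> v \<in> carrier (free_product G H)"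
    by (auto simp: free_product_def intro!: reduced_foldr) (auto simp: reduced_word_def)
next
  fix u v w
  assume uvw: "u \<in> carrier (free_product G H)" "v \<in> carrier (free_product G H)"
    "w \<in> carrier (free_product G H)"
  have v: "reduced_word G H v" and w: "reduced_word G H w"
    using uvw by (auto simp: free_product_def)
  have "foldr (letter_mult G H) (foldr (letter_mult G H) u v) w =
      foldr (letter_mult G H) u (foldr (letter_mult G H) v w)"
    if "\<forall>l\<in>set u. letter G H l" for u
    using that
  proof (induction u)
    case (Cons l u)
    then show ?case
      by (simp add: foldr_letter_mult reduced_foldr v w)
  qed simp
  moreover have "\<forall>l\<in>set u. letter G H l"
    using uvw by (simp add: free_product_def reduced_word_def)
  ultimately show "u \<otimes>\<^bsub>free_product G H\<^esub> v \<otimes>\<^bsub>free_product G H\<^esub> w =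
      u \<otimes>\<^bsub>free_product G H\<^esub> (v \<otimes>\<^bsub>free_product G H\<^esub> w)"
    by (simp add: free_product_def)
next
  fix w assume "w \<in> carrier (free_product G H)"
  then have w: "reduced_word G H w" by (simp add: free_product_def)
  let ?inv = "map_sum (m_inv G) (m_inv H)"
  have l: "letter G H (?inv l)" "letter_mult G H (?inv l) (l # v) = v" if "letter G H l" for l v
    using that by (cases l; auto)+
  have i: "isl (?inv l) = isl l" for l by (cases l) auto
  have "foldr (letter_mult G H) (rev (map ?inv w)) w = []"
    using w by (induction w) (auto simp: reduced_word_Cons l)
  moreover have "reduced_word G H (rev (map ?inv w))"
  proof -
    have a: "\<forall>l\<in>set w. letter G H l" and "successively (\<lambda>l l'. isl l \<noteq> isl l') w"
      using w by (auto simp: reduced_word_def)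
    from this(2) have "successively (\<lambda>l l'. isl l' \<noteq> isl l) w"
      by (rule successively_mono) auto
    then show ?thesis
      using a unfolding reduced_word_def successively_rev successively_map i by (auto simp: l)
  qed
  ultimately show "\<exists>v\<in>carrier (free_product G H). v \<otimes>\<^bsub>free_product G H\<^esub> w = \<one>\<^bsub>free_product G H\<^esub>"
    by (auto simp: free_product_def)
qed (auto simp: free_product_def)

end

lemma complex_ring_simps [simp]:
  "carrier complex_ring = UNIV" "\<one>\<^bsub>complex_ring\<^esub> = 1" "\<zero>\<^bsub>complex_ring\<^esub> = 0"
  "x \<otimes>\<^bsub>complex_ring\<^esub> y = x * y" "x \<oplus>\<^bsub>complex_ring\<^esub> y = x + y"
  by (simp_all add: complex_ring_def)

lemma cring_complex_ring: "cring complex_ring"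
proof -
  have "\<exists>y. y + x = 0" for x :: complex by (rule exI[of _ "- x"]) simp
  then show ?thesis
    by (intro cringI abelian_groupI comm_monoidI) (auto simp: algebra_simps)
qed

lemma complex_ring_a_inv [simp]: "\<ominus>\<^bsub>complex_ring\<^esub> x = - x"
proof -
  interpret cring complex_ring by (rule cring_complex_ring)
  show ?thesis using minus_equality[of "- x" x] by simp
qed

locale star_seminorm = star_algebra A for A :: "('a, 'm) star_algebra_scheme" (structure) +
  fixes p :: "'a \<Rightarrow> real"
  assumes p_ge_0: "x \<in> carrier A \<Longrightarrow> 0 \<le> p x"
    and p_add: "\<lbrakk>x \<in> carrier A; y \<in> carrier A\<rbrakk> \<Longrightarrow> p (x \<oplus> y) \<le> p x + p y"
    and p_smult: "x \<in> carrier A \<Longrightarrow> p (c \<odot> x) = cmod c * p x"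
    and p_mult: "\<lbrakk>x \<in> carrier A; y \<in> carrier A\<rbrakk> \<Longrightarrow> p (x \<otimes> y) \<le> p x * p y"
    and p_star_mult: "x \<in> carrier A \<Longrightarrow> p (star A x \<otimes> x) = (p x)\<^sup>2"
begin

lemma a_inv_eq: "x \<in> carrier A \<Longrightarrow> \<ominus> x = (-1) \<odot> x"
  using smult_l_minus[of 1 x] smult_one[of x] by simp

lemma p_zero [simp]: "p \<zero> = 0"
  using p_smult[of \<zero> 0] smult_l_null[of \<zero>] by simp

lemma p_a_inv: "x \<in> carrier A \<Longrightarrow> p (\<ominus> x) = p x"
  by (simp add: a_inv_eq p_smult)

lemma p_minus_commute: "\<lbrakk>x \<in> carrier A; y \<in> carrier A\<rbrakk> \<Longrightarrow> p (x \<ominus> y) = p (y \<ominus> x)"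
  using p_a_inv[of "x \<ominus> y"] by (simp add: minus_eq minus_add a_comm)

lemma minus_trans:
  "\<lbrakk>x \<in> carrier A; y \<in> carrier A; z \<in> carrier A\<rbrakk> \<Longrightarrow> x \<ominus> z = (x \<ominus> y) \<oplus> (y \<ominus> z)"
  by (simp add: minus_eq a_assoc r_neg1)

lemma p_triangle:
  "\<lbrakk>x \<in> carrier A; y \<in> carrier A; z \<in> carrier A\<rbrakk> \<Longrightarrow> p (x \<ominus> z) \<le> p (x \<ominus> y) + p (y \<ominus> z)"
  using p_add[of "x \<ominus> y" "y \<ominus> z"] minus_trans[of x y z] by simp

lemma p_diff: "\<lbrakk>x \<in> carrier A; y \<in> carrier A\<rbrakk> \<Longrightarrow> \<bar>p x - p y\<bar> \<le> p (x \<ominus> y)"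
  using p_triangle[of x y \<zero>] p_triangle[of y x \<zero>] p_minus_commute[of x y]
  by (simp add: minus_eq)

lemma p_star: "x \<in> carrier A \<Longrightarrow> p (star A x) = p x"
proof -
  have *: "p x \<le> p (star A x)" if "x \<in> carrier A" for x
  proof (cases "p x = 0")
    case False
    have "p x * p x \<le> p (star A x) * p x"
      using p_mult[of "star A x" x] p_star_mult[of x] that by (simp add: power2_eq_square)
    then show ?thesis using False p_ge_0[of x] that by simp
  qed (use p_ge_0 that in auto)
  then show "x \<in> carrier A \<Longrightarrow> p (star A x) = p x"
    using *[of x] *[of "star A x"] star_star[of x] by (metis antisym star_closed)
qed

abbreviation "cau \<equiv> norm_cauchy A p"
abbreviation "cls \<equiv> cauchy_class A p"
abbreviation "B \<equiv> completion A p"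

lemma cau_closed [simp, intro]: "cau s \<Longrightarrow> s n \<in> carrier A"
  by (auto simp: norm_cauchy_def)

lemma cauI:
  assumes "\<And>n. s n \<in> carrier A" "\<And>e. e > 0 \<Longrightarrow> \<exists>N. \<forall>m\<ge>N. \<forall>n\<ge>N. p (s m \<ominus> s n) < e"
  shows "cau s"
  using assms by (auto simp: norm_cauchy_def)

lemma cauD: "cau s \<Longrightarrow> e > 0 \<Longrightarrow> \<exists>N. \<forall>m\<ge>N. \<forall>n\<ge>N. p (s m \<ominus> s n) < e"
  by (auto simp: norm_cauchy_def)

lemma cau_dominated:
  assumes s: "cau s" and t: "cau t" and r: "\<And>n. r n \<in> carrier A" and K: "K \<ge> 0"
    and le: "\<And>m n. p (r m \<ominus> r n) \<le> K * (p (s m \<ominus> s n) + p (t m \<ominus> t n))"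
  shows "cau r"
proof (rule cauI[OF r])
  fix e :: real assume e: "e > 0"
  define d where "d = e / (2 * (K + 1))"
  have d: "d > 0" using e K by (simp add: d_def)
  obtain N1 N2 where N: "\<forall>m\<ge>N1. \<forall>n\<ge>N1. p (s m \<ominus> s n) < d" "\<forall>m\<ge>N2. \<forall>n\<ge>N2. p (t m \<ominus> t n) < d"
    using cauD[OF s d] cauD[OF t d] by blast
  have "p (r m \<ominus> r n) < e" if "m \<ge> max N1 N2" "n \<ge> max N1 N2" for m n
  proof -
    have "p (s m \<ominus> s n) < d" "p (t m \<ominus> t n) < d" using N that by auto
    then have "K * (p (s m \<ominus> s n) + p (t m \<ominus> t n)) \<le> K * (d + d)"
      using K by (intro mult_left_mono) auto
    also have "\<dots> < (K + 1) * (d + d)" using d by simp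
    also have "\<dots> = (2 * (K + 1)) * d" by simp
    also have "\<dots> = e" using K by (simp add: d_def)
    finally show ?thesis using le[of m n] by simp
  qed
  then show "\<exists>N. \<forall>m\<ge>N. \<forall>n\<ge>N. p (r m \<ominus> r n) < e" by blast
qed

lemma cau_bounded: assumes "cau s" shows "\<exists>K>0. \<forall>n. p (s n) \<le> K"
proof -
  obtain N where N: "\<forall>m\<ge>N. \<forall>n\<ge>N. p (s m \<ominus> s n) < 1"
    using cauD[OF assms, of 1] by auto
  define K where "K = Max ((\<lambda>n. p (s n)) ` {..N}) + 1"
  have *: "p (s n) + 1 \<le> K" if "n \<le> N" for n
    using that by (simp add: K_def)
  have "p (s n) \<le> K" for n
  proof (cases "n \<le> N")
    case False
    then have "p (s n \<ominus> s N) < 1" using N by simp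
    then show ?thesis
      using p_diff[of "s n" "s N"] *[of N] assms by auto
  qed (use * in force)
  moreover have "K > 0" using *[of 0] p_ge_0[of "s 0"] assms by auto
  ultimately show ?thesis by blast
qed

lemma cau_const [simp, intro]: "x \<in> carrier A \<Longrightarrow> cau (\<lambda>n. x)"
  by (rule cauI) (auto simp: minus_eq r_neg)

definition eqv where "eqv s t \<longleftrightarrow> (\<lambda>n. p (s n \<ominus> t n)) \<longlonglongrightarrow> 0"

lemma null_dominated:
  assumes "a \<longlonglongrightarrow> 0" "b \<longlonglongrightarrow> 0" "\<And>n. 0 \<le> c n" "\<And>n. c n \<le> K * (a n + b n)"
  shows "c \<longlonglongrightarrow> (0::real)"
proof (rule tendsto_sandwich[of "\<lambda>_. 0" c _ "\<lambda>n. K * (a n + b n)"])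
  show "(\<lambda>n. K * (a n + b n)) \<longlonglongrightarrow> 0"
    using tendsto_mult[OF tendsto_const[of K] tendsto_add[OF assms(1,2)]] by simp
qed (use assms in auto)

lemma eqv_dominated:
  assumes "eqv s s'" "eqv t t'" "\<And>n. r n \<in> carrier A" "\<And>n. r' n \<in> carrier A"
    "\<And>n. p (r n \<ominus> r' n) \<le> K * (p (s n \<ominus> s' n) + p (t n \<ominus> t' n))"
  shows "eqv r r'"
  unfolding eqv_def using assms
  by (intro null_dominated[OF assms(1,2)[unfolded eqv_def], where K = K]) (auto intro!: p_ge_0)

lemma eqv_refl: "cau s \<Longrightarrow> eqv s s"
  by (simp add: eqv_def minus_eq r_neg)

lemma eqv_sym: "cau s \<Longrightarrow> cau t \<Longrightarrow> eqv s t \<Longrightarrow> eqv t s"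
  by (simp add: eqv_def p_minus_commute)

lemma eqv_trans: "cau s \<Longrightarrow> cau t \<Longrightarrow> cau u \<Longrightarrow> eqv s t \<Longrightarrow> eqv t u \<Longrightarrow> eqv s u"
  by (rule eqv_dominated[of s t t u _ _ 1]) (auto intro: p_triangle)

lemma mem_cls: "t \<in> cls s \<longleftrightarrow> cau t \<and> eqv s t"
  by (simp add: cauchy_class_def eqv_def)

lemma cls_eq_iff: "cau s \<Longrightarrow> cau t \<Longrightarrow> cls s = cls t \<longleftrightarrow> eqv s t"
  by (auto simp: set_eq_iff mem_cls intro: eqv_refl eqv_sym eqv_trans)

lemma class_rep:
  assumes "cau s" shows "cau (class_rep (cls s))" "eqv s (class_rep (cls s))"
proof -
  have "s \<in> cls s" using assms by (simp add: mem_cls eqv_refl)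
  then have "class_rep (cls s) \<in> cls s" unfolding class_rep_def by (metis someI)
  then show "cau (class_rep (cls s))" "eqv s (class_rep (cls s))" by (auto simp: mem_cls)
qed

lemma minus_add_add:
  "\<lbrakk>x \<in> carrier A; y \<in> carrier A; x' \<in> carrier A; y' \<in> carrier A\<rbrakk> \<Longrightarrow>
    (x \<oplus> y) \<ominus> (x' \<oplus> y') = (x \<ominus> x') \<oplus> (y \<ominus> y')"
  by (simp add: minus_eq minus_add a_ac)

lemma p_minus_add:
  "\<lbrakk>x \<in> carrier A; y \<in> carrier A; x' \<in> carrier A; y' \<in> carrier A\<rbrakk> \<Longrightarrow>
    p ((x \<oplus> y) \<ominus> (x' \<oplus> y')) \<le> 1 * (p (x \<ominus> x') + p (y \<ominus> y'))"
  using p_add[of "x \<ominus> x'" "y \<ominus> y'"] by (simp add: minus_add_add)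

lemma p_minus_smult:
  "\<lbrakk>x \<in> carrier A; x' \<in> carrier A\<rbrakk> \<Longrightarrow> p ((c \<odot> x) \<ominus> (c \<odot> x')) = cmod c * p (x \<ominus> x')"
proof -
  assume x: "x \<in> carrier A" "x' \<in> carrier A"
  then have "(c \<odot> x) \<ominus> (c \<odot> x') = c \<odot> (x \<ominus> x')"
    using smult_r_minus[of c x'] by (simp add: minus_eq smult_r_distr)
  then show ?thesis using x by (simp add: p_smult)
qed

lemma p_minus_star:
  "\<lbrakk>x \<in> carrier A; x' \<in> carrier A\<rbrakk> \<Longrightarrow> p (star A x \<ominus> star A x') = p (x \<ominus> x')"
proof -
  assume x: "x \<in> carrier A" "x' \<in> carrier A"
  then have "star A x \<ominus> star A x' = star A (x \<ominus> x')"
    by (simp add: minus_eq star_add a_inv_eq star_smult)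
  then show ?thesis using x by (simp add: p_star)
qed

lemma p_minus_mult:
  assumes x: "x \<in> carrier A" "y \<in> carrier A" "x' \<in> carrier A" "y' \<in> carrier A"
    and K: "p x' \<le> K" "p y \<le> K"
  shows "p ((x \<otimes> y) \<ominus> (x' \<otimes> y')) \<le> K * (p (x \<ominus> x') + p (y \<ominus> y'))"
proof -
  have "(x \<otimes> y) \<ominus> (x' \<otimes> y) = (x \<ominus> x') \<otimes> y" "(x' \<otimes> y) \<ominus> (x' \<otimes> y') = x' \<otimes> (y \<ominus> y')"
    using x by (simp_all add: minus_eq l_distr r_distr l_minus r_minus)
  then have "p ((x \<otimes> y) \<ominus> (x' \<otimes> y')) \<le> p ((x \<ominus> x') \<otimes> y) + p (x' \<otimes> (y \<ominus> y'))"
    using p_triangle[of "x \<otimes> y" "x' \<otimes> y" "x' \<otimes> y'"] x by simp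
  also have "\<dots> \<le> p (x \<ominus> x') * p y + p x' * p (y \<ominus> y')"
    using x by (intro add_mono p_mult) auto
  also have "\<dots> \<le> p (x \<ominus> x') * K + K * p (y \<ominus> y')"
    using x K by (intro add_mono mult_left_mono mult_right_mono p_ge_0) auto
  finally show ?thesis by (simp add: algebra_simps)
qed

lemma cau_add [simp, intro]: "cau s \<Longrightarrow> cau t \<Longrightarrow> cau (\<lambda>n. s n \<oplus> t n)"
  by (rule cau_dominated[of s t _ 1]) (auto intro!: p_minus_add simp del: mult_1_left)

lemma cau_smult [simp, intro]: "cau s \<Longrightarrow> cau (\<lambda>n. c \<odot> s n)"
  by (rule cau_dominated[of s s _ "cmod c"]) (auto simp: p_minus_smult intro!: mult_left_mono mult_nonneg_nonneg p_ge_0)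

lemma cau_star [simp, intro]: "cau s \<Longrightarrow> cau (\<lambda>n. star A (s n))"
  by (rule cau_dominated[of s s _ 1]) (auto simp: p_minus_star intro!: p_ge_0)

lemma cau_mult [simp, intro]:
  assumes s: "cau s" and t: "cau t" shows "cau (\<lambda>n. s n \<otimes> t n)"
proof -
  obtain K L where KL: "K > 0" "\<forall>n. p (s n) \<le> K" "L > 0" "\<forall>n. p (t n) \<le> L"
    using cau_bounded[OF s] cau_bounded[OF t] by blast
  have K': "p (s n) \<le> K + L" "p (t n) \<le> K + L" for n
    using KL(2)[rule_format, of n] KL(4)[rule_format, of n] KL(1,3) by auto
  show ?thesis
    using s t KL K' by (intro cau_dominated[OF s t, of _ "K + L"]) (auto intro!: p_minus_mult)
qed

lemma add_cls [simp]:
  assumes "cau s" "cau t" shows "cls s \<oplus>\<^bsub>B\<^esub> cls t = cls (\<lambda>n. s n \<oplus> t n)"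
proof -
  note r = class_rep[OF assms(1)] class_rep[OF assms(2)]
  have "eqv (\<lambda>n. s n \<oplus> t n) (\<lambda>n. class_rep (cls s) n \<oplus> class_rep (cls t) n)"
    using assms r by (intro eqv_dominated[OF r(2,4), of _ _ 1] p_minus_add) auto
  then have "cls (\<lambda>n. s n \<oplus> t n) = cls (\<lambda>n. class_rep (cls s) n \<oplus> class_rep (cls t) n)"
    using assms r by (subst cls_eq_iff) auto
  then show ?thesis by (simp add: completion_def)
qed

lemma mult_cls [simp]:
  assumes "cau s" "cau t" shows "cls s \<otimes>\<^bsub>B\<^esub> cls t = cls (\<lambda>n. s n \<otimes> t n)"
proof -
  note r = class_rep[OF assms(1)] class_rep[OF assms(2)]
  obtain K L where KL: "K > 0" "\<forall>n. p (class_rep (cls s) n) \<le> K" "L > 0" "\<forall>n. p (t n) \<le> L"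
    using cau_bounded[OF r(1)] cau_bounded[OF assms(2)] by blast
  have K': "p (class_rep (cls s) n) \<le> K + L" "p (t n) \<le> K + L" for n
    using KL(2)[rule_format, of n] KL(4)[rule_format, of n] KL(1,3) by auto
  have "eqv (\<lambda>n. s n \<otimes> t n) (\<lambda>n. class_rep (cls s) n \<otimes> class_rep (cls t) n)"
    using assms r K' by (intro eqv_dominated[OF r(2,4), of _ _ "K + L"] p_minus_mult) auto
  then have "cls (\<lambda>n. s n \<otimes> t n) = cls (\<lambda>n. class_rep (cls s) n \<otimes> class_rep (cls t) n)"
    using assms r by (subst cls_eq_iff) auto
  then show ?thesis by (simp add: completion_def)
qed

lemma smult_cls [simp]:
  assumes "cau s" shows "c \<odot>\<^bsub>B\<^esub> cls s = cls (\<lambda>n. c \<odot> s n)"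
proof -
  note r = class_rep[OF assms]
  have "eqv (\<lambda>n. c \<odot> s n) (\<lambda>n. c \<odot> class_rep (cls s) n)"
    using assms r
    by (intro eqv_dominated[OF r(2,2), of _ _ "cmod c"])
      (auto simp: p_minus_smult intro!: mult_left_mono mult_nonneg_nonneg p_ge_0)
  then have "cls (\<lambda>n. c \<odot> s n) = cls (\<lambda>n. c \<odot> class_rep (cls s) n)"
    using assms r by (subst cls_eq_iff) auto
  then show ?thesis by (simp add: completion_def)
qed

lemma star_cls [simp]:
  assumes "cau s" shows "star B (cls s) = cls (\<lambda>n. star A (s n))"
proof -
  note r = class_rep[OF assms]
  have "eqv (\<lambda>n. star A (s n)) (\<lambda>n. star A (class_rep (cls s) n))"
    using assms r
    by (intro eqv_dominated[OF r(2,2), of _ _ 1])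
      (auto simp: p_minus_star algebra_simps intro!: p_ge_0)
  then have "cls (\<lambda>n. star A (s n)) = cls (\<lambda>n. star A (class_rep (cls s) n))"
    using assms r by (subst cls_eq_iff) auto
  then show ?thesis by (simp add: completion_def)
qed

lemma cau_norm_convergent: assumes "cau s" shows "convergent (\<lambda>n. p (s n))"
proof -
  have "Cauchy (\<lambda>n. p (s n))"
  proof (rule CauchyI)
    fix e :: real assume "e > 0"
    then obtain N where N: "\<forall>m\<ge>N. \<forall>n\<ge>N. p (s m \<ominus> s n) < e" using cauD[OF assms] by blast
    have "norm (p (s m) - p (s n)) < e" if "m \<ge> N" "n \<ge> N" for m n
      using p_diff[of "s m" "s n"] N that assms by fastforce
    then show "\<exists>M. \<forall>m\<ge>M. \<forall>n\<ge>M. norm (p (s m) - p (s n)) < e" by blast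
  qed
  then show ?thesis by (simp add: Cauchy_convergent_iff)
qed

lemma cnorm_cls: assumes "cau s" shows "(\<lambda>n. p (s n)) \<longlonglongrightarrow> cnorm B (cls s)"
proof -
  note r = class_rep[OF assms]
  have 1: "(\<lambda>n. p (class_rep (cls s) n)) \<longlonglongrightarrow> cnorm B (cls s)"
    using cau_norm_convergent[OF r(1)] by (simp add: completion_def convergent_LIMSEQ_iff)
  have "(\<lambda>n. p (s n) - p (class_rep (cls s) n)) \<longlonglongrightarrow> 0"
  proof (rule tendsto_rabs_zero_cancel)
    show "(\<lambda>n. \<bar>p (s n) - p (class_rep (cls s) n)\<bar>) \<longlonglongrightarrow> 0"
      using r(2)[unfolded eqv_def] by (rule null_dominated[of _ "\<lambda>_. 0" _ 1])
        (use assms r in \<open>auto intro!: p_diff\<close>)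
  qed
  from tendsto_add[OF this 1] show ?thesis by simp
qed

lemma cnorm_cls_eqI: "cau s \<Longrightarrow> (\<lambda>n. p (s n)) \<longlonglongrightarrow> c \<Longrightarrow> cnorm B (cls s) = c"
  using cnorm_cls LIMSEQ_unique by blast

lemma one_B: "\<one>\<^bsub>B\<^esub> = cls (\<lambda>n. \<one>)" and zero_B: "\<zero>\<^bsub>B\<^esub> = cls (\<lambda>n. \<zero>)"
  and carrier_B: "carrier B = cls ` {s. cau s}"
  by (simp_all add: completion_def)

lemma BE: assumes "X \<in> carrier B" obtains s where "cau s" "X = cls s"
  using assms by (auto simp: carrier_B)

lemma cls_carrier [simp, intro]: "cau s \<Longrightarrow> cls s \<in> carrier B"
  by (auto simp: carrier_B)

lemma cau_a_inv [simp, intro]: "cau s \<Longrightarrow> cau (\<lambda>n. \<ominus> s n)"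
  using cau_smult[of s "-1"] by (simp add: a_inv_eq)

lemma abelian_group_B: "abelian_group B"
proof (rule abelian_groupI)
  show "\<exists>Y\<in>carrier B. Y \<oplus>\<^bsub>B\<^esub> X = \<zero>\<^bsub>B\<^esub>" if X: "X \<in> carrier B" for X
  proof -
    obtain s where s: "cau s" "X = cls s" using X by (rule BE)
    then show ?thesis
      by (intro bexI[of _ "cls (\<lambda>n. \<ominus> s n)"]) (auto simp: zero_B l_neg)
  qed
qed (auto elim!: BE simp: zero_B a_ac)

lemma module_B: "Module.module complex_ring B"
  by (intro moduleI cring_complex_ring abelian_group_B)
    (auto elim!: BE simp: smult_l_distr[simplified] smult_r_distr smult_assoc1[simplified]
      smult_one[simplified])

lemma ring_B: "ring B"
  by (intro ringI abelian_group_B monoidI)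
    (auto elim!: BE simp: one_B m_assoc l_distr r_distr)

lemma star_algebra_B: "star_algebra B"
  by (intro star_algebra.intro module_B ring_B star_algebra_axioms.intro)
    (auto elim!: BE simp: smult_mult_left smult_mult_right star_add star_smult star_mult)

interpretation BB: star_algebra B by (rule star_algebra_B)

lemma a_inv_cls: "cau s \<Longrightarrow> \<ominus>\<^bsub>B\<^esub> cls s = cls (\<lambda>n. \<ominus> s n)"
  by (rule BB.minus_equality) (auto simp: zero_B l_neg)

lemma minus_cls: "cau s \<Longrightarrow> cau t \<Longrightarrow> cls s \<ominus>\<^bsub>B\<^esub> cls t = cls (\<lambda>n. s n \<ominus> t n)"
  by (simp add: BB.minus_eq a_inv_cls minus_eq)

lemma cau_minus [simp, intro]: "cau s \<Longrightarrow> cau t \<Longrightarrow> cau (\<lambda>n. s n \<ominus> t n)"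
  by (simp add: minus_eq)

lemma B_ge_0: assumes "X \<in> carrier B" shows "0 \<le> cnorm B X"
proof -
  obtain s where s: "cau s" "X = cls s" using assms by (rule BE)
  show ?thesis unfolding s(2)
    by (rule LIMSEQ_le_const[OF cnorm_cls]) (use s in \<open>auto intro!: p_ge_0\<close>)
qed

lemma B_add:
  assumes "X \<in> carrier B" "Y \<in> carrier B"
  shows "cnorm B (X \<oplus>\<^bsub>B\<^esub> Y) \<le> cnorm B X + cnorm B Y"
proof -
  obtain s where s: "cau s" "X = cls s" using assms(1) by (rule BE)
  obtain t where t: "cau t" "Y = cls t" using assms(2) by (rule BE)
  show ?thesis
    using LIMSEQ_le[OF cnorm_cls[OF cau_add[OF s(1) t(1)]]
        tendsto_add[OF cnorm_cls[OF s(1)] cnorm_cls[OF t(1)]]] s t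
    by (auto intro: p_add)
qed

lemma B_mult:
  assumes "X \<in> carrier B" "Y \<in> carrier B"
  shows "cnorm B (X \<otimes>\<^bsub>B\<^esub> Y) \<le> cnorm B X * cnorm B Y"
proof -
  obtain s where s: "cau s" "X = cls s" using assms(1) by (rule BE)
  obtain t where t: "cau t" "Y = cls t" using assms(2) by (rule BE)
  show ?thesis
    using LIMSEQ_le[OF cnorm_cls[OF cau_mult[OF s(1) t(1)]]
        tendsto_mult[OF cnorm_cls[OF s(1)] cnorm_cls[OF t(1)]]] s t
    by (auto intro: p_mult)
qed

lemma B_smult:
  assumes "X \<in> carrier B" shows "cnorm B (c \<odot>\<^bsub>B\<^esub> X) = cmod c * cnorm B X"
proof -
  obtain s where s: "cau s" "X = cls s" using assms(1) by (rule BE)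
  show ?thesis
    using tendsto_mult[OF tendsto_const[of "cmod c"] cnorm_cls[OF s(1)]] s
    by (auto intro!: cnorm_cls_eqI simp: p_smult)
qed

lemma B_star:
  assumes "X \<in> carrier B" shows "cnorm B (star B X \<otimes>\<^bsub>B\<^esub> X) = (cnorm B X)\<^sup>2"
proof -
  obtain s where s: "cau s" "X = cls s" using assms(1) by (rule BE)
  show ?thesis
    using tendsto_power[OF cnorm_cls[OF s(1)], of 2] s
    by (auto intro!: cnorm_cls_eqI simp: p_star_mult)
qed

lemma B_eq_0:
  assumes "X \<in> carrier B" shows "cnorm B X = 0 \<longleftrightarrow> X = \<zero>\<^bsub>B\<^esub>"
proof -
  obtain s where s: "cau s" "X = cls s" using assms(1) by (rule BE)
  have "X = \<zero>\<^bsub>B\<^esub> \<longleftrightarrow> eqv s (\<lambda>n. \<zero>)"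
    using s by (simp add: zero_B cls_eq_iff)
  also have "\<dots> \<longleftrightarrow> (\<lambda>n. p (s n)) \<longlonglongrightarrow> 0"
    using s by (simp add: eqv_def minus_eq)
  also have "\<dots> \<longleftrightarrow> cnorm B X = 0"
    using cnorm_cls[OF s(1)] cnorm_cls_eqI[OF s(1)] s(2) by metis
  finally show ?thesis by simp
qed

lemma B_const_dense:
  assumes "X \<in> carrier B" "e > 0"
  shows "\<exists>a\<in>carrier A. cnorm B (X \<ominus>\<^bsub>B\<^esub> cls (\<lambda>n. a)) \<le> e"
proof -
  obtain s where s: "cau s" "X = cls s" using assms(1) by (rule BE)
  obtain N where N: "\<forall>m\<ge>N. \<forall>n\<ge>N. p (s m \<ominus> s n) < e" using cauD[OF s(1) assms(2)] by blast
  have "cnorm B (cls (\<lambda>n. s n \<ominus> s N)) \<le> e"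
    by (rule LIMSEQ_le_const2[OF cnorm_cls]) (use s N in \<open>auto intro!: exI[of _ N] less_imp_le\<close>)
  then show ?thesis using s by (intro bexI[of _ "s N"]) (auto simp: minus_cls)
qed

lemma B_triangle:
  assumes "X \<in> carrier B" "Y \<in> carrier B" "Z \<in> carrier B"
  shows "cnorm B (X \<ominus>\<^bsub>B\<^esub> Z) \<le> cnorm B (X \<ominus>\<^bsub>B\<^esub> Y) + cnorm B (Y \<ominus>\<^bsub>B\<^esub> Z)"
proof -
  have "X \<ominus>\<^bsub>B\<^esub> Z = (X \<ominus>\<^bsub>B\<^esub> Y) \<oplus>\<^bsub>B\<^esub> (Y \<ominus>\<^bsub>B\<^esub> Z)"
    using assms by (simp add: BB.minus_eq BB.a_assoc BB.r_neg1)
  then show ?thesis using B_add[of "X \<ominus>\<^bsub>B\<^esub> Y" "Y \<ominus>\<^bsub>B\<^esub> Z"] assms by simp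
qed

lemma B_minus_commute:
  assumes "X \<in> carrier B" "Y \<in> carrier B"
  shows "cnorm B (X \<ominus>\<^bsub>B\<^esub> Y) = cnorm B (Y \<ominus>\<^bsub>B\<^esub> X)"
proof -
  have "Y \<ominus>\<^bsub>B\<^esub> X = (-1) \<odot>\<^bsub>B\<^esub> (X \<ominus>\<^bsub>B\<^esub> Y)"
    using assms BB.smult_l_minus[of 1 "X \<ominus>\<^bsub>B\<^esub> Y"] BB.smult_one[of "X \<ominus>\<^bsub>B\<^esub> Y"]
    by (simp add: BB.minus_eq BB.minus_add BB.a_comm)
  then show ?thesis using assms by (simp add: B_smult)
qed

lemma complete_B: "norm_complete B (cnorm B)"
  unfolding norm_complete_def
proof (intro allI impI)
  fix X assume X: "norm_cauchy B (cnorm B) X"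
  then have Xc [simp]: "X k \<in> carrier B" for k by (auto simp: norm_cauchy_def)
  have "\<exists>a\<in>carrier A. cnorm B (X k \<ominus>\<^bsub>B\<^esub> cls (\<lambda>n. a)) \<le> 1 / real (Suc k)" for k
    by (rule B_const_dense) auto
  then obtain d where d [simp]: "\<And>k. d k \<in> carrier A"
    and Xd: "\<And>k. cnorm B (X k \<ominus>\<^bsub>B\<^esub> cls (\<lambda>n. d k)) \<le> 1 / real (Suc k)"
    by metis
  have pd: "p (d k \<ominus> d l) \<le> 1 / real (Suc k) + cnorm B (X k \<ominus>\<^bsub>B\<^esub> X l) + 1 / real (Suc l)" for k l
  proof -
    have "p (d k \<ominus> d l) = cnorm B (cls (\<lambda>n. d k) \<ominus>\<^bsub>B\<^esub> cls (\<lambda>n. d l))"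
      using cnorm_cls_eqI[of "\<lambda>n. d k \<ominus> d l" "p (d k \<ominus> d l)"] by (simp add: minus_cls)
    also have "\<dots> \<le> cnorm B (cls (\<lambda>n. d k) \<ominus>\<^bsub>B\<^esub> X k) + (cnorm B (X k \<ominus>\<^bsub>B\<^esub> X l) +
        cnorm B (X l \<ominus>\<^bsub>B\<^esub> cls (\<lambda>n. d l)))"
      by (rule order_trans[OF B_triangle[of _ "X k"]]) (auto intro!: B_triangle)
    finally show ?thesis
      using Xd[of k] Xd[of l] B_minus_commute[of "X k" "cls (\<lambda>n. d k)"] by simp
  qed
  have inv: "\<exists>N. \<forall>n\<ge>N. 1 / real (Suc n) < e" if "e > 0" for e
    using LIMSEQ_inverse_real_of_nat that
    by (auto simp: LIMSEQ_iff inverse_eq_divide)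
  have dc: "cau d"
  proof (rule cauI[OF d])
    fix e :: real assume "e > 0"
    then have e: "e / 3 > 0" by simp
    obtain N where N: "\<forall>m\<ge>N. \<forall>n\<ge>N. cnorm B (X m \<ominus>\<^bsub>B\<^esub> X n) < e / 3"
      using X e unfolding norm_cauchy_def by blast
    obtain M where M: "\<forall>n\<ge>M. 1 / real (Suc n) < e / 3" using inv[OF e] by blast
    have "p (d k \<ominus> d l) < e" if "k \<ge> max M N" "l \<ge> max M N" for k l
    proof -
      have "1 / real (Suc k) < e/3" "1 / real (Suc l) < e/3" "cnorm B (X k \<ominus>\<^bsub>B\<^esub> X l) < e/3"
        using M N that by auto
      then show ?thesis using pd[of k l] by linarith
    qed
    then show "\<exists>N. \<forall>m\<ge>N. \<forall>n\<ge>N. p (d m \<ominus> d n) < e" by blast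
  qed
  have "norm_converges B (cnorm B) X (cls d)"
    unfolding norm_converges_def
  proof (rule LIMSEQ_I)
    fix e :: real assume "e > 0"
    then have e: "e / 3 > 0" by simp
    obtain N where N: "\<forall>m\<ge>N. \<forall>n\<ge>N. p (d m \<ominus> d n) < e / 3"
      using cauD[OF dc e] by blast
    obtain M where M: "\<forall>n\<ge>M. 1 / real (Suc n) < e / 3" using inv[OF e] by blast
    have "norm (cnorm B (X k \<ominus>\<^bsub>B\<^esub> cls d) - 0) < e" if k: "k \<ge> max M N" for k
    proof -
      have "cnorm B (cls (\<lambda>n. d k \<ominus> d n)) \<le> e / 3"
        by (rule LIMSEQ_le_const2[OF cnorm_cls])
          (use dc N k in \<open>auto intro!: exI[of _ N] less_imp_le\<close>)
      moreover have "1 / real (Suc k) < e/3" using M k by auto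
      moreover have "cnorm B (X k \<ominus>\<^bsub>B\<^esub> cls d) \<le>
          cnorm B (X k \<ominus>\<^bsub>B\<^esub> cls (\<lambda>n. d k)) + cnorm B (cls (\<lambda>n. d k) \<ominus>\<^bsub>B\<^esub> cls d)"
        using dc by (intro B_triangle) auto
      moreover have "0 \<le> cnorm B (X k \<ominus>\<^bsub>B\<^esub> cls d)" using dc by (intro B_ge_0) auto
      ultimately show ?thesis
        using Xd[of k] dc \<open>e > 0\<close> by (simp add: minus_cls)
    qed
    then show "\<exists>no. \<forall>n\<ge>no. norm (cnorm B (X n \<ominus>\<^bsub>B\<^esub> cls d) - 0) < e" by blast
  qed
  then show "\<exists>x\<in>carrier B. norm_converges B (cnorm B) X x" using dc by blast
qed

theorem c_star_algebra_completion: "c_star_algebra (completion A p)"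
  by (intro c_star_algebra.intro star_algebra_B c_star_algebra_axioms.intro complete_B
      B_ge_0 B_eq_0 B_add B_smult B_mult B_star)

end

context hilbert_space begin

lemma smult_closed' [simp, intro]: "x \<in> carrier H \<Longrightarrow> c \<odot> x \<in> carrier H"
  by (rule smult_closed) simp_all

lemma ip_add_right:
  "\<lbrakk>x \<in> carrier H; y \<in> carrier H; z \<in> carrier H\<rbrakk> \<Longrightarrow> ip H z (x \<oplus> y) = ip H z x + ip H z y"
  using ip_cnj[of "x \<oplus> y" z] ip_cnj[of x z] ip_cnj[of y z] by (simp add: ip_add_left)

lemma ip_smult_right:
  "\<lbrakk>x \<in> carrier H; y \<in> carrier H\<rbrakk> \<Longrightarrow> ip H x (c \<odot> y) = cnj c * ip H x y"
  using ip_cnj[of "c \<odot> y" x] ip_cnj[of y x] by (simp add: ip_smult_left)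

lemma ip_self: "x \<in> carrier H \<Longrightarrow> ip H x x = complex_of_real ((vnorm H x)\<^sup>2)"
  using ip_cnj[of x x] ip_ge_0[of x] by (simp add: vnorm_def complex_eq_iff)

lemma vnorm_ge_0: "x \<in> carrier H \<Longrightarrow> 0 \<le> vnorm H x"
  by (simp add: vnorm_def ip_ge_0)

lemma vnorm_sq: "x \<in> carrier H \<Longrightarrow> (vnorm H x)\<^sup>2 = Re (ip H x x)"
  by (simp add: vnorm_def ip_ge_0)

lemma vnorm_smult: "x \<in> carrier H \<Longrightarrow> vnorm H (c \<odot> x) = cmod c * vnorm H x"
proof -
  assume x: "x \<in> carrier H"
  have "ip H (c \<odot> x) (c \<odot> x) = (c * cnj c) * ip H x x"
    using x by (simp add: ip_smult_left ip_smult_right)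
  also have "\<dots> = complex_of_real ((cmod c * vnorm H x)\<^sup>2)"
    using x by (simp only: ip_self complex_norm_square[symmetric]) (simp add: power_mult_distrib)
  finally show ?thesis using x vnorm_ge_0[OF x] by (simp add: vnorm_def del: of_real_power)
qed

lemma vnorm_eq_0: "x \<in> carrier H \<Longrightarrow> vnorm H x = 0 \<longleftrightarrow> x = \<zero>"
  using ip_eq_0[of x] ip_self[of x] vnorm_smult[of \<zero> 0] by auto

lemma cauchy_schwarz:
  assumes x: "x \<in> carrier H" and y: "y \<in> carrier H"
  shows "cmod (ip H x y) \<le> vnorm H x * vnorm H y"
proof (cases "vnorm H y = 0")
  case True
  then have "y = 0 \<odot> y" using y vnorm_eq_0[OF y] by simp
  then have "ip H x y = 0" using ip_smult_right[OF x y, of 0] by simp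
  then show ?thesis using True by simp
next
  case False
  then have ypos: "vnorm H y > 0" using vnorm_ge_0[OF y] by simp
  define c where "c = - (ip H x y / complex_of_real ((vnorm H y)\<^sup>2))"
  define z where "z = x \<oplus> c \<odot> y"
  have z: "z \<in> carrier H" using x y by (simp add: z_def)
  have "ip H z y = ip H x y + c * ip H y y"
    using x y by (simp add: z_def ip_add_left ip_smult_left)
  also have "\<dots> = 0" using ypos y by (simp add: c_def ip_self)
  finally have zy: "ip H z y = 0" .
  have "ip H z z = ip H z (x \<oplus> c \<odot> y)" by (simp add: z_def)
  also have "\<dots> = ip H z x" using x y z zy by (simp add: ip_add_right ip_smult_right)
  also have "\<dots> = ip H x x + c * cnj (ip H x y)"
    using x y ip_cnj[of x y] by (simp add: z_def ip_add_left ip_smult_left)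
  also have "\<dots> = ip H x x - (ip H x y * cnj (ip H x y)) / complex_of_real ((vnorm H y)\<^sup>2)"
    by (simp add: c_def)
  also have "\<dots> = complex_of_real ((vnorm H x)\<^sup>2 - (cmod (ip H x y))\<^sup>2 / (vnorm H y)\<^sup>2)"
    using x by (simp only: ip_self complex_norm_square[symmetric]) simp
  finally have "0 \<le> (vnorm H x)\<^sup>2 - (cmod (ip H x y))\<^sup>2 / (vnorm H y)\<^sup>2"
    using ip_ge_0[OF z] by (simp only: Re_complex_of_real)
  then have "(cmod (ip H x y))\<^sup>2 \<le> (vnorm H x * vnorm H y)\<^sup>2"
    using ypos by (simp add: pos_divide_le_eq power_mult_distrib)
  then show ?thesis
    by (rule power2_le_imp_le) (intro mult_nonneg_nonneg vnorm_ge_0 x y)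
qed

lemma vnorm_add:
  assumes x: "x \<in> carrier H" and y: "y \<in> carrier H"
  shows "vnorm H (x \<oplus> y) \<le> vnorm H x + vnorm H y"
proof (rule power2_le_imp_le)
  have "(vnorm H (x \<oplus> y))\<^sup>2 = (vnorm H x)\<^sup>2 + (vnorm H y)\<^sup>2 + 2 * Re (ip H x y)"
    using x y ip_cnj[of x y] by (simp add: vnorm_sq ip_add_left ip_add_right)
  also have "\<dots> \<le> (vnorm H x)\<^sup>2 + (vnorm H y)\<^sup>2 + 2 * (vnorm H x * vnorm H y)"
    using order_trans[OF complex_Re_le_cmod cauchy_schwarz[OF x y]] by simp
  finally show "(vnorm H (x \<oplus> y))\<^sup>2 \<le> (vnorm H x + vnorm H y)\<^sup>2"
    by (simp add: power2_sum algebra_simps)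
qed (intro add_nonneg_nonneg vnorm_ge_0 x y)

lemma bdd_above_op_norm:
  assumes "\<And>x. x \<in> carrier H \<Longrightarrow> vnorm H (T x) \<le> K * vnorm H x"
  shows "x \<in> carrier H \<Longrightarrow> vnorm H (T x) / vnorm H x \<le> \<bar>K\<bar>"
    "bdd_above ((\<lambda>x. vnorm H (T x) / vnorm H x) ` carrier H)"
proof -
  show *: "vnorm H (T x) / vnorm H x \<le> \<bar>K\<bar>" if x: "x \<in> carrier H" for x
  proof (cases "vnorm H x = 0")
    case False
    then have "vnorm H x > 0" using vnorm_ge_0[OF x] by simp
    then show ?thesis using assms[OF x]
      by (simp add: pos_divide_le_eq) (meson abs_ge_self mult_right_mono order_trans less_imp_le)
  qed simp
  show "bdd_above ((\<lambda>x. vnorm H (T x) / vnorm H x) ` carrier H)" by (rule bdd_aboveI2) (rule *)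
qed

lemma op_norm_le:
  assumes "K \<ge> 0" "\<And>x. x \<in> carrier H \<Longrightarrow> vnorm H (T x) \<le> K * vnorm H x"
  shows "op_norm H T \<le> K"
  unfolding op_norm_def
  using bdd_above_op_norm(1)[of T K] assms by (intro cSUP_least) auto

lemma op_norm_ge_0:
  assumes "bounded_operator H T" shows "0 \<le> op_norm H T"
proof -
  obtain K where K: "\<And>x. x \<in> carrier H \<Longrightarrow> vnorm H (T x) \<le> K * vnorm H x"
    using assms unfolding bounded_operator_def by metis
  have "vnorm H (T \<zero>) / vnorm H \<zero> \<le> op_norm H T"
    unfolding op_norm_def by (rule cSUP_upper[OF _ bdd_above_op_norm(2)[OF K]]) auto
  then show ?thesis using vnorm_eq_0[of \<zero>] by simp
qed

lemma op_norm_bound: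
  assumes "bounded_operator H T" and x: "x \<in> carrier H"
  shows "vnorm H (T x) \<le> op_norm H T * vnorm H x"
proof -
  obtain K where K: "\<And>x. x \<in> carrier H \<Longrightarrow> vnorm H (T x) \<le> K * vnorm H x"
    using assms unfolding bounded_operator_def by metis
  have *: "vnorm H (T x) / vnorm H x \<le> op_norm H T"
    unfolding op_norm_def by (rule cSUP_upper[OF x bdd_above_op_norm(2)[OF K]])
  show ?thesis
  proof (cases "vnorm H x = 0")
    case True
    then show ?thesis using K[OF x] by simp
  next
    case False
    then have "vnorm H x > 0" using vnorm_ge_0[OF x] by simp
    then show ?thesis using * by (simp add: pos_divide_le_eq)
  qed
qed

end

definition zero_hilbert :: "(nat \<Rightarrow> 'a) hilbert" where
  "zero_hilbert = \<lparr>carrier = {undefined}, monoid.mult = (\<lambda>x y. undefined), one = undefined,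
     zero = undefined, add = (\<lambda>x y. undefined), smult = (\<lambda>c x. undefined), ip = (\<lambda>x y. 0)\<rparr>"

lemma hilbert_space_zero_hilbert: "hilbert_space zero_hilbert"
proof -
  have "abelian_group zero_hilbert"
    by (rule abelian_groupI) (auto simp: zero_hilbert_def)
  then have "Module.module complex_ring zero_hilbert"
    by (intro moduleI cring_complex_ring) (auto simp: zero_hilbert_def)
  then show ?thesis
    by (intro hilbert_space.intro hilbert_space_axioms.intro)
      (auto simp: zero_hilbert_def norm_complete_def norm_converges_def vnorm_def)
qed

locale star_algebra_bounded = star_algebra A for A :: "('a, 'm) star_algebra_scheme" (structure) +
  assumes bounded: "a \<in> carrier A \<Longrightarrow> \<exists>K. \<forall>(H :: (nat \<Rightarrow> 'a) hilbert) \<pi>.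
    star_representation A H \<pi> \<longrightarrow> (\<forall>x\<in>carrier H. vnorm H (\<pi> a x) \<le> K * vnorm H x)"
begin

lemma smult_closed' [simp, intro]: "x \<in> carrier A \<Longrightarrow> c \<odot> x \<in> carrier A"
  by (rule smult_closed) simp_all

lemma trivial_representation: "star_representation A zero_hilbert (\<lambda>a x. x)"
  unfolding star_representation_def
  using hilbert_space_zero_hilbert
  by (auto simp: bounded_operator_def zero_hilbert_def vnorm_def)

abbreviation "u \<equiv> universal_norm A"

lemma u_set:
  assumes "a \<in> carrier A"
  shows "bdd_above {op_norm H (\<pi> a) | (H :: (nat \<Rightarrow> 'a) hilbert) \<pi>. star_representation A H \<pi>}"
    (is "bdd_above ?S")
proof -
  obtain K where K: "\<And>(H :: (nat \<Rightarrow> 'a) hilbert) \<pi> x. star_representation A H \<pi> \<Longrightarrow>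
      x \<in> carrier H \<Longrightarrow> vnorm H (\<pi> a x) \<le> K * vnorm H x"
    using bounded[OF assms] by blast
  show ?thesis
  proof (rule bdd_aboveI[of _ "\<bar>K\<bar>"])
    fix r assume "r \<in> ?S"
    then obtain H :: "(nat \<Rightarrow> 'a) hilbert" and \<pi>
      where r: "r = op_norm H (\<pi> a)" and rep: "star_representation A H \<pi>" by blast
    interpret hilbert_space H using rep by (simp add: star_representation_def)
    show "r \<le> \<bar>K\<bar>" unfolding r
    proof (rule op_norm_le)
      fix x assume x: "x \<in> carrier H"
      have "K * vnorm H x \<le> \<bar>K\<bar> * vnorm H x"
        using vnorm_ge_0[OF x] by (simp add: mult_right_mono)
      then show "vnorm H (\<pi> a x) \<le> \<bar>K\<bar> * vnorm H x" using K[OF rep x] by simp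
    qed simp
  qed
qed

lemma op_norm_le_u:
  fixes H :: "(nat \<Rightarrow> 'a) hilbert"
  assumes "a \<in> carrier A" "star_representation A H \<pi>"
  shows "op_norm H (\<pi> a) \<le> u a"
  unfolding universal_norm_def
  by (rule cSup_upper[OF _ u_set[OF assms(1)]]) (use assms in blast)

lemma u_bound:
  fixes H :: "(nat \<Rightarrow> 'a) hilbert"
  assumes a: "a \<in> carrier A" and rep: "star_representation A H \<pi>" and x: "x \<in> carrier H"
  shows "vnorm H (\<pi> a x) \<le> u a * vnorm H x"
proof -
  interpret hilbert_space H using rep by (simp add: star_representation_def)
  have "bounded_operator H (\<pi> a)" using rep a by (simp add: star_representation_def)
  then have "vnorm H (\<pi> a x) \<le> op_norm H (\<pi> a) * vnorm H x" by (rule op_norm_bound[OF _ x])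
  also have "\<dots> \<le> u a * vnorm H x"
    by (intro mult_right_mono op_norm_le_u a rep vnorm_ge_0 x)
  finally show ?thesis .
qed

lemma u_least:
  assumes "K \<ge> 0"
    "\<And>(H :: (nat \<Rightarrow> 'a) hilbert) \<pi> x. \<lbrakk>star_representation A H \<pi>; hilbert_space H; x \<in> carrier H\<rbrakk> \<Longrightarrow>
       vnorm H (\<pi> a x) \<le> K * vnorm H x"
  shows "u a \<le> K"
  unfolding universal_norm_def
proof (rule cSup_least)
  show "{op_norm H (\<pi> a) |(H :: (nat \<Rightarrow> 'a) hilbert) \<pi>. star_representation A H \<pi>} \<noteq> {}"
    using trivial_representation by blast
next
  fix r
  assume "r \<in> {op_norm H (\<pi> a) |(H :: (nat \<Rightarrow> 'a) hilbert) \<pi>. star_representation A H \<pi>}"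
  then obtain H :: "(nat \<Rightarrow> 'a) hilbert" and \<pi>
    where r: "r = op_norm H (\<pi> a)" and rep: "star_representation A H \<pi>" by blast
  have H: "hilbert_space H" using rep by (simp add: star_representation_def)
  show "r \<le> K" unfolding r
    by (rule hilbert_space.op_norm_le[OF H assms(1)]) (use assms(2) rep H in auto)
qed

lemma u_ge_0: assumes a: "a \<in> carrier A" shows "0 \<le> u a"
proof -
  have "0 \<le> op_norm (zero_hilbert :: (nat \<Rightarrow> 'a) hilbert) (\<lambda>x. x)"
    by (rule hilbert_space.op_norm_ge_0[OF hilbert_space_zero_hilbert])
      (use trivial_representation a in \<open>auto simp: star_representation_def\<close>)
  also have "\<dots> \<le> u a" using op_norm_le_u[OF a trivial_representation] by simp
  finally show ?thesis .
qed

lemma repD: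
  assumes "star_representation A H \<pi>" "a \<in> carrier A" "b \<in> carrier A" "x \<in> carrier H"
  shows "\<pi> a x \<in> carrier H" "\<pi> (a \<oplus> b) x = \<pi> a x \<oplus>\<^bsub>H\<^esub> \<pi> b x" "\<pi> (a \<otimes> b) x = \<pi> a (\<pi> b x)"
    "\<pi> (c \<odot> a) x = c \<odot>\<^bsub>H\<^esub> \<pi> a x"
  using assms by (auto simp: star_representation_def bounded_operator_def)

lemma rep_ip:
  assumes "star_representation A H \<pi>" "a \<in> carrier A" "x \<in> carrier H" "y \<in> carrier H"
  shows "ip H (\<pi> a x) y = ip H x (\<pi> (star A a) y)"
  using assms by (auto simp: star_representation_def)

lemma u_add: assumes "a \<in> carrier A" "b \<in> carrier A" shows "u (a \<oplus> b) \<le> u a + u b"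
proof (rule u_least)
  fix H :: "(nat \<Rightarrow> 'a) hilbert" and \<pi> x
  assume rep: "star_representation A H \<pi>" and "hilbert_space H" and x: "x \<in> carrier H"
  then interpret H: hilbert_space H by simp
  have "vnorm H (\<pi> (a \<oplus> b) x) \<le> vnorm H (\<pi> a x) + vnorm H (\<pi> b x)"
    using repD[OF rep assms x] repD[OF rep assms(2,1) x] by (simp add: H.vnorm_add)
  also have "\<dots> \<le> u a * vnorm H x + u b * vnorm H x"
    using assms rep x by (intro add_mono u_bound)
  finally show "vnorm H (\<pi> (a \<oplus> b) x) \<le> (u a + u b) * vnorm H x"
    by (simp add: algebra_simps)
qed (use u_ge_0 assms in auto)

lemma u_mult: assumes "a \<in> carrier A" "b \<in> carrier A" shows "u (a \<otimes> b) \<le> u a * u b"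
proof (rule u_least)
  fix H :: "(nat \<Rightarrow> 'a) hilbert" and \<pi> x
  assume rep: "star_representation A H \<pi>" and "hilbert_space H" and x: "x \<in> carrier H"
  then interpret H: hilbert_space H by simp
  have "vnorm H (\<pi> (a \<otimes> b) x) \<le> u a * vnorm H (\<pi> b x)"
    using repD[OF rep assms x] repD[OF rep assms(2,1) x] u_bound[OF assms(1) rep] by simp
  also have "\<dots> \<le> u a * (u b * vnorm H x)"
    using assms rep x by (intro mult_left_mono u_bound u_ge_0)
  finally show "vnorm H (\<pi> (a \<otimes> b) x) \<le> u a * u b * vnorm H x"
    by (simp add: algebra_simps)
qed (use u_ge_0 assms in auto)

lemma u_smult_le: assumes "a \<in> carrier A" shows "u (c \<odot> a) \<le> cmod c * u a"
proof (rule u_least)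
  fix H :: "(nat \<Rightarrow> 'a) hilbert" and \<pi> x
  assume rep: "star_representation A H \<pi>" and "hilbert_space H" and x: "x \<in> carrier H"
  then interpret H: hilbert_space H by simp
  show "vnorm H (\<pi> (c \<odot> a) x) \<le> cmod c * u a * vnorm H x"
    using repD[OF rep assms assms x] u_bound[OF assms rep x]
    by (simp add: H.vnorm_smult mult.assoc mult_left_mono)
qed (use u_ge_0 assms in auto)

lemma u_smult: assumes "a \<in> carrier A" shows "u (c \<odot> a) = cmod c * u a"
proof (cases "c = 0")
  case True
  then show ?thesis
    using u_smult_le[OF assms, of c] u_ge_0[of "c \<odot> a"] assms by simp
next
  case False
  have "a = inverse c \<odot> (c \<odot> a)"
    using smult_assoc1[of "inverse c" c a] smult_one[of a] False assms by simp
  then have "u a \<le> cmod (inverse c) * u (c \<odot> a)"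
    using u_smult_le[of "c \<odot> a" "inverse c"] assms by simp
  then have "cmod c * u a \<le> u (c \<odot> a)"
    using False by (simp add: norm_inverse inverse_eq_divide norm_divide field_simps)
  then show ?thesis using u_smult_le[OF assms, of c] by simp
qed

lemma u_star_le: assumes a: "a \<in> carrier A" shows "u (star A a) \<le> u a"
proof (rule u_least)
  fix H :: "(nat \<Rightarrow> 'a) hilbert" and \<pi> x
  assume rep: "star_representation A H \<pi>" and "hilbert_space H" and x: "x \<in> carrier H"
  then interpret H: hilbert_space H by simp
  define y where "y = \<pi> (star A a) x"
  have y: "y \<in> carrier H" and ay: "\<pi> a y \<in> carrier H"
    using repD(1)[OF rep _ a] a x by (auto simp: y_def)
  have "(vnorm H y)\<^sup>2 = Re (ip H (\<pi> a y) x)"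
    using H.vnorm_sq[OF y] rep_ip[OF rep a y x] by (simp add: y_def)
  also have "\<dots> \<le> vnorm H (\<pi> a y) * vnorm H x"
    using order_trans[OF complex_Re_le_cmod H.cauchy_schwarz[OF ay x]] .
  also have "\<dots> \<le> u a * vnorm H y * vnorm H x"
    using a rep x y by (intro mult_right_mono u_bound H.vnorm_ge_0)
  finally have "vnorm H y * vnorm H y \<le> (u a * vnorm H x) * vnorm H y"
    by (simp add: power2_eq_square algebra_simps)
  then show "vnorm H (\<pi> (star A a) x) \<le> u a * vnorm H x"
    using H.vnorm_ge_0[OF y] mult_nonneg_nonneg[OF u_ge_0[OF a] H.vnorm_ge_0[OF x]]
    unfolding y_def[symmetric] by (metis mult_right_le_imp_le order_le_less)
qed (use u_ge_0 a in auto)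

lemma u_star_mult: assumes a: "a \<in> carrier A" shows "u (star A a \<otimes> a) = (u a)\<^sup>2"
proof (rule antisym)
  have "u (star A a \<otimes> a) \<le> u (star A a) * u a" using a by (intro u_mult) auto
  also have "\<dots> \<le> u a * u a" using a by (intro mult_right_mono u_star_le u_ge_0)
  finally show "u (star A a \<otimes> a) \<le> (u a)\<^sup>2" by (simp add: power2_eq_square)
  let ?b = "star A a \<otimes> a"
  have b: "?b \<in> carrier A" using a by simp
  have "u a \<le> sqrt (u ?b)"
  proof (rule u_least)
    fix H :: "(nat \<Rightarrow> 'a) hilbert" and \<pi> x
    assume rep: "star_representation A H \<pi>" and "hilbert_space H" and x: "x \<in> carrier H"
    then interpret H: hilbert_space H by simp
    have c: "\<pi> a x \<in> carrier H" "\<pi> ?b x \<in> carrier H"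
      using repD(1)[OF rep _ a] a x by auto
    have "(vnorm H (\<pi> a x))\<^sup>2 = Re (ip H x (\<pi> ?b x))"
      using H.vnorm_sq[OF c(1)] rep_ip[OF rep a x c(1)] repD(3)[OF rep _ a x, of "star A a"] a by simp
    also have "\<dots> \<le> vnorm H x * vnorm H (\<pi> ?b x)"
      using order_trans[OF complex_Re_le_cmod H.cauchy_schwarz[OF x c(2)]] .
    also have "\<dots> \<le> vnorm H x * (u ?b * vnorm H x)"
      using b rep x by (intro mult_left_mono u_bound H.vnorm_ge_0)
    also have "\<dots> = (sqrt (u ?b) * vnorm H x)\<^sup>2"
      using real_sqrt_pow2[OF u_ge_0[OF b]] by (simp only: power_mult_distrib power2_eq_square mult_ac)
    finally show "vnorm H (\<pi> a x) \<le> sqrt (u ?b) * vnorm H x"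
      by (rule power2_le_imp_le)
        (intro mult_nonneg_nonneg real_sqrt_ge_zero u_ge_0[OF b] H.vnorm_ge_0[OF x])
  qed (use u_ge_0 b in auto)
  then have "(u a)\<^sup>2 \<le> (sqrt (u ?b))\<^sup>2" using u_ge_0[OF a] by (intro power_mono)
  then show "(u a)\<^sup>2 \<le> u ?b" using u_ge_0[OF b] by simp
qed

lemma star_seminorm_u: "star_seminorm A u"
  by (intro star_seminorm.intro star_seminorm_axioms.intro star_algebra_axioms
      u_ge_0 u_add u_smult u_mult u_star_mult)

end

locale complex_group_algebra = group G for G :: "('a, 'm) monoid_scheme" (structure)
begin

abbreviation "CG \<equiv> group_algebra G"

lemma CG_simps:
  "carrier CG = {f. finite {x. f x \<noteq> 0} \<and> {x. f x \<noteq> 0} \<subseteq> carrier G}"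
  "\<one>\<^bsub>CG\<^esub> = (\<lambda>x. if x = \<one> then 1 else 0)" "\<zero>\<^bsub>CG\<^esub> = (\<lambda>x. 0)"
  "f \<oplus>\<^bsub>CG\<^esub> h = (\<lambda>x. f x + h x)" "c \<odot>\<^bsub>CG\<^esub> f = (\<lambda>x. c * f x)"
  "star CG f = (\<lambda>x. if x \<in> carrier G then cnj (f (inv x)) else 0)"
  "f \<otimes>\<^bsub>CG\<^esub> h = (\<lambda>x. if x \<in> carrier G then \<Sum>y | f y \<noteq> 0. f y * h (inv y \<otimes> x) else 0)"
  by (simp_all add: group_algebra_def)

lemma supp: "f \<in> carrier CG \<Longrightarrow> finite {x. f x \<noteq> 0}" "f \<in> carrier CG \<Longrightarrow> f x \<noteq> 0 \<Longrightarrow> x \<in> carrier G"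
  by (auto simp: CG_simps)

lemma CG_I: "finite S \<Longrightarrow> (\<And>x. f x \<noteq> 0 \<Longrightarrow> x \<in> S \<inter> carrier G) \<Longrightarrow> f \<in> carrier CG"
  by (auto simp: CG_simps intro: finite_subset[of _ S])

definition pair :: "('a \<Rightarrow> complex) \<Rightarrow> ('a \<Rightarrow> complex) \<Rightarrow> complex" where
  "pair f \<phi> = (\<Sum>y | f y \<noteq> 0. f y * \<phi> y)"

lemma pair_eq: "finite S \<Longrightarrow> {y. f y \<noteq> 0} \<subseteq> S \<Longrightarrow> pair f \<phi> = (\<Sum>y\<in>S. f y * \<phi> y)"
  unfolding pair_def by (rule sum.mono_neutral_left) auto

lemma pair_add_left:
  assumes "f \<in> carrier CG" "h \<in> carrier CG"
  shows "pair (\<lambda>x. f x + h x) \<phi> = pair f \<phi> + pair h \<phi>"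
proof -
  let ?S = "{x. f x \<noteq> 0} \<union> {x. h x \<noteq> 0}"
  have S: "finite ?S" using assms by (simp add: supp)
  have "pair f \<phi> = (\<Sum>y\<in>?S. f y * \<phi> y)" "pair h \<phi> = (\<Sum>y\<in>?S. h y * \<phi> y)"
    "pair (\<lambda>x. f x + h x) \<phi> = (\<Sum>y\<in>?S. (f y + h y) * \<phi> y)"
    by (rule pair_eq[OF S]; auto)+
  then show ?thesis by (simp add: sum.distrib distrib_right)
qed

lemma pair_smult_left:
  assumes "f \<in> carrier CG"
  shows "pair (\<lambda>x. c * f x) \<phi> = c * pair f \<phi>"
proof -
  let ?S = "{x. f x \<noteq> 0}"
  have S: "finite ?S" using assms by (simp add: supp)
  show ?thesis
    using pair_eq[OF S, of f] pair_eq[OF S, of "\<lambda>x. c * f x"]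
    by (auto simp: sum_distrib_left mult.assoc)
qed

lemma pair_add_right: "pair f (\<lambda>x. \<phi> x + \<psi> x) = pair f \<phi> + pair f \<psi>"
  by (simp add: pair_def sum.distrib algebra_simps)

lemma pair_smult_right: "pair f (\<lambda>x. c * \<phi> x) = c * pair f \<phi>"
  by (simp add: pair_def sum_distrib_left algebra_simps)

lemma pair_cong:
  assumes "f \<in> carrier CG" "\<And>x. x \<in> carrier G \<Longrightarrow> \<phi> x = \<psi> x" shows "pair f \<phi> = pair f \<psi>"
  unfolding pair_def using assms by (intro sum.cong) (auto dest: supp)

lemma pair_point: "finite {y. f y \<noteq> 0} \<Longrightarrow> pair f (\<lambda>y. if y = x then 1 else 0) = f x"
  unfolding pair_def by (simp add: if_distrib[of "(*) _"] cong: if_cong)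

lemma mult_eq: "f \<otimes>\<^bsub>CG\<^esub> h = (\<lambda>x. if x \<in> carrier G then pair f (\<lambda>y. h (inv y \<otimes> x)) else 0)"
  unfolding CG_simps pair_def by (rule refl)

lemma mult_closed_CG: assumes f: "f \<in> carrier CG" and h: "h \<in> carrier CG"
  shows "f \<otimes>\<^bsub>CG\<^esub> h \<in> carrier CG"
proof (rule CG_I)
  let ?S = "(\<lambda>(y, z). y \<otimes> z) ` ({y. f y \<noteq> 0} \<times> {z. h z \<noteq> 0})"
  show "finite ?S" using supp(1)[OF f] supp(1)[OF h] by blast
  fix x assume x: "(f \<otimes>\<^bsub>CG\<^esub> h) x \<noteq> 0"
  then have xG: "x \<in> carrier G" by (auto simp: mult_eq split: if_splits)
  have "(\<Sum>y | f y \<noteq> 0. f y * h (inv y \<otimes> x)) \<noteq> 0"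
    using x xG by (simp add: CG_simps)
  then obtain y where y: "f y \<noteq> 0" "h (inv y \<otimes> x) \<noteq> 0"
    by (metis (mono_tags, lifting) mem_Collect_eq mult_eq_0_iff sum.not_neutral_contains_not_neutral)
  have yG: "y \<in> carrier G" using supp(2)[OF f y(1)] .
  have "x = y \<otimes> (inv y \<otimes> x)" using xG yG by (simp add: m_assoc[symmetric])
  then have "x \<in> ?S" using y by force
  then show "x \<in> ?S \<inter> carrier G" using xG by simp
qed

lemma pair_mult:
  assumes f: "f \<in> carrier CG" and h: "h \<in> carrier CG"
  shows "pair (f \<otimes>\<^bsub>CG\<^esub> h) \<phi> = pair f (\<lambda>y. pair h (\<lambda>z. \<phi> (y \<otimes> z)))"
proof -
  let ?F = "{y. f y \<noteq> 0}" and ?H = "{z. h z \<noteq> 0}"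
  let ?S = "{x. (f \<otimes>\<^bsub>CG\<^esub> h) x \<noteq> 0} \<union> (\<lambda>(y, z). y \<otimes> z) ` (?F \<times> ?H)"
  have S: "finite ?S"
    using supp(1)[OF f] supp(1)[OF h] supp(1)[OF mult_closed_CG[OF f h]] by blast
  have SG: "?S \<subseteq> carrier G"
    using supp(2)[OF f] supp(2)[OF h] supp(2)[OF mult_closed_CG[OF f h]] by auto
  have "pair (f \<otimes>\<^bsub>CG\<^esub> h) \<phi> = (\<Sum>x\<in>?S. (f \<otimes>\<^bsub>CG\<^esub> h) x * \<phi> x)"
    using S by (rule pair_eq) auto
  also have "\<dots> = (\<Sum>x\<in>?S. \<Sum>y\<in>?F. f y * (h (inv y \<otimes> x) * \<phi> x))"
    using SG by (intro sum.cong refl) (auto simp: CG_simps sum_distrib_right mult.assoc)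
  also have "\<dots> = (\<Sum>y\<in>?F. f y * (\<Sum>x\<in>?S. h (inv y \<otimes> x) * \<phi> x))"
    by (subst sum.swap) (simp add: sum_distrib_left)
  also have "\<dots> = (\<Sum>y\<in>?F. f y * pair h (\<lambda>z. \<phi> (y \<otimes> z)))"
  proof (intro sum.cong refl arg_cong2[where f = "(*)"])
    fix y assume y: "y \<in> ?F"
    then have yG: "y \<in> carrier G" using supp(2)[OF f] by simp
    have inj: "inj_on ((\<otimes>) y) ?H"
      using supp(2)[OF h] yG by (intro inj_onI) auto
    have sub: "(\<otimes>) y ` ?H \<subseteq> ?S" using y by auto
    have "(\<Sum>x\<in>?S. h (inv y \<otimes> x) * \<phi> x) = (\<Sum>x\<in>(\<otimes>) y ` ?H. h (inv y \<otimes> x) * \<phi> x)"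
    proof (rule sum.mono_neutral_right[OF S sub], rule ballI, rule ccontr)
      fix x assume x: "x \<in> ?S - (\<otimes>) y ` ?H" and "h (inv y \<otimes> x) * \<phi> x \<noteq> 0"
      then have "inv y \<otimes> x \<in> ?H" by simp
      moreover have "x = y \<otimes> (inv y \<otimes> x)"
        using x SG yG by (auto simp: m_assoc[symmetric])
      ultimately show False using x by blast
    qed
    also have "\<dots> = (\<Sum>z\<in>?H. h (inv y \<otimes> (y \<otimes> z)) * \<phi> (y \<otimes> z))"
      by (simp add: sum.reindex[OF inj])
    also have "\<dots> = (\<Sum>z\<in>?H. h z * \<phi> (y \<otimes> z))"
      using supp(2)[OF h] yG by (intro sum.cong) (auto simp: m_assoc[symmetric])
    finally show "(\<Sum>x\<in>?S. h (inv y \<otimes> x) * \<phi> x) = pair h (\<lambda>z. \<phi> (y \<otimes> z))"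
      by (simp add: pair_def)
  qed
  finally show ?thesis by (simp add: pair_def)
qed

lemma pair_swap: "pair f (\<lambda>y. pair h (\<lambda>z. \<phi> y z)) = pair h (\<lambda>z. pair f (\<lambda>y. \<phi> y z))"
  unfolding pair_def sum_distrib_left
  by (subst sum.swap) (simp add: algebra_simps)

lemma CG_ext:
  assumes "f \<in> carrier CG" "h \<in> carrier CG" "\<And>x. x \<in> carrier G \<Longrightarrow> f x = h x"
  shows "f = h"
proof
  fix x show "f x = h x"
    using assms(3)[of x] supp(2)[OF assms(1), of x] supp(2)[OF assms(2), of x] by metis
qed

lemma add_closed_CG: "f \<in> carrier CG \<Longrightarrow> h \<in> carrier CG \<Longrightarrow> f \<oplus>\<^bsub>CG\<^esub> h \<in> carrier CG"
proof (rule CG_I[of "{x. f x \<noteq> 0} \<union> {x. h x \<noteq> 0}"])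
  assume "f \<in> carrier CG" "h \<in> carrier CG"
  then show "finite ({x. f x \<noteq> 0} \<union> {x. h x \<noteq> 0})" by (simp add: supp)
  fix x assume "(f \<oplus>\<^bsub>CG\<^esub> h) x \<noteq> 0"
  then have "f x \<noteq> 0 \<or> h x \<noteq> 0" by (auto simp: CG_simps)
  then show "x \<in> ({x. f x \<noteq> 0} \<union> {x. h x \<noteq> 0}) \<inter> carrier G"
    using supp(2)[OF \<open>f \<in> carrier CG\<close>] supp(2)[OF \<open>h \<in> carrier CG\<close>] by auto
qed

lemma smult_closed_CG: "f \<in> carrier CG \<Longrightarrow> c \<odot>\<^bsub>CG\<^esub> f \<in> carrier CG"
  by (rule CG_I[of "{x. f x \<noteq> 0}"]) (auto simp: supp, auto simp: CG_simps)

lemma star_closed_CG: "f \<in> carrier CG \<Longrightarrow> star CG f \<in> carrier CG"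
proof (rule CG_I[of "m_inv G ` {x. f x \<noteq> 0}"])
  fix x assume "f \<in> carrier CG" "star CG f x \<noteq> 0"
  then have "x \<in> carrier G" "f (inv x) \<noteq> 0" by (auto simp: CG_simps split: if_splits)
  moreover from this have "x = inv (inv x)" by simp
  ultimately show "x \<in> m_inv G ` {x. f x \<noteq> 0} \<inter> carrier G" by blast
qed (simp add: supp)

definition delta :: "'a \<Rightarrow> 'a \<Rightarrow> complex" where "delta g = (\<lambda>x. if x = g then 1 else 0)"

lemma delta_closed: "g \<in> carrier G \<Longrightarrow> delta g \<in> carrier CG"
  by (rule CG_I[of "{g}"]) (auto simp: delta_def split: if_splits)

lemma pair_delta: "pair (delta g) \<phi> = \<phi> g"
  by (subst pair_eq[of "{g}"]) (auto simp: delta_def)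

lemma one_CG: "\<one>\<^bsub>CG\<^esub> = delta \<one>" by (simp add: CG_simps delta_def)

lemma pair_delta_right: "f \<in> carrier CG \<Longrightarrow> pair f (delta x) = f x"
  unfolding delta_def by (rule pair_point) (rule supp)

lemma CG_eqI:
  assumes "f \<in> carrier CG" "h \<in> carrier CG" "\<And>\<phi>. pair f \<phi> = pair h \<phi>" shows "f = h"
  using assms pair_delta_right by (metis CG_ext)

lemma pair_star: "f \<in> carrier CG \<Longrightarrow> pair (star CG f) \<phi> = cnj (pair f (\<lambda>x. cnj (\<phi> (inv x))))"
proof -
  assume f: "f \<in> carrier CG"
  let ?F = "{x. f x \<noteq> 0}"
  have F: "x \<in> ?F \<Longrightarrow> x \<in> carrier G" for x using supp(2)[OF f] by simp
  have inj: "inj_on (m_inv G) ?F" by (rule inj_onI) (metis F inv_inv)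
  have "{y. star CG f y \<noteq> 0} \<subseteq> m_inv G ` ?F"
  proof
    fix x assume "x \<in> {y. star CG f y \<noteq> 0}"
    then have "x \<in> carrier G" "f (inv x) \<noteq> 0" by (auto simp: CG_simps split: if_splits)
    moreover from this have "x = inv (inv x)" by simp
    ultimately show "x \<in> m_inv G ` ?F" by blast
  qed
  then have "pair (star CG f) \<phi> = (\<Sum>y\<in>m_inv G ` ?F. star CG f y * \<phi> y)"
    using supp(1)[OF f] by (intro pair_eq) auto
  also have "\<dots> = (\<Sum>x\<in>?F. cnj (f x) * \<phi> (inv x))"
    unfolding sum.reindex[OF inj] by (rule sum.cong) (auto simp: CG_simps dest: supp(2)[OF f])
  finally show ?thesis by (simp add: pair_def)
qed

lemma pair_CG:
  "f \<in> carrier CG \<Longrightarrow> h \<in> carrier CG \<Longrightarrow> pair (f \<oplus>\<^bsub>CG\<^esub> h) \<phi> = pair f \<phi> + pair h \<phi>"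
  "f \<in> carrier CG \<Longrightarrow> pair (c \<odot>\<^bsub>CG\<^esub> f) \<phi> = c * pair f \<phi>"
  "pair \<one>\<^bsub>CG\<^esub> \<phi> = \<phi> \<one>" "pair \<zero>\<^bsub>CG\<^esub> \<phi> = 0"
  using pair_add_left pair_smult_left by (simp_all add: one_CG pair_delta) (simp_all add: CG_simps pair_def)

lemmas CG_closed = mult_closed_CG add_closed_CG smult_closed_CG star_closed_CG

lemma one_closed_CG: "\<one>\<^bsub>CG\<^esub> \<in> carrier CG" by (simp add: one_CG delta_closed)
lemma zero_closed_CG: "\<zero>\<^bsub>CG\<^esub> \<in> carrier CG" by (simp add: CG_simps)

lemma abelian_group_CG: "abelian_group CG"
proof (rule abelian_groupI)
  fix f assume f: "f \<in> carrier CG"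
  show "\<exists>h\<in>carrier CG. h \<oplus>\<^bsub>CG\<^esub> f = \<zero>\<^bsub>CG\<^esub>"
    using smult_closed_CG[OF f, of "-1"] by (intro bexI[of _ "(-1) \<odot>\<^bsub>CG\<^esub> f"]) (auto simp: CG_simps)
qed (auto intro: add_closed_CG zero_closed_CG, auto simp: CG_simps)

lemma module_CG: "Module.module complex_ring CG"
  by (intro moduleI cring_complex_ring abelian_group_CG)
    (auto intro: smult_closed_CG, auto simp: CG_simps algebra_simps)

lemma ring_CG: "ring CG"
proof (intro ringI abelian_group_CG monoidI)
  fix f h k assume c: "f \<in> carrier CG" "h \<in> carrier CG" "k \<in> carrier CG"
  show "f \<otimes>\<^bsub>CG\<^esub> h \<in> carrier CG" using c by (simp add: CG_closed)
  show "f \<otimes>\<^bsub>CG\<^esub> h \<otimes>\<^bsub>CG\<^esub> k = f \<otimes>\<^bsub>CG\<^esub> (h \<otimes>\<^bsub>CG\<^esub> k)"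
  proof (rule CG_eqI)
    fix \<phi>
    show "pair (f \<otimes>\<^bsub>CG\<^esub> h \<otimes>\<^bsub>CG\<^esub> k) \<phi> = pair (f \<otimes>\<^bsub>CG\<^esub> (h \<otimes>\<^bsub>CG\<^esub> k)) \<phi>"
      using c by (simp add: CG_closed pair_mult) (intro pair_cong; simp add: m_assoc)
  qed (use c in \<open>simp_all add: CG_closed\<close>)
  show "(f \<oplus>\<^bsub>CG\<^esub> h) \<otimes>\<^bsub>CG\<^esub> k = f \<otimes>\<^bsub>CG\<^esub> k \<oplus>\<^bsub>CG\<^esub> h \<otimes>\<^bsub>CG\<^esub> k"
    using c by (intro CG_eqI) (simp_all add: CG_closed pair_mult pair_CG)
  show "k \<otimes>\<^bsub>CG\<^esub> (f \<oplus>\<^bsub>CG\<^esub> h) = k \<otimes>\<^bsub>CG\<^esub> f \<oplus>\<^bsub>CG\<^esub> k \<otimes>\<^bsub>CG\<^esub> h"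
    using c by (intro CG_eqI) (simp_all add: CG_closed pair_mult pair_CG pair_add_right)
next
  show "\<one>\<^bsub>CG\<^esub> \<in> carrier CG" by (rule one_closed_CG)
next
  fix f assume c: "f \<in> carrier CG"
  have "pair f (\<lambda>z. \<phi> (\<one> \<otimes> z)) = pair f \<phi>" "pair f (\<lambda>z. \<phi> (z \<otimes> \<one>)) = pair f \<phi>" for \<phi>
    using c by (auto intro: pair_cong)
  then show "\<one>\<^bsub>CG\<^esub> \<otimes>\<^bsub>CG\<^esub> f = f" "f \<otimes>\<^bsub>CG\<^esub> \<one>\<^bsub>CG\<^esub> = f"
    using c by (auto intro!: CG_eqI simp: CG_closed one_closed_CG pair_mult pair_CG)
qed

lemma star_algebra_CG: "star_algebra CG"
proof (intro star_algebra.intro module_CG ring_CG star_algebra_axioms.intro)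
  fix f h c assume c: "f \<in> carrier CG" "h \<in> carrier CG"
  show "(c \<odot>\<^bsub>CG\<^esub> f) \<otimes>\<^bsub>CG\<^esub> h = c \<odot>\<^bsub>CG\<^esub> (f \<otimes>\<^bsub>CG\<^esub> h)"
    using c by (intro CG_eqI) (simp_all add: CG_closed pair_mult pair_CG)
  show "f \<otimes>\<^bsub>CG\<^esub> (c \<odot>\<^bsub>CG\<^esub> h) = c \<odot>\<^bsub>CG\<^esub> (f \<otimes>\<^bsub>CG\<^esub> h)"
    using c by (intro CG_eqI) (simp_all add: CG_closed pair_mult pair_CG pair_smult_right)
  show "star CG (f \<otimes>\<^bsub>CG\<^esub> h) = star CG h \<otimes>\<^bsub>CG\<^esub> star CG f"
  proof (rule CG_eqI)
    fix \<phi>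
    have "pair h (\<lambda>z. pair f (\<lambda>y. cnj (\<phi> (inv (y \<otimes> z))))) =
        pair h (\<lambda>z. pair f (\<lambda>y. cnj (\<phi> (inv z \<otimes> inv y))))"
      using c by (intro pair_cong) (auto simp: inv_mult_group)
    then show "pair (star CG (f \<otimes>\<^bsub>CG\<^esub> h)) \<phi> = pair (star CG h \<otimes>\<^bsub>CG\<^esub> star CG f) \<phi>"
      using c by (simp add: CG_closed pair_mult pair_star pair_swap[of f h])
  qed (use c in \<open>simp_all add: CG_closed\<close>)
next
  fix f assume c: "f \<in> carrier CG"
  show "star CG f \<in> carrier CG" using c by (rule star_closed_CG)
  show "star CG (star CG f) = f"
    using c by (intro CG_ext star_closed_CG) (auto simp: CG_simps)
qed (auto simp: CG_simps)

lemma delta_unitary: "g \<in> carrier G \<Longrightarrow> star CG (delta g) \<otimes>\<^bsub>CG\<^esub> delta g = \<one>\<^bsub>CG\<^esub>"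
  by (rule CG_eqI)
    (simp_all add: CG_closed delta_closed one_closed_CG pair_mult pair_star pair_delta pair_CG)

lemma delta_isometry:
  fixes H :: "('h, 'n) hilbert_scheme"
  assumes g: "g \<in> carrier G" and rep: "star_representation CG H \<pi>" and x: "x \<in> carrier H"
  shows "vnorm H (\<pi> (delta g) x) = vnorm H x"
proof -
  have d: "delta g \<in> carrier CG" "star CG (delta g) \<in> carrier CG"
    using g by (auto intro: delta_closed star_closed_CG)
  have y: "\<pi> (delta g) x \<in> carrier H"
    using rep d x by (auto simp: star_representation_def bounded_operator_def)
  have "ip H (\<pi> (delta g) x) (\<pi> (delta g) x) = ip H x (\<pi> (star CG (delta g) \<otimes>\<^bsub>CG\<^esub> delta g) x)"
    using rep d x y by (simp add: star_representation_def)
  also have "\<dots> = ip H x x"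
    unfolding delta_unitary[OF g] using rep x by (simp add: star_representation_def)
  finally show ?thesis by (simp add: vnorm_def)
qed

lemma CG_bounded:
  assumes "f \<in> carrier CG"
  shows "\<exists>K. \<forall>(H :: (nat \<Rightarrow> 'a \<Rightarrow> complex) hilbert) \<pi>. star_representation CG H \<pi> \<longrightarrow>
    (\<forall>x\<in>carrier H. vnorm H (\<pi> f x) \<le> K * vnorm H x)"
  using assms
proof (induction "card {x. f x \<noteq> 0}" arbitrary: f)
  case 0
  then have "f = \<zero>\<^bsub>CG\<^esub>" using supp(1)[OF 0(2)] by (auto simp: CG_simps)
  then have f: "f = 0 \<odot>\<^bsub>CG\<^esub> \<one>\<^bsub>CG\<^esub>" by (simp add: CG_simps)
  have "vnorm H (\<pi> f x) \<le> 0 * vnorm H x"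
    if rep: "star_representation CG H \<pi>" and x: "x \<in> carrier H"
    for H :: "(nat \<Rightarrow> 'a \<Rightarrow> complex) hilbert" and \<pi> x
  proof -
    interpret hilbert_space H using rep by (simp add: star_representation_def)
    have "\<pi> f x = 0 \<odot>\<^bsub>H\<^esub> x"
      unfolding f using rep x one_closed_CG by (simp add: star_representation_def)
    then show ?thesis using x by (simp add: vnorm_smult)
  qed
  then show ?case by blast
next
  case (Suc n)
  then obtain g where g: "f g \<noteq> 0" by (metis (mono_tags, lifting) Collect_empty_eq card.empty nat.distinct(1))
  have gG: "g \<in> carrier G" using supp(2)[OF Suc.prems g] .
  define f' where "f' = f(g := 0)"
  have s: "{x. f' x \<noteq> 0} = {x. f x \<noteq> 0} - {g}" by (auto simp: f'_def)
  have f': "f' \<in> carrier CG"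
    using Suc.prems by (intro CG_I[of "{x. f x \<noteq> 0}"]) (auto simp: f'_def supp split: if_splits)
  have "n = card {x. f' x \<noteq> 0}"
    using Suc.hyps(2) g supp(1)[OF Suc.prems] unfolding s by simp
  from Suc.hyps(1)[OF this f'] obtain K where
    K: "\<And>(H :: (nat \<Rightarrow> 'a \<Rightarrow> complex) hilbert) \<pi> x. star_representation CG H \<pi> \<Longrightarrow>
      x \<in> carrier H \<Longrightarrow> vnorm H (\<pi> f' x) \<le> K * vnorm H x" by blast
  have f: "f = f' \<oplus>\<^bsub>CG\<^esub> (f g \<odot>\<^bsub>CG\<^esub> delta g)"
    by (auto simp: CG_simps f'_def delta_def)
  have d: "delta g \<in> carrier CG" "f g \<odot>\<^bsub>CG\<^esub> delta g \<in> carrier CG"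
    using gG by (auto intro: delta_closed smult_closed_CG)
  have "vnorm H (\<pi> f x) \<le> (K + cmod (f g)) * vnorm H x"
    if rep: "star_representation CG H \<pi>" and x: "x \<in> carrier H"
    for H :: "(nat \<Rightarrow> 'a \<Rightarrow> complex) hilbert" and \<pi> x
  proof -
    interpret hilbert_space H using rep by (simp add: star_representation_def)
    have c: "\<pi> f' x \<in> carrier H" "\<pi> (delta g) x \<in> carrier H"
      using rep f' d x by (auto simp: star_representation_def bounded_operator_def)
    have "\<pi> f x = \<pi> f' x \<oplus>\<^bsub>H\<^esub> f g \<odot>\<^bsub>H\<^esub> \<pi> (delta g) x"
      by (subst f) (use rep f' d x in \<open>simp add: star_representation_def\<close>)
    then have "vnorm H (\<pi> f x) \<le> vnorm H (\<pi> f' x) + cmod (f g) * vnorm H (\<pi> (delta g) x)"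
      using vnorm_add[OF c(1), of "f g \<odot>\<^bsub>H\<^esub> \<pi> (delta g) x"] c by (simp add: vnorm_smult)
    also have "\<dots> \<le> K * vnorm H x + cmod (f g) * vnorm H x"
      using K[OF rep x] delta_isometry[OF gG rep x] by simp
    finally show ?thesis by (simp add: algebra_simps)
  qed
  then show ?case by blast
qed

lemma star_algebra_bounded_CG: "star_algebra_bounded CG"
  by (intro star_algebra_bounded.intro star_algebra_CG star_algebra_bounded_axioms.intro CG_bounded)

lemma c_star_algebra_full: "c_star_algebra (full_group_c_star_algebra G)"
  unfolding full_group_c_star_algebra_def
  by (intro star_seminorm.c_star_algebra_completion star_algebra_bounded.star_seminorm_u
      star_algebra_bounded_CG)

end

theorem c_star_algebra_full_group_c_star_algebra:
  assumes "group G" shows "c_star_algebra (full_group_c_star_algebra G)"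
  using assms by (intro complex_group_algebra.c_star_algebra_full complex_group_algebra.intro)

end

theory Submission
  imports Defs "HOL-Analysis.Infinite_Sum" "HOL-Analysis.Continuum_Not_Denumerable"
begin

text \<open>The group algebra of the free product \<open>G1 * G2\<close> acts on a Hilbert space as soon as \<open>G1\<close> and \<open>G2\<close>
  act on it by unitaries, with no relation between the two actions. Its full C*-algebra is primitive if
  there is a pair of actions without common invariant closed subspaces (\<open>irreducible_pair\<close>) such that
  the norm of every element of the group algebra is the universal norm: the representation then
  extends to the completion isometrically, hence faithfully
  (\<open>primitive_full_group_c_star_algebraI\<close>). The norm is large enough if all pairs of a countable
  family of pairs of actions, which together attain the universal norm approximately
  (\<open>norming_family_exists\<close>), are approximately contained in the irreducible pair, in the sense that
  isometries almost intertwine them (\<open>approx_contains_algebra\<close>, \<open>primitive_free_productI\<close>). So the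
  task is to construct an irreducible pair that approximately contains a given countable family.

  Amenability makes room for this. Let \<open>G1\<close> translate the first coordinate of the functions on the
  set \<open>(G1 \<times> G2) \<times> K\<close>, and let \<open>G2\<close> translate the second coordinate, conjugated by a block diagonal
  unitary with blocks \<open>V a b\<close> on \<open>K\<close> (locale \<open>twisted_pair\<close>). If \<open>V a b\<close> is the commutator
  \<open>R2 b\<inverse> R1 a\<inverse> R2 b R1 a\<close> for a pair of actions \<open>R1\<close>, \<open>R2\<close>, then
  \<open>f \<mapsto> x a * y b * R2 b\<inverse> R1 a\<inverse> f\<close> intertwines the pair with the twisted pair up to
  an error that measures how far \<open>x\<close> and \<open>y\<close> are from being invariant under translation
  (\<open>almost_invariant_vector\<close>, \<open>approx_contains_twisted\<close>). \<open>K\<close> consists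
  of infinitely many copies of each pair of the family and of one new summand. Approximate containment
  survives any change of the blocks on the new summand, and a change on the copies that is
  arbitrarily small on suitable ones.

  Irreducibility is forced by such changes. Choose \<open>a0 \<noteq> 1\<close> in \<open>G1\<close> and distinct
  \<open>b0, b1 \<noteq> 1\<close> in \<open>G2\<close>; this is where one of the groups needs a third element. The product of the
  commutators of \<open>a0\<inverse>\<close> with \<open>b0\<inverse>\<close> and with \<open>b1\<inverse>\<close> acts block diagonally, and its
  block at \<open>(1, 1)\<close> is the inverse of \<open>V a0 b1 V a0 b0\<close>. When all blocks \<open>V a0 b\<close> with \<open>b \<noteq> 1\<close> are
  multiplied by \<open>cis t\<close> (copies of the pairs that were multiplied by \<open>cis r\<close> in advance, with \<open>r\<close>
  rational and close to \<open>-t\<close>, compensate this), the block at \<open>(a, b)\<close> is multiplied by a power of \<open>cis t\<close>, with exponent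
  \<open>-2\<close> at \<open>(1, 1)\<close> and a different one elsewhere (\<open>expo_other\<close>). Unitaries on separable spaces have
  only countably many eigenvalues (\<open>countable_eigenvalues\<close>). Hence, for all but countably many \<open>t\<close>,
  eigenvalues \<open>z i\<close> that are planted in \<open>V a0 b1 V a0 b0\<close> on a new summand of \<open>K\<close> belong to eigenvectors
  that are unique up to scalars in the whole space. An invariant closed subspace contains such an
  eigenvector or is orthogonal to it (\<open>eigenvector_dichotomy\<close>). The block \<open>V a0 b0\<close> moves the
  eigenvectors transitively and, by a small rotation, mixes them with the old part of \<open>K\<close>, so that the
  subspace contains everything or nothing (\<open>irreducible\<close>, \<open>irreducible_twist_V\<close>).\<close>

section \<open>Orthonormal bases and projections in Hilbert spaces\<close>

context hilbert_space begin

lemma ip_zero_left [simp]: "y \<in> carrier H \<Longrightarrow> ip H \<zero> y = 0"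
  using ip_smult_left[of \<zero> y 0] by simp

lemma ip_zero_right [simp]: "y \<in> carrier H \<Longrightarrow> ip H y \<zero> = 0"
  using ip_smult_right[of y \<zero> 0] by simp

lemma a_inv_eq: "x \<in> carrier H \<Longrightarrow> \<ominus> x = (-1) \<odot> x"
  using smult_l_minus[of 1 x] smult_one[of x] by simp

lemma ip_minus_left:
  "\<lbrakk>x \<in> carrier H; y \<in> carrier H; z \<in> carrier H\<rbrakk> \<Longrightarrow> ip H (x \<ominus> y) z = ip H x z - ip H y z"
  by (simp add: minus_eq a_inv_eq ip_add_left ip_smult_left)

lemma ip_minus_right:
  "\<lbrakk>x \<in> carrier H; y \<in> carrier H; z \<in> carrier H\<rbrakk> \<Longrightarrow> ip H z (x \<ominus> y) = ip H z x - ip H z y"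
  by (simp add: minus_eq a_inv_eq ip_add_right ip_smult_right)

lemma minus_eq_zero_iff: "\<lbrakk>x \<in> carrier H; y \<in> carrier H\<rbrakk> \<Longrightarrow> x \<ominus> y = \<zero> \<longleftrightarrow> x = y"
  by (metis minus_eq r_neg minus_minus minus_equality a_inv_closed a_comm)

lemma vnorm_minus_sq:
  assumes x: "x \<in> carrier H" and y: "y \<in> carrier H"
  shows "(vnorm H (x \<ominus> y))\<^sup>2 = (vnorm H x)\<^sup>2 + (vnorm H y)\<^sup>2 - 2 * Re (ip H x y)"
  using x y ip_cnj[of x y] by (simp add: vnorm_sq ip_minus_left ip_minus_right)

lemma vnorm_zero [simp]: "vnorm H \<zero> = 0"
  by (simp add: vnorm_eq_0)

lemma vnorm_triangle:
  assumes "x \<in> carrier H" "y \<in> carrier H"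
  shows "vnorm H x \<le> vnorm H (x \<ominus> y) + vnorm H y"
proof -
  have "x = (x \<ominus> y) \<oplus> y" using assms by (simp add: minus_eq a_assoc l_neg)
  then show ?thesis using vnorm_add[of "x \<ominus> y" y] assms by simp
qed

lemma vnorm_minus_commute:
  assumes "x \<in> carrier H" "y \<in> carrier H" shows "vnorm H (x \<ominus> y) = vnorm H (y \<ominus> x)"
proof (rule power2_eq_imp_eq)
  show "(vnorm H (x \<ominus> y))\<^sup>2 = (vnorm H (y \<ominus> x))\<^sup>2"
    using assms ip_cnj[of x y] by (simp add: vnorm_minus_sq)
qed (use assms vnorm_ge_0 in auto)

lemma tendsto_ip:
  assumes s: "norm_converges H (vnorm H) s x" "\<And>n. s n \<in> carrier H" and x: "x \<in> carrier H"
    and y: "y \<in> carrier H"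
  shows "(\<lambda>n. ip H (s n) y) \<longlonglongrightarrow> ip H x y"
proof -
  have "(\<lambda>n. vnorm H (s n \<ominus> x) * vnorm H y) \<longlonglongrightarrow> 0 * vnorm H y"
    using s(1) unfolding norm_converges_def by (intro tendsto_mult tendsto_const)
  then have "(\<lambda>n. vnorm H (s n \<ominus> x) * vnorm H y) \<longlonglongrightarrow> 0" by simp
  then have "(\<lambda>n. ip H (s n) y - ip H x y) \<longlonglongrightarrow> 0"
    by (rule tendsto_0_le[where K = 1])
      (use s x y cauchy_schwarz[of "s _ \<ominus> x" y] vnorm_ge_0 in
        \<open>auto simp: ip_minus_left[symmetric] abs_mult intro!: always_eventually\<close>)
  then show ?thesis by (simp add: LIM_zero_iff)
qed

lemma norm_converges_unique:
  assumes "norm_converges H (vnorm H) s x" "norm_converges H (vnorm H) s y"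
    "\<And>n. s n \<in> carrier H" "x \<in> carrier H" "y \<in> carrier H"
  shows "x = y"
proof -
  have "ip H x (x \<ominus> y) = ip H y (x \<ominus> y)"
    by (rule LIMSEQ_unique[OF tendsto_ip[OF assms(1,3,4)] tendsto_ip[OF assms(2,3,5)]]) (use assms in auto)
  then have "ip H (x \<ominus> y) (x \<ominus> y) = 0" using assms by (simp add: ip_minus_left)
  then show ?thesis using assms ip_eq_0[of "x \<ominus> y"] by (simp add: minus_eq_zero_iff)
qed

definition orthonormal :: "'a set \<Rightarrow> bool" where
  "orthonormal A \<longleftrightarrow> A \<subseteq> carrier H \<and> (\<forall>x\<in>A. \<forall>y\<in>A. ip H x y = (if x = y then 1 else 0))"

lemma orthonormalD:
  assumes "orthonormal A"
  shows "x \<in> A \<Longrightarrow> x \<in> carrier H"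
    "\<lbrakk>x \<in> A; y \<in> A\<rbrakk> \<Longrightarrow> ip H x y = (if x = y then 1 else 0)"
  using assms by (auto simp: orthonormal_def)

definition comb :: "'a set \<Rightarrow> ('a \<Rightarrow> complex) \<Rightarrow> 'a" where
  "comb F c = (\<Oplus>x\<in>F. c x \<odot> x)"

lemma comb_closed: "F \<subseteq> carrier H \<Longrightarrow> comb F c \<in> carrier H"
  unfolding comb_def by (intro finsum_closed) auto

lemma ip_comb:
  assumes "finite F" "F \<subseteq> carrier H" "y \<in> carrier H"
  shows "ip H (comb F c) y = (\<Sum>x\<in>F. c x * ip H x y)"
  using assms unfolding comb_def
proof (induction F)
  case (insert a F)
  moreover have "(\<Oplus>x\<in>F. c x \<odot> x) \<in> carrier H" using insert by (intro finsum_closed) auto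
  ultimately show ?case
    by (subst finsum_insert) (auto simp: ip_add_left ip_smult_left)
qed simp

lemma ip_comb_orthonormal:
  assumes A: "orthonormal A" and F: "finite F" "F \<subseteq> A"
  shows "y \<in> A \<Longrightarrow> ip H (comb F c) y = (if y \<in> F then c y else 0)"
    and "finite F' \<Longrightarrow> F' \<subseteq> A \<Longrightarrow> Re (ip H (comb F c) (comb F' c)) = (\<Sum>x\<in>F \<inter> F'. (cmod (c x))\<^sup>2)"
    and "(vnorm H (comb F c))\<^sup>2 = (\<Sum>x\<in>F. (cmod (c x))\<^sup>2)"
proof -
  have AH: "A \<subseteq> carrier H" using A by (simp add: orthonormal_def)
  have 1: "ip H (comb F c) y = (if y \<in> F then c y else 0)" if "y \<in> A" "finite F" "F \<subseteq> A" for y F c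
  proof -
    have "ip H (comb F c) y = (\<Sum>x\<in>F. c x * (if x = y then 1 else 0))"
      using that AH A by (subst ip_comb) (auto simp: orthonormal_def intro!: sum.cong)
    also have "\<dots> = (if y \<in> F then c y else 0)" using that by (simp add: if_distrib[of "(*) _"] cong: if_cong)
    finally show ?thesis .
  qed
  then show "ip H (comb F c) y = (if y \<in> F then c y else 0)" if "y \<in> A" using that F by simp
  have 2: "Re (ip H (comb F c) (comb F' c)) = (\<Sum>x\<in>F \<inter> F'. (cmod (c x))\<^sup>2)"
    if F': "finite F'" "F' \<subseteq> A" for F'
  proof -
    have "ip H (comb F c) (comb F' c) = (\<Sum>x\<in>F. c x * cnj (ip H (comb F' c) x))"
    proof (subst ip_comb)
      show "(\<Sum>x\<in>F. c x * ip H x (comb F' c)) = (\<Sum>x\<in>F. c x * cnj (ip H (comb F' c) x))"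
        using F F' AH by (intro sum.cong refl arg_cong2[where f = "(*)"] ip_cnj comb_closed) auto
    qed (use F F' AH comb_closed in auto)
    also have "\<dots> = (\<Sum>x\<in>F. if x \<in> F' then complex_of_real ((cmod (c x))\<^sup>2) else 0)"
      using F F' by (intro sum.cong refl) (auto simp: 1 subset_iff complex_norm_square[symmetric])
    also have "\<dots> = (\<Sum>x\<in>F \<inter> F'. complex_of_real ((cmod (c x))\<^sup>2))"
      using F by (simp add: sum.If_cases Int_def)
    finally show ?thesis by simp
  qed
  then show "finite F' \<Longrightarrow> F' \<subseteq> A \<Longrightarrow> Re (ip H (comb F c) (comb F' c)) = (\<Sum>x\<in>F \<inter> F'. (cmod (c x))\<^sup>2)"
    by simp
  show "(vnorm H (comb F c))\<^sup>2 = (\<Sum>x\<in>F. (cmod (c x))\<^sup>2)"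
    using 2[of F] F AH by (subst vnorm_sq) (auto intro!: comb_closed)
qed

lemma bessel_finite:
  assumes A: "orthonormal A" and F: "finite F" "F \<subseteq> A" and v: "v \<in> carrier H"
  shows "(\<Sum>x\<in>F. (cmod (ip H v x))\<^sup>2) \<le> (vnorm H v)\<^sup>2"
proof -
  have AH: "A \<subseteq> carrier H" using A by (simp add: orthonormal_def)
  define c where "c = (\<lambda>x. ip H v x)"
  have cc: "comb F c \<in> carrier H" using F AH by (intro comb_closed) auto
  have "ip H (comb F c) v = (\<Sum>x\<in>F. c x * cnj (c x))"
  proof (subst ip_comb)
    show "(\<Sum>x\<in>F. c x * ip H x v) = (\<Sum>x\<in>F. c x * cnj (c x))"
      unfolding c_def using F AH v by (intro sum.cong refl arg_cong2[where f = "(*)"] ip_cnj) auto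
  qed (use F AH v in auto)
  also have "\<dots> = complex_of_real (\<Sum>x\<in>F. (cmod (c x))\<^sup>2)"
    by (simp add: complex_norm_square[symmetric] del: of_real_power)
  finally have "Re (ip H (comb F c) v) = (\<Sum>x\<in>F. (cmod (c x))\<^sup>2)" by simp
  moreover have "Re (ip H v (comb F c)) = Re (ip H (comb F c) v)"
    using ip_cnj[OF v cc] by simp
  ultimately have "(vnorm H (v \<ominus> comb F c))\<^sup>2 = (vnorm H v)\<^sup>2 - (\<Sum>x\<in>F. (cmod (c x))\<^sup>2)"
    using vnorm_minus_sq[OF v cc] ip_comb_orthonormal(3)[OF A F, of c] by simp
  then show ?thesis using zero_le_power2[of "vnorm H (v \<ominus> comb F c)"] by (simp add: c_def)
qed

lemma bessel:
  assumes A: "orthonormal A" and v: "v \<in> carrier H"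
  shows "(\<lambda>x. (cmod (ip H v x))\<^sup>2) summable_on A"
    "(\<Sum>\<^sub>\<infinity>x\<in>A. (cmod (ip H v x))\<^sup>2) \<le> (vnorm H v)\<^sup>2"
proof -
  show "(\<lambda>x. (cmod (ip H v x))\<^sup>2) summable_on A"
    using bessel_finite[OF A _ _ v]
    by (intro nonneg_bdd_above_summable_on bdd_aboveI[of _ "(vnorm H v)\<^sup>2"]) auto
  then show "(\<Sum>\<^sub>\<infinity>x\<in>A. (cmod (ip H v x))\<^sup>2) \<le> (vnorm H v)\<^sup>2"
    by (rule infsum_le_finite_sums) (use bessel_finite[OF A _ _ v] in auto)
qed

text \<open>The finite sums over sets that nearly exhaust the sum of squares form a Cauchy sequence. Its limit has
  the prescribed coefficients, and Bessel's inequality bounds its norm from below.\<close>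

lemma riesz_fischer:
  assumes A: "orthonormal A" and c: "(\<lambda>x. (cmod (c x))\<^sup>2) summable_on A"
  obtains v where "v \<in> carrier H" "\<And>x. x \<in> A \<Longrightarrow> ip H v x = c x"
    "(vnorm H v)\<^sup>2 = (\<Sum>\<^sub>\<infinity>x\<in>A. (cmod (c x))\<^sup>2)"
proof -
  have AH: "A \<subseteq> carrier H" using A by (simp add: orthonormal_def)
  define q where "q F = (\<Sum>x\<in>F. (cmod (c x))\<^sup>2)" for F
  define I where "I = (\<Sum>\<^sub>\<infinity>x\<in>A. (cmod (c x))\<^sup>2)"
  have qI: "q F \<le> I" if "finite F" "F \<subseteq> A" for F
    unfolding q_def I_def using that c by (intro finite_sum_le_infsum) auto
  have "\<exists>F. finite F \<and> F \<subseteq> A \<and> I - q F \<le> 1 / real (Suc n)" for n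
  proof -
    obtain F where "finite F" "F \<subseteq> A" "dist (q F) I \<le> 1 / real (Suc n)"
      using infsum_finite_approximation[OF c, of "1 / real (Suc n)"] by (auto simp: q_def I_def)
    then show ?thesis by (intro exI[of _ F]) (auto simp: dist_real_def)
  qed
  then obtain F where F: "\<And>n. finite (F n)" "\<And>n. F n \<subseteq> A" "\<And>n. I - q (F n) \<le> 1 / real (Suc n)"
    by metis
  define s where "s n = comb (F n) c" for n
  have sH [simp]: "s n \<in> carrier H" for n unfolding s_def using F(2)[of n] AH by (intro comb_closed) blast
  have sq: "(vnorm H (s n))\<^sup>2 = q (F n)" for n
    unfolding s_def q_def using ip_comb_orthonormal(3)[OF A F(1,2)] .
  have diff: "(vnorm H (s m \<ominus> s n))\<^sup>2 \<le> 1 / real (Suc m) + 1 / real (Suc n)" for m n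
  proof -
    have "Re (ip H (s m) (s n)) = q (F m \<inter> F n)"
      unfolding s_def q_def using F by (intro ip_comb_orthonormal(2)[OF A]) auto
    moreover have "q (F m \<union> F n) + q (F m \<inter> F n) = q (F m) + q (F n)"
      unfolding q_def using F by (simp add: sum.union_inter)
    moreover have "q (F m \<union> F n) \<le> I" using F by (intro qI) auto
    moreover have "(vnorm H (s m \<ominus> s n))\<^sup>2 = q (F m) + q (F n) - 2 * Re (ip H (s m) (s n))"
      by (simp add: vnorm_minus_sq sq)
    ultimately show ?thesis using F(3)[of m] F(3)[of n] by linarith
  qed
  have "norm_cauchy H (vnorm H) s"
    unfolding norm_cauchy_def
  proof (intro conjI allI impI)
    fix e :: real assume e: "e > 0"
    then have "e\<^sup>2 / 2 > 0" by simp
    then obtain N where N: "1 / real (Suc N) < e\<^sup>2 / 2" by (metis nat_approx_posE)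
    have "vnorm H (s m \<ominus> s n) < e" if "m \<ge> N" "n \<ge> N" for m n
    proof (rule power2_less_imp_less)
      have "1 / real (Suc m) \<le> 1 / real (Suc N)" "1 / real (Suc n) \<le> 1 / real (Suc N)"
        using that by (auto intro!: divide_left_mono)
      then show "(vnorm H (s m \<ominus> s n))\<^sup>2 < e\<^sup>2" using diff[of m n] N by linarith
    qed (use e in simp)
    then show "\<exists>N. \<forall>m\<ge>N. \<forall>n\<ge>N. vnorm H (s m \<ominus> s n) < e" by blast
  qed auto
  then obtain v where v: "v \<in> carrier H" and lim: "norm_converges H (vnorm H) s v"
    using complete by (auto simp: norm_complete_def)
  have inv: "(\<lambda>n. sqrt (1 / real (Suc n))) \<longlonglongrightarrow> 0"
    using tendsto_real_sqrt[OF LIMSEQ_inverse_real_of_nat] by (simp add: inverse_eq_divide)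
  have coef: "ip H v y = c y" if y: "y \<in> A" for y
  proof -
    have "cmod (ip H (s n) y - c y) \<le> sqrt (1 / real (Suc n))" for n
    proof (cases "y \<in> F n")
      case True
      then show ?thesis unfolding s_def using ip_comb_orthonormal(1)[OF A F(1,2) y] by simp
    next
      case False
      then have "q (insert y (F n)) = (cmod (c y))\<^sup>2 + q (F n)" unfolding q_def using F by simp
      moreover have "q (insert y (F n)) \<le> I" using F y by (intro qI) auto
      ultimately have "(cmod (c y))\<^sup>2 \<le> 1 / real (Suc n)" using F(3)[of n] by linarith
      then have "cmod (c y) \<le> sqrt (1 / real (Suc n))" by (rule real_le_rsqrt)
      then show ?thesis unfolding s_def using ip_comb_orthonormal(1)[OF A F(1,2) y] False by simp
    qed
    then have "(\<lambda>n. ip H (s n) y - c y) \<longlonglongrightarrow> 0"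
      by (intro tendsto_0_le[OF inv, of _ 1] always_eventually) simp
    then have "(\<lambda>n. ip H (s n) y) \<longlonglongrightarrow> c y" by (simp add: LIM_zero_iff)
    moreover have "(\<lambda>n. ip H (s n) y) \<longlonglongrightarrow> ip H v y"
      using lim v y AH by (intro tendsto_ip) auto
    ultimately show ?thesis by (rule LIMSEQ_unique[symmetric])
  qed
  have I0: "0 \<le> I" unfolding I_def by (intro infsum_nonneg) simp
  have "vnorm H v \<le> vnorm H (s n \<ominus> v) + sqrt I" for n
  proof -
    have "vnorm H (s n) \<le> sqrt I" using qI[OF F(1,2)] sq[of n] by (intro real_le_rsqrt) simp
    then show ?thesis using vnorm_triangle[OF v sH[of n]] vnorm_minus_commute[OF v sH[of n]] by linarith
  qed
  moreover have "(\<lambda>n. vnorm H (s n \<ominus> v) + sqrt I) \<longlonglongrightarrow> 0 + sqrt I"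
    using lim unfolding norm_converges_def by (intro tendsto_add tendsto_const)
  ultimately have "vnorm H v \<le> sqrt I"
    by (intro LIMSEQ_le_const[of _ "sqrt I"]) auto
  then have "(vnorm H v)\<^sup>2 \<le> I"
    using I0 vnorm_ge_0[OF v] by (metis real_sqrt_pow2 power_mono)
  moreover have "I \<le> (vnorm H v)\<^sup>2"
    using bessel(2)[OF A v] by (simp add: I_def coef cong: infsum_cong)
  ultimately show thesis using that[OF v coef] by (simp add: I_def)
qed

definition orthonormal_basis :: "'a set \<Rightarrow> bool" where
  "orthonormal_basis A \<longleftrightarrow> orthonormal A \<and> (\<forall>v\<in>carrier H. (\<forall>x\<in>A. ip H v x = 0) \<longrightarrow> v = \<zero>)"

text \<open>By Zorn's lemma; a nonzero vector orthogonal to a maximal orthonormal set could be normalized and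
  added to it.\<close>

lemma orthonormal_basis_exists: "\<exists>A. orthonormal_basis A"
proof -
  have "\<exists>A\<in>Collect orthonormal. \<forall>X\<in>Collect orthonormal. A \<subseteq> X \<longrightarrow> X = A"
  proof (rule subset_Zorn_nonempty)
    show "Collect orthonormal \<noteq> {}" by (auto simp: orthonormal_def intro!: exI[of _ "{}"])
    fix \<C> assume ne: "\<C> \<noteq> {}" and ch: "subset.chain (Collect orthonormal) \<C>"
    have "ip H x y = (if x = y then 1 else 0)" if "x \<in> X" "X \<in> \<C>" "y \<in> Y" "Y \<in> \<C>" for x X y Y
    proof -
      have "orthonormal X" "orthonormal Y" "X \<subseteq> Y \<or> Y \<subseteq> X"
        using ch that by (auto simp: subset_chain_def)
      then show ?thesis using that unfolding orthonormal_def by (metis subsetD)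
    qed
    note ip = this
    have "x \<in> carrier H" if "x \<in> X" "X \<in> \<C>" for x X
    proof -
      have "orthonormal X" using ch that by (auto simp: subset_chain_def)
      then show ?thesis using that(1) by (rule orthonormalD)
    qed
    then have "\<Union> \<C> \<subseteq> carrier H" by (intro Union_least subsetI)
    moreover have "\<forall>x\<in>\<Union> \<C>. \<forall>y\<in>\<Union> \<C>. ip H x y = (if x = y then 1 else 0)"
      by (intro ballI) (elim UnionE, rule ip)
    ultimately show "\<Union> \<C> \<in> Collect orthonormal" by (simp add: orthonormal_def)
  qed
  then obtain A where A: "orthonormal A" and max: "\<And>X. orthonormal X \<Longrightarrow> A \<subseteq> X \<Longrightarrow> X = A" by auto
  have "v = \<zero>" if v: "v \<in> carrier H" and orth: "\<forall>x\<in>A. ip H v x = 0" for v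
  proof (rule ccontr)
    assume "v \<noteq> \<zero>"
    then have nz: "vnorm H v > 0" using vnorm_eq_0[OF v] vnorm_ge_0[OF v] by simp
    define w where "w = complex_of_real (1 / vnorm H v) \<odot> v"
    have w: "w \<in> carrier H" using v by (simp add: w_def)
    have wA: "ip H w x = 0" "ip H x w = 0" if "x \<in> A" for x
      using that orth v orthonormalD[OF A] ip_cnj[of v x]
      by (simp_all add: w_def ip_smult_left ip_smult_right)
    have "vnorm H w = 1" using v nz by (simp add: w_def vnorm_smult del: of_real_divide)
    then have ww: "ip H w w = 1" using w by (simp add: ip_self)
    have "orthonormal (insert w A)"
      using A w wA ww unfolding orthonormal_def by auto
    then have "w \<in> A" using max[of "insert w A"] by auto
    then show False using wA(1) ww by simp
  qed
  then show ?thesis using A by (auto simp: orthonormal_basis_def)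
qed

lemma parseval:
  assumes A: "orthonormal_basis A" and v: "v \<in> carrier H"
  shows "(\<Sum>\<^sub>\<infinity>x\<in>A. (cmod (ip H v x))\<^sup>2) = (vnorm H v)\<^sup>2"
proof -
  have A': "orthonormal A" using A by (simp add: orthonormal_basis_def)
  obtain w where w: "w \<in> carrier H" "\<And>x. x \<in> A \<Longrightarrow> ip H w x = ip H v x"
    "(vnorm H w)\<^sup>2 = (\<Sum>\<^sub>\<infinity>x\<in>A. (cmod (ip H v x))\<^sup>2)"
    using riesz_fischer[OF A' bessel(1)[OF A' v]] by blast
  have "\<forall>x\<in>A. ip H (v \<ominus> w) x = 0"
    using w v orthonormalD[OF A'] by (simp add: ip_minus_left)
  then have "v \<ominus> w = \<zero>" using A v w by (auto simp: orthonormal_basis_def)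
  then show ?thesis using w v by (simp add: minus_eq_zero_iff)
qed

text \<open>Every member of the orthonormal set has a nonzero coefficient with some vector of the total set, and
  each vector has only countably many nonzero coefficients.\<close>

lemma countable_orthonormal:
  assumes A: "orthonormal A" and D: "countable D" "D \<subseteq> carrier H"
    and total: "\<And>v. v \<in> carrier H \<Longrightarrow> (\<And>d. d \<in> D \<Longrightarrow> ip H d v = 0) \<Longrightarrow> v = \<zero>"
  shows "countable A"
proof -
  have "A \<subseteq> (\<Union>d\<in>D. {x\<in>A. (cmod (ip H d x))\<^sup>2 \<noteq> 0})"
  proof
    fix x assume x: "x \<in> A"
    then have "x \<noteq> \<zero>" using orthonormalD[OF A] by force
    then obtain d where "d \<in> D" "ip H d x \<noteq> 0" using total x orthonormalD[OF A] by blast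
    then show "x \<in> (\<Union>d\<in>D. {x\<in>A. (cmod (ip H d x))\<^sup>2 \<noteq> 0})" using x by auto
  qed
  moreover have "countable {x\<in>A. (cmod (ip H d x))\<^sup>2 \<noteq> 0}" if "d \<in> D" for d
    using that D by (intro summable_countable_real bessel(1)[OF A]) auto
  ultimately show ?thesis using D(1) by (meson countable_UN countable_subset)
qed

lemma
  assumes W: "closed_subspace H W"
  shows closed_subspace_subset: "W \<subseteq> carrier H"
    and closed_subspace_zero: "\<zero> \<in> W"
    and closed_subspace_add: "\<And>x y. x \<in> W \<Longrightarrow> y \<in> W \<Longrightarrow> x \<oplus> y \<in> W"
    and closed_subspace_smult: "\<And>c x. x \<in> W \<Longrightarrow> c \<odot> x \<in> W"
    and closed_subspace_minus: "\<And>x y. x \<in> W \<Longrightarrow> y \<in> W \<Longrightarrow> x \<ominus> y \<in> W"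
    and closed_subspace_lim: "\<And>s x. (\<And>n. s n \<in> W) \<Longrightarrow> x \<in> carrier H \<Longrightarrow>
      norm_converges H (vnorm H) s x \<Longrightarrow> x \<in> W"
proof -
  have sub: "submodule W complex_ring H" using W by (simp add: closed_subspace_def)
  then show 1: "W \<subseteq> carrier H" by (rule submoduleE(1))
  show sm: "c \<odot> x \<in> W" if "x \<in> W" for c x
    using submoduleE(4)[OF sub, of c x] that by simp
  show add: "x \<oplus> y \<in> W" if "x \<in> W" "y \<in> W" for x y
    using submoduleE(5)[OF sub] that by simp
  show "\<zero> \<in> W"
  proof -
    obtain x where "x \<in> W" using submoduleE(2)[OF sub] by auto
    then have "0 \<odot> x \<in> W" "x \<in> carrier H" using sm 1 by auto
    then show ?thesis using smult_l_null[of x] by simp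
  qed
  show "x \<ominus> y \<in> W" if "x \<in> W" "y \<in> W" for x y
  proof -
    have "\<ominus> y = (-1) \<odot> y" using a_inv_eq[of y] that 1 by auto
    then show ?thesis using add[OF that(1) sm[OF that(2), of "-1"]] by (simp add: minus_eq)
  qed
  show "\<And>s x. (\<And>n. s n \<in> W) \<Longrightarrow> x \<in> carrier H \<Longrightarrow> norm_converges H (vnorm H) s x \<Longrightarrow> x \<in> W"
    using W unfolding closed_subspace_def by blast
qed

lemma closed_subspaceI:
  assumes "W \<subseteq> carrier H" "\<zero> \<in> W" "\<And>x y. x \<in> W \<Longrightarrow> y \<in> W \<Longrightarrow> x \<oplus> y \<in> W"
    "\<And>c x. x \<in> W \<Longrightarrow> c \<odot> x \<in> W"
    "\<And>s x. (\<And>n. s n \<in> W) \<Longrightarrow> x \<in> carrier H \<Longrightarrow> norm_converges H (vnorm H) s x \<Longrightarrow> x \<in> W"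
  shows "closed_subspace H W"
proof -
  have "submodule W complex_ring H"
  proof (rule submoduleI)
    fix x assume "x \<in> W"
    then show "\<ominus> x \<in> W" using assms(1) assms(4)[of x "-1"] a_inv_eq[of x] by auto
  qed (use assms in auto)
  then show ?thesis
    unfolding closed_subspace_def
  proof (intro conjI allI ballI impI)
    fix s x assume "x \<in> carrier H" "range s \<subseteq> W \<and> norm_converges H (vnorm H) s x"
    then show "x \<in> W" using assms(5)[of s x] by (auto simp: image_subset_iff)
  qed
qed

text \<open>Lets the results on orthonormal bases be applied to closed subspaces.\<close>

lemma hilbert_space_subspace:
  assumes W: "closed_subspace H W"
  shows "hilbert_space (H\<lparr>carrier := W\<rparr>)"
    and "\<And>x y. x \<in> W \<Longrightarrow> y \<in> W \<Longrightarrow> x \<ominus>\<^bsub>H\<lparr>carrier := W\<rparr>\<^esub> y = x \<ominus> y"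
    and "vnorm (H\<lparr>carrier := W\<rparr>) = vnorm H"
proof -
  note cs = closed_subspace_subset[OF W] closed_subspace_zero[OF W] closed_subspace_add[OF W]
    closed_subspace_smult[OF W] closed_subspace_minus[OF W]
  let ?W = "H\<lparr>carrier := W\<rparr>"
  have inW: "x \<in> W \<Longrightarrow> x \<in> carrier H" for x using cs(1) by auto
  have "abelian_group ?W"
  proof (rule abelian_groupI)
    fix x assume "x \<in> carrier ?W"
    then have x: "x \<in> W" by simp
    then have "(-1) \<odot> x \<in> W" "(-1) \<odot> x \<oplus> x = \<zero>"
      using cs(4) inW[OF x] a_inv_eq[of x] l_neg[of x] by auto
    then show "\<exists>y\<in>carrier ?W. y \<oplus>\<^bsub>?W\<^esub> x = \<zero>\<^bsub>?W\<^esub>" by auto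
  qed (use cs inW in \<open>auto simp: a_ac\<close>)
  then have mod: "Module.module complex_ring ?W"
    using cs inW smult_l_distr smult_r_distr smult_assoc1 smult_one
    by (intro moduleI cring_complex_ring) auto
  interpret WW: Module.module complex_ring ?W by (rule mod)
  show m: "x \<ominus>\<^bsub>?W\<^esub> y = x \<ominus> y" if "x \<in> W" "y \<in> W" for x y
  proof -
    have y: "y \<in> carrier H" by (rule inW[OF that(2)])
    have "\<ominus> y \<in> W" unfolding a_inv_eq[OF y] by (rule cs(4)[OF that(2)])
    then have "\<ominus>\<^bsub>?W\<^esub> y = \<ominus> y"
      using that(2) l_neg[OF y] by (intro WW.minus_equality) simp_all
    then show ?thesis by (simp add: a_minus_def)
  qed
  show vn: "vnorm ?W = vnorm H" by (rule ext) (simp add: vnorm_def)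
  have "norm_complete ?W (vnorm ?W)"
    unfolding norm_complete_def
  proof (intro allI impI)
    fix s assume s: "norm_cauchy ?W (vnorm ?W) s"
    then have sW: "s n \<in> W" for n by (auto simp: norm_cauchy_def)
    have "norm_cauchy H (vnorm H) s"
      using s sW inW by (auto simp: norm_cauchy_def m vn)
    then obtain x where "x \<in> carrier H" "norm_converges H (vnorm H) s x"
      using complete by (auto simp: norm_complete_def)
    then have "x \<in> W" "norm_converges ?W (vnorm ?W) s x"
      using closed_subspace_lim[OF W sW] sW by (auto simp: norm_converges_def m vn)
    then show "\<exists>x\<in>carrier ?W. norm_converges ?W (vnorm ?W) s x" by auto
  qed
  then show "hilbert_space ?W"
  proof (intro hilbert_space.intro mod hilbert_space_axioms.intro)
    fix x y assume "x \<in> carrier ?W" "y \<in> carrier ?W"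
    then show "ip ?W y x = cnj (ip ?W x y)" using ip_cnj[OF inW inW, of x y] by simp
  qed (simp_all add: inW ip_add_left ip_smult_left ip_ge_0 ip_eq_0)
qed

text \<open>The projection is the vector of the subspace with the same coefficients in an orthonormal basis of the
  subspace.\<close>

lemma orthogonal_projection:
  assumes W: "closed_subspace H W" and v: "v \<in> carrier H"
  obtains w where "w \<in> W" "\<And>x. x \<in> W \<Longrightarrow> ip H (v \<ominus> w) x = 0"
proof -
  note inW = subsetD[OF closed_subspace_subset[OF W]]
  interpret WW: hilbert_space "H\<lparr>carrier := W\<rparr>" by (rule hilbert_space_subspace(1)[OF W])
  obtain A where "WW.orthonormal_basis A" using WW.orthonormal_basis_exists by blast
  then have A: "WW.orthonormal A" and Az: "\<And>x. x \<in> W \<Longrightarrow> (\<And>a. a \<in> A \<Longrightarrow> ip H x a = 0) \<Longrightarrow> x = \<zero>"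
    by (auto simp: WW.orthonormal_basis_def)
  have AW: "A \<subseteq> W" and AH: "orthonormal A"
    using A inW by (auto simp: WW.orthonormal_def orthonormal_def)
  obtain w where w: "w \<in> W" "\<And>x. x \<in> A \<Longrightarrow> ip H w x = ip H v x"
    using WW.riesz_fischer[OF A bessel(1)[OF AH v]] by auto
  define r where "r = v \<ominus> w"
  have r: "r \<in> carrier H" using v w inW by (simp add: r_def)
  have rA: "ip H a r = 0" if "a \<in> A" for a
    using that w v inW AW ip_cnj[of r a] r by (auto simp: r_def ip_minus_left)
  \<comment> \<open>The vectors of \<open>W\<close> orthogonal to \<open>r\<close> form a Hilbert space with the same orthonormal basis.\<close>
  define M where "M = {x\<in>W. ip H x r = 0}"
  have M: "closed_subspace H M"
  proof (rule closed_subspaceI)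
    fix s x assume s: "\<And>n. s n \<in> M" and x: "x \<in> carrier H" "norm_converges H (vnorm H) s x"
    have sW: "\<And>n. s n \<in> W" using s by (auto simp: M_def)
    have "(\<lambda>n. ip H (s n) r) \<longlonglongrightarrow> ip H x r"
      using x r sW inW by (intro tendsto_ip) auto
    then have "ip H x r = 0" using s by (simp add: M_def LIMSEQ_const_iff)
    then show "x \<in> M" using closed_subspace_lim[OF W sW x] by (simp add: M_def)
  qed (use closed_subspace_zero[OF W] closed_subspace_add[OF W] closed_subspace_smult[OF W] inW r
       in \<open>auto simp: M_def ip_add_left ip_smult_left\<close>)
  interpret MM: hilbert_space "H\<lparr>carrier := M\<rparr>" by (rule hilbert_space_subspace(1)[OF M])
  have "A \<subseteq> M" using AW rA by (auto simp: M_def)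
  then have AM: "MM.orthonormal A" using A by (simp add: MM.orthonormal_def WW.orthonormal_def)
  have "ip H r x = 0" if x: "x \<in> W" for x
  proof -
    obtain m where m: "m \<in> M" "\<And>a. a \<in> A \<Longrightarrow> ip H m a = ip H x a"
      using MM.riesz_fischer[OF AM bessel(1)[OF AH inW[OF x]]] by auto
    have "x \<ominus> m = \<zero>"
    proof (rule Az)
      show "x \<ominus> m \<in> W" using x m closed_subspace_minus[OF W] by (auto simp: M_def)
      show "ip H (x \<ominus> m) a = 0" if "a \<in> A" for a
        using that m x AW inW by (auto simp: M_def ip_minus_left)
    qed
    then have "x = m" using x m inW by (subst (asm) minus_eq_zero_iff) (auto simp: M_def)
    then have "ip H x r = 0" using m(1) by (simp add: M_def)
    then show ?thesis using ip_cnj[of x r] r inW[OF x] by simp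
  qed
  then show thesis using that[OF w(1)] by (simp add: r_def)
qed

end

section \<open>Square summable functions and their unitary operators\<close>

text \<open>Square summable functions on \<open>S\<close> are total functions that vanish outside \<open>S\<close>, so that equality of
  functions is equality of vectors.\<close>

definition L2 :: "'i set \<Rightarrow> ('i \<Rightarrow> complex) set" where
  "L2 S = {f. (\<forall>i. i \<notin> S \<longrightarrow> f i = 0) \<and> (\<lambda>i. (cmod (f i))\<^sup>2) summable_on S}"

definition nrm :: "'i set \<Rightarrow> ('i \<Rightarrow> complex) \<Rightarrow> real" where
  "nrm S f = sqrt (\<Sum>\<^sub>\<infinity>i\<in>S. (cmod (f i))\<^sup>2)"

definition ell2 :: "'i set \<Rightarrow> ('i \<Rightarrow> complex) hilbert" where
  "ell2 S = \<lparr>carrier = L2 S, monoid.mult = (\<lambda>f g i. 0), one = (\<lambda>i. 0), zero = (\<lambda>i. 0),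
     add = (\<lambda>f g i. f i + g i), smult = (\<lambda>c f i. c * f i),
     ip = (\<lambda>f g. \<Sum>\<^sub>\<infinity>i\<in>S. f i * cnj (g i))\<rparr>"

lemma ell2_simps [simp]:
  "carrier (ell2 S) = L2 S" "\<zero>\<^bsub>ell2 S\<^esub> = (\<lambda>i. 0)" "f \<oplus>\<^bsub>ell2 S\<^esub> g = (\<lambda>i. f i + g i)"
  "c \<odot>\<^bsub>ell2 S\<^esub> f = (\<lambda>i. c * f i)" "ip (ell2 S) f g = (\<Sum>\<^sub>\<infinity>i\<in>S. f i * cnj (g i))"
  by (simp_all add: ell2_def)

lemma L2_out: "f \<in> L2 S \<Longrightarrow> i \<notin> S \<Longrightarrow> f i = 0"
  by (simp add: L2_def)

lemma L2_summable: "f \<in> L2 S \<Longrightarrow> (\<lambda>i. (cmod (f i))\<^sup>2) summable_on S"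
  by (simp add: L2_def)

lemma L2I: "(\<And>i. i \<notin> S \<Longrightarrow> f i = 0) \<Longrightarrow> (\<lambda>i. (cmod (f i))\<^sup>2) summable_on S \<Longrightarrow> f \<in> L2 S"
  by (simp add: L2_def)

lemma L2_ext: "f \<in> L2 S \<Longrightarrow> g \<in> L2 S \<Longrightarrow> (\<And>i. i \<in> S \<Longrightarrow> f i = g i) \<Longrightarrow> f = g"
  by (rule ext) (metis L2_out)

lemma L2_zero [simp]: "(\<lambda>i. 0) \<in> L2 S"
  by (rule L2I) simp_all

lemma L2_scale [simp]: "f \<in> L2 S \<Longrightarrow> (\<lambda>i. c * f i) \<in> L2 S"
  using L2_out[of f S] summable_on_cmult_right[OF L2_summable[of f S], of "(cmod c)\<^sup>2"]
  by (intro L2I) (simp_all add: norm_mult power_mult_distrib)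

lemma L2_dominated:
  assumes "\<And>i. i \<notin> S \<Longrightarrow> f i = 0" "g summable_on S" "\<And>i. i \<in> S \<Longrightarrow> (cmod (f i))\<^sup>2 \<le> g i"
  shows "f \<in> L2 S"
  by (rule L2I[OF assms(1) summable_on_comparison_test[OF assms(2,3)]]) auto

lemma L2_add [simp]:
  assumes f: "f \<in> L2 S" and g: "g \<in> L2 S" shows "(\<lambda>i. f i + g i) \<in> L2 S"
proof (rule L2_dominated)
  show "(\<lambda>i. 2 * ((cmod (f i))\<^sup>2 + (cmod (g i))\<^sup>2)) summable_on S"
    by (intro summable_on_cmult_right summable_on_add L2_summable f g)
  fix i
  have "(cmod (f i + g i))\<^sup>2 \<le> (cmod (f i) + cmod (g i))\<^sup>2"
    by (intro power_mono norm_triangle_ineq) simp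
  also have "\<dots> \<le> 2 * ((cmod (f i))\<^sup>2 + (cmod (g i))\<^sup>2)"
    using zero_le_power2[of "cmod (f i) - cmod (g i)"] by (simp add: power2_sum power2_diff)
  finally show "(cmod (f i + g i))\<^sup>2 \<le> 2 * ((cmod (f i))\<^sup>2 + (cmod (g i))\<^sup>2)" .
qed (use L2_out[OF f] L2_out[OF g] in simp)

lemma L2_minus [simp]: "f \<in> L2 S \<Longrightarrow> g \<in> L2 S \<Longrightarrow> (\<lambda>i. f i - g i) \<in> L2 S"
  using L2_add[OF _ L2_scale[of g S "-1"], of f] by simp

lemma L2_sum [simp]:
  assumes "\<And>a. a \<in> F \<Longrightarrow> f a \<in> L2 S" shows "(\<lambda>i. \<Sum>a\<in>F. f a i) \<in> L2 S"
  using assms by (induction F rule: infinite_finite_induct) auto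

lemma L2_product_summable:
  assumes f: "f \<in> L2 S" and g: "g \<in> L2 S" shows "(\<lambda>i. f i * cnj (g i)) summable_on S"
proof -
  have "(\<lambda>i. f i * cnj (g i)) abs_summable_on S"
  proof (rule abs_summable_on_comparison_test')
    show "(\<lambda>i. (cmod (f i))\<^sup>2 + (cmod (g i))\<^sup>2) summable_on S"
      by (intro summable_on_add L2_summable f g)
    fix i
    show "cmod (f i * cnj (g i)) \<le> (cmod (f i))\<^sup>2 + (cmod (g i))\<^sup>2"
      using zero_le_power2[of "cmod (f i) - cmod (g i)"]
        mult_nonneg_nonneg[OF norm_ge_zero[of "f i"] norm_ge_zero[of "g i"]]
      unfolding power2_diff norm_mult complex_mod_cnj mult.assoc by linarith
  qed
  then show ?thesis by (rule abs_summable_summable)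
qed

lemma nrm_sq: "(nrm S f)\<^sup>2 = (\<Sum>\<^sub>\<infinity>i\<in>S. (cmod (f i))\<^sup>2)"
  by (simp add: nrm_def infsum_nonneg)

lemma nrm_ge_0 [simp]: "0 \<le> nrm S f"
  by (simp add: nrm_def infsum_nonneg)

lemma infsum_complex_of_real:
  "(\<Sum>\<^sub>\<infinity>i\<in>S. complex_of_real (f i)) = complex_of_real (\<Sum>\<^sub>\<infinity>i\<in>S. f i)"
proof (cases "f summable_on S")
  case True
  then show ?thesis by (intro infsumI has_sum_of_real has_sum_infsum)
next
  case False
  then have "\<not> (\<lambda>i. complex_of_real (f i)) summable_on S"
    using summable_on_Re[of "\<lambda>i. complex_of_real (f i)" S] by auto
  then show ?thesis using False by (simp add: infsum_not_exists)
qed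

lemma vnorm_ell2 [simp]: "vnorm (ell2 S) f = nrm S f"
proof -
  have "(\<Sum>\<^sub>\<infinity>i\<in>S. f i * cnj (f i)) = (\<Sum>\<^sub>\<infinity>i\<in>S. complex_of_real ((cmod (f i))\<^sup>2))"
    by (simp only: complex_norm_square)
  also have "\<dots> = complex_of_real (\<Sum>\<^sub>\<infinity>i\<in>S. (cmod (f i))\<^sup>2)"
    by (rule infsum_complex_of_real)
  finally show ?thesis by (simp add: vnorm_def nrm_def del: of_real_power)
qed

lemma module_ell2: "Module.module complex_ring (ell2 S)"
proof -
  have "abelian_group (ell2 S)"
  proof (rule abelian_groupI)
    fix f assume "f \<in> carrier (ell2 S)"
    then show "\<exists>g\<in>carrier (ell2 S). g \<oplus>\<^bsub>ell2 S\<^esub> f = \<zero>\<^bsub>ell2 S\<^esub>"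
      using L2_scale[of f S "-1"] by (intro bexI[of _ "\<lambda>i. - f i"]) auto
  qed (auto simp: algebra_simps)
  then show ?thesis
    by (intro moduleI cring_complex_ring) (auto simp: algebra_simps)
qed

lemma ell2_minus [simp]:
  assumes "f \<in> L2 S" "g \<in> L2 S" shows "f \<ominus>\<^bsub>ell2 S\<^esub> g = (\<lambda>i. f i - g i)"
proof -
  interpret Module.module complex_ring "ell2 S" by (rule module_ell2)
  have "\<ominus>\<^bsub>ell2 S\<^esub> g = (\<lambda>i. - g i)"
    using assms L2_scale[of g S "-1"] by (intro minus_equality) auto
  then show ?thesis by (simp add: minus_eq)
qed

text \<open>A Cauchy sequence in \<open>\<ell>\<^sup>2\<close> converges pointwise; the bounds on finite partial sums survive
  the pointwise limit, and finite partial sums determine the norm.\<close>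

lemma complete_ell2: "norm_complete (ell2 S) (vnorm (ell2 S))"
  unfolding norm_complete_def
proof (intro allI impI)
  fix s assume s: "norm_cauchy (ell2 S) (vnorm (ell2 S)) s"
  then have sL: "s n \<in> L2 S" for n by (auto simp: norm_cauchy_def)
  have cau: "\<exists>N. \<forall>m\<ge>N. \<forall>n\<ge>N. nrm S (\<lambda>i. s m i - s n i) < e" if "e > 0" for e
    using s that by (simp add: norm_cauchy_def sL)
  have fin: "(\<Sum>i\<in>F. (cmod (f i))\<^sup>2) \<le> (nrm S f)\<^sup>2" if "f \<in> L2 S" "finite F" "F \<subseteq> S" for f F
    unfolding nrm_sq using that by (intro finite_sum_le_infsum L2_summable) auto
  have "Cauchy (\<lambda>n. s n i)" for i
  proof (cases "i \<in> S")
    case True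
    have "cmod (f i) \<le> nrm S f" if "f \<in> L2 S" for f
      using fin[OF that, of "{i}"] True by (auto intro: power2_le_imp_le)
    then have *: "cmod (s m i - s n i) \<le> nrm S (\<lambda>i. s m i - s n i)" for m n
      using sL by (metis (no_types) L2_minus)
    show ?thesis
    proof (rule CauchyI)
      fix e :: real assume "e > 0"
      then obtain N where "\<forall>m\<ge>N. \<forall>n\<ge>N. nrm S (\<lambda>i. s m i - s n i) < e" using cau by blast
      then show "\<exists>M. \<forall>m\<ge>M. \<forall>n\<ge>M. cmod (s m i - s n i) < e"
        using * by (meson le_less_trans)
    qed
  qed (use sL in \<open>simp add: L2_out[OF sL] Cauchy_def\<close>)
  then have "\<exists>l. (\<lambda>n. s n i) \<longlonglongrightarrow> l" for i
    by (simp add: Cauchy_convergent_iff convergent_def)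
  then obtain f where lim: "\<And>i. (\<lambda>n. s n i) \<longlonglongrightarrow> f i" by metis
  have close: "(\<lambda>i. s m i - f i) \<in> L2 S \<and> nrm S (\<lambda>i. s m i - f i) \<le> e"
    if e: "e \<ge> 0" and N: "\<forall>n\<ge>N. nrm S (\<lambda>i. s m i - s n i) \<le> e" for e N m
  proof -
    have b: "(\<Sum>i\<in>F. (cmod (s m i - f i))\<^sup>2) \<le> e\<^sup>2" if F: "finite F" "F \<subseteq> S" for F
    proof (rule LIMSEQ_le_const2)
      show "(\<lambda>n. \<Sum>i\<in>F. (cmod (s m i - s n i))\<^sup>2) \<longlonglongrightarrow> (\<Sum>i\<in>F. (cmod (s m i - f i))\<^sup>2)"
        by (intro tendsto_intros lim)
      have "(\<Sum>i\<in>F. (cmod (s m i - s n i))\<^sup>2) \<le> e\<^sup>2" if "n \<ge> N" for n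
        using fin[OF L2_minus[OF sL sL] F, of m n] power_mono[OF N[rule_format, OF that], of 2]
        by simp
      then show "\<exists>N. \<forall>n\<ge>N. (\<Sum>i\<in>F. (cmod (s m i - s n i))\<^sup>2) \<le> e\<^sup>2" by blast
    qed
    have sm: "(\<lambda>i. (cmod (s m i - f i))\<^sup>2) summable_on S"
      using b by (intro nonneg_bdd_above_summable_on bdd_aboveI[of _ "e\<^sup>2"]) auto
    have "f i = 0" if "i \<notin> S" for i
      using lim[of i] L2_out[OF sL that] by (simp add: LIMSEQ_const_iff)
    then have "(\<lambda>i. s m i - f i) \<in> L2 S" using sm L2_out[OF sL] by (intro L2I) auto
    moreover have "(nrm S (\<lambda>i. s m i - f i))\<^sup>2 \<le> e\<^sup>2"
      unfolding nrm_sq using sm b by (rule infsum_le_finite_sums)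
    then have "nrm S (\<lambda>i. s m i - f i) \<le> e" using e by (rule power2_le_imp_le)
    ultimately show ?thesis by simp
  qed
  have ev: "\<exists>N. \<forall>m\<ge>N. (\<lambda>i. s m i - f i) \<in> L2 S \<and> nrm S (\<lambda>i. s m i - f i) \<le> e" if e: "e > 0" for e
  proof -
    obtain N where "\<forall>m\<ge>N. \<forall>n\<ge>N. nrm S (\<lambda>i. s m i - s n i) < e" using cau[OF e] by blast
    then have "\<forall>m\<ge>N. (\<lambda>i. s m i - f i) \<in> L2 S \<and> nrm S (\<lambda>i. s m i - f i) \<le> e"
      using e by (intro allI impI close[of e N]) (auto intro: less_imp_le)
    then show ?thesis by blast
  qed
  obtain m where "(\<lambda>i. s m i - f i) \<in> L2 S" using ev[of 1] by auto
  then have fL: "f \<in> L2 S" using L2_minus[OF sL[of m], of "\<lambda>i. s m i - f i"] by simp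
  have "(\<lambda>n. nrm S (\<lambda>i. s n i - f i)) \<longlonglongrightarrow> 0"
  proof (rule LIMSEQ_I)
    fix e :: real assume "e > 0"
    then obtain N where N: "\<forall>m\<ge>N. nrm S (\<lambda>i. s m i - f i) \<le> e / 2" using ev[of "e/2"] by auto
    have "norm (nrm S (\<lambda>i. s m i - f i) - 0) < e" if "m \<ge> N" for m
      using N[rule_format, OF that] \<open>e > 0\<close> by simp
    then show "\<exists>N. \<forall>m\<ge>N. norm (nrm S (\<lambda>i. s m i - f i) - 0) < e" by blast
  qed
  then show "\<exists>x\<in>carrier (ell2 S). norm_converges (ell2 S) (vnorm (ell2 S)) s x"
    using fL by (auto simp: norm_converges_def sL)
qed

lemma nrm_eq_0D: assumes "f \<in> L2 S" "nrm S f = 0" shows "f = (\<lambda>i. 0)"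
proof (rule L2_ext[OF assms(1) L2_zero])
  fix i assume i: "i \<in> S"
  have "(cmod (f i))\<^sup>2 = 0"
    using assms i nonneg_infsum_le_0D[of "\<lambda>i. (cmod (f i))\<^sup>2" S i]
    by (simp add: nrm_def L2_summable)
  then show "f i = 0" by simp
qed

lemma hilbert_space_ell2: "hilbert_space (ell2 S)"
proof (intro hilbert_space.intro module_ell2 hilbert_space_axioms.intro complete_ell2)
  fix f g h c
  assume "f \<in> carrier (ell2 S)" "g \<in> carrier (ell2 S)"
  then have fg: "f \<in> L2 S" "g \<in> L2 S" by simp_all
  show "ip (ell2 S) g f = cnj (ip (ell2 S) f g)"
    by (simp add: infsum_cnj[symmetric] mult.commute del: infsum_cnj)
  show "ip (ell2 S) (c \<odot>\<^bsub>ell2 S\<^esub> f) g = c * ip (ell2 S) f g"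
    using L2_product_summable[OF fg] by (simp add: infsum_cmult_right mult.assoc)
  assume "h \<in> carrier (ell2 S)"
  then have h: "h \<in> L2 S" by simp
  show "ip (ell2 S) (f \<oplus>\<^bsub>ell2 S\<^esub> g) h = ip (ell2 S) f h + ip (ell2 S) g h"
    using L2_product_summable[OF fg(1) h] L2_product_summable[OF fg(2) h]
    by (simp add: infsum_add distrib_right)
next
  fix f assume f: "f \<in> carrier (ell2 S)"
  have "(\<Sum>\<^sub>\<infinity>i\<in>S. f i * cnj (f i)) = (\<Sum>\<^sub>\<infinity>i\<in>S. complex_of_real ((cmod (f i))\<^sup>2))"
    by (simp only: complex_norm_square)
  then have ip: "ip (ell2 S) f f = complex_of_real ((nrm S f)\<^sup>2)"
    by (simp add: infsum_complex_of_real nrm_sq del: of_real_power)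
  show "0 \<le> Re (ip (ell2 S) f f)" unfolding ip by simp
  show "f = \<zero>\<^bsub>ell2 S\<^esub>" if "ip (ell2 S) f f = 0"
    using that f nrm_eq_0D[of f S] unfolding ip by simp
qed

lemma nrm_triangle: "f \<in> L2 S \<Longrightarrow> g \<in> L2 S \<Longrightarrow> nrm S (\<lambda>i. f i + g i) \<le> nrm S f + nrm S g"
  using hilbert_space.vnorm_add[OF hilbert_space_ell2, of f S g] by simp

lemma nrm_scale: "nrm S (\<lambda>i. c * f i) = cmod c * nrm S f"
proof -
  have "(\<Sum>\<^sub>\<infinity>i\<in>S. (cmod c)\<^sup>2 * (cmod (f i))\<^sup>2) = (cmod c)\<^sup>2 * (\<Sum>\<^sub>\<infinity>i\<in>S. (cmod (f i))\<^sup>2)"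
    by (rule infsum_cmult_right')
  then show ?thesis by (simp add: nrm_def norm_mult power_mult_distrib real_sqrt_mult)
qed

lemma nrm_zero [simp]: "nrm S (\<lambda>i. 0) = 0"
  by (simp add: nrm_def)

lemma nrm_minus_commute: "nrm S (\<lambda>i. f i - g i) = nrm S (\<lambda>i. g i - f i)"
  by (simp add: nrm_def norm_minus_commute)

lemma nrm_diff_triangle:
  assumes "f \<in> L2 S" "g \<in> L2 S" "h \<in> L2 S"
  shows "nrm S (\<lambda>i. f i - h i) \<le> nrm S (\<lambda>i. f i - g i) + nrm S (\<lambda>i. g i - h i)"
  using nrm_triangle[OF L2_minus[OF assms(1,2)] L2_minus[OF assms(2,3)]] by simp

lemma nrm_minus_le:
  assumes "f \<in> L2 S" "g \<in> L2 S" shows "nrm S (\<lambda>i. f i - g i) \<le> nrm S f + nrm S g"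
  using nrm_triangle[OF assms(1) L2_scale[OF assms(2), of "-1"]] nrm_scale[of S "-1" g] by simp

lemma nrm_sum_le:
  assumes "\<And>a. a \<in> F \<Longrightarrow> f a \<in> L2 S"
  shows "nrm S (\<lambda>i. \<Sum>a\<in>F. f a i) \<le> (\<Sum>a\<in>F. nrm S (f a))"
  using assms
proof (induction F rule: infinite_finite_induct)
  case (insert a F)
  have "nrm S (\<lambda>i. f a i + (\<Sum>a\<in>F. f a i)) \<le> nrm S (f a) + nrm S (\<lambda>i. \<Sum>a\<in>F. f a i)"
    using insert.prems by (intro nrm_triangle L2_sum) auto
  then show ?case using insert by force
qed simp_all

definition unit_vec :: "'i \<Rightarrow> 'i \<Rightarrow> complex" where "unit_vec s = (\<lambda>i. if i = s then 1 else 0)"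

lemma unit_vec_L2 [simp]: "s \<in> S \<Longrightarrow> unit_vec s \<in> L2 S"
  by (rule L2I) (auto simp: unit_vec_def intro!: finite_nonzero_values_imp_summable_on)

lemma infsum_single:
  assumes "s \<in> S" "\<And>i. i \<in> S \<Longrightarrow> i \<noteq> s \<Longrightarrow> f i = 0" shows "infsum f S = (f s :: 'c :: {comm_monoid_add, t2_space})"
  using infsum_cong_neutral[of "{s}" S f f] assms by auto

lemma ip_unit_vec: "s \<in> S \<Longrightarrow> ip (ell2 S) f (unit_vec s) = f s"
  by (simp add: unit_vec_def infsum_single[of s])

lemma nrm_unit_vec [simp]: "s \<in> S \<Longrightarrow> nrm S (unit_vec s) = 1"
  by (simp add: nrm_def unit_vec_def infsum_single[of s])

text \<open>The difference of a function and its projection to the subspace is orthogonal to all unit vectors.\<close>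

lemma closed_subspace_eq_L2:
  assumes W: "closed_subspace (ell2 S) W" and u: "\<And>s. s \<in> S \<Longrightarrow> unit_vec s \<in> W"
  shows "W = L2 S"
proof
  interpret hilbert_space "ell2 S" by (rule hilbert_space_ell2)
  show WL: "W \<subseteq> L2 S" using closed_subspace_subset[OF W] by simp
  show "L2 S \<subseteq> W"
  proof
    fix f assume f: "f \<in> L2 S"
    then obtain w where w: "w \<in> W" "\<And>x. x \<in> W \<Longrightarrow> ip (ell2 S) (f \<ominus>\<^bsub>ell2 S\<^esub> w) x = 0"
      using orthogonal_projection[OF W, of f] by auto
    have wL: "w \<in> L2 S" using w WL by auto
    have "f = w"
    proof (rule L2_ext[OF f wL])
      fix i assume "i \<in> S"
      then show "f i = w i" using w(2)[OF u] ip_unit_vec[of i S "\<lambda>i. f i - w i"] f wL by simp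
    qed
    then show "f \<in> W" using w by simp
  qed
qed

text \<open>Operators are functions of arbitrary families; only their values at square summable ones are
  constrained.\<close>

definition isometry :: "'i set \<Rightarrow> 'j set \<Rightarrow> (('i \<Rightarrow> complex) \<Rightarrow> 'j \<Rightarrow> complex) \<Rightarrow> bool" where
  "isometry A S T \<longleftrightarrow> T \<in> L2 A \<rightarrow> L2 S \<and>
     (\<forall>f\<in>L2 A. \<forall>g\<in>L2 A. T (\<lambda>i. f i + g i) = (\<lambda>i. T f i + T g i)) \<and>
     (\<forall>c. \<forall>f\<in>L2 A. T (\<lambda>i. c * f i) = (\<lambda>i. c * T f i)) \<and>
     (\<forall>f\<in>L2 A. nrm S (T f) = nrm A f)"

lemma isometryI:
  assumes "\<And>f. f \<in> L2 A \<Longrightarrow> T f \<in> L2 S"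
    "\<And>f g. f \<in> L2 A \<Longrightarrow> g \<in> L2 A \<Longrightarrow> T (\<lambda>i. f i + g i) = (\<lambda>i. T f i + T g i)"
    "\<And>c f. f \<in> L2 A \<Longrightarrow> T (\<lambda>i. c * f i) = (\<lambda>i. c * T f i)"
    "\<And>f. f \<in> L2 A \<Longrightarrow> nrm S (T f) = nrm A f"
  shows "isometry A S T"
  using assms by (auto simp: isometry_def)

lemma isometryD:
  assumes "isometry A S T" "f \<in> L2 A"
  shows "T f \<in> L2 S" "g \<in> L2 A \<Longrightarrow> T (\<lambda>i. f i + g i) = (\<lambda>i. T f i + T g i)"
    "T (\<lambda>i. c * f i) = (\<lambda>i. c * T f i)" "nrm S (T f) = nrm A f"
  using assms by (auto simp: isometry_def)

lemma isometry_zero: "isometry A S T \<Longrightarrow> T (\<lambda>i. 0) = (\<lambda>i. 0)"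
  using isometryD(3)[of A S T "\<lambda>i. 0" 0] by simp

lemma isometry_minus:
  assumes "isometry A S T" "f \<in> L2 A" "g \<in> L2 A"
  shows "T (\<lambda>i. f i - g i) = (\<lambda>i. T f i - T g i)"
proof -
  have "T (\<lambda>i. f i + (- 1) * g i) = (\<lambda>i. T f i + T (\<lambda>i. (- 1) * g i) i)"
    by (rule isometryD(2)[OF assms(1,2) L2_scale[OF assms(3)]])
  then show ?thesis unfolding isometryD(3)[OF assms(1,3)] by simp
qed

lemma isometry_sum:
  assumes T: "isometry A S T" and f: "\<And>a. a \<in> F \<Longrightarrow> f a \<in> L2 A"
  shows "T (\<lambda>i. \<Sum>a\<in>F. c a * f a i) = (\<lambda>i. \<Sum>a\<in>F. c a * T (f a) i)"
  using f
proof (induction F rule: infinite_finite_induct)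
  case (insert a F)
  have "T (\<lambda>i. c a * f a i + (\<Sum>a\<in>F. c a * f a i)) = (\<lambda>i. T (\<lambda>i. c a * f a i) i + T (\<lambda>i. \<Sum>a\<in>F. c a * f a i) i)"
    using insert.prems by (intro isometryD(2)[OF T] L2_scale L2_sum) auto
  then show ?case using insert isometryD(3)[OF T, of "f a" "c a"] by simp
qed (use isometry_zero[OF T] in simp_all)

lemma isometry_inj: assumes "isometry A S T" shows "inj_on T (L2 A)"
proof (rule inj_onI)
  fix f g assume fg: "f \<in> L2 A" "g \<in> L2 A" "T f = T g"
  then have "nrm A (\<lambda>i. f i - g i) = 0"
    using isometryD(4)[OF assms L2_minus[OF fg(1,2)]] isometry_minus[OF assms fg(1,2)] by simp
  then have "(\<lambda>i. f i - g i) = (\<lambda>i. 0)" using fg by (intro nrm_eq_0D) auto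
  then show "f = g" by (metis (no_types, lifting) ext right_minus_eq)
qed

text \<open>By polarization.\<close>

lemma isometry_ip:
  assumes T: "isometry A S T" and f: "f \<in> L2 A" and g: "g \<in> L2 A"
  shows "ip (ell2 S) (T f) (T g) = ip (ell2 A) f g"
proof -
  have re: "Re (ip (ell2 B) h k) = ((nrm B h)\<^sup>2 + (nrm B k)\<^sup>2 - (nrm B (\<lambda>i. h i - k i))\<^sup>2) / 2"
    if "h \<in> L2 B" "k \<in> L2 B" for B :: "'z set" and h k
    using hilbert_space.vnorm_minus_sq[OF hilbert_space_ell2, of h B k] that by (simp del: ell2_simps(5))
  have Re: "Re (ip (ell2 S) (T f) (T g)) = Re (ip (ell2 A) f g)" if "f \<in> L2 A" "g \<in> L2 A" for f g
    using that isometryD(1,4)[OF T] L2_minus[OF that]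
    by (simp add: re isometry_minus[OF T that, symmetric] del: ell2_simps(5))
  have im: "Im (ip (ell2 B) h k) = Re (ip (ell2 B) h (\<lambda>i. \<i> * k i))" if "h \<in> L2 B" "k \<in> L2 B"
    for B :: "'z set" and h k
    using hilbert_space.ip_smult_right[OF hilbert_space_ell2, of h B k \<i>] that by (simp del: ell2_simps(5))
  have "Im (ip (ell2 S) (T f) (T g)) = Im (ip (ell2 A) f g)"
    using f g Re[OF f L2_scale[OF g]] isometryD(1)[OF T]
    by (simp add: im isometryD(3)[OF T g] del: ell2_simps(5))
  then show ?thesis using Re[OF f g] by (simp add: complex_eq_iff del: ell2_simps(5))
qed

lemma isometry_comp: "isometry A S T \<Longrightarrow> isometry S R U \<Longrightarrow> isometry A R (\<lambda>f. U (T f))"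
  by (rule isometryI) (simp_all add: isometryD)

definition unitary :: "'i set \<Rightarrow> (('i \<Rightarrow> complex) \<Rightarrow> 'i \<Rightarrow> complex) \<Rightarrow> bool" where
  "unitary S U \<longleftrightarrow> isometry S S U \<and> U ` L2 S = L2 S"

definition uinv :: "'i set \<Rightarrow> (('i \<Rightarrow> complex) \<Rightarrow> 'i \<Rightarrow> complex) \<Rightarrow> ('i \<Rightarrow> complex) \<Rightarrow> 'i \<Rightarrow> complex" where
  "uinv S U = inv_into (L2 S) U"

lemma unitary_isometry: "unitary S U \<Longrightarrow> isometry S S U"
  by (simp add: unitary_def)

lemmas unitaryD = isometryD[OF unitary_isometry]

lemma unitary_uinv_closed: "unitary S U \<Longrightarrow> f \<in> L2 S \<Longrightarrow> uinv S U f \<in> L2 S"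
  by (auto simp: unitary_def uinv_def intro: inv_into_into)

lemma uinv_right [simp]: "unitary S U \<Longrightarrow> f \<in> L2 S \<Longrightarrow> U (uinv S U f) = f"
  unfolding unitary_def uinv_def by (metis f_inv_into_f)

lemma uinv_left [simp]: "unitary S U \<Longrightarrow> f \<in> L2 S \<Longrightarrow> uinv S U (U f) = f"
  by (auto simp: unitary_def uinv_def intro: inv_into_f_f isometry_inj)

lemma uinv_eqI: "unitary S U \<Longrightarrow> g \<in> L2 S \<Longrightarrow> U g = f \<Longrightarrow> uinv S U f = g"
  by auto

lemma unitaryI:
  assumes "isometry S S U" "\<And>f. f \<in> L2 S \<Longrightarrow> V f \<in> L2 S" "\<And>f. f \<in> L2 S \<Longrightarrow> U (V f) = f"
  shows "unitary S U"
proof -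
  have "L2 S \<subseteq> U ` L2 S" using assms(2,3) by (metis image_eqI subsetI)
  then show ?thesis unfolding unitary_def using assms(1) isometryD(1)[OF assms(1)] by blast
qed

lemma unitary_uinv: assumes U: "unitary S U" shows "unitary S (uinv S U)"
proof (rule unitaryI[where V = U])
  note c = unitary_uinv_closed[OF U] unitaryD(1)[OF U]
  show "isometry S S (uinv S U)"
  proof (rule isometryI)
    fix f g assume fg: "f \<in> L2 S" "g \<in> L2 S"
    then show "uinv S U (\<lambda>i. f i + g i) = (\<lambda>i. uinv S U f i + uinv S U g i)"
      using unitaryD(2)[OF U c(1) c(1), of f g] U c(1) by (intro uinv_eqI) auto
  next
    fix f c assume f: "f \<in> L2 S"
    then show "uinv S U (\<lambda>i. c * f i) = (\<lambda>i. c * uinv S U f i)"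
      using unitaryD(3)[OF U unitary_uinv_closed[OF U f], of c] U unitary_uinv_closed[OF U f]
      by (intro uinv_eqI) simp_all
  next
    fix f assume f: "f \<in> L2 S"
    then show "nrm S (uinv S U f) = nrm S f"
      using unitaryD(4)[OF U c(1)[OF f]] U by simp
  qed (use c in simp)
qed (use U unitaryD(1)[OF U] in auto)

lemma unitary_comp:
  assumes "unitary S U" "unitary S V" shows "unitary S (\<lambda>f. U (V f))"
  by (rule unitaryI[where V = "\<lambda>f. uinv S V (uinv S U f)"])
    (use assms in \<open>simp_all add: isometry_comp[of S S V S U] unitary_uinv_closed unitary_isometry\<close>)

lemma unitary_id: "unitary S (\<lambda>f. f)"
  by (rule unitaryI[where V = "\<lambda>f. f"]) (auto intro: isometryI)

lemma unitary_scale: assumes "unitary S U" "cmod c = 1" shows "unitary S (\<lambda>f i. c * U f i)"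
proof (rule unitaryI[where V = "\<lambda>f. uinv S U (\<lambda>i. cnj c * f i)"])
  show "isometry S S (\<lambda>f i. c * U f i)"
    using assms by (intro isometryI) (auto simp: unitaryD algebra_simps nrm_scale intro: unitaryD(1))
  fix f assume "f \<in> L2 S"
  then have cf: "(\<lambda>i. cnj c * f i) \<in> L2 S" by auto
  then show "uinv S U (\<lambda>i. cnj c * f i) \<in> L2 S" by (rule unitary_uinv_closed[OF assms(1)])
  have "c * cnj c = 1" using assms(2) complex_norm_square[of c] by simp
  then show "(\<lambda>i. c * U (uinv S U (\<lambda>i. cnj c * f i)) i) = f"
    using assms(1) cf by (simp add: mult.assoc[symmetric])
qed

lemma unitary_ip_adjoint:
  assumes U: "unitary S U" and f: "f \<in> L2 S" and g: "g \<in> L2 S"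
  shows "ip (ell2 S) (U f) g = ip (ell2 S) f (uinv S U g)"
  using isometry_ip[OF unitary_isometry[OF U] f unitary_uinv_closed[OF U g]] U g by simp

text \<open>Composition with a permutation of the index set; the result is set to \<open>0\<close> outside the index set to
  stay in the space.\<close>

lemma unitary_reindex:
  assumes g: "bij_betw g S S"
  shows "unitary S (\<lambda>f i. if i \<in> S then f (g i) else 0)"
proof -
  have gS: "i \<in> S \<Longrightarrow> g i \<in> S" for i using g by (auto simp: bij_betw_def)
  define h where "h = inv_into S g"
  have h: "bij_betw h S S" unfolding h_def by (rule bij_betw_inv_into[OF g])
  have hS: "i \<in> S \<Longrightarrow> h i \<in> S" for i using h by (auto simp: bij_betw_def)
  have L: "(\<lambda>i. if i \<in> S then f (g i) else 0) \<in> L2 S" if "bij_betw g S S" "f \<in> L2 S" for f g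
  proof (rule L2I)
    have "(\<lambda>i. (cmod (f (g i)))\<^sup>2) summable_on S"
      using summable_on_reindex_bij_betw[OF that(1), of "\<lambda>i. (cmod (f i))\<^sup>2"] L2_summable[OF that(2)] by simp
    then show "(\<lambda>i. (cmod (if i \<in> S then f (g i) else 0))\<^sup>2) summable_on S"
      by (rule summable_on_cong[THEN iffD1, rotated]) simp
  qed simp
  have n: "nrm S (\<lambda>i. if i \<in> S then f (g i) else 0) = nrm S f" for f
  proof -
    have "(\<Sum>\<^sub>\<infinity>i\<in>S. (cmod (if i \<in> S then f (g i) else 0))\<^sup>2) = (\<Sum>\<^sub>\<infinity>i\<in>S. (cmod (f (g i)))\<^sup>2)"
      by (rule infsum_cong) simp
    also have "\<dots> = (\<Sum>\<^sub>\<infinity>i\<in>S. (cmod (f i))\<^sup>2)" by (rule infsum_reindex_bij_betw[OF g])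
    finally show ?thesis by (simp add: nrm_def)
  qed
  show ?thesis
  proof (rule unitaryI[where V = "\<lambda>f i. if i \<in> S then f (h i) else 0"])
    fix f assume f: "f \<in> L2 S"
    have "h (g i) = i" if "i \<in> S" for i using that g by (simp add: h_def bij_betw_def)
    then show "(\<lambda>i. if i \<in> S then (if g i \<in> S then f (h (g i)) else 0) else 0) = f"
      using gS L2_out[OF f] by fastforce
  qed (use L g h n in \<open>auto intro!: isometryI\<close>)
qed

lemma unitary_diag:
  assumes z: "\<And>i. i \<in> S \<Longrightarrow> cmod (z i) = 1" shows "unitary S (\<lambda>f i. z i * f i)"
proof -
  have L: "(\<lambda>i. w i * f i) \<in> L2 S \<and> nrm S (\<lambda>i. w i * f i) = nrm S f"
    if w: "\<And>i. i \<in> S \<Longrightarrow> cmod (w i) = 1" and f: "f \<in> L2 S" for w f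
  proof
    have eq: "i \<in> S \<Longrightarrow> (cmod (w i * f i))\<^sup>2 = (cmod (f i))\<^sup>2" for i using w by (simp add: norm_mult)
    show "(\<lambda>i. w i * f i) \<in> L2 S"
      using L2_summable[OF f] L2_out[OF f] eq by (intro L2I) (auto simp: cong: summable_on_cong)
    show "nrm S (\<lambda>i. w i * f i) = nrm S f"
      unfolding nrm_def using infsum_cong[of S, OF eq] by simp
  qed
  show ?thesis
  proof (rule unitaryI[where V = "\<lambda>f i. cnj (z i) * f i"])
    show "isometry S S (\<lambda>f i. z i * f i)"
      using L[OF z] by (intro isometryI) (auto simp: algebra_simps)
    fix f assume f: "f \<in> L2 S"
    show "(\<lambda>i. cnj (z i) * f i) \<in> L2 S" using L[of "\<lambda>i. cnj (z i)"] z f by simp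
    have "z i * cnj (z i) = 1" if "i \<in> S" for i
      using z[OF that] complex_norm_square[of "z i"] by simp
    then show "(\<lambda>i. z i * (cnj (z i) * f i)) = f"
      using L2_out[OF f] unfolding mult.assoc[symmetric] by fastforce
  qed
qed

text \<open>Square summable functions on a disjoint union are square summable families of square
  summable functions.\<close>

lemma L2_slice:
  assumes f: "f \<in> L2 (Sigma A B)"
  shows "a \<in> A \<Longrightarrow> (\<lambda>b. f (a, b)) \<in> L2 (B a)"
    "(\<lambda>a. (nrm (B a) (\<lambda>b. f (a, b)))\<^sup>2) summable_on A"
    "(nrm (Sigma A B) f)\<^sup>2 = (\<Sum>\<^sub>\<infinity>a\<in>A. (nrm (B a) (\<lambda>b. f (a, b)))\<^sup>2)"
proof -
  have s: "(\<lambda>(a, b). (cmod (f (a, b)))\<^sup>2) summable_on Sigma A B"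
    using L2_summable[OF f] by (simp add: case_prod_unfold)
  show "(\<lambda>b. f (a, b)) \<in> L2 (B a)" if "a \<in> A"
    using summable_on_SigmaD1[OF s that] L2_out[OF f] that by (intro L2I) auto
  show "(\<lambda>a. (nrm (B a) (\<lambda>b. f (a, b)))\<^sup>2) summable_on A"
    using summable_on_Sigma_banach[OF s] by (simp add: nrm_sq)
  show "(nrm (Sigma A B) f)\<^sup>2 = (\<Sum>\<^sub>\<infinity>a\<in>A. (nrm (B a) (\<lambda>b. f (a, b)))\<^sup>2)"
    using infsum_Sigma'_banach[OF s] by (simp add: nrm_sq case_prod_unfold)
qed

lemma L2_SigmaI:
  assumes "\<And>a b. a \<notin> A \<Longrightarrow> f (a, b) = 0" "\<And>a. a \<in> A \<Longrightarrow> (\<lambda>b. f (a, b)) \<in> L2 (B a)"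
    and "(\<lambda>a. (nrm (B a) (\<lambda>b. f (a, b)))\<^sup>2) summable_on A"
  shows "f \<in> L2 (Sigma A B)"
proof (rule L2I)
  fix x assume "x \<notin> Sigma A B"
  then show "f x = 0" using assms(1,2) by (cases x) (auto dest: L2_out)
next
  show "(\<lambda>x. (cmod (f x))\<^sup>2) summable_on Sigma A B"
    by (rule summable_on_SigmaI[OF _ assms(3)])
      (use L2_summable[OF assms(2)] in \<open>auto simp: nrm_sq\<close>)
qed

text \<open>The estimate behind all norm bounds for operators that act blockwise.\<close>

lemma L2_Sigma_le:
  assumes "\<And>a b. a \<notin> A \<Longrightarrow> f (a, b) = 0" "\<And>a. a \<in> A \<Longrightarrow> (\<lambda>b. f (a, b)) \<in> L2 (B a)"
    and g: "g \<in> L2 A" and K: "K \<ge> 0" "\<And>a. a \<in> A \<Longrightarrow> nrm (B a) (\<lambda>b. f (a, b)) \<le> K * cmod (g a)"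
  shows "f \<in> L2 (Sigma A B)" "nrm (Sigma A B) f \<le> K * nrm A g"
proof -
  have le: "(nrm (B a) (\<lambda>b. f (a, b)))\<^sup>2 \<le> K\<^sup>2 * (cmod (g a))\<^sup>2" if "a \<in> A" for a
    using power_mono[OF K(2)[OF that], of 2] by (simp add: power_mult_distrib)
  have s: "(\<lambda>a. K\<^sup>2 * (cmod (g a))\<^sup>2) summable_on A"
    by (intro summable_on_cmult_right L2_summable g)
  then have s': "(\<lambda>a. (nrm (B a) (\<lambda>b. f (a, b)))\<^sup>2) summable_on A"
    by (rule summable_on_comparison_test) (use le in auto)
  show f: "f \<in> L2 (Sigma A B)" by (rule L2_SigmaI[OF assms(1,2) s'])
  have "(nrm (Sigma A B) f)\<^sup>2 \<le> (\<Sum>\<^sub>\<infinity>a\<in>A. K\<^sup>2 * (cmod (g a))\<^sup>2)"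
    unfolding L2_slice(3)[OF f] by (intro infsum_mono s s' le)
  also have "\<dots> = (K * nrm A g)\<^sup>2"
    by (simp add: infsum_cmult_right' power_mult_distrib nrm_sq)
  finally show "nrm (Sigma A B) f \<le> K * nrm A g"
    by (rule power2_le_imp_le) (use K in simp)
qed

definition blk :: "'a set \<Rightarrow> ('a \<Rightarrow> ('b \<Rightarrow> complex) \<Rightarrow> 'c \<Rightarrow> complex) \<Rightarrow>
    ('a \<times> 'b \<Rightarrow> complex) \<Rightarrow> 'a \<times> 'c \<Rightarrow> complex" where
  "blk A U f = (\<lambda>(a, b). if a \<in> A then U a (\<lambda>b. f (a, b)) b else 0)"

lemma blk_slice: "a \<in> A \<Longrightarrow> (\<lambda>b. blk A U f (a, b)) = U a (\<lambda>b. f (a, b))"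
  by (simp add: blk_def)

lemma unitary_blk:
  assumes U: "\<And>a. a \<in> A \<Longrightarrow> unitary (B a) (U a)"
  shows "unitary (Sigma A B) (blk A U)"
proof (rule unitaryI[where V = "blk A (\<lambda>a. uinv (B a) (U a))"])
  have L: "blk A U f \<in> L2 (Sigma A B) \<and> nrm (Sigma A B) (blk A U f) = nrm (Sigma A B) f"
    if U: "\<And>a. a \<in> A \<Longrightarrow> unitary (B a) (U a)" and f: "f \<in> L2 (Sigma A B)" for f U
  proof -
    note s = L2_slice[OF f]
    have n: "nrm (B a) (\<lambda>b. blk A U f (a, b)) = nrm (B a) (\<lambda>b. f (a, b))" if "a \<in> A" for a
      using that U s by (simp add: blk_slice unitaryD)
    have L: "blk A U f \<in> L2 (Sigma A B)"
    proof (rule L2_SigmaI)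
      show "(\<lambda>a. (nrm (B a) (\<lambda>b. blk A U f (a, b)))\<^sup>2) summable_on A"
        using s(2) n by (simp cong: summable_on_cong)
      fix a assume a: "a \<in> A"
      show "(\<lambda>b. blk A U f (a, b)) \<in> L2 (B a)"
        unfolding blk_slice[OF a] by (rule unitaryD(1)[OF U[OF a] s(1)[OF a]])
    qed (simp add: blk_def)
    moreover have "(nrm (Sigma A B) (blk A U f))\<^sup>2 = (nrm (Sigma A B) f)\<^sup>2"
      unfolding L2_slice(3)[OF L] s(3) using n by (intro infsum_cong) simp
    ultimately show ?thesis by (simp add: power2_eq_iff_nonneg)
  qed
  show "isometry (Sigma A B) (Sigma A B) (blk A U)"
  proof (rule isometryI)
    fix f g assume fg: "f \<in> L2 (Sigma A B)" "g \<in> L2 (Sigma A B)"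
    show "blk A U (\<lambda>i. f i + g i) = (\<lambda>i. blk A U f i + blk A U g i)"
      using unitaryD(2)[OF U L2_slice(1)[OF fg(1)] L2_slice(1)[OF fg(2)]] by (auto simp: blk_def fun_eq_iff)
  next
    fix c f assume f: "f \<in> L2 (Sigma A B)"
    show "blk A U (\<lambda>i. c * f i) = (\<lambda>i. c * blk A U f i)"
      using unitaryD(3)[OF U L2_slice(1)[OF f]] by (auto simp: blk_def fun_eq_iff)
  qed (use L[OF U] in simp_all)
  fix f assume f: "f \<in> L2 (Sigma A B)"
  show "blk A (\<lambda>a. uinv (B a) (U a)) f \<in> L2 (Sigma A B)" using L[OF unitary_uinv[OF U] f] by simp
  show "blk A U (blk A (\<lambda>a. uinv (B a) (U a)) f) = f"
  proof (rule ext, clarify)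
    fix a b
    show "blk A U (blk A (\<lambda>a. uinv (B a) (U a)) f) (a, b) = f (a, b)"
    proof (cases "a \<in> A")
      case True
      have "blk A U (blk A (\<lambda>a. uinv (B a) (U a)) f) (a, b) = U a (uinv (B a) (U a) (\<lambda>b. f (a, b))) b"
        using True by (simp add: blk_def)
      also have "\<dots> = f (a, b)" using uinv_right[OF U[OF True] L2_slice(1)[OF f True]] by simp
      finally show ?thesis .
    qed (use L2_out[OF f] in \<open>simp add: blk_def\<close>)
  qed
qed

lemma uinv_blk:
  assumes U: "\<And>a. a \<in> A \<Longrightarrow> unitary (B a) (U a)" and f: "f \<in> L2 (Sigma A B)"
  shows "uinv (Sigma A B) (blk A U) f = blk A (\<lambda>a. uinv (B a) (U a)) f"
proof (rule uinv_eqI[OF unitary_blk[OF U]])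
  show "blk A (\<lambda>a. uinv (B a) (U a)) f \<in> L2 (Sigma A B)"
    by (rule unitaryD(1)[OF unitary_blk f]) (rule unitary_uinv[OF U])
  show "blk A U (blk A (\<lambda>a. uinv (B a) (U a)) f) = f"
  proof (rule ext, clarify)
    fix a b
    show "blk A U (blk A (\<lambda>a. uinv (B a) (U a)) f) (a, b) = f (a, b)"
    proof (cases "a \<in> A")
      case True
      have "blk A U (blk A (\<lambda>a. uinv (B a) (U a)) f) (a, b) = U a (uinv (B a) (U a) (\<lambda>b. f (a, b))) b"
        using True by (simp add: blk_def)
      also have "\<dots> = f (a, b)" using uinv_right[OF U[OF True] L2_slice(1)[OF f True]] by simp
      finally show ?thesis .
    qed (use L2_out[OF f] in \<open>simp add: blk_def\<close>)
  qed
qed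

text \<open>Eigenvectors of a unitary for different eigenvalues are orthogonal, and a separable Hilbert
  space has no uncountable orthonormal set.\<close>

definition eigenvalue :: "'i set \<Rightarrow> (('i \<Rightarrow> complex) \<Rightarrow> 'i \<Rightarrow> complex) \<Rightarrow> complex \<Rightarrow> bool" where
  "eigenvalue S U c \<longleftrightarrow> (\<exists>f\<in>L2 S. f \<noteq> (\<lambda>i. 0) \<and> U f = (\<lambda>i. c * f i))"

lemma countable_eigenvalues:
  assumes S: "countable S" and U: "unitary S U" shows "countable {c. eigenvalue S U c}"
proof -
  interpret hilbert_space "ell2 S" by (rule hilbert_space_ell2)
  have ex: "\<exists>f\<in>L2 S. nrm S f = 1 \<and> U f = (\<lambda>i. c * f i)" if c: "eigenvalue S U c" for c
  proof -
    obtain f where f: "f \<in> L2 S" "f \<noteq> (\<lambda>i. 0)" "U f = (\<lambda>i. c * f i)"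
      using c by (auto simp: eigenvalue_def)
    then have n: "nrm S f \<noteq> 0" using nrm_eq_0D by auto
    let ?g = "\<lambda>i. complex_of_real (1 / nrm S f) * f i"
    have "?g \<in> L2 S" by (rule L2_scale[OF f(1)])
    moreover have "nrm S ?g = 1" unfolding nrm_scale using n by (simp add: norm_divide)
    moreover have "U ?g = (\<lambda>i. c * ?g i)"
      using unitaryD(3)[OF U f(1), of "complex_of_real (1 / nrm S f)"] f(3) by (simp add: mult_ac)
    ultimately show ?thesis by blast
  qed
  then obtain v where v: "\<And>c. eigenvalue S U c \<Longrightarrow> v c \<in> L2 S"
    "\<And>c. eigenvalue S U c \<Longrightarrow> nrm S (v c) = 1"
    "\<And>c. eigenvalue S U c \<Longrightarrow> U (v c) = (\<lambda>i. c * v c i)" by metis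
  let ?E = "{c. eigenvalue S U c}"
  have c1: "cmod c = 1" if "c \<in> ?E" for c
    using unitaryD(4)[OF U v(1)] v that by (simp add: nrm_scale)
  have ip: "ip (ell2 S) (v c) (v d) = (if c = d then 1 else 0)" if cd: "c \<in> ?E" "d \<in> ?E" for c d
  proof (cases "c = d")
    case True
    then show ?thesis using ip_self[of "v c"] v cd by (simp del: ell2_simps(5))
  next
    case False
    have "ip (ell2 S) (v c) (v d) = ip (ell2 S) (U (v c)) (U (v d))"
      using isometry_ip[OF unitary_isometry[OF U] v(1) v(1)] cd by simp
    also have "\<dots> = (c * cnj d) * ip (ell2 S) (v c) (v d)"
      using cd v ip_smult_left[of "v c" "\<lambda>i. d * v d i" c] ip_smult_right[of "v c" "v d" d]
      by (simp del: ell2_simps(5) add: L2_scale)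
    finally have "c * cnj d = 1 \<or> ip (ell2 S) (v c) (v d) = 0"
      by (metis mult_cancel_right1 mult_cancel_right2)
    moreover have "c * cnj d \<noteq> 1"
    proof
      assume "c * cnj d = 1"
      then have "c * (cnj d * d) = d" by (simp add: mult.assoc[symmetric])
      moreover have "cnj d * d = 1" using c1[OF cd(2)] complex_norm_square[of d] by (simp add: mult.commute)
      ultimately show False using False by simp
    qed
    ultimately show ?thesis using False by simp
  qed
  have "orthonormal (v ` ?E)"
    unfolding orthonormal_def
  proof (intro conjI ballI)
    show "v ` ?E \<subseteq> carrier (ell2 S)" using v(1) by auto
    fix f g assume "f \<in> v ` ?E" "g \<in> v ` ?E"
    then obtain c d where cd: "c \<in> ?E" "d \<in> ?E" "f = v c" "g = v d" by blast
    then have "f = g \<longleftrightarrow> c = d" using ip[OF cd(1,2)] ip[OF cd(1,1)] by (metis zero_neq_one)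
    then show "ip (ell2 S) f g = (if f = g then 1 else 0)" using ip[OF cd(1,2)] cd(3,4) by metis
  qed
  then have "countable (v ` ?E)"
  proof (rule countable_orthonormal)
    show "countable (unit_vec ` S)" using S by simp
    fix f assume f: "f \<in> carrier (ell2 S)" and z: "\<And>d. d \<in> unit_vec ` S \<Longrightarrow> ip (ell2 S) d f = 0"
    show "f = \<zero>\<^bsub>ell2 S\<^esub>"
    proof (simp, rule L2_ext)
      fix i assume i: "i \<in> S"
      have "ip (ell2 S) f (unit_vec i) = cnj (ip (ell2 S) (unit_vec i) f)"
        using f i by (intro ip_cnj) auto
      then show "f i = 0" using ip_unit_vec[OF i] z[of "unit_vec i"] i by simp
    qed (use f in auto)
  qed auto
  moreover have "inj_on v ?E"
  proof (rule inj_onI)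
    fix c d assume cd: "c \<in> ?E" "d \<in> ?E" "v c = v d"
    show "c = d" using ip[OF cd(1,2)] ip[OF cd(1,1)] cd(3) by (metis zero_neq_one)
  qed
  ultimately show ?thesis by (rule countable_image_inj_on)
qed

section \<open>Almost invariant vectors of amenable groups\<close>

definition finsupp :: "'i set \<Rightarrow> ('i \<Rightarrow> real) set" where
  "finsupp I = {v. finite {i. v i \<noteq> 0} \<and> {i. v i \<noteq> 0} \<subseteq> I}"

definition sublinear_on :: "('i \<Rightarrow> real) set \<Rightarrow> (('i \<Rightarrow> real) \<Rightarrow> real) \<Rightarrow> bool" where
  "sublinear_on V N \<longleftrightarrow> N (\<lambda>i. 0) = 0 \<and>
     (\<forall>v\<in>V. \<forall>w\<in>V. N (\<lambda>i. v i + w i) \<le> N v + N w) \<and>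
     (\<forall>t>0. \<forall>v\<in>V. N (\<lambda>i. t * v i) \<le> t * N v)"

lemma finsuppI: "finite F \<Longrightarrow> F \<subseteq> I \<Longrightarrow> (\<And>i. i \<notin> F \<Longrightarrow> v i = 0) \<Longrightarrow> v \<in> finsupp I"
  unfolding finsupp_def by (auto intro: finite_subset[of _ F])

lemma finsupp_zero [simp]: "(\<lambda>i. 0) \<in> finsupp I"
  by (simp add: finsupp_def)

lemma finsupp_add [simp]: "v \<in> finsupp I \<Longrightarrow> w \<in> finsupp I \<Longrightarrow> (\<lambda>i. v i + w i) \<in> finsupp I"
  by (rule finsuppI[of "{i. v i \<noteq> 0} \<union> {i. w i \<noteq> 0}"]) (auto simp: finsupp_def)

lemma finsupp_scale [simp]: "v \<in> finsupp I \<Longrightarrow> (\<lambda>i. t * v i) \<in> finsupp I"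
  by (rule finsuppI[of "{i. v i \<noteq> 0}"]) (auto simp: finsupp_def)

lemma finsupp_sum [simp]:
  "(\<And>a. a \<in> F \<Longrightarrow> f a \<in> finsupp I) \<Longrightarrow> (\<lambda>i. \<Sum>a\<in>F. f a i) \<in> finsupp I"
  by (induction F rule: infinite_finite_induct) auto

definition point :: "'i \<Rightarrow> 'i \<Rightarrow> real" where "point a = (\<lambda>i. if i = a then 1 else 0)"

lemma finsupp_point [simp]: "a \<in> I \<Longrightarrow> point a \<in> finsupp I"
  by (rule finsuppI[of "{a}"]) (auto simp: point_def)

text \<open>The largest sublinear functional below \<open>N\<close> whose value at \<open>-x\<close> is at most \<open>- N x\<close>. It agrees
  with a linear functional on the line through \<open>x\<close>.\<close>

definition linearize :: "('i \<Rightarrow> real) \<Rightarrow> (('i \<Rightarrow> real) \<Rightarrow> real) \<Rightarrow> ('i \<Rightarrow> real) \<Rightarrow> real" where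
  "linearize x N v = (INF t\<in>{0..}. N (\<lambda>i. v i + t * x i) - t * N x)"

lemma linearize:
  assumes N: "sublinear_on (finsupp I) N" and x: "x \<in> finsupp I"
  shows "sublinear_on (finsupp I) (linearize x N)"
    and "v \<in> finsupp I \<Longrightarrow> linearize x N v \<le> N v"
    and "linearize x N (\<lambda>i. - x i) \<le> - N x"
proof -
  have N0: "N (\<lambda>i. 0) = 0" and Na: "\<And>v w. v \<in> finsupp I \<Longrightarrow> w \<in> finsupp I \<Longrightarrow> N (\<lambda>i. v i + w i) \<le> N v + N w"
    and Nt: "\<And>t v. t > 0 \<Longrightarrow> v \<in> finsupp I \<Longrightarrow> N (\<lambda>i. t * v i) \<le> t * N v"
    using N by (auto simp: sublinear_on_def)
  have Nt': "N (\<lambda>i. t * v i) \<le> t * N v" if "t \<ge> 0" "v \<in> finsupp I" for t v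
    using Nt[of t v] that N0 by (cases "t = 0") auto
  have below: "- N (\<lambda>i. - v i) \<le> N (\<lambda>i. v i + t * x i) - t * N x" if t: "t \<ge> 0" and v: "v \<in> finsupp I" for t v
  proof -
    have mv: "(\<lambda>i. - v i) \<in> finsupp I" using finsupp_scale[OF v, of "-1"] by simp
    have Nx: "t * N x \<le> N (\<lambda>i. t * x i)"
    proof (cases "t = 0")
      case False
      then have "N (\<lambda>i. (1 / t) * (t * x i)) \<le> (1 / t) * N (\<lambda>i. t * x i)" using t x by (intro Nt) auto
      then show ?thesis using False t by (simp add: field_simps)
    qed (simp add: N0)
    have "N (\<lambda>i. t * x i) = N (\<lambda>i. (v i + t * x i) + (- v i))" by simp
    also have "\<dots> \<le> N (\<lambda>i. v i + t * x i) + N (\<lambda>i. - v i)" using v x mv by (intro Na) auto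
    finally show ?thesis using Nx by simp
  qed
  have le: "linearize x N v \<le> N (\<lambda>i. v i + t * x i) - t * N x" if "t \<ge> 0" "v \<in> finsupp I" for t v
    unfolding linearize_def
    by (rule cINF_lower[OF bdd_belowI2[of _ "- N (\<lambda>i. - v i)"]]) (use that below in auto)
  have ge: "c \<le> linearize x N v" if "\<And>t. t \<ge> 0 \<Longrightarrow> c \<le> N (\<lambda>i. v i + t * x i) - t * N x" for c v
    unfolding linearize_def by (rule cINF_greatest) (use that in auto)
  show "v \<in> finsupp I \<Longrightarrow> linearize x N v \<le> N v" for v using le[of 0 v] by simp
  show "linearize x N (\<lambda>i. - x i) \<le> - N x"
    using le[of 1 "\<lambda>i. - x i"] finsupp_scale[OF x, of "-1"] N0 by simp
  show "sublinear_on (finsupp I) (linearize x N)"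
    unfolding sublinear_on_def
  proof (intro conjI ballI allI impI antisym)
    show "linearize x N (\<lambda>i. 0) \<le> 0" using le[of 0 "\<lambda>i. 0"] N0 by simp
    show "0 \<le> linearize x N (\<lambda>i. 0)" by (rule ge) (use below[of _ "\<lambda>i. 0"] N0 in auto)
  next
    fix v w assume vw: "v \<in> finsupp I" "w \<in> finsupp I"
    have "linearize x N (\<lambda>i. v i + w i) - (N (\<lambda>i. w i + t * x i) - t * N x) \<le> linearize x N v"
      if t: "t \<ge> 0" for t
    proof (rule ge)
      fix r :: real assume r: "r \<ge> 0"
      have "linearize x N (\<lambda>i. v i + w i) \<le> N (\<lambda>i. (v i + w i) + (r + t) * x i) - (r + t) * N x"
        using vw r t by (intro le) auto
      also have "N (\<lambda>i. (v i + w i) + (r + t) * x i) = N (\<lambda>i. (v i + r * x i) + (w i + t * x i))"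
        by (simp add: algebra_simps)
      also have "\<dots> \<le> N (\<lambda>i. v i + r * x i) + N (\<lambda>i. w i + t * x i)"
        using vw x by (intro Na) auto
      finally show "linearize x N (\<lambda>i. v i + w i) - (N (\<lambda>i. w i + t * x i) - t * N x)
          \<le> N (\<lambda>i. v i + r * x i) - r * N x" by (simp add: algebra_simps)
    qed
    then have "linearize x N (\<lambda>i. v i + w i) - linearize x N v \<le> linearize x N w"
      by (intro ge) (simp add: algebra_simps)
    then show "linearize x N (\<lambda>i. v i + w i) \<le> linearize x N v + linearize x N w" by simp
  next
    fix t :: real and v assume t: "t > 0" and v: "v \<in> finsupp I"
    have "(1 / t) * linearize x N (\<lambda>i. t * v i) \<le> linearize x N v"
    proof (rule ge)
      fix r :: real assume r: "r \<ge> 0"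
      have "linearize x N (\<lambda>i. t * v i) \<le> N (\<lambda>i. t * v i + (t * r) * x i) - (t * r) * N x"
        using t r v by (intro le) auto
      also have "N (\<lambda>i. t * v i + (t * r) * x i) = N (\<lambda>i. t * (v i + r * x i))"
        by (simp add: algebra_simps)
      also have "\<dots> \<le> t * N (\<lambda>i. v i + r * x i)" using t v x by (intro Nt) auto
      finally show "(1 / t) * linearize x N (\<lambda>i. t * v i) \<le> N (\<lambda>i. v i + r * x i) - r * N x"
        using t by (simp add: field_simps)
    qed
    then show "linearize x N (\<lambda>i. t * v i) \<le> t * linearize x N v" using t by (simp add: field_simps)
  qed
qed

text \<open>The functional is linearized along the basis vectors one after the other. Every vector is a
  combination of finitely many of them, so that its value is determined after finitely many steps.\<close>

lemma countable_hahn_banach: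
  assumes I: "countable I" and N: "sublinear_on (finsupp I) N"
  obtains \<psi> where "\<And>v. v \<in> finsupp I \<Longrightarrow> (\<Sum>i | v i \<noteq> 0. \<psi> i * v i) \<le> N v"
proof (cases "I = {}")
  case True
  then have "v \<in> finsupp I \<Longrightarrow> v = (\<lambda>i. 0)" for v by (auto simp: finsupp_def)
  then have "v \<in> finsupp I \<Longrightarrow> (\<Sum>i | v i \<noteq> 0. 0 * v i) \<le> N v" for v
    using N by (simp add: sublinear_on_def)
  then show ?thesis using that[of "\<lambda>i. 0"] by blast
next
  case False
  define e where "e = from_nat_into I"
  have eI: "e n \<in> I" for n using False by (simp add: e_def from_nat_into)
  define NN where "NN = rec_nat N (\<lambda>n. linearize (point (e n)))"
  have NN: "NN 0 = N" "NN (Suc n) = linearize (point (e n)) (NN n)" for n by (simp_all add: NN_def)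
  have sub: "sublinear_on (finsupp I) (NN n)" for n
    by (induction n) (simp_all add: NN N linearize(1) eI)
  have dec: "NN (n + k) v \<le> NN n v" if "v \<in> finsupp I" for n k v
  proof (induction k)
    case (Suc k)
    have "NN (n + Suc k) v \<le> NN (n + k) v"
      using linearize(2)[OF sub finsupp_point[OF eI] that] by (simp add: NN)
    then show ?case using Suc by simp
  qed simp
  define c where "c k = NN k (point (e k))" for k
  have neg: "(\<lambda>i. - point (e k) i) \<in> finsupp I" for k
    using finsupp_scale[OF finsupp_point[OF eI[of k]], of "-1"] by simp
  have val: "NN n (point (e k)) = c k" "NN n (\<lambda>i. - point (e k) i) = - c k" if "k < n" for k n
  proof -
    obtain j where n: "n = Suc k + j" using less_imp_Suc_add[OF \<open>k < n\<close>] by auto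
    have 1: "NN n (point (e k)) \<le> c k" using dec[of "point (e k)" k "Suc j"] eI n by (simp add: c_def)
    have "NN n (\<lambda>i. - point (e k) i) \<le> NN (Suc k) (\<lambda>i. - point (e k) i)"
      unfolding n by (rule dec[OF neg])
    also have "\<dots> \<le> - c k" unfolding NN c_def by (rule linearize(3)[OF sub finsupp_point[OF eI]])
    finally have 2: "NN n (\<lambda>i. - point (e k) i) \<le> - c k" .
    have "NN n (\<lambda>i. point (e k) i + - point (e k) i) \<le> NN n (point (e k)) + NN n (\<lambda>i. - point (e k) i)"
    proof -
      have "\<forall>v\<in>finsupp I. \<forall>w\<in>finsupp I. NN n (\<lambda>i. v i + w i) \<le> NN n v + NN n w"
        using sub[of n] by (simp add: sublinear_on_def)
      from this[rule_format, OF finsupp_point[OF eI] neg] show ?thesis .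
    qed
    moreover have "NN n (\<lambda>i. 0) = 0" using sub[of n] by (simp add: sublinear_on_def)
    ultimately show "NN n (point (e k)) = c k" "NN n (\<lambda>i. - point (e k) i) = - c k" using 1 2 by auto
  qed
  define \<psi> where "\<psi> i = c (to_nat_on I i)" for i
  have "(\<Sum>i | v i \<noteq> 0. \<psi> i * v i) \<le> N v" if v: "v \<in> finsupp I" for v
  proof -
    let ?F = "{i. v i \<noteq> 0}"
    have F: "finite ?F" "?F \<subseteq> I" using v by (auto simp: finsupp_def)
    define n where "n = Suc (Max (insert 0 (to_nat_on I ` ?F)))"
    have lt: "to_nat_on I i < n" if "i \<in> ?F" for i
      using that F unfolding n_def by (auto simp: less_Suc_eq_le intro!: Max_ge)
    have ei: "e (to_nat_on I i) = i" if "i \<in> ?F" for i using that F I by (auto simp: e_def)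
    have M0: "NN n (\<lambda>i. 0) = 0"
      and Ma: "\<And>v w. v \<in> finsupp I \<Longrightarrow> w \<in> finsupp I \<Longrightarrow> NN n (\<lambda>i. v i + w i) \<le> NN n v + NN n w"
      and Mt: "\<And>t v. t > 0 \<Longrightarrow> v \<in> finsupp I \<Longrightarrow> NN n (\<lambda>i. t * v i) \<le> t * NN n v"
      using sub[of n] by (auto simp: sublinear_on_def)
    have one: "NN n (\<lambda>j. - v i * point i j) \<le> - (\<psi> i * v i)" if i: "i \<in> ?F" for i
    proof (cases "v i > 0")
      case True
      have "NN n (\<lambda>j. v i * - point i j) \<le> v i * NN n (\<lambda>j. - point i j)"
        using True neg[of "to_nat_on I i"] ei[OF i] by (intro Mt) auto
      also have "NN n (\<lambda>j. - point i j) = - \<psi> i" using val(2)[OF lt[OF i]] ei[OF i] by (simp add: \<psi>_def)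
      finally show ?thesis by (simp add: mult.commute)
    next
      case False
      then have "- v i > 0" using i by auto
      then have "NN n (\<lambda>j. - v i * point i j) \<le> - v i * NN n (point i)"
        using F i by (intro Mt finsupp_point) auto
      also have "NN n (point i) = \<psi> i" using val(1)[OF lt[OF i]] ei[OF i] by (simp add: \<psi>_def)
      finally show ?thesis by (simp add: mult.commute)
    qed
    have "NN n (\<lambda>j. \<Sum>i\<in>E. - v i * point i j) \<le> (\<Sum>i\<in>E. - (\<psi> i * v i))" if "E \<subseteq> ?F" for E
      using finite_subset[OF that F(1)] that
    proof (induction E)
      case (insert a E)
      have "NN n (\<lambda>j. - v a * point a j + (\<Sum>i\<in>E. - v i * point i j))
          \<le> NN n (\<lambda>j. - v a * point a j) + NN n (\<lambda>j. \<Sum>i\<in>E. - v i * point i j)"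
        using insert.prems F by (intro Ma finsupp_sum finsupp_scale finsupp_point) auto
      then show ?case using insert one[of a] by simp
    qed (simp add: M0)
    from this[of ?F] have "NN n (\<lambda>j. \<Sum>i\<in>?F. - v i * point i j) \<le> - (\<Sum>i\<in>?F. \<psi> i * v i)"
      by (simp add: sum_negf)
    also have "(\<lambda>j. \<Sum>i\<in>?F. - v i * point i j) = (\<lambda>j. - v j)"
    proof
      fix j show "(\<Sum>i\<in>?F. - v i * point i j) = - v j"
        using F(1) by (cases "v j = 0") (auto simp: point_def if_distrib[of "(*) _"] cong: if_cong)
    qed
    finally have "NN n (\<lambda>j. - v j) \<le> - (\<Sum>i\<in>?F. \<psi> i * v i)" .
    moreover have "NN n (\<lambda>j. v j + - v j) \<le> NN n v + NN n (\<lambda>j. - v j)"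
      using finsupp_scale[OF v, of "-1"] by (intro Ma v) simp
    moreover have "NN n v \<le> N v" using dec[OF v, of 0 n] by (simp add: NN)
    ultimately show ?thesis using M0 by simp
  qed
  then show ?thesis using that by blast
qed

definition l1 :: "('i \<Rightarrow> real) \<Rightarrow> real" where "l1 v = (\<Sum>i | v i \<noteq> 0. \<bar>v i\<bar>)"

lemma l1_eq: "finite F \<Longrightarrow> (\<And>i. i \<notin> F \<Longrightarrow> v i = 0) \<Longrightarrow> l1 v = (\<Sum>i\<in>F. \<bar>v i\<bar>)"
  unfolding l1_def by (rule sum.mono_neutral_left) auto

lemma l1_zero [simp]: "l1 (\<lambda>i. 0) = 0" by (simp add: l1_def)

lemma l1_triangle:
  assumes "v \<in> finsupp I" "w \<in> finsupp I" shows "l1 (\<lambda>i. v i + w i) \<le> l1 v + l1 w"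
proof -
  let ?F = "{i. v i \<noteq> 0} \<union> {i. w i \<noteq> 0}"
  have F: "finite ?F" using assms by (simp add: finsupp_def)
  have "(\<Sum>i\<in>?F. \<bar>v i + w i\<bar>) \<le> (\<Sum>i\<in>?F. \<bar>v i\<bar> + \<bar>w i\<bar>)" by (intro sum_mono) auto
  moreover have "l1 v = (\<Sum>i\<in>?F. \<bar>v i\<bar>)" "l1 w = (\<Sum>i\<in>?F. \<bar>w i\<bar>)" "l1 (\<lambda>i. v i + w i) = (\<Sum>i\<in>?F. \<bar>v i + w i\<bar>)"
    by (rule l1_eq[OF F]; auto)+
  ultimately show ?thesis by (simp add: sum.distrib)
qed

lemma l1_scale: "l1 (\<lambda>i. t * v i) = \<bar>t\<bar> * l1 v"
  by (cases "t = 0") (simp_all add: l1_def abs_mult sum_distrib_left)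

lemma l1_add_nonneg:
  assumes "v \<in> finsupp I" "w \<in> finsupp I" "\<And>i. v i \<ge> 0" "\<And>i. w i \<ge> 0"
  shows "l1 (\<lambda>i. v i + w i) = l1 v + l1 w"
proof -
  let ?F = "{i. v i \<noteq> 0} \<union> {i. w i \<noteq> 0}"
  have F: "finite ?F" using assms by (simp add: finsupp_def)
  have "l1 v = (\<Sum>i\<in>?F. \<bar>v i\<bar>)" "l1 w = (\<Sum>i\<in>?F. \<bar>w i\<bar>)" "l1 (\<lambda>i. v i + w i) = (\<Sum>i\<in>?F. \<bar>v i + w i\<bar>)"
    by (rule l1_eq[OF F]; auto)+
  then show ?thesis using assms(3,4) by (simp add: sum.distrib)
qed

lemma bounded_fun_on_add:
  assumes "bounded_fun_on C f" "bounded_fun_on C h" shows "bounded_fun_on C (\<lambda>x. f x + h x)"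
proof -
  obtain A B where "\<forall>x\<in>C. \<bar>f x\<bar> \<le> A" "\<forall>x\<in>C. \<bar>h x\<bar> \<le> B"
    using assms by (auto simp: bounded_fun_on_def)
  then have "\<forall>x\<in>C. \<bar>f x + h x\<bar> \<le> A + B" by (meson abs_triangle_ineq add_mono order_trans)
  then show ?thesis by (auto simp: bounded_fun_on_def)
qed

context group begin

text \<open>The boundary collects the differences between \<open>p\<close> and its translates by the elements of \<open>S\<close>. It
  vanishes if \<open>p\<close> is invariant under \<open>S\<close>.\<close>

definition bdry :: "'a set \<Rightarrow> ('a \<Rightarrow> real) \<Rightarrow> 'a \<times> 'a \<Rightarrow> real" where
  "bdry S p = (\<lambda>(s, q). if s \<in> S \<and> q \<in> carrier G then p (inv s \<otimes> q) - p q else 0)"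

lemma bdry_finsupp:
  assumes S: "finite S" "S \<subseteq> carrier G" and p: "p \<in> finsupp (carrier G)"
  shows "bdry S p \<in> finsupp (S \<times> carrier G)"
proof (rule finsuppI)
  let ?P = "{q. p q \<noteq> 0}"
  have P: "finite ?P" "?P \<subseteq> carrier G" using p by (auto simp: finsupp_def)
  let ?F = "S \<times> (?P \<union> (\<lambda>(s, q). s \<otimes> q) ` (S \<times> ?P))"
  show "finite ?F" using S P by simp
  show "?F \<subseteq> S \<times> carrier G" using S P by auto
  fix x assume x: "x \<notin> ?F"
  obtain s q where [simp]: "x = (s, q)" by (cases x)
  show "bdry S p x = 0"
  proof (cases "s \<in> S \<and> q \<in> carrier G")
    case True
    then have "q = s \<otimes> (inv s \<otimes> q)" using S by (auto simp: m_assoc[symmetric])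
    then have "p (inv s \<otimes> q) = 0" "p q = 0" using x True by force+
    then show ?thesis by (simp add: bdry_def)
  qed (auto simp: bdry_def)
qed

text \<open>Each summand is the difference of a bounded function and one of its translates.\<close>

lemma mean_sum_zero:
  assumes add: "\<And>f h. bounded_fun_on (carrier G) f \<Longrightarrow> bounded_fun_on (carrier G) h \<Longrightarrow>
        m (\<lambda>x. f x + h x) = m f + m h"
    and scale: "\<And>c f. bounded_fun_on (carrier G) f \<Longrightarrow> m (\<lambda>x. c * f x) = c * m f"
    and inv: "\<And>g f. g \<in> carrier G \<Longrightarrow> bounded_fun_on (carrier G) f \<Longrightarrow> m (\<lambda>x. f (inv g \<otimes> x)) = (m f :: real)"
    and S: "finite S" "S \<subseteq> carrier G" and \<psi>: "\<And>s x. s \<in> S \<Longrightarrow> x \<in> carrier G \<Longrightarrow> \<bar>\<psi> s x\<bar> \<le> 1"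
  shows "bounded_fun_on (carrier G) (\<lambda>x. \<Sum>s\<in>S. \<psi> s (s \<otimes> x) - \<psi> s x) \<and>
    m (\<lambda>x. \<Sum>s\<in>S. \<psi> s (s \<otimes> x) - \<psi> s x) = 0"
  using S \<psi>
proof (induction S)
  case empty
  have "bounded_fun_on (carrier G) (\<lambda>x. 0)" by (auto simp: bounded_fun_on_def)
  then show ?case using scale[of "\<lambda>x. 0" 0] by simp
next
  case (insert s S)
  have s: "s \<in> carrier G" using insert.prems by simp
  have b: "bounded_fun_on (carrier G) (\<psi> s)" "bounded_fun_on (carrier G) (\<lambda>x. \<psi> s (s \<otimes> x))"
    "bounded_fun_on (carrier G) (\<lambda>x. (- 1) * \<psi> s x)"
    using insert.prems(2)[of s] s unfolding bounded_fun_on_def by (auto intro!: exI[of _ 1])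
  have bd: "bounded_fun_on (carrier G) (\<lambda>x. \<psi> s (s \<otimes> x) + (- 1) * \<psi> s x)"
    by (rule bounded_fun_on_add[OF b(2,3)])
  have "m (\<lambda>x. \<psi> s (s \<otimes> x)) = m (\<psi> s)" using inv[of "inv s" "\<psi> s"] b s by simp
  then have m0: "m (\<lambda>x. \<psi> s (s \<otimes> x) + (- 1) * \<psi> s x) = 0"
    using add[OF b(2,3)] scale[OF b(1), of "-1"] by simp
  have IH: "bounded_fun_on (carrier G) (\<lambda>x. \<Sum>s\<in>S. \<psi> s (s \<otimes> x) - \<psi> s x)"
    "m (\<lambda>x. \<Sum>s\<in>S. \<psi> s (s \<otimes> x) - \<psi> s x) = 0"
    using insert.IH insert.prems by auto
  have "bounded_fun_on (carrier G) (\<lambda>x. (\<psi> s (s \<otimes> x) + (- 1) * \<psi> s x) + (\<Sum>s\<in>S. \<psi> s (s \<otimes> x) - \<psi> s x))"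
    by (rule bounded_fun_on_add[OF bd IH(1)])
  then show ?case using add[OF bd IH(1)] m0 IH(2) insert.hyps by simp
qed

text \<open>Reiter's condition. If the boundaries of all probability measures had norm at least \<open>c\<close>, a
  functional separating them from \<open>0\<close> would be a bounded function whose mean is both \<open>0\<close> and at
  least \<open>c\<close>.\<close>

lemma reiter:
  assumes am: "amenable G" and co: "countable (carrier G)"
    and S: "finite S" "S \<subseteq> carrier G" and c: "c > 0"
  obtains p where "p \<in> finsupp (carrier G)" "\<And>q. p q \<ge> 0" "l1 p = 1" "l1 (bdry S p) < c"
proof (rule ccontr)
  assume "\<not> thesis"
  then have no: "c \<le> l1 (bdry S p)" if "p \<in> finsupp (carrier G)" "\<And>q. p q \<ge> 0" "l1 p = 1" for p
    using that \<open>\<And>p. \<lbrakk>p \<in> finsupp (carrier G); \<And>q. 0 \<le> p q; l1 p = 1; l1 (bdry S p) < c\<rbrakk> \<Longrightarrow> thesis\<close>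
    by force
  let ?C = "carrier G"
  define P where "P = {p \<in> finsupp ?C. \<forall>q. p q \<ge> 0}"
  let ?V = "finsupp (S \<times> ?C)"
  have bscale: "bdry S (\<lambda>q. t * p q) = (\<lambda>x. t * bdry S p x)" for t p
    by (auto simp: bdry_def fun_eq_iff algebra_simps)
  have badd: "bdry S (\<lambda>q. p q + r q) = (\<lambda>x. bdry S p x + bdry S r x)" for p r
    by (auto simp: bdry_def fun_eq_iff)
  have bV: "bdry S p \<in> ?V" if "p \<in> P" for p using that S by (auto simp: P_def bdry_finsupp)
  have l1P: "l1 p \<ge> 0" for p :: "'z \<Rightarrow> real" by (simp add: l1_def sum_nonneg)
  have no': "c * l1 p \<le> l1 (bdry S p)" if p: "p \<in> P" for p
  proof (cases "l1 p = 0")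
    case False
    let ?r = "\<lambda>q. (1 / l1 p) * p q"
    have "c \<le> l1 (bdry S ?r)"
    proof (rule no)
      show "l1 ?r = 1" unfolding l1_scale using False l1P[of p] by simp
    qed (use p l1P[of p] in \<open>auto simp: P_def simp del: times_divide_eq_left\<close>)
    also have "\<dots> = (1 / l1 p) * l1 (bdry S p)"
      unfolding bscale using l1P[of p] by (simp only: l1_scale) simp
    finally show ?thesis using False l1P[of p] by (simp add: field_simps)
  qed (use l1P in simp)
  \<comment> \<open>The sublinear functional \<open>N\<close> is at most the norm and at most \<open>-c\<close> at \<open>-bdry S p\<close> for each probability measure \<open>p\<close>.\<close>
  define N where "N v = (INF p\<in>P. l1 (\<lambda>x. v x + bdry S p x) - c * l1 p)" for v
  have P0: "(\<lambda>q. 0) \<in> P" by (simp add: P_def)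
  have below: "- l1 v \<le> l1 (\<lambda>x. v x + bdry S p x) - c * l1 p" if "v \<in> ?V" "p \<in> P" for v p
  proof -
    have "l1 (bdry S p) = l1 (\<lambda>x. (v x + bdry S p x) + (-1) * v x)" by simp
    also have "\<dots> \<le> l1 (\<lambda>x. v x + bdry S p x) + l1 (\<lambda>x. (-1) * v x)"
      using that bV by (intro l1_triangle[of _ "S \<times> ?C"] finsupp_add finsupp_scale)
    finally show ?thesis using no'[OF that(2)] l1_scale[of "-1" v] by simp
  qed
  have le: "N v \<le> l1 (\<lambda>x. v x + bdry S p x) - c * l1 p" if "v \<in> ?V" "p \<in> P" for v p
    unfolding N_def by (rule cINF_lower[OF bdd_belowI2[of _ "- l1 v"]]) (use that below in auto)
  have ge: "d \<le> N v" if "\<And>p. p \<in> P \<Longrightarrow> d \<le> l1 (\<lambda>x. v x + bdry S p x) - c * l1 p" for d v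
    unfolding N_def by (rule cINF_greatest) (use that P0 in auto)
  have b0: "bdry S (\<lambda>q. 0) = (\<lambda>x. 0)" by (auto simp: bdry_def)
  have Nl1: "N v \<le> l1 v" if "v \<in> ?V" for v using le[OF that P0] by (simp add: b0)
  have "sublinear_on ?V N"
    unfolding sublinear_on_def
  proof (intro conjI ballI allI impI antisym)
    show "N (\<lambda>i. 0) \<le> 0" using Nl1[of "\<lambda>i. 0"] by simp
    show "0 \<le> N (\<lambda>i. 0)" by (rule ge) (use no' in auto)
  next
    fix v w assume vw: "v \<in> ?V" "w \<in> ?V"
    have "N (\<lambda>i. v i + w i) - (l1 (\<lambda>x. w x + bdry S r x) - c * l1 r) \<le> N v" if r: "r \<in> P" for r
    proof (rule ge)
      fix p assume p: "p \<in> P"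
      have pr: "(\<lambda>q. p q + r q) \<in> P" using p r by (auto simp: P_def)
      have "l1 (\<lambda>q. p q + r q) = l1 p + l1 r"
        using p r by (intro l1_add_nonneg[of _ ?C]) (auto simp: P_def)
      moreover have "l1 (\<lambda>x. (v x + bdry S p x) + (w x + bdry S r x))
          \<le> l1 (\<lambda>x. v x + bdry S p x) + l1 (\<lambda>x. w x + bdry S r x)"
        using vw p r bV by (intro l1_triangle[of _ "S \<times> ?C"]) auto
      moreover have "(\<lambda>x. (v x + w x) + bdry S (\<lambda>q. p q + r q) x) =
          (\<lambda>x. (v x + bdry S p x) + (w x + bdry S r x))" by (simp add: badd algebra_simps)
      ultimately show "N (\<lambda>i. v i + w i) - (l1 (\<lambda>x. w x + bdry S r x) - c * l1 r)
          \<le> l1 (\<lambda>x. v x + bdry S p x) - c * l1 p"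
        using le[OF finsupp_add[OF vw] pr] by (simp add: algebra_simps)
    qed
    then have "N (\<lambda>i. v i + w i) - N v \<le> N w" by (intro ge) (simp add: algebra_simps)
    then show "N (\<lambda>i. v i + w i) \<le> N v + N w" by simp
  next
    fix t :: real and v assume t: "t > 0" and v: "v \<in> ?V"
    have "(1 / t) * N (\<lambda>i. t * v i) \<le> N v"
    proof (rule ge)
      fix p assume p: "p \<in> P"
      have tp: "(\<lambda>q. t * p q) \<in> P" using p t by (auto simp: P_def)
      have "l1 (\<lambda>x. t * v x + bdry S (\<lambda>q. t * p q) x) = l1 (\<lambda>x. t * (v x + bdry S p x))"
        by (simp add: bscale algebra_simps)
      also have "\<dots> = t * l1 (\<lambda>x. v x + bdry S p x)" using t by (simp only: l1_scale)
      finally have "N (\<lambda>i. t * v i) \<le> t * (l1 (\<lambda>x. v x + bdry S p x) - c * l1 p)"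
        using le[OF finsupp_scale[OF v, of t] tp] t l1_scale[of t p] by (simp add: algebra_simps)
      then show "(1 / t) * N (\<lambda>i. t * v i) \<le> l1 (\<lambda>x. v x + bdry S p x) - c * l1 p"
        using t by (simp add: field_simps)
    qed
    then show "N (\<lambda>i. t * v i) \<le> t * N v" using t by (simp add: field_simps)
  qed
  moreover have "countable (S \<times> ?C)" using S co by (simp add: countable_finite)
  ultimately obtain \<psi> where \<psi>: "\<And>v. v \<in> ?V \<Longrightarrow> (\<Sum>x | v x \<noteq> 0. \<psi> x * v x) \<le> N v"
    using countable_hahn_banach by blast
  have \<psi>F: "(\<Sum>x\<in>F. \<psi> x * v x) \<le> N v" if "v \<in> ?V" "finite F" "\<And>x. x \<notin> F \<Longrightarrow> v x = 0" for F v
  proof -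
    have "(\<Sum>x | v x \<noteq> 0. \<psi> x * v x) = (\<Sum>x\<in>F. \<psi> x * v x)"
      by (rule sum.mono_neutral_left) (use that in auto)
    then show ?thesis using \<psi>[OF that(1)] by simp
  qed
  have bnd: "\<bar>\<psi> (s, q)\<bar> \<le> 1" if "s \<in> S" "q \<in> ?C" for s q
  proof -
    have l: "l1 (point (s, q)) = 1" by (subst l1_eq[of "{(s, q)}"]) (auto simp: point_def)
    have "\<psi> (s, q) * t \<le> \<bar>t\<bar>" for t
    proof -
      have "(\<Sum>x\<in>{(s, q)}. \<psi> x * (t * point (s, q) x)) \<le> N (\<lambda>x. t * point (s, q) x)"
        using that by (intro \<psi>F finsupp_scale finsupp_point) (auto simp: point_def)
      also have "\<dots> \<le> l1 (\<lambda>x. t * point (s, q) x)" using that by (intro Nl1 finsupp_scale) auto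
      finally show ?thesis by (simp add: l1_scale l) (simp add: point_def)
    qed
    from this[of 1] this[of "-1"] show ?thesis by auto
  qed
  \<comment> \<open>Apply the functional to the boundary of the point mass at \<open>q\<close>.\<close>
  have big: "c \<le> (\<Sum>s\<in>S. \<psi> (s, s \<otimes> q) - \<psi> (s, q))" if q: "q \<in> ?C" for q
  proof -
    have pP: "point q \<in> P" unfolding P_def using finsupp_point[OF q] by (auto simp: point_def[of q, THEN fun_cong])
    have l: "l1 (point q) = 1" by (subst l1_eq[of "{q}"]) (auto simp: point_def)
    have bq: "bdry S (point q) (s, r) = (if s \<in> S \<and> r \<in> ?C then (if r = s \<otimes> q then 1 else 0) - (if r = q then 1 else 0) else 0)" for s r
    proof -
      have "inv s \<otimes> r = q \<longleftrightarrow> r = s \<otimes> q" if "s \<in> S" "r \<in> ?C"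
        using that q S(2) by (metis inv_solve_left subsetD)
      then show ?thesis by (auto simp: bdry_def point_def)
    qed
    let ?F = "Sigma S (\<lambda>s. {q, s \<otimes> q})"
    have sq: "s \<otimes> q \<in> ?C" if "s \<in> S" for s using that S q by auto
    have "(\<Sum>x\<in>?F. \<psi> x * ((-1) * bdry S (point q) x)) \<le> N (\<lambda>x. (-1) * bdry S (point q) x)"
      using bV[OF pP] S by (intro \<psi>F finsupp_scale) (auto simp: bq split: if_splits)
    also have "\<dots> \<le> - c"
      using le[OF finsupp_scale[OF bV[OF pP], of "-1"] pP] by (simp add: l)
    also have "(\<Sum>x\<in>?F. \<psi> x * ((-1) * bdry S (point q) x)) =
        (\<Sum>s\<in>S. \<Sum>r\<in>{q, s \<otimes> q}. \<psi> (s, r) * ((-1) * bdry S (point q) (s, r)))"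
      using S by (subst sum.Sigma) (auto simp: case_prod_unfold)
    also have "\<dots> = (\<Sum>s\<in>S. - (\<psi> (s, s \<otimes> q) - \<psi> (s, q)))"
    proof (rule sum.cong[OF refl])
      fix s assume s: "s \<in> S"
      show "(\<Sum>r\<in>{q, s \<otimes> q}. \<psi> (s, r) * ((-1) * bdry S (point q) (s, r))) = - (\<psi> (s, s \<otimes> q) - \<psi> (s, q))"
        using s q sq[OF s] by (cases "s \<otimes> q = q") (auto simp: bq)
    qed
    finally show ?thesis unfolding sum_negf by simp
  qed
  obtain m :: "('a \<Rightarrow> real) \<Rightarrow> real" where M:
    "(\<forall>f h. bounded_fun_on ?C f \<and> bounded_fun_on ?C h \<longrightarrow> m (\<lambda>x. f x + h x) = m f + m h) \<and>
     (\<forall>c f. bounded_fun_on ?C f \<longrightarrow> m (\<lambda>x. c * f x) = c * m f) \<and>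
     (\<forall>f. bounded_fun_on ?C f \<and> (\<forall>x\<in>?C. 0 \<le> f x) \<longrightarrow> 0 \<le> m f) \<and>
     m (\<lambda>x. 1) = 1 \<and>
     (\<forall>g\<in>?C. \<forall>f. bounded_fun_on ?C f \<longrightarrow> m (\<lambda>x. f (inv g \<otimes> x)) = m f)"
    using am unfolding amenable_def by (elim exE)
  have add: "m (\<lambda>x. f x + h x) = m f + m h" if "bounded_fun_on ?C f" "bounded_fun_on ?C h" for f h
    using M[THEN conjunct1] that by simp
  have scale: "m (\<lambda>x. c * f x) = c * m f" if "bounded_fun_on ?C f" for c f
    using M[THEN conjunct2, THEN conjunct1] that by simp
  have pos: "0 \<le> m f" if "bounded_fun_on ?C f" "\<forall>x\<in>?C. 0 \<le> f x" for f
    using M[THEN conjunct2, THEN conjunct2, THEN conjunct1] that by simp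
  have m1: "m (\<lambda>x. 1) = 1" using M by (elim conjE)
  have inv: "m (\<lambda>x. f (inv g \<otimes> x)) = m f" if "g \<in> ?C" "bounded_fun_on ?C f" for g f
    using M[THEN conjunct2, THEN conjunct2, THEN conjunct2, THEN conjunct2] that by simp
  define h where "h = (\<lambda>x. \<Sum>s\<in>S. \<psi> (s, s \<otimes> x) - \<psi> (s, x))"
  have "bounded_fun_on ?C h \<and> m h = 0"
    unfolding h_def
  proof (rule mean_sum_zero[of m S "\<lambda>s x. \<psi> (s, x)"])
    show "\<bar>\<psi> (s, x)\<bar> \<le> 1" if "s \<in> S" "x \<in> ?C" for s x using bnd[OF that] .
  qed (fact add scale inv S)+
  then have h: "bounded_fun_on ?C h" "m h = 0" by simp_all
  have one: "bounded_fun_on ?C (\<lambda>x. 1)" "bounded_fun_on ?C (\<lambda>x. - c * 1)" by (auto simp: bounded_fun_on_def)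
  have hc: "bounded_fun_on ?C (\<lambda>x. h x + - c * 1)"
    by (rule bounded_fun_on_add[OF h(1) one(2)])
  have "0 \<le> m (\<lambda>x. h x + - c * 1)" using big by (intro pos[OF hc]) (simp add: h_def)
  also have "\<dots> = - c" using add[OF h(1) one(2)] scale[OF one(1), of "- c"] h(2) m1 by simp
  finally show False using c by simp
qed

text \<open>The square root of a probability measure is a unit vector, and \<open>(\<surd>a - \<surd>b)\<^sup>2 \<le> \<bar>a - b\<bar>\<close>.\<close>

lemma almost_invariant_vector:
  assumes am: "amenable G" and co: "countable (carrier G)"
    and S: "finite S" "S \<subseteq> carrier G" and c: "c > 0"
  obtains \<phi> where "\<phi> \<in> L2 (carrier G)" "nrm (carrier G) \<phi> = 1"
    "\<And>s. s \<in> S \<Longrightarrow> nrm (carrier G) (\<lambda>q. (if q \<in> carrier G then \<phi> (inv s \<otimes> q) else 0) - \<phi> q) \<le> c"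
proof -
  let ?C = "carrier G"
  obtain p where p: "p \<in> finsupp ?C" "\<And>q. p q \<ge> 0" "l1 p = 1" "l1 (bdry S p) < c\<^sup>2"
    using reiter[OF am co S, of "c\<^sup>2"] c by auto
  have fin: "finite {q. p q \<noteq> 0}" "{q. p q \<noteq> 0} \<subseteq> ?C" using p(1) by (auto simp: finsupp_def)
  define \<phi> where "\<phi> q = complex_of_real (sqrt (p q))" for q
  have sum_eq: "infsum f ?C = sum f F" if "finite F" "F \<subseteq> ?C" "\<And>q. q \<in> ?C \<Longrightarrow> q \<notin> F \<Longrightarrow> f q = 0" for f :: "'a \<Rightarrow> real" and F
  proof -
    have "infsum f F = infsum f ?C"
      by (rule infsum_cong_neutral) (use that in auto)
    then show ?thesis using that by simp
  qed
  have sq: "(cmod (\<phi> q))\<^sup>2 = p q" for q using p(2) by (simp add: \<phi>_def)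
  have "\<phi> \<in> L2 ?C"
  proof (rule L2I)
    show "(\<lambda>q. (cmod (\<phi> q))\<^sup>2) summable_on ?C" unfolding sq
      by (rule finite_nonzero_values_imp_summable_on) (rule finite_subset[OF _ fin(1)], auto)
  qed (use fin in \<open>auto simp: \<phi>_def\<close>)
  moreover have "nrm ?C \<phi> = 1"
    unfolding nrm_def sq using sum_eq[OF fin, of p] p(2,3) by (simp add: l1_def)
  moreover have "nrm ?C (\<lambda>q. (if q \<in> ?C then \<phi> (inv s \<otimes> q) else 0) - \<phi> q) \<le> c" if s: "s \<in> S" for s
  proof -
    let ?d = "\<lambda>q. \<bar>bdry S p (s, q)\<bar>"
    let ?f = "\<lambda>q. (if q \<in> ?C then \<phi> (inv s \<otimes> q) else 0) - \<phi> q"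
    let ?F = "{q. bdry S p (s, q) \<noteq> 0}"
    have bF: "finite {x. bdry S p x \<noteq> 0}" "{x. bdry S p x \<noteq> 0} \<subseteq> S \<times> ?C"
      using bdry_finsupp[OF S p(1)] by (auto simp: finsupp_def)
    have F: "finite ?F" by (rule finite_subset[OF _ finite_imageI[OF bF(1), of snd]]) force
    have FC: "?F \<subseteq> ?C" using bF(2) by auto
    have le: "(cmod (?f q))\<^sup>2 \<le> ?d q" if q: "q \<in> ?C" for q
    proof -
      have key: "(sqrt a - sqrt b)\<^sup>2 \<le> \<bar>a - b\<bar>" if ab: "a \<ge> 0" "b \<ge> 0" for a b
      proof -
        have "(sqrt a - sqrt b)\<^sup>2 = \<bar>sqrt a - sqrt b\<bar> * \<bar>sqrt a - sqrt b\<bar>" by (simp add: power2_eq_square)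
        also have "\<dots> \<le> \<bar>sqrt a - sqrt b\<bar> * \<bar>sqrt a + sqrt b\<bar>" using ab by (intro mult_left_mono) (auto simp: abs_le_iff)
        also have "\<dots> = \<bar>(sqrt a - sqrt b) * (sqrt a + sqrt b)\<bar>" by (simp only: abs_mult)
        also have "(sqrt a - sqrt b) * (sqrt a + sqrt b) = a - b" using ab by (simp add: algebra_simps)
        finally show ?thesis .
      qed
      have "(cmod (?f q))\<^sup>2 = (sqrt (p (inv s \<otimes> q)) - sqrt (p q))\<^sup>2"
        using q by (simp add: \<phi>_def of_real_diff[symmetric] del: of_real_diff)
      then show ?thesis using key[OF p(2) p(2), of "inv s \<otimes> q" q] q s by (simp add: bdry_def)
    qed
    have ds: "?d summable_on ?C"
      by (rule finite_nonzero_values_imp_summable_on) (rule finite_subset[OF _ F], auto)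
    have "(nrm ?C ?f)\<^sup>2 \<le> infsum ?d ?C"
      unfolding nrm_sq by (rule infsum_mono[OF summable_on_comparison_test[OF ds le] ds le]) simp_all
    also have "\<dots> = sum ?d ?F" by (rule sum_eq[OF F FC]) simp
    also have "\<dots> = (\<Sum>x\<in>Pair s ` ?F. \<bar>bdry S p x\<bar>)" by (subst sum.reindex) (auto simp: inj_on_def)
    also have "\<dots> \<le> l1 (bdry S p)" unfolding l1_def using bF by (intro sum_mono2) auto
    also have "\<dots> \<le> c\<^sup>2" using p(4) by simp
    finally show ?thesis by (rule power2_le_imp_le) (use c in simp)
  qed
  ultimately show thesis using that by blast
qed

end

section \<open>Unitary actions of free products\<close>

definition unitary_action ::
    "('a, 'm) monoid_scheme \<Rightarrow> 'i set \<Rightarrow> ('a \<Rightarrow> ('i \<Rightarrow> complex) \<Rightarrow> 'i \<Rightarrow> complex) \<Rightarrow> bool" where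
  "unitary_action G S U \<longleftrightarrow> (\<forall>g\<in>carrier G. unitary S (U g)) \<and> (\<forall>f\<in>L2 S. U \<one>\<^bsub>G\<^esub> f = f) \<and>
     (\<forall>g\<in>carrier G. \<forall>h\<in>carrier G. \<forall>f\<in>L2 S. U (g \<otimes>\<^bsub>G\<^esub> h) f = U g (U h f))"

lemma unitary_actionD:
  assumes "unitary_action G S U"
  shows "g \<in> carrier G \<Longrightarrow> unitary S (U g)" "f \<in> L2 S \<Longrightarrow> U \<one>\<^bsub>G\<^esub> f = f"
    "g \<in> carrier G \<Longrightarrow> h \<in> carrier G \<Longrightarrow> f \<in> L2 S \<Longrightarrow> U (g \<otimes>\<^bsub>G\<^esub> h) f = U g (U h f)"
    "g \<in> carrier G \<Longrightarrow> f \<in> L2 S \<Longrightarrow> U g f \<in> L2 S"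
    "g \<in> carrier G \<Longrightarrow> f \<in> L2 S \<Longrightarrow> nrm S (U g f) = nrm S f"
  using assms by (auto simp: unitary_action_def unitaryD)

lemma unitary_action_inv:
  assumes "group G" "unitary_action G S U" "g \<in> carrier G" "f \<in> L2 S"
  shows "U g (U (inv\<^bsub>G\<^esub> g) f) = f" "U (inv\<^bsub>G\<^esub> g) (U g f) = f" "uinv S (U g) f = U (inv\<^bsub>G\<^esub> g) f"
proof -
  interpret group G by (rule assms(1))
  show 1: "U g (U (inv\<^bsub>G\<^esub> g) f) = f" "U (inv\<^bsub>G\<^esub> g) (U g f) = f"
    using unitary_actionD(2,3)[OF assms(2)] assms(3,4) by (metis inv_closed r_inv l_inv)+
  show "uinv S (U g) f = U (inv\<^bsub>G\<^esub> g) f"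
    using assms 1 by (intro uinv_eqI) (auto simp: unitary_actionD)
qed

definition word_action ::
    "('a \<Rightarrow> 'v \<Rightarrow> 'v) \<Rightarrow> ('b \<Rightarrow> 'v \<Rightarrow> 'v) \<Rightarrow> ('a + 'b) list \<Rightarrow> 'v \<Rightarrow> 'v" where
  "word_action U1 U2 w f = foldr (case_sum U1 U2) w f"

lemma word_action_simps [simp]:
  "word_action U1 U2 [] f = f"
  "word_action U1 U2 (Inl x # w) f = U1 x (word_action U1 U2 w f)"
  "word_action U1 U2 (Inr y # w) f = U2 y (word_action U1 U2 w f)"
  by (simp_all add: word_action_def)

lemma free_product_simps:
  "carrier (free_product G H) = {w. reduced_word G H w}"
  "u \<otimes>\<^bsub>free_product G H\<^esub> v = foldr (letter_mult G H) u v"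
  "\<one>\<^bsub>free_product G H\<^esub> = []"
  by (simp_all add: free_product_def)

lemma reduced_induct [consumes 1, case_names Nil Inl Inr]:
  assumes "reduced_word G H w" and "P []"
    and "\<And>x w. x \<in> carrier G \<Longrightarrow> reduced_word G H w \<Longrightarrow> P w \<Longrightarrow> P (Inl x # w)"
    and "\<And>y w. y \<in> carrier H \<Longrightarrow> reduced_word G H w \<Longrightarrow> P w \<Longrightarrow> P (Inr y # w)"
  shows "P w"
  using assms(1)
proof (induction w)
  case (Cons l w)
  then show ?case using assms(3,4) by (cases l) (auto simp: reduced_word_Cons)
qed (rule assms(2))

text \<open>The universal property of the free product.\<close>

lemma unitary_action_free_product:
  assumes G: "group G" and H: "group H"
    and U1: "unitary_action G S U1" and U2: "unitary_action H S U2"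
  shows "unitary_action (free_product G H) S (word_action U1 U2)"
proof -
  interpret G: group G by (rule G)
  interpret H: group H by (rule H)
  have un: "unitary S (word_action U1 U2 w)" if "reduced_word G H w" for w
    using that
  proof (induction rule: reduced_induct)
    case (Inl x w)
    then show ?case using unitary_comp[OF unitary_actionD(1)[OF U1], of x] by simp
  next
    case (Inr y w)
    then show ?case using unitary_comp[OF unitary_actionD(1)[OF U2], of y] by simp
  qed (use unitary_id in simp)
  have lm: "word_action U1 U2 (letter_mult G H l w) f = case_sum U1 U2 l (word_action U1 U2 w f)"
    if "letter G H l" "reduced_word G H w" and f: "f \<in> L2 S" for l w f
    using that(1,2)
  proof (cases "(G, H, l, w)" rule: letter_mult.cases)
    case (1 G' H' x y w')
    then have w': "reduced_word G H w'" and xy: "x \<in> carrier G" "y \<in> carrier G"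
      using that by (auto simp: reduced_word_Cons)
    have fw: "word_action U1 U2 w' f \<in> L2 S" by (rule unitaryD(1)[OF un[OF w'] f])
    show ?thesis using 1 unitary_actionD(2)[OF U1 fw] fw
      by (auto simp flip: unitary_actionD(3)[OF U1 xy fw])
  next
    case (2 G' H' x y w')
    then have w': "reduced_word G H w'" and xy: "x \<in> carrier H" "y \<in> carrier H"
      using that by (auto simp: reduced_word_Cons)
    have fw: "word_action U1 U2 w' f \<in> L2 S" by (rule unitaryD(1)[OF un[OF w'] f])
    show ?thesis using 2 unitary_actionD(2)[OF U2 fw] fw
      by (auto simp flip: unitary_actionD(3)[OF U2 xy fw])
  qed (auto simp: word_action_def)
  have mult: "word_action U1 U2 (foldr (letter_mult G H) u v) f = word_action U1 U2 u (word_action U1 U2 v f)"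
    if "reduced_word G H u" "reduced_word G H v" "f \<in> L2 S" for u v f
    using that(1)
  proof (induction u)
    case (Cons l u)
    then have "reduced_word G H (foldr (letter_mult G H) u v)" "letter G H l"
      using reduced_foldr[OF G H _ that(2), of u] by (auto simp: reduced_word_Cons reduced_word_def)
    then show ?case using Cons lm[of l "foldr (letter_mult G H) u v" f] that(3)
      by (simp add: reduced_word_Cons) (simp add: word_action_def)
  qed simp
  show ?thesis
    using un mult by (simp add: unitary_action_def free_product_simps)
qed

definition emb_left :: "('a, 'm) monoid_scheme \<Rightarrow> 'a \<Rightarrow> ('a + 'b) list" where
  "emb_left G x = (if x = \<one>\<^bsub>G\<^esub> then [] else [Inl x])"

definition emb_right :: "('b, 'm) monoid_scheme \<Rightarrow> 'b \<Rightarrow> ('a + 'b) list" where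
  "emb_right H y = (if y = \<one>\<^bsub>H\<^esub> then [] else [Inr y])"

text \<open>The converse of \<open>unitary_action_free_product\<close>: every action of the free product comes from its
  restrictions to the two factors.\<close>

lemma unitary_action_restrict:
  assumes G: "group G" and H: "group H" and R: "unitary_action (free_product G H) S R"
  shows "unitary_action G S (\<lambda>x. R (emb_left G x))" "unitary_action H S (\<lambda>y. R (emb_right H y))"
    and "reduced_word G H w \<Longrightarrow> f \<in> L2 S \<Longrightarrow>
      word_action (\<lambda>x. R (emb_left G x)) (\<lambda>y. R (emb_right H y)) w f = R w f"
proof -
  interpret G: group G by (rule G)
  interpret H: group H by (rule H)
  let ?F = "free_product G H"
  have c: "x \<in> carrier G \<Longrightarrow> emb_left G x \<in> carrier ?F" "y \<in> carrier H \<Longrightarrow> emb_right H y \<in> carrier ?F" for x y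
    by (auto simp: emb_left_def emb_right_def free_product_simps reduced_word_Cons)
  have m1: "emb_left G (x \<otimes>\<^bsub>G\<^esub> y) = emb_left G x \<otimes>\<^bsub>?F\<^esub> emb_left G y" if "x \<in> carrier G" "y \<in> carrier G" for x y
    using that by (auto simp: emb_left_def free_product_simps)
  have m2: "emb_right H (x \<otimes>\<^bsub>H\<^esub> y) = emb_right H x \<otimes>\<^bsub>?F\<^esub> emb_right H y" if "x \<in> carrier H" "y \<in> carrier H" for x y
    using that by (auto simp: emb_right_def free_product_simps)
  have e1: "emb_left G \<one>\<^bsub>G\<^esub> = \<one>\<^bsub>?F\<^esub>" "emb_right H \<one>\<^bsub>H\<^esub> = \<one>\<^bsub>?F\<^esub>"
    by (simp_all add: emb_left_def emb_right_def free_product_simps)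
  show "unitary_action G S (\<lambda>x. R (emb_left G x))" "unitary_action H S (\<lambda>y. R (emb_right H y))"
    using unitary_actionD(1-3)[OF R] c m1 m2 e1 by (simp_all add: unitary_action_def)
  show "word_action (\<lambda>x. R (emb_left G x)) (\<lambda>y. R (emb_right H y)) w f = R w f"
    if w: "reduced_word G H w" and f: "f \<in> L2 S"
    using w
  proof (induction w)
    case Nil
    then show ?case using unitary_actionD(2)[OF R f] by (simp add: free_product_simps)
  next
    case (Cons l w)
    have lw: "[l] \<otimes>\<^bsub>?F\<^esub> w = l # w" and cs: "[l] \<in> carrier ?F" "w \<in> carrier ?F"
      using Cons.prems by (cases l; cases w; cases "hd w"; auto simp: free_product_simps reduced_word_Cons)+
    have "R (l # w) f = R [l] (R w f)" using unitary_actionD(3)[OF R cs f] lw by simp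
    moreover have "word_action (\<lambda>x. R (emb_left G x)) (\<lambda>y. R (emb_right H y)) w f = R w f"
      using Cons by (simp add: reduced_word_Cons)
    ultimately show ?case using Cons.prems
      by (cases l) (auto simp: emb_left_def emb_right_def reduced_word_Cons)
  qed
qed

lemma countable_free_product:
  assumes "countable (carrier G)" "countable (carrier H)"
  shows "countable (carrier (free_product G H))"
proof (rule countable_subset)
  show "carrier (free_product G H) \<subseteq> lists (Inl ` carrier G \<union> Inr ` carrier H)"
  proof
    fix w assume "w \<in> carrier (free_product G H)"
    then have "reduced_word G H w" by (simp add: free_product_simps)
    then show "w \<in> lists (Inl ` carrier G \<union> Inr ` carrier H)"
      by (induction rule: reduced_induct) auto
  qed
  show "countable (lists (Inl ` carrier G \<union> Inr ` carrier H))" using assms by (intro countable_lists) auto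
qed

context complex_group_algebra begin

text \<open>The linear extension of the action to finitely supported functions.\<close>

definition algebra_action :: "('a \<Rightarrow> ('i \<Rightarrow> complex) \<Rightarrow> 'i \<Rightarrow> complex) \<Rightarrow>
    ('a \<Rightarrow> complex) \<Rightarrow> ('i \<Rightarrow> complex) \<Rightarrow> 'i \<Rightarrow> complex" where
  "algebra_action U f v = (\<lambda>i. \<Sum>g | f g \<noteq> 0. f g * U g v i)"

lemma algebra_action_pair: "algebra_action U f v = (\<lambda>i. pair f (\<lambda>g. U g v i))"
  by (simp add: algebra_action_def pair_def)

lemma algebra_action_delta [simp]: "algebra_action U (delta g) v = U g v"
  by (simp add: algebra_action_pair pair_delta)

lemma algebra_action_closed:
  assumes "unitary_action G S U" "f \<in> carrier CG" "v \<in> L2 S" shows "algebra_action U f v \<in> L2 S"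
  unfolding algebra_action_def
  by (intro L2_sum L2_scale) (use assms supp(2)[OF assms(2)] in \<open>auto simp: unitary_actionD\<close>)

lemma algebra_action_bound:
  assumes U: "unitary_action G S U" and f: "f \<in> carrier CG" and v: "v \<in> L2 S"
  shows "nrm S (algebra_action U f v) \<le> (\<Sum>g | f g \<noteq> 0. cmod (f g)) * nrm S v"
proof -
  have "nrm S (algebra_action U f v) \<le> (\<Sum>g | f g \<noteq> 0. nrm S (\<lambda>i. f g * U g v i))"
    unfolding algebra_action_def
    by (rule nrm_sum_le) (use U v supp(2)[OF f] in \<open>auto simp: unitary_actionD\<close>)
  also have "\<dots> = (\<Sum>g | f g \<noteq> 0. cmod (f g) * nrm S v)"
    using U v supp(2)[OF f] by (intro sum.cong) (auto simp: nrm_scale unitary_actionD)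
  finally show ?thesis by (simp add: sum_distrib_right)
qed

lemma star_representation_algebra_action:
  assumes U: "unitary_action G S U"
  shows "star_representation CG (ell2 S) (algebra_action U)"
proof -
  note c = algebra_action_closed[OF U]
  interpret L: hilbert_space "ell2 S" by (rule hilbert_space_ell2)
  have lin: "algebra_action U f (\<lambda>i. v i + w i) = (\<lambda>i. algebra_action U f v i + algebra_action U f w i)"
    "algebra_action U f (\<lambda>i. k * v i) = (\<lambda>i. k * algebra_action U f v i)"
    if "f \<in> carrier CG" "v \<in> L2 S" "w \<in> L2 S" for f v w k
  proof -
    have "U g (\<lambda>i. v i + w i) = (\<lambda>i. U g v i + U g w i)" "U g (\<lambda>i. k * v i) = (\<lambda>i. k * U g v i)"
      if "g \<in> carrier G" for g
      using unitaryD(2,3)[OF unitary_actionD(1)[OF U that]] \<open>v \<in> L2 S\<close> \<open>w \<in> L2 S\<close> by auto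
    then show "algebra_action U f (\<lambda>i. v i + w i) = (\<lambda>i. algebra_action U f v i + algebra_action U f w i)"
      "algebra_action U f (\<lambda>i. k * v i) = (\<lambda>i. k * algebra_action U f v i)"
      unfolding algebra_action_pair pair_add_right[symmetric] pair_smult_right[symmetric]
      using that(1) by (auto intro!: ext pair_cong)
  qed
  have ipsum: "ip (ell2 S) (algebra_action U f v) w = pair f (\<lambda>g. ip (ell2 S) (U g v) w)"
    if f: "f \<in> carrier CG" and v: "v \<in> L2 S" and w: "w \<in> L2 S" for f v w
  proof -
    have *: "ip (ell2 S) (\<lambda>i. \<Sum>g\<in>F. f g * U g v i) w = (\<Sum>g\<in>F. f g * ip (ell2 S) (U g v) w)"
      if "finite F" "F \<subseteq> carrier G" for F
      using that
    proof (induction F)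
      case (insert a F)
      have "(\<lambda>i. \<Sum>g\<in>F. f g * U g v i) \<in> L2 S" "(\<lambda>i. f a * U a v i) \<in> L2 S" "U a v \<in> L2 S"
        using insert.prems U v by (auto intro!: L2_sum L2_scale simp: unitary_actionD)
      then show ?case
        using insert L.ip_add_left[of "\<lambda>i. f a * U a v i" "\<lambda>i. \<Sum>g\<in>F. f g * U g v i" w]
          L.ip_smult_left[of "U a v" w "f a"] w by (simp del: ell2_simps(5) add: ell2_simps(3,4))
    qed (use L.ip_zero_left[of w] w in \<open>simp del: ell2_simps(5)\<close>)
    show ?thesis unfolding algebra_action_def pair_def by (rule *) (use supp[OF f] in auto)
  qed
  have star: "ip (ell2 S) (algebra_action U f v) w = ip (ell2 S) v (algebra_action U (star CG f) w)"
    if f: "f \<in> carrier CG" and v: "v \<in> L2 S" and w: "w \<in> L2 S" for f v w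
  proof -
    have adj: "ip (ell2 S) (U g v) w = ip (ell2 S) v (U (inv g) w)" if "g \<in> carrier G" for g
      using unitary_ip_adjoint[OF unitary_actionD(1)[OF U that] v w]
        unitary_action_inv(3)[OF is_group U that w] by simp
    have cj: "ip (ell2 S) v x = cnj (ip (ell2 S) x v)" if "x \<in> L2 S" for x
      using L.ip_cnj[of x v] that v by (simp del: ell2_simps(5))
    have sf: "star CG f \<in> carrier CG" by (rule star_closed_CG[OF f])
    have "ip (ell2 S) v (algebra_action U (star CG f) w)
        = cnj (pair (star CG f) (\<lambda>g. ip (ell2 S) (U g w) v))"
      using cj[OF c[OF sf w]] ipsum[OF sf w v] by (simp del: ell2_simps(5))
    also have "\<dots> = pair f (\<lambda>g. cnj (ip (ell2 S) (U (inv g) w) v))"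
      by (simp add: pair_star[OF f] del: ell2_simps(5))
    also have "\<dots> = pair f (\<lambda>g. ip (ell2 S) (U g v) w)"
      by (rule pair_cong[OF f])
        (use cj adj w in \<open>simp del: ell2_simps(5) add: unitary_actionD[OF U]\<close>)
    finally show ?thesis using ipsum[OF f v w] by simp
  qed
  have mult: "algebra_action U (f \<otimes>\<^bsub>CG\<^esub> h) v = algebra_action U f (algebra_action U h v)"
    if f: "f \<in> carrier CG" and h: "h \<in> carrier CG" and v: "v \<in> L2 S" for f h v
  proof
    fix i
    have "algebra_action U (f \<otimes>\<^bsub>CG\<^esub> h) v i = pair f (\<lambda>y. pair h (\<lambda>z. U (y \<otimes> z) v i))"
      unfolding algebra_action_pair by (rule pair_mult[OF f h])
    also have "\<dots> = pair f (\<lambda>y. U y (algebra_action U h v) i)"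
    proof (rule pair_cong[OF f])
      fix y assume y: "y \<in> carrier G"
      have "pair h (\<lambda>z. U (y \<otimes> z) v i) = pair h (\<lambda>z. U y (U z v) i)"
        by (rule pair_cong[OF h]) (simp add: unitary_actionD(3)[OF U y _ v])
      also have "\<dots> = U y (algebra_action U h v) i"
        unfolding algebra_action_def pair_def
        by (subst isometry_sum[OF unitary_isometry[OF unitary_actionD(1)[OF U y]]])
          (use supp(2)[OF h] in \<open>auto simp: unitary_actionD[OF U] v\<close>)
      finally show "pair h (\<lambda>z. U (y \<otimes> z) v i) = U y (algebra_action U h v) i" .
    qed
    finally show "algebra_action U (f \<otimes>\<^bsub>CG\<^esub> h) v i = algebra_action U f (algebra_action U h v) i"
      by (simp add: algebra_action_pair)
  qed
  have bdd: "bounded_operator (ell2 S) (algebra_action U f)" if f: "f \<in> carrier CG" for f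
  proof -
    have "\<exists>K. \<forall>x\<in>carrier (ell2 S). vnorm (ell2 S) (algebra_action U f x) \<le> K * vnorm (ell2 S) x"
      using algebra_action_bound[OF U f] by auto
    then show ?thesis unfolding bounded_operator_def using c[OF f] lin[OF f] by auto
  qed
  show ?thesis
    unfolding star_representation_def
    using bdd star mult hilbert_space_ell2
    by (auto simp: algebra_action_pair pair_CG unitary_actionD[OF U] simp del: ell2_simps(5))
qed

end

section \<open>Representations of the full group C*-algebra\<close>

text \<open>Primitivity and the universal norm refer to Hilbert spaces over one fixed type. Hilbert spaces over
  other types are moved there along an injection.\<close>

definition transport :: "('h \<Rightarrow> 'k) \<Rightarrow> 'h hilbert \<Rightarrow> 'k hilbert" where
  "transport \<iota> H = (let r = inv_into (carrier H) \<iota> in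
     \<lparr>carrier = \<iota> ` carrier H, monoid.mult = (\<lambda>x y. x), one = \<iota> \<zero>\<^bsub>H\<^esub>, zero = \<iota> \<zero>\<^bsub>H\<^esub>,
      add = (\<lambda>x y. \<iota> (r x \<oplus>\<^bsub>H\<^esub> r y)), smult = (\<lambda>c x. \<iota> (c \<odot>\<^bsub>H\<^esub> r x)), ip = (\<lambda>x y. ip H (r x) (r y))\<rparr>)"

locale transported = hilbert_space H for H :: "'h hilbert" (structure) +
  fixes \<iota> :: "'h \<Rightarrow> 'k"
  assumes inj: "inj_on \<iota> (carrier H)"
begin

abbreviation "K \<equiv> transport \<iota> H"
abbreviation "r \<equiv> inv_into (carrier H) \<iota>"

lemma r_iota [simp]: "x \<in> carrier H \<Longrightarrow> r (\<iota> x) = x"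
  by (rule inv_into_f_f[OF inj])

lemma iota_eq_iff [simp]: "x \<in> carrier H \<Longrightarrow> y \<in> carrier H \<Longrightarrow> \<iota> x = \<iota> y \<longleftrightarrow> x = y"
  using inj by (auto dest: inj_onD)

lemma K_simps [simp]:
  "carrier K = \<iota> ` carrier H" "\<zero>\<^bsub>K\<^esub> = \<iota> \<zero>"
  "x \<in> carrier H \<Longrightarrow> y \<in> carrier H \<Longrightarrow> \<iota> x \<oplus>\<^bsub>K\<^esub> \<iota> y = \<iota> (x \<oplus> y)"
  "x \<in> carrier H \<Longrightarrow> c \<odot>\<^bsub>K\<^esub> \<iota> x = \<iota> (c \<odot> x)"
  "x \<in> carrier H \<Longrightarrow> y \<in> carrier H \<Longrightarrow> ip K (\<iota> x) (\<iota> y) = ip H x y"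
  by (simp_all add: transport_def Let_def)

lemma vnorm_K [simp]: "x \<in> carrier H \<Longrightarrow> vnorm K (\<iota> x) = vnorm H x"
  by (simp add: vnorm_def)

lemma module_K: "Module.module complex_ring K"
proof -
  have "abelian_group K"
  proof (rule abelian_groupI)
    fix x assume "x \<in> carrier K"
    then obtain y where y: "y \<in> carrier H" "x = \<iota> y" by auto
    then show "\<exists>y\<in>carrier K. y \<oplus>\<^bsub>K\<^esub> x = \<zero>\<^bsub>K\<^esub>"
      by (intro bexI[of _ "\<iota> (\<ominus> y)"]) (auto simp: l_neg)
  qed (auto simp: a_ac)
  then show ?thesis
    using smult_l_distr smult_r_distr smult_assoc1 smult_one
    by (intro moduleI cring_complex_ring) auto
qed

lemma K_minus [simp]: assumes "x \<in> carrier H" "y \<in> carrier H" shows "\<iota> x \<ominus>\<^bsub>K\<^esub> \<iota> y = \<iota> (x \<ominus> y)"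
proof -
  interpret KK: Module.module complex_ring K by (rule module_K)
  have "\<ominus>\<^bsub>K\<^esub> \<iota> y = \<iota> (\<ominus> y)" by (rule KK.minus_equality) (use assms in \<open>auto simp: l_neg\<close>)
  then show ?thesis using assms by (simp add: a_minus_def)
qed

lemma K_converges:
  assumes "\<And>n. s n \<in> carrier H" "x \<in> carrier H"
  shows "norm_converges K (vnorm K) (\<lambda>n. \<iota> (s n)) (\<iota> x) \<longleftrightarrow> norm_converges H (vnorm H) s x"
  using assms by (simp add: norm_converges_def)

lemma hilbert_space_K: "hilbert_space K"
proof (intro hilbert_space.intro module_K hilbert_space_axioms.intro)
  show "norm_complete K (vnorm K)"
    unfolding norm_complete_def
  proof (intro allI impI)
    fix s assume s: "norm_cauchy K (vnorm K) s"
    then have "\<exists>x\<in>carrier H. s n = \<iota> x" for n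
      unfolding norm_cauchy_def K_simps by blast
    then obtain t where t: "\<And>n. t n \<in> carrier H" "\<And>n. s n = \<iota> (t n)" by metis
    have "norm_cauchy H (vnorm H) t" using s t by (auto simp: norm_cauchy_def)
    then obtain x where "x \<in> carrier H" "norm_converges H (vnorm H) t x"
      using complete by (auto simp: norm_complete_def)
    then show "\<exists>x\<in>carrier K. norm_converges K (vnorm K) s x"
      using t by (intro bexI[of _ "\<iota> x"]) (auto simp: norm_converges_def)
  qed
  fix x y assume "x \<in> carrier K" "y \<in> carrier K"
  then obtain x' y' where *: "x' \<in> carrier H" "y' \<in> carrier H" "x = \<iota> x'" "y = \<iota> y'" by auto
  then show "ip K y x = cnj (ip K x y)" using ip_cnj[of x' y'] by simp
next
  fix x assume "x \<in> carrier K" "ip K x x = 0"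
  then show "x = \<zero>\<^bsub>K\<^esub>" using ip_eq_0 by auto
qed (auto simp: ip_add_left ip_smult_left ip_ge_0)

definition rep_K :: "('a \<Rightarrow> 'h \<Rightarrow> 'h) \<Rightarrow> 'a \<Rightarrow> 'k \<Rightarrow> 'k" where
  "rep_K \<pi> a x = \<iota> (\<pi> a (r x))"

lemma rep_K_iota [simp]: "x \<in> carrier H \<Longrightarrow> rep_K \<pi> a (\<iota> x) = \<iota> (\<pi> a x)"
  by (simp add: rep_K_def)

lemma star_representation_K:
  assumes A: "star_algebra A" and rep: "star_representation A H \<pi>"
  shows "star_representation A K (rep_K \<pi>)"
proof -
  note st = star_algebra.star_closed[OF A]
  have bo: "bounded_operator H (\<pi> a)" if "a \<in> carrier A" for a
    using rep that by (simp add: star_representation_def)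
  have c: "\<pi> a x \<in> carrier H" if "a \<in> carrier A" "x \<in> carrier H" for a x
    using bo[OF that(1)] that(2) by (auto simp: bounded_operator_def)
  have "bounded_operator K (rep_K \<pi> a)" if a: "a \<in> carrier A" for a
  proof -
    obtain L where "\<And>x. x \<in> carrier H \<Longrightarrow> vnorm H (\<pi> a x) \<le> L * vnorm H x"
      using bo[OF a] unfolding bounded_operator_def by blast
    then have "\<exists>L. \<forall>x\<in>carrier K. vnorm K (rep_K \<pi> a x) \<le> L * vnorm K x"
      using c[OF a] by (intro exI[of _ L]) auto
    then show ?thesis using bo[OF a] c[OF a] unfolding bounded_operator_def by auto
  qed
  then show ?thesis
    using rep c hilbert_space_K st unfolding star_representation_def by auto
qed

lemma faithful_K:
  assumes A: "star_algebra A" and fth: "faithful_representation A H \<pi>" shows "faithful_representation A K (rep_K \<pi>)"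
proof -
  have rep: "star_representation A H \<pi>" using fth by (simp add: faithful_representation_def)
  have c: "\<pi> a x \<in> carrier H" if "a \<in> carrier A" "x \<in> carrier H" for a x
    using rep that by (auto simp: star_representation_def bounded_operator_def)
  have "a = \<zero>\<^bsub>A\<^esub>" if "a \<in> carrier A" "\<forall>x\<in>carrier K. rep_K \<pi> a x = \<zero>\<^bsub>K\<^esub>" for a
  proof -
    have "\<pi> a x = \<zero>" if "x \<in> carrier H" for x
      using bspec[OF \<open>\<forall>x\<in>carrier K. rep_K \<pi> a x = \<zero>\<^bsub>K\<^esub>\<close>, of "\<iota> x"] that c[OF \<open>a \<in> carrier A\<close> that] by simp
    then show ?thesis using fth that(1) by (simp add: faithful_representation_def)
  qed
  then show ?thesis using star_representation_K[OF A rep] by (auto simp: faithful_representation_def)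
qed

lemma irreducible_K:
  assumes A: "star_algebra A" and irr: "irreducible_representation A H \<pi>" shows "irreducible_representation A K (rep_K \<pi>)"
proof -
  have rep: "star_representation A H \<pi>" using irr by (simp add: irreducible_representation_def)
  interpret KK: hilbert_space K by (rule hilbert_space_K)
  have "W = {\<zero>\<^bsub>K\<^esub>} \<or> W = carrier K"
    if W: "closed_subspace K W" and inv: "\<forall>a\<in>carrier A. \<forall>x\<in>W. rep_K \<pi> a x \<in> W" for W
  proof -
    note cs = KK.closed_subspace_subset[OF W] KK.closed_subspace_zero[OF W]
      KK.closed_subspace_add[OF W] KK.closed_subspace_smult[OF W]
    define V where "V = {x\<in>carrier H. \<iota> x \<in> W}"
    have WV: "W = \<iota> ` V" using cs(1) by (auto simp: V_def)
    have "closed_subspace H V"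
    proof (rule closed_subspaceI)
      show "\<zero> \<in> V" using cs(2) by (simp add: V_def)
      show "x \<oplus> y \<in> V" if "x \<in> V" "y \<in> V" for x y
        using cs(3)[of "\<iota> x" "\<iota> y"] that by (simp add: V_def)
      show "c \<odot> x \<in> V" if "x \<in> V" for c x using cs(4)[of "\<iota> x" c] that by (simp add: V_def)
      fix s x assume s: "\<And>n. s n \<in> V" and x: "x \<in> carrier H" "norm_converges H (vnorm H) s x"
      have "norm_converges K (vnorm K) (\<lambda>n. \<iota> (s n)) (\<iota> x)"
        using s x by (subst K_converges) (auto simp: V_def)
      moreover have "\<iota> (s n) \<in> W" for n using s[of n] by (simp add: V_def)
      ultimately have "\<iota> x \<in> W" using KK.closed_subspace_lim[OF W, of "\<lambda>n. \<iota> (s n)" "\<iota> x"] x by simp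
      then show "x \<in> V" using x by (simp add: V_def)
    qed (auto simp: V_def)
    moreover have "\<pi> a x \<in> V" if "a \<in> carrier A" "x \<in> V" for a x
    proof -
      have "\<pi> a x \<in> carrier H" using rep that by (auto simp: star_representation_def bounded_operator_def V_def)
      then show ?thesis using inv that by (force simp: V_def)
    qed
    ultimately have "V = {\<zero>} \<or> V = carrier H" using irr by (auto simp: irreducible_representation_def)
    then show ?thesis using WV by auto
  qed
  moreover have "carrier K \<noteq> {\<zero>\<^bsub>K\<^esub>}"
  proof
    assume *: "carrier K = {\<zero>\<^bsub>K\<^esub>}"
    have "x = \<zero>" if "x \<in> carrier H" for x
    proof -
      have "\<iota> x \<in> carrier K" using that by simp
      then show ?thesis using that unfolding * by simp
    qed
    then have "carrier H = {\<zero>}" by auto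
    then show False using irr by (simp add: irreducible_representation_def)
  qed
  ultimately show ?thesis
    using star_representation_K[OF A rep] unfolding irreducible_representation_def by auto
qed

end

context hilbert_space begin

abbreviation "conv \<equiv> norm_converges H (vnorm H)"

lemma convI:
  assumes "\<And>n. vnorm H (s n \<ominus> x) \<le> a n" "a \<longlonglongrightarrow> 0" "\<And>n. s n \<in> carrier H" "x \<in> carrier H"
  shows "conv s x"
  unfolding norm_converges_def
  by (rule tendsto_sandwich[OF _ _ tendsto_const assms(2)])
    (use assms vnorm_ge_0 in \<open>auto intro!: always_eventually\<close>)

lemma conv_add:
  assumes s: "conv s x" "\<And>n. s n \<in> carrier H" "x \<in> carrier H"
    and t: "conv t y" "\<And>n. t n \<in> carrier H" "y \<in> carrier H"
  shows "conv (\<lambda>n. s n \<oplus> t n) (x \<oplus> y)"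
proof (rule convI)
  show "(\<lambda>n. vnorm H (s n \<ominus> x) + vnorm H (t n \<ominus> y)) \<longlonglongrightarrow> 0"
    using tendsto_add[OF s(1)[unfolded norm_converges_def] t(1)[unfolded norm_converges_def]] by simp
  fix n
  have "(s n \<oplus> t n) \<ominus> (x \<oplus> y) = (s n \<ominus> x) \<oplus> (t n \<ominus> y)"
    using s t by (simp add: minus_eq minus_add a_ac)
  then show "vnorm H ((s n \<oplus> t n) \<ominus> (x \<oplus> y)) \<le> vnorm H (s n \<ominus> x) + vnorm H (t n \<ominus> y)"
    using vnorm_add[of "s n \<ominus> x" "t n \<ominus> y"] s t by simp
qed (use s t in auto)

lemma conv_smult:
  assumes s: "conv s x" "\<And>n. s n \<in> carrier H" "x \<in> carrier H"
  shows "conv (\<lambda>n. c \<odot> s n) (c \<odot> x)"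
proof (rule convI)
  show "(\<lambda>n. cmod c * vnorm H (s n \<ominus> x)) \<longlonglongrightarrow> 0"
    using tendsto_mult[OF tendsto_const s(1)[unfolded norm_converges_def]] by simp
  fix n
  have "(c \<odot> s n) \<ominus> (c \<odot> x) = c \<odot> (s n \<ominus> x)"
    using s smult_r_minus[of c x] by (simp add: minus_eq smult_r_distr)
  then show "vnorm H ((c \<odot> s n) \<ominus> (c \<odot> x)) \<le> cmod c * vnorm H (s n \<ominus> x)"
    using s by (simp add: vnorm_smult)
qed (use s in auto)

lemma conv_vnorm:
  assumes "conv s x" "\<And>n. s n \<in> carrier H" "x \<in> carrier H"
  shows "(\<lambda>n. vnorm H (s n)) \<longlonglongrightarrow> vnorm H x"
proof -
  have "\<bar>vnorm H (s n) - vnorm H x\<bar> \<le> vnorm H (s n \<ominus> x)" for n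
    using vnorm_triangle[OF assms(2,3), of n] vnorm_triangle[OF assms(3) assms(2)[of n]]
      vnorm_minus_commute[OF assms(3) assms(2)[of n]] by linarith
  then have "(\<lambda>n. vnorm H (s n) - vnorm H x) \<longlonglongrightarrow> 0"
    by (intro tendsto_0_le[OF assms(1)[unfolded norm_converges_def], of _ 1] always_eventually)
      (auto intro: order_trans[OF _ abs_ge_self])
  then show ?thesis by (simp add: LIM_zero_iff)
qed

end

text \<open>A representation bounded by a C*-seminorm extends to the completion.\<close>

locale bounded_representation = star_seminorm A p + HH: hilbert_space H
  for A :: "('a, 'm) star_algebra_scheme" (structure) and p and H :: "('h, 'n) hilbert_scheme" +
  fixes \<pi> :: "'a \<Rightarrow> 'h \<Rightarrow> 'h"
  assumes rep: "star_representation A H \<pi>"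
    and bound: "\<lbrakk>a \<in> carrier A; x \<in> carrier H\<rbrakk> \<Longrightarrow> vnorm H (\<pi> a x) \<le> p a * vnorm H x"
begin

lemma repD:
  "\<lbrakk>a \<in> carrier A; x \<in> carrier H\<rbrakk> \<Longrightarrow> \<pi> a x \<in> carrier H"
  "\<lbrakk>a \<in> carrier A; x \<in> carrier H; y \<in> carrier H\<rbrakk> \<Longrightarrow> \<pi> a (x \<oplus>\<^bsub>H\<^esub> y) = \<pi> a x \<oplus>\<^bsub>H\<^esub> \<pi> a y"
  "\<lbrakk>a \<in> carrier A; x \<in> carrier H\<rbrakk> \<Longrightarrow> \<pi> a (c \<odot>\<^bsub>H\<^esub> x) = c \<odot>\<^bsub>H\<^esub> \<pi> a x"
  "\<lbrakk>a \<in> carrier A; b \<in> carrier A; x \<in> carrier H\<rbrakk> \<Longrightarrow> \<pi> (a \<oplus> b) x = \<pi> a x \<oplus>\<^bsub>H\<^esub> \<pi> b x"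
  "\<lbrakk>a \<in> carrier A; b \<in> carrier A; x \<in> carrier H\<rbrakk> \<Longrightarrow> \<pi> (a \<otimes> b) x = \<pi> a (\<pi> b x)"
  "\<lbrakk>a \<in> carrier A; x \<in> carrier H\<rbrakk> \<Longrightarrow> \<pi> (c \<odot> a) x = c \<odot>\<^bsub>H\<^esub> \<pi> a x"
  "x \<in> carrier H \<Longrightarrow> \<pi> \<one> x = x"
  "\<lbrakk>a \<in> carrier A; x \<in> carrier H; y \<in> carrier H\<rbrakk> \<Longrightarrow> ip H (\<pi> a x) y = ip H x (\<pi> (star A a) y)"
  using rep by (auto simp: star_representation_def bounded_operator_def)

lemma rep_minus:
  assumes "a \<in> carrier A" "b \<in> carrier A" "x \<in> carrier H"
  shows "\<pi> (a \<ominus> b) x = \<pi> a x \<ominus>\<^bsub>H\<^esub> \<pi> b x"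
  using assms smult_closed[of "-1" b]
  by (simp add: minus_eq HH.minus_eq a_inv_eq HH.a_inv_eq repD)

lemma rep_minus_right:
  assumes "a \<in> carrier A" "x \<in> carrier H" "y \<in> carrier H"
  shows "\<pi> a (x \<ominus>\<^bsub>H\<^esub> y) = \<pi> a x \<ominus>\<^bsub>H\<^esub> \<pi> a y"
  using assms by (simp add: HH.minus_eq HH.a_inv_eq repD)

text \<open>The class of a Cauchy sequence acts as the limit of the actions of its terms.\<close>

definition extension :: "(nat \<Rightarrow> 'a) set \<Rightarrow> 'h \<Rightarrow> 'h" where
  "extension X x = (SOME y. y \<in> carrier H \<and> HH.conv (\<lambda>n. \<pi> (class_rep X n) x) y)"

text \<open>The chosen representative of the class can be replaced by any other member, because the
  representation is bounded by the seminorm.\<close>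

lemma extension_conv:
  assumes s: "cau s" and x: "x \<in> carrier H"
  shows "extension (cls s) x \<in> carrier H" "HH.conv (\<lambda>n. \<pi> (s n) x) (extension (cls s) x)"
proof -
  let ?r = "class_rep (cls s)"
  have r: "cau ?r" "eqv s ?r" using class_rep[OF s] by auto
  have pi: "\<pi> (t n) x \<in> carrier H" if "cau t" for t n using that x by (simp add: repD)
  have "norm_cauchy H (vnorm H) (\<lambda>n. \<pi> (?r n) x)"
    unfolding norm_cauchy_def
  proof (intro conjI allI impI)
    fix e :: real assume e: "e > 0"
    define d where "d = e / (vnorm H x + 1)"
    have vx: "vnorm H x \<ge> 0" by (rule HH.vnorm_ge_0[OF x])
    have d: "d > 0" using e vx by (simp add: d_def)
    obtain N where N: "\<forall>m\<ge>N. \<forall>n\<ge>N. p (?r m \<ominus> ?r n) < d" using cauD[OF r(1) d] by blast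
    have "vnorm H (\<pi> (?r m) x \<ominus>\<^bsub>H\<^esub> \<pi> (?r n) x) < e" if "m \<ge> N" "n \<ge> N" for m n
    proof -
      have "vnorm H (\<pi> (?r m) x \<ominus>\<^bsub>H\<^esub> \<pi> (?r n) x) \<le> p (?r m \<ominus> ?r n) * vnorm H x"
        using bound[of "?r m \<ominus> ?r n" x] r(1) x by (simp add: rep_minus)
      also have "\<dots> \<le> d * vnorm H x"
        using N that vx by (intro mult_right_mono) (auto intro: less_imp_le)
      also have "\<dots> < d * (vnorm H x + 1)" using d by simp
      also have "\<dots> = e" using vx by (simp add: d_def)
      finally show ?thesis .
    qed
    then show "\<exists>N. \<forall>m\<ge>N. \<forall>n\<ge>N. vnorm H (\<pi> (?r m) x \<ominus>\<^bsub>H\<^esub> \<pi> (?r n) x) < e" by blast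
  qed (use pi[OF r(1)] in auto)
  then have "\<exists>y. y \<in> carrier H \<and> HH.conv (\<lambda>n. \<pi> (?r n) x) y"
    using HH.complete by (auto simp: norm_complete_def)
  then have y: "extension (cls s) x \<in> carrier H" "HH.conv (\<lambda>n. \<pi> (?r n) x) (extension (cls s) x)"
    unfolding extension_def by (rule someI2_ex, simp)+
  show "extension (cls s) x \<in> carrier H" by (rule y(1))
  show "HH.conv (\<lambda>n. \<pi> (s n) x) (extension (cls s) x)"
  proof (rule HH.convI[OF _ _ pi[OF s] y(1)])
    show "(\<lambda>n. p (s n \<ominus> ?r n) * vnorm H x + vnorm H (\<pi> (?r n) x \<ominus>\<^bsub>H\<^esub> extension (cls s) x)) \<longlonglongrightarrow> 0"
      using tendsto_add[OF tendsto_mult[OF r(2)[unfolded eqv_def] tendsto_const] y(2)[unfolded norm_converges_def]]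
      by simp
    fix n
    let ?y = "extension (cls s) x"
    have "\<pi> (s n) x \<ominus>\<^bsub>H\<^esub> ?y = (\<pi> (s n) x \<ominus>\<^bsub>H\<^esub> \<pi> (?r n) x) \<oplus>\<^bsub>H\<^esub> (\<pi> (?r n) x \<ominus>\<^bsub>H\<^esub> ?y)"
      using pi[OF s, of n] pi[OF r(1), of n] y(1) by (simp add: HH.minus_eq HH.a_assoc HH.r_neg1)
    then have "vnorm H (\<pi> (s n) x \<ominus>\<^bsub>H\<^esub> ?y) \<le>
        vnorm H (\<pi> (s n) x \<ominus>\<^bsub>H\<^esub> \<pi> (?r n) x) + vnorm H (\<pi> (?r n) x \<ominus>\<^bsub>H\<^esub> ?y)"
      using HH.vnorm_add[of "\<pi> (s n) x \<ominus>\<^bsub>H\<^esub> \<pi> (?r n) x" "\<pi> (?r n) x \<ominus>\<^bsub>H\<^esub> ?y"]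
        pi[OF s, of n] pi[OF r(1), of n] y(1) by simp
    moreover have "vnorm H (\<pi> (s n) x \<ominus>\<^bsub>H\<^esub> \<pi> (?r n) x) \<le> p (s n \<ominus> ?r n) * vnorm H x"
      using bound[of "s n \<ominus> ?r n" x] r(1) s x by (simp add: rep_minus)
    ultimately show "vnorm H (\<pi> (s n) x \<ominus>\<^bsub>H\<^esub> ?y) \<le>
        p (s n \<ominus> ?r n) * vnorm H x + vnorm H (\<pi> (?r n) x \<ominus>\<^bsub>H\<^esub> ?y)" by linarith
  qed
qed

lemma extension_eqI:
  assumes "cau s" "x \<in> carrier H" "y \<in> carrier H" "HH.conv (\<lambda>n. \<pi> (s n) x) y"
  shows "extension (cls s) x = y"
  by (rule HH.norm_converges_unique[OF extension_conv(2)[OF assms(1,2)] assms(4)])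
    (use assms extension_conv in \<open>auto simp: repD\<close>)

lemma extension_const:
  assumes "a \<in> carrier A" "x \<in> carrier H" shows "extension (cls (\<lambda>n. a)) x = \<pi> a x"
  by (rule extension_eqI) (use assms in \<open>auto simp: repD norm_converges_def HH.minus_eq HH.r_neg\<close>)

lemma star_representation_extension: "star_representation B H extension"
proof -
  note ec = extension_conv
  have pc: "\<And>s n x. cau s \<Longrightarrow> x \<in> carrier H \<Longrightarrow> \<pi> (s n) x \<in> carrier H" by (simp add: repD)
  have bdd: "bounded_operator H (extension (cls s))" if s: "cau s" for s
    unfolding bounded_operator_def
  proof (intro conjI ballI allI)
    show "extension (cls s) \<in> carrier H \<rightarrow> carrier H" using ec(1)[OF s] by auto
  next
    fix x y assume xy: "x \<in> carrier H" "y \<in> carrier H"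
    have "HH.conv (\<lambda>n. \<pi> (s n) x \<oplus>\<^bsub>H\<^esub> \<pi> (s n) y) (extension (cls s) x \<oplus>\<^bsub>H\<^esub> extension (cls s) y)"
      using s xy ec pc by (intro HH.conv_add) auto
    then show "extension (cls s) (x \<oplus>\<^bsub>H\<^esub> y) = extension (cls s) x \<oplus>\<^bsub>H\<^esub> extension (cls s) y"
      using s xy ec(1) by (intro extension_eqI) (auto simp: repD)
  next
    fix c x assume x: "x \<in> carrier H"
    have "HH.conv (\<lambda>n. c \<odot>\<^bsub>H\<^esub> \<pi> (s n) x) (c \<odot>\<^bsub>H\<^esub> extension (cls s) x)"
      using s x ec pc by (intro HH.conv_smult) auto
    then show "extension (cls s) (c \<odot>\<^bsub>H\<^esub> x) = c \<odot>\<^bsub>H\<^esub> extension (cls s) x"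
      using s x ec(1) by (intro extension_eqI) (auto simp: repD)
  next
    have "vnorm H (extension (cls s) x) \<le> cnorm B (cls s) * vnorm H x" if x: "x \<in> carrier H" for x
    proof (rule LIMSEQ_le)
      show "(\<lambda>n. vnorm H (\<pi> (s n) x)) \<longlonglongrightarrow> vnorm H (extension (cls s) x)"
        using s x ec pc by (intro HH.conv_vnorm) auto
      show "(\<lambda>n. p (s n) * vnorm H x) \<longlonglongrightarrow> cnorm B (cls s) * vnorm H x"
        by (intro tendsto_mult tendsto_const cnorm_cls s)
    qed (use s x bound in auto)
    then show "\<exists>K. \<forall>x\<in>carrier H. vnorm H (extension (cls s) x) \<le> K * vnorm H x" by blast
  qed
  have add: "extension (cls (\<lambda>n. s n \<oplus> t n)) x = extension (cls s) x \<oplus>\<^bsub>H\<^esub> extension (cls t) x"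
    if s: "cau s" and t: "cau t" and x: "x \<in> carrier H" for s t x
  proof (rule extension_eqI)
    have "HH.conv (\<lambda>n. \<pi> (s n) x \<oplus>\<^bsub>H\<^esub> \<pi> (t n) x) (extension (cls s) x \<oplus>\<^bsub>H\<^esub> extension (cls t) x)"
      using s t x ec pc by (intro HH.conv_add) auto
    then show "HH.conv (\<lambda>n. \<pi> (s n \<oplus> t n) x) (extension (cls s) x \<oplus>\<^bsub>H\<^esub> extension (cls t) x)"
      using s t x by (simp add: repD)
  qed (use s t x ec in auto)
  have smult: "extension (cls (\<lambda>n. c \<odot> s n)) x = c \<odot>\<^bsub>H\<^esub> extension (cls s) x"
    if s: "cau s" and x: "x \<in> carrier H" for s c x
  proof (rule extension_eqI)
    have "HH.conv (\<lambda>n. c \<odot>\<^bsub>H\<^esub> \<pi> (s n) x) (c \<odot>\<^bsub>H\<^esub> extension (cls s) x)"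
      using s x ec pc by (intro HH.conv_smult) auto
    then show "HH.conv (\<lambda>n. \<pi> (c \<odot> s n) x) (c \<odot>\<^bsub>H\<^esub> extension (cls s) x)"
      using s x by (simp add: repD)
  qed (use s x ec in auto)
  have mult: "extension (cls (\<lambda>n. s n \<otimes> t n)) x = extension (cls s) (extension (cls t) x)"
    if s: "cau s" and t: "cau t" and x: "x \<in> carrier H" for s t x
  proof (rule extension_eqI)
    let ?y = "extension (cls t) x"
    let ?z = "extension (cls s) ?y"
    have y: "?y \<in> carrier H" "?z \<in> carrier H" using ec(1) s t x by auto
    obtain C where C: "C > 0" "\<forall>n. p (s n) \<le> C" using cau_bounded[OF s] by blast
    show "HH.conv (\<lambda>n. \<pi> (s n \<otimes> t n) x) ?z"
    proof (rule HH.convI)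
      show "(\<lambda>n. C * vnorm H (\<pi> (t n) x \<ominus>\<^bsub>H\<^esub> ?y) + vnorm H (\<pi> (s n) ?y \<ominus>\<^bsub>H\<^esub> ?z)) \<longlonglongrightarrow> 0"
        using tendsto_add[OF tendsto_mult[OF tendsto_const[of C] ec(2)[OF t x, unfolded norm_converges_def]]
            ec(2)[OF s y(1), unfolded norm_converges_def]] by simp
      fix n
      have c: "\<pi> (t n) x \<in> carrier H" "\<pi> (s n) (\<pi> (t n) x) \<in> carrier H" "\<pi> (s n) ?y \<in> carrier H"
        using s t x y by (auto simp: repD)
      show "\<pi> (s n \<otimes> t n) x \<in> carrier H" using s t x by (simp add: repD)
      have "\<pi> (s n \<otimes> t n) x \<ominus>\<^bsub>H\<^esub> ?z =
          (\<pi> (s n) (\<pi> (t n) x) \<ominus>\<^bsub>H\<^esub> \<pi> (s n) ?y) \<oplus>\<^bsub>H\<^esub> (\<pi> (s n) ?y \<ominus>\<^bsub>H\<^esub> ?z)"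
        using c y s t x by (simp add: repD HH.minus_eq HH.a_assoc HH.r_neg1)
      then have "vnorm H (\<pi> (s n \<otimes> t n) x \<ominus>\<^bsub>H\<^esub> ?z) \<le>
          vnorm H (\<pi> (s n) (\<pi> (t n) x) \<ominus>\<^bsub>H\<^esub> \<pi> (s n) ?y) + vnorm H (\<pi> (s n) ?y \<ominus>\<^bsub>H\<^esub> ?z)"
        using HH.vnorm_add[of "\<pi> (s n) (\<pi> (t n) x) \<ominus>\<^bsub>H\<^esub> \<pi> (s n) ?y" "\<pi> (s n) ?y \<ominus>\<^bsub>H\<^esub> ?z"] c y by simp
      also have "vnorm H (\<pi> (s n) (\<pi> (t n) x) \<ominus>\<^bsub>H\<^esub> \<pi> (s n) ?y) \<le> p (s n) * vnorm H (\<pi> (t n) x \<ominus>\<^bsub>H\<^esub> ?y)"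
        using bound[of "s n" "\<pi> (t n) x \<ominus>\<^bsub>H\<^esub> ?y"] s c y by (simp add: rep_minus_right)
      also have "\<dots> \<le> C * vnorm H (\<pi> (t n) x \<ominus>\<^bsub>H\<^esub> ?y)"
        using C c y by (intro mult_right_mono HH.vnorm_ge_0) auto
      finally show "vnorm H (\<pi> (s n \<otimes> t n) x \<ominus>\<^bsub>H\<^esub> ?z) \<le>
          C * vnorm H (\<pi> (t n) x \<ominus>\<^bsub>H\<^esub> ?y) + vnorm H (\<pi> (s n) ?y \<ominus>\<^bsub>H\<^esub> ?z)" by simp
    qed (use y in auto)
  qed (use s t x ec in auto)
  have star: "ip H (extension (cls s) x) y = ip H x (extension (cls (\<lambda>n. star A (s n))) y)"
    if s: "cau s" and x: "x \<in> carrier H" and y: "y \<in> carrier H" for s x y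
  proof (rule LIMSEQ_unique)
    have ss: "cau (\<lambda>n. star A (s n))" using s by simp
    show "(\<lambda>n. ip H (\<pi> (s n) x) y) \<longlonglongrightarrow> ip H (extension (cls s) x) y"
      using s x y ec pc by (intro HH.tendsto_ip) auto
    have "(\<lambda>n. cnj (ip H (\<pi> (star A (s n)) y) x)) \<longlonglongrightarrow> cnj (ip H (extension (cls (\<lambda>n. star A (s n))) y) x)"
      using ec(2)[OF ss y] ec(1)[OF ss y] pc[OF ss y] x by (intro tendsto_cnj HH.tendsto_ip)
    moreover have "cnj (ip H (\<pi> (star A (s n)) y) x) = ip H (\<pi> (s n) x) y" for n
      using s x y HH.ip_cnj[of "\<pi> (star A (s n)) y" x] by (simp add: repD)
    moreover have "cnj (ip H (extension (cls (\<lambda>n. star A (s n))) y) x) =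
        ip H x (extension (cls (\<lambda>n. star A (s n))) y)"
      using HH.ip_cnj[OF ec(1)[OF ss y] x] by simp
    ultimately show "(\<lambda>n. ip H (\<pi> (s n) x) y) \<longlonglongrightarrow> ip H x (extension (cls (\<lambda>n. star A (s n))) y)"
      by simp
  qed
  show ?thesis
    unfolding star_representation_def
  proof (intro conjI ballI allI)
    fix X assume "X \<in> carrier B"
    then obtain s where s: "cau s" "X = cls s" by (rule BE)
    show "bounded_operator H (extension X)" using bdd s by simp
    show "extension (c \<odot>\<^bsub>B\<^esub> X) x = c \<odot>\<^bsub>H\<^esub> extension X x" if "x \<in> carrier H" for c x
      using s smult that by simp
    show "ip H (extension X x) y = ip H x (extension (star B X) y)"
      if "x \<in> carrier H" "y \<in> carrier H" for x y using s star that by simp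
    fix Y x assume "Y \<in> carrier B" and x: "x \<in> carrier H"
    then obtain t where t: "cau t" "Y = cls t" by (elim BE)
    show "extension (X \<oplus>\<^bsub>B\<^esub> Y) x = extension X x \<oplus>\<^bsub>H\<^esub> extension Y x"
      "extension (X \<otimes>\<^bsub>B\<^esub> Y) x = extension X (extension Y x)"
      using s t x add mult by simp_all
  next
    fix x assume "x \<in> carrier H"
    then show "extension \<one>\<^bsub>B\<^esub> x = x" by (simp add: one_B extension_const repD)
  qed (rule HH.hilbert_space_axioms)
qed

text \<open>If the extension kills the class of a sequence, the representing operators tend to \<open>0\<close> at every
  vector, but they have to be large at a vector where the seminorm is almost attained.\<close>

lemma faithful_extension:
  assumes lower: "\<And>a e. a \<in> carrier A \<Longrightarrow> e > 0 \<Longrightarrow>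
    \<exists>x\<in>carrier H. x \<noteq> \<zero>\<^bsub>H\<^esub> \<and> (p a - e) * vnorm H x \<le> vnorm H (\<pi> a x)"
  shows "faithful_representation B H extension"
  unfolding faithful_representation_def
proof (intro conjI ballI impI star_representation_extension)
  fix X assume "X \<in> carrier B" and z: "\<forall>x\<in>carrier H. extension X x = \<zero>\<^bsub>H\<^esub>"
  then obtain s where s: "cau s" "X = cls s" by (elim BE)
  have "(\<lambda>n. p (s n)) \<longlonglongrightarrow> 0"
  proof (rule LIMSEQ_I)
    fix e :: real assume "e > 0"
    then have e: "e / 3 > 0" by simp
    obtain N where N: "\<forall>m\<ge>N. \<forall>n\<ge>N. p (s m \<ominus> s n) < e / 3" using cauD[OF s(1) e] by blast
    have "p (s n) < e" if n: "n \<ge> N" for n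
    proof -
      obtain x where x: "x \<in> carrier H" "x \<noteq> \<zero>\<^bsub>H\<^esub>" and lo: "(p (s n) - e / 3) * vnorm H x \<le> vnorm H (\<pi> (s n) x)"
        using lower[of "s n" "e / 3"] s e by auto
      have vx: "vnorm H x > 0" using x HH.vnorm_eq_0[of x] HH.vnorm_ge_0[of x] by simp
      have c: "\<pi> (s m) x \<in> carrier H" for m using s x by (simp add: repD)
      have lim: "(\<lambda>m. vnorm H (\<pi> (s m) x)) \<longlonglongrightarrow> 0"
        using HH.conv_vnorm[OF extension_conv(2)[OF s(1) x(1)] c extension_conv(1)[OF s(1) x(1)]]
          z x s by simp
      have "vnorm H (\<pi> (s n) x) \<le> (e / 3) * vnorm H x + vnorm H (\<pi> (s m) x)" if "m \<ge> N" for m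
      proof -
        have "vnorm H (\<pi> (s n) x \<ominus>\<^bsub>H\<^esub> \<pi> (s m) x) \<le> p (s n \<ominus> s m) * vnorm H x"
          using bound[of "s n \<ominus> s m" x] s x by (simp add: rep_minus)
        also have "\<dots> \<le> (e / 3) * vnorm H x"
          using N n that vx by (intro mult_right_mono) (auto intro: less_imp_le)
        finally show ?thesis using HH.vnorm_triangle[OF c[of n] c[of m]] by simp
      qed
      then have "vnorm H (\<pi> (s n) x) \<le> (e / 3) * vnorm H x + 0"
        by (intro LIMSEQ_le_const[OF tendsto_add[OF tendsto_const lim]]) blast
      then have "(p (s n) - e / 3) * vnorm H x \<le> (e / 3) * vnorm H x" using lo by simp
      then have "p (s n) - e / 3 \<le> e / 3" using vx by simp
      then show ?thesis using \<open>e > 0\<close> by simp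
    qed
    then have "\<forall>n\<ge>N. norm (p (s n) - 0) < e" using p_ge_0 s by simp
    then show "\<exists>N. \<forall>n\<ge>N. norm (p (s n) - 0) < e" by blast
  qed
  then have "cnorm B X = 0" using cnorm_cls_eqI[OF s(1)] s(2) by simp
  then show "X = \<zero>\<^bsub>B\<^esub>" using B_eq_0 s by auto
qed

text \<open>The algebra embeds into its completion by constant sequences, so the completion has no more invariant
  subspaces than the algebra.\<close>

lemma irreducible_extension:
  assumes ne: "carrier H \<noteq> {\<zero>\<^bsub>H\<^esub>}"
    and irr: "\<And>W. closed_subspace H W \<Longrightarrow> (\<And>a x. a \<in> carrier A \<Longrightarrow> x \<in> W \<Longrightarrow> \<pi> a x \<in> W) \<Longrightarrow>
      W = {\<zero>\<^bsub>H\<^esub>} \<or> W = carrier H"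
  shows "irreducible_representation B H extension"
  unfolding irreducible_representation_def
proof (intro conjI allI impI star_representation_extension ne)
  fix W assume W: "closed_subspace H W \<and> (\<forall>a\<in>carrier B. \<forall>x\<in>W. extension a x \<in> W)"
  then have Ws: "W \<subseteq> carrier H" using HH.closed_subspace_subset by blast
  show "W = {\<zero>\<^bsub>H\<^esub>} \<or> W = carrier H"
  proof (rule irr)
    fix a x assume a: "a \<in> carrier A" and x: "x \<in> W"
    have "extension (cls (\<lambda>n. a)) x \<in> W" using W a x by auto
    then show "\<pi> a x \<in> W" using extension_const[OF a] x Ws by auto
  qed (use W in simp)
qed

end

text \<open>Functions on a countable set are sequences, so that an injection of the complex numbers provides the
  injection needed for transport.\<close>

lemma inj_on_L2_sequence:
  assumes S: "countable S" "S \<noteq> {}" and j: "inj j"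
  shows "inj_on (\<lambda>f n. j (f (from_nat_into S n))) (L2 S)"
proof (rule inj_onI)
  fix f g assume fg: "f \<in> L2 S" "g \<in> L2 S"
    "(\<lambda>n. j (f (from_nat_into S n))) = (\<lambda>n. j (g (from_nat_into S n)))"
  show "f = g"
  proof (rule L2_ext[OF fg(1,2)])
    fix i assume "i \<in> S"
    then have "from_nat_into S (to_nat_on S i) = i" using S by simp
    then show "f i = g i" using fun_cong[OF fg(3), of "to_nat_on S i"] j by (auto dest: injD)
  qed
qed

text \<open>The supremum defining the universal norm ranges over Hilbert spaces over one type; the action is
  transported to it.\<close>

lemma (in complex_group_algebra) algebra_action_le_universal_norm:
  fixes S :: "'s set" and U :: "'a \<Rightarrow> ('s \<Rightarrow> complex) \<Rightarrow> 's \<Rightarrow> complex"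
  assumes S: "countable S" "S \<noteq> {}" and U: "unitary_action G S U"
    and f: "f \<in> carrier CG" and v: "v \<in> L2 S"
  shows "nrm S (algebra_action U f v) \<le> universal_norm CG f * nrm S v"
proof -
  interpret BA: star_algebra_bounded CG by (rule star_algebra_bounded_CG)
  note rep = star_representation_algebra_action[OF U]
  define \<iota> :: "('s \<Rightarrow> complex) \<Rightarrow> nat \<Rightarrow> 'a \<Rightarrow> complex" where
    "\<iota> = (\<lambda>f n. (\<lambda>z _. z) (f (from_nat_into S n)))"
  have inj: "inj_on \<iota> (L2 S)"
    unfolding \<iota>_def by (rule inj_on_L2_sequence[OF S]) (auto simp: inj_on_def fun_eq_iff)
  interpret T1: transported "ell2 S" \<iota>
    by (intro transported.intro hilbert_space_ell2 transported_axioms.intro) (use inj in simp)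
  have "vnorm T1.K (T1.rep_K (algebra_action U) f (\<iota> v)) \<le> universal_norm CG f * vnorm T1.K (\<iota> v)"
    using v by (intro BA.u_bound[OF f T1.star_representation_K[OF star_algebra_CG rep]]) simp
  then show ?thesis
    using v algebra_action_closed[OF U f, of v] T1.vnorm_K[of v] T1.vnorm_K[of "algebra_action U f v"] by simp
qed

lemma (in complex_group_algebra) primitive_full_group_c_star_algebraI:
  fixes S :: "'s set" and U :: "'a \<Rightarrow> ('s \<Rightarrow> complex) \<Rightarrow> 's \<Rightarrow> complex"
  assumes S: "countable S" "S \<noteq> {}" and U: "unitary_action G S U"
    and irr: "\<And>W. closed_subspace (ell2 S) W \<Longrightarrow> (\<And>g x. g \<in> carrier G \<Longrightarrow> x \<in> W \<Longrightarrow> U g x \<in> W) \<Longrightarrow>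
      W = {\<lambda>i. 0} \<or> W = L2 S"
    and lower: "\<And>f e. f \<in> carrier CG \<Longrightarrow> e > 0 \<Longrightarrow>
      \<exists>v\<in>L2 S. v \<noteq> (\<lambda>i. 0) \<and> (universal_norm CG f - e) * nrm S v \<le> nrm S (algebra_action U f v)"
  shows "primitive_c_star_algebra (full_group_c_star_algebra G)"
proof -
  note rep = star_representation_algebra_action[OF U]
  interpret BR: bounded_representation CG "universal_norm CG" "ell2 S" "algebra_action U"
    by (intro bounded_representation.intro bounded_representation_axioms.intro hilbert_space_ell2 rep
        star_algebra_bounded.star_seminorm_u star_algebra_bounded_CG)
      (use algebra_action_le_universal_norm[OF S U] in simp)
  have faith: "faithful_representation BR.B (ell2 S) BR.extension"
    by (rule BR.faithful_extension) (use lower in auto)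
  have irred: "irreducible_representation BR.B (ell2 S) BR.extension"
  proof (rule BR.irreducible_extension)
    obtain s where "s \<in> S" using S by blast
    then have "unit_vec s \<in> L2 S" by simp
    moreover have "unit_vec s \<noteq> (\<lambda>i. 0)" by (auto simp: unit_vec_def fun_eq_iff)
    ultimately have "unit_vec s \<in> L2 S \<and> unit_vec s \<noteq> (\<lambda>i. 0)" by simp
    then show "carrier (ell2 S) \<noteq> {\<zero>\<^bsub>ell2 S\<^esub>}" by auto
    fix W assume W: "closed_subspace (ell2 S) W"
      and inv: "\<And>a x. a \<in> carrier CG \<Longrightarrow> x \<in> W \<Longrightarrow> algebra_action U a x \<in> W"
    have "U g x \<in> W" if "g \<in> carrier G" "x \<in> W" for g x
      using inv[OF delta_closed[OF that(1)] that(2)] by simp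
    then show "W = {\<zero>\<^bsub>ell2 S\<^esub>} \<or> W = carrier (ell2 S)" using irr[OF W] by simp
  qed
  define \<kappa> :: "('s \<Rightarrow> complex) \<Rightarrow> nat \<Rightarrow> (nat \<Rightarrow> 'a \<Rightarrow> complex) set" where
    "\<kappa> = (\<lambda>f n. (\<lambda>z. {\<lambda>_ _. z}) (f (from_nat_into S n)))"
  have inj: "inj_on \<kappa> (L2 S)"
    unfolding \<kappa>_def by (rule inj_on_L2_sequence[OF S]) (auto simp: inj_on_def fun_eq_iff)
  interpret T2: transported "ell2 S" \<kappa>
    by (intro transported.intro hilbert_space_ell2 transported_axioms.intro) (use inj in simp)
  show ?thesis
    unfolding primitive_c_star_algebra_def
    using c_star_algebra_full T2.faithful_K[OF BR.star_algebra_B faith] T2.irreducible_K[OF BR.star_algebra_B irred]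
    unfolding full_group_c_star_algebra_def by blast
qed

section \<open>Almost norming representations in coordinates\<close>

context complex_group_algebra begin

lemma CG_induct [consumes 1, case_names zero add]:
  assumes "f \<in> carrier CG" and P0: "P \<zero>\<^bsub>CG\<^esub>"
    and Padd: "\<And>f c g. f \<in> carrier CG \<Longrightarrow> g \<in> carrier G \<Longrightarrow> P f \<Longrightarrow> P (f \<oplus>\<^bsub>CG\<^esub> (c \<odot>\<^bsub>CG\<^esub> delta g))"
  shows "P f"
  using assms(1)
proof (induction "card {x. f x \<noteq> 0}" arbitrary: f)
  case 0
  then have "f = \<zero>\<^bsub>CG\<^esub>" using supp(1)[OF 0(2)] by (auto simp: CG_simps)
  then show ?case using P0 by simp
next
  case (Suc n)
  then obtain g where g: "f g \<noteq> 0" by (metis (mono_tags, lifting) Collect_empty_eq card.empty nat.distinct(1))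
  have gG: "g \<in> carrier G" using supp(2)[OF Suc.prems g] .
  define f' where "f' = f(g := 0)"
  have s: "{x. f' x \<noteq> 0} = {x. f x \<noteq> 0} - {g}" by (auto simp: f'_def)
  have f': "f' \<in> carrier CG"
    using Suc.prems by (intro CG_I[of "{x. f x \<noteq> 0}"]) (auto simp: f'_def supp split: if_splits)
  have "n = card {x. f' x \<noteq> 0}"
    using Suc.hyps(2) g supp(1)[OF Suc.prems] unfolding s by simp
  from Suc.hyps(1)[OF this f'] have "P (f' \<oplus>\<^bsub>CG\<^esub> (f g \<odot>\<^bsub>CG\<^esub> delta g))" by (rule Padd[OF f' gG])
  moreover have "f = f' \<oplus>\<^bsub>CG\<^esub> (f g \<odot>\<^bsub>CG\<^esub> delta g)"
    by (auto simp: CG_simps f'_def delta_def)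
  ultimately show ?case by simp
qed

lemma delta_mult: "g \<in> carrier G \<Longrightarrow> h \<in> carrier G \<Longrightarrow> delta g \<otimes>\<^bsub>CG\<^esub> delta h = delta (g \<otimes> h)"
  by (rule CG_eqI) (simp_all add: CG_closed delta_closed pair_mult pair_delta)

lemma star_delta: "g \<in> carrier G \<Longrightarrow> star CG (delta g) = delta (inv g)"
  by (rule CG_eqI) (simp_all add: CG_closed delta_closed pair_star pair_delta)

lemma rep_delta:
  assumes rep: "star_representation CG H \<pi>" and g: "g \<in> carrier G" and x: "x \<in> carrier H"
  shows "\<pi> (delta g) x \<in> carrier H" "y \<in> carrier H \<Longrightarrow> ip H (\<pi> (delta g) x) y = ip H x (\<pi> (delta (inv g)) y)"
    "h \<in> carrier G \<Longrightarrow> \<pi> (delta (g \<otimes> h)) x = \<pi> (delta g) (\<pi> (delta h) x)"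
    "\<pi> (delta \<one>) x = x"
  using rep g x unfolding star_representation_def bounded_operator_def
  by (auto simp: delta_closed star_delta simp flip: delta_mult one_CG)

text \<open>Both sides are linear in \<open>f\<close>.\<close>

lemma ip_rep_pair:
  assumes rep: "star_representation CG H \<pi>" and x: "x \<in> carrier H" and y: "y \<in> carrier H"
    and f: "f \<in> carrier CG"
  shows "ip H (\<pi> f x) y = pair f (\<lambda>g. ip H (\<pi> (delta g) x) y)"
proof -
  interpret H: hilbert_space H using rep by (simp add: star_representation_def)
  have c: "\<pi> h x \<in> carrier H" if "h \<in> carrier CG" for h
    using rep that x by (auto simp: star_representation_def bounded_operator_def)
  have add: "\<pi> (h \<oplus>\<^bsub>CG\<^esub> k) x = \<pi> h x \<oplus>\<^bsub>H\<^esub> \<pi> k x" "\<pi> (a \<odot>\<^bsub>CG\<^esub> h) x = a \<odot>\<^bsub>H\<^esub> \<pi> h x"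
    if "h \<in> carrier CG" "k \<in> carrier CG" for h k a
    using rep that x by (auto simp: star_representation_def)
  show ?thesis using f
  proof (induction rule: CG_induct)
    case zero
    have "\<zero>\<^bsub>CG\<^esub> = 0 \<odot>\<^bsub>CG\<^esub> delta \<one>" by (simp add: CG_simps)
    then have "\<pi> \<zero>\<^bsub>CG\<^esub> x = \<zero>\<^bsub>H\<^esub>"
      using add(2)[of "delta \<one>" "delta \<one>" 0] c[of "delta \<one>"] H.smult_l_null[of "\<pi> (delta \<one>) x"]
      by (simp add: delta_closed)
    then show ?case using y by (simp add: pair_CG)
  next
    case (add f a g)
    then show ?case using y c
      by (simp add: pair_CG pair_delta CG_closed delta_closed \<open>\<And>k h. h \<in> carrier CG \<Longrightarrow> k \<in> carrier CG \<Longrightarrow> \<pi> (h \<oplus>\<^bsub>CG\<^esub> k) x = \<pi> h x \<oplus>\<^bsub>H\<^esub> \<pi> k x\<close>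
        \<open>\<And>k h a. h \<in> carrier CG \<Longrightarrow> k \<in> carrier CG \<Longrightarrow> \<pi> (a \<odot>\<^bsub>CG\<^esub> h) x = a \<odot>\<^bsub>H\<^esub> \<pi> h x\<close>[OF _ delta_closed[OF one_closed]]
        H.ip_add_left H.ip_smult_left)
  qed
qed

text \<open>The closed subspace generated by the orbit of \<open>\<xi>\<close> is described as the double orthogonal
  complement of the orbit. It is separable because \<open>G\<close> is countable, so in coordinates with respect
  to an orthonormal basis it becomes a space of functions on a countable set.\<close>

lemma cyclic_action:
  fixes H :: "('h, 'n) hilbert_scheme"
  assumes co: "countable (carrier G)" and rep: "star_representation CG H \<pi>"
    and xi: "\<xi> \<in> carrier H" "\<xi> \<noteq> \<zero>\<^bsub>H\<^esub>"
  obtains A :: "'h set" and R \<eta> where "countable A" "A \<noteq> {}" "unitary_action G A R"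
    "\<eta> \<in> L2 A" "\<eta> \<noteq> (\<lambda>i. 0)" "nrm A \<eta> = vnorm H \<xi>"
    "\<And>f. f \<in> carrier CG \<Longrightarrow> nrm A (algebra_action R f \<eta>) = vnorm H (\<pi> f \<xi>)"
proof -
  interpret H: hilbert_space H using rep by (simp add: star_representation_def)
  note rd = rep_delta[OF rep]
  define D where "D = (\<lambda>g. \<pi> (delta g) \<xi>) ` carrier G"
  have DH: "D \<subseteq> carrier H" using rd(1) xi by (auto simp: D_def)
  define W where "W = {v\<in>carrier H. \<forall>x\<in>carrier H. (\<forall>d\<in>D. ip H d x = 0) \<longrightarrow> ip H v x = 0}"
  have W: "closed_subspace H W"
  proof (rule H.closed_subspaceI)
    fix s x assume s: "\<And>n. s n \<in> W" and x: "x \<in> carrier H" "norm_converges H (vnorm H) s x"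
    have "ip H x y = 0" if y: "y \<in> carrier H" "\<forall>d\<in>D. ip H d y = 0" for y
    proof -
      have "(\<lambda>n. ip H (s n) y) \<longlonglongrightarrow> ip H x y"
        using s x y by (intro H.tendsto_ip) (auto simp: W_def)
      moreover have "ip H (s n) y = 0" for n using s[of n] y by (simp add: W_def)
      ultimately show ?thesis by (simp add: LIMSEQ_const_iff)
    qed
    then show "x \<in> W" using x by (simp add: W_def)
  qed (auto simp: W_def H.ip_add_left H.ip_smult_left)
  note inW = subsetD[OF H.closed_subspace_subset[OF W]]
  have inv: "\<pi> (delta g) v \<in> W" if g: "g \<in> carrier G" and v: "v \<in> W" for g v
  proof -
    have "ip H (\<pi> (delta g) v) x = 0" if x: "x \<in> carrier H" "\<forall>d\<in>D. ip H d x = 0" for x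
    proof -
      have "ip H d (\<pi> (delta (inv g)) x) = 0" if "d \<in> D" for d
      proof -
        obtain h where h: "h \<in> carrier G" "d = \<pi> (delta h) \<xi>" using \<open>d \<in> D\<close> by (auto simp: D_def)
        have dH: "d \<in> carrier H" using \<open>d \<in> D\<close> DH by auto
        have "ip H (\<pi> (delta g) d) x = ip H d (\<pi> (delta (inv g)) x)" by (rule rd(2)[OF g dH x(1)])
        moreover have "\<pi> (delta g) d \<in> D" unfolding h(2) D_def
          using g h(1) rd(3)[OF g xi(1) h(1)] by (intro image_eqI[of _ _ "g \<otimes> h"]) auto
        ultimately show ?thesis using x(2) by simp
      qed
      moreover have "\<pi> (delta (inv g)) x \<in> carrier H" using rd(1) g x by simp
      ultimately have "ip H v (\<pi> (delta (inv g)) x) = 0" using v by (simp add: W_def)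
      then show ?thesis using rd(2)[OF g inW[OF v] x(1)] by simp
    qed
    then show ?thesis using rd(1)[OF g inW[OF v]] by (simp add: W_def)
  qed
  have DW: "D \<subseteq> W" using DH by (auto simp: W_def)
  have xiW: "\<xi> \<in> W" using DW rd(4)[OF one_closed xi(1)] by (force simp: D_def)
  interpret WW: hilbert_space "H\<lparr>carrier := W\<rparr>" by (rule H.hilbert_space_subspace(1)[OF W])
  have vW: "vnorm (H\<lparr>carrier := W\<rparr>) = vnorm H" by (rule H.hilbert_space_subspace(3)[OF W])
  obtain A where A: "WW.orthonormal_basis A" using WW.orthonormal_basis_exists by blast
  then have A': "WW.orthonormal A" by (simp add: WW.orthonormal_basis_def)
  have AW: "A \<subseteq> W" using A' by (simp add: WW.orthonormal_def)
  have cA: "countable A"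
  proof (rule WW.countable_orthonormal[OF A'])
    show "countable D" using co by (simp add: D_def)
    fix v assume "v \<in> carrier (H\<lparr>carrier := W\<rparr>)" and z: "\<And>d. d \<in> D \<Longrightarrow> ip (H\<lparr>carrier := W\<rparr>) d v = 0"
    then have v: "v \<in> W" by simp
    have zH: "\<forall>d\<in>D. ip H d v = 0" using z by simp
    have "\<forall>x\<in>carrier H. (\<forall>d\<in>D. ip H d x = 0) \<longrightarrow> ip H v x = 0" using v unfolding W_def by (elim CollectE conjE)
    then have "ip H v v = 0" using zH inW[OF v] by blast
    then show "v = \<zero>\<^bsub>H\<lparr>carrier := W\<rparr>\<^esub>" using H.ip_eq_0[OF inW[OF v]] by simp
  qed (use DW in simp)
  have neA: "A \<noteq> {}" using A xiW xi by (auto simp: WW.orthonormal_basis_def)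
  \<comment> \<open>The coordinates with respect to \<open>A\<close>; the inverse map exists by the Riesz-Fischer theorem.\<close>
  define T where "T v = (\<lambda>x. if x \<in> A then ip H v x else 0)" for v
  have TL: "T v \<in> L2 A" and Tn: "nrm A (T v) = vnorm H v" if v: "v \<in> W" for v
  proof -
    have "(\<lambda>x. (cmod (ip H v x))\<^sup>2) summable_on A" using WW.bessel(1)[OF A'] v by simp
    then have "(\<lambda>x. (cmod (T v x))\<^sup>2) summable_on A"
      by (rule summable_on_cong[THEN iffD1, rotated]) (simp add: T_def)
    then show "T v \<in> L2 A" by (intro L2I) (simp_all add: T_def)
    have "(\<Sum>\<^sub>\<infinity>x\<in>A. (cmod (T v x))\<^sup>2) = (\<Sum>\<^sub>\<infinity>x\<in>A. (cmod (ip H v x))\<^sup>2)"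
      by (rule infsum_cong) (simp add: T_def)
    also have "\<dots> = (vnorm H v)\<^sup>2" using WW.parseval[OF A] v vW by simp
    finally show "nrm A (T v) = vnorm H v" using H.vnorm_ge_0[OF inW[OF v]] by (simp add: nrm_def)
  qed
  have Tsurj: "\<exists>v\<in>W. T v = f" if f: "f \<in> L2 A" for f
  proof -
    obtain v where "v \<in> W" "\<And>x. x \<in> A \<Longrightarrow> ip H v x = f x"
      using WW.riesz_fischer[OF A' L2_summable[OF f]] by auto
    then show ?thesis using L2_out[OF f] by (intro bexI[of _ v]) (auto simp: T_def)
  qed
  have Tadd: "T (v \<oplus>\<^bsub>H\<^esub> w) = (\<lambda>i. T v i + T w i)" "T (c \<odot>\<^bsub>H\<^esub> v) = (\<lambda>i. c * T v i)" if "v \<in> W" "w \<in> W" for v w c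
    using that inW AW by (auto simp: T_def fun_eq_iff H.ip_add_left H.ip_smult_left)
  have Tinj: "v = w" if "v \<in> W" "w \<in> W" "T v = T w" for v w
  proof -
    have "ip H (v \<ominus>\<^bsub>H\<^esub> w) x = 0" if "x \<in> A" for x
      using fun_cong[OF \<open>T v = T w\<close>, of x] that \<open>v \<in> W\<close> \<open>w \<in> W\<close> inW AW
      by (auto simp: T_def H.ip_minus_left)
    then have "v \<ominus>\<^bsub>H\<^esub> w = \<zero>\<^bsub>H\<^esub>"
      using A H.closed_subspace_minus[OF W that(1,2)] by (auto simp: WW.orthonormal_basis_def)
    then show ?thesis using that inW by (simp add: H.minus_eq_zero_iff)
  qed
  define I where "I f = (SOME v. v \<in> W \<and> T v = f)" for f
  have I: "I f \<in> W" "T (I f) = f" if "f \<in> L2 A" for f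
  proof -
    have "\<exists>v. v \<in> W \<and> T v = f" using Tsurj[OF that] by blast
    from someI_ex[OF this] show "I f \<in> W" "T (I f) = f" by (simp_all add: I_def)
  qed
  have IT: "I (T v) = v" if "v \<in> W" for v using I TL that by (intro Tinj) auto
  define R where "R g f = T (\<pi> (delta g) (I f))" for g f
  have RL: "R g f \<in> L2 A" if "g \<in> carrier G" "f \<in> L2 A" for g f
    unfolding R_def using that I inv TL by simp
  have Rmult: "R (g \<otimes> h) f = R g (R h f)" if "g \<in> carrier G" "h \<in> carrier G" "f \<in> L2 A" for g h f
    unfolding R_def using that I inv IT rd(3)[OF that(1) inW[OF I(1)[OF that(3)]] that(2)] by simp
  have Rone: "R \<one> f = f" if "f \<in> L2 A" for f
    unfolding R_def using that I rd(4)[OF one_closed inW[OF I(1)[OF that]]] by simp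
  have lin: "\<pi> (delta g) (v \<oplus>\<^bsub>H\<^esub> w) = \<pi> (delta g) v \<oplus>\<^bsub>H\<^esub> \<pi> (delta g) w"
    "\<pi> (delta g) (c \<odot>\<^bsub>H\<^esub> v) = c \<odot>\<^bsub>H\<^esub> \<pi> (delta g) v"
    if "g \<in> carrier G" "v \<in> carrier H" "w \<in> carrier H" for g v w c
    using rep that delta_closed[OF that(1)] unfolding star_representation_def bounded_operator_def by auto
  have Run: "unitary A (R g)" if g: "g \<in> carrier G" for g
  proof (rule unitaryI[where V = "R (inv g)"])
    show "isometry A A (R g)"
    proof (rule isometryI)
      fix f h assume fh: "f \<in> L2 A" "h \<in> L2 A"
      have "I (\<lambda>i. f i + h i) = I f \<oplus>\<^bsub>H\<^esub> I h"
        using fh I Tadd(1)[OF I(1)[OF fh(1)] I(1)[OF fh(2)]] H.closed_subspace_add[OF W]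
        by (intro Tinj) simp_all
      then show "R g (\<lambda>i. f i + h i) = (\<lambda>i. R g f i + R g h i)"
        unfolding R_def using fh I inv[OF g] lin(1)[OF g] inW Tadd(1) by simp
    next
      fix c f assume f: "f \<in> L2 A"
      have "I (\<lambda>i. c * f i) = c \<odot>\<^bsub>H\<^esub> I f"
        using f I Tadd(2)[OF I(1)[OF f] I(1)[OF f]] H.closed_subspace_smult[OF W]
        by (intro Tinj) simp_all
      then show "R g (\<lambda>i. c * f i) = (\<lambda>i. c * R g f i)"
        unfolding R_def using lin(2)[OF g inW inW, OF I(1) I(1), OF f f] Tadd(2)[OF inv[OF g] inv[OF g], OF I(1) I(1), OF f f]
        by simp
    next
      fix f assume f: "f \<in> L2 A"
      have "nrm A (R g f) = vnorm H (\<pi> (delta g) (I f))" unfolding R_def using f I inv[OF g] Tn by simp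
      also have "\<dots> = vnorm H (I f)" using f I inW by (intro delta_isometry[OF g rep]) auto
      also have "\<dots> = nrm A f" using Tn[OF I(1)[OF f]] I(2)[OF f] by simp
      finally show "nrm A (R g f) = nrm A f" .
    qed (rule RL[OF g])
    show "R g (R (inv g) f) = f" if "f \<in> L2 A" for f
      using Rmult[OF g _ that, of "inv g"] Rone[OF that] g by simp
  qed (use g RL in simp)
  have act: "unitary_action G A R" using Run Rmult Rone by (simp add: unitary_action_def)
  show thesis
  proof (rule that[OF cA neA act, of "T \<xi>"])
    show "T \<xi> \<in> L2 A" by (rule TL[OF xiW])
    show "nrm A (T \<xi>) = vnorm H \<xi>" by (rule Tn[OF xiW])
    then show "T \<xi> \<noteq> (\<lambda>i. 0)" using xi H.vnorm_eq_0[of \<xi>] by auto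
    fix f assume f: "f \<in> carrier CG"
    have fH: "\<pi> f \<xi> \<in> carrier H" using rep f xi by (auto simp: star_representation_def bounded_operator_def)
    have "\<pi> f \<xi> \<in> W"
    proof -
      have "ip H (\<pi> f \<xi>) x = 0" if "x \<in> carrier H" "\<forall>d\<in>D. ip H d x = 0" for x
      proof -
        have "pair f (\<lambda>g. ip H (\<pi> (delta g) \<xi>) x) = pair f (\<lambda>g. 0)"
          using that by (intro pair_cong[OF f]) (auto simp: D_def)
        then show ?thesis using ip_rep_pair[OF rep xi(1) that(1) f] by (simp add: pair_def)
      qed
      then show ?thesis using fH by (simp add: W_def)
    qed
    moreover have "algebra_action R f (T \<xi>) = T (\<pi> f \<xi>)"
    proof
      fix x
      have "algebra_action R f (T \<xi>) x = pair f (\<lambda>g. T (\<pi> (delta g) \<xi>) x)"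
        unfolding algebra_action_pair R_def using IT[OF xiW] by simp
      also have "\<dots> = T (\<pi> f \<xi>) x"
        using ip_rep_pair[OF rep xi(1) _ f, of x] AW inW by (auto simp: T_def pair_def)
      finally show "algebra_action R f (T \<xi>) x = T (\<pi> f \<xi>) x" .
    qed
    ultimately show "nrm A (algebra_action R f (T \<xi>)) = vnorm H (\<pi> f \<xi>)" using Tn by simp
  qed
qed

text \<open>Restrict a representation to the cyclic subspace of a vector where the norm is almost attained. If
  the required bound is negative, the trivial action will do.\<close>

lemma universal_norm_almost_attained:
  assumes co: "countable (carrier G)" and d: "d \<in> carrier CG" and e: "e > 0"
  shows "\<exists>(A :: (nat \<Rightarrow> 'a \<Rightarrow> complex) set) R \<eta>. countable A \<and> A \<noteq> {} \<and> unitary_action G A R \<and>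
    \<eta> \<in> L2 A \<and> \<eta> \<noteq> (\<lambda>i. 0) \<and> (universal_norm CG d - e) * nrm A \<eta> \<le> nrm A (algebra_action R d \<eta>)"
proof (cases "universal_norm CG d - e < 0")
  case True
  let ?A = "{undefined} :: (nat \<Rightarrow> 'a \<Rightarrow> complex) set"
  have "unitary_action G ?A (\<lambda>g f. f)" by (simp add: unitary_action_def unitary_id)
  moreover have "unit_vec undefined \<in> L2 ?A" by (rule unit_vec_L2) simp
  moreover have "unit_vec undefined \<noteq> (\<lambda>i :: nat \<Rightarrow> 'a \<Rightarrow> complex. 0)"
    by (auto simp: unit_vec_def fun_eq_iff)
  moreover have "(universal_norm CG d - e) * nrm ?A (unit_vec undefined) \<le>
      nrm ?A (algebra_action (\<lambda>g f. f) d (unit_vec undefined))"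
    using True by (intro order_trans[OF mult_nonpos_nonneg nrm_ge_0]) auto
  ultimately show ?thesis
    by (intro exI[of _ ?A] exI[of _ "\<lambda>g f. f"] exI[of _ "unit_vec undefined"]) auto
next
  case False
  interpret BA: star_algebra_bounded CG by (rule star_algebra_bounded_CG)
  let ?S = "{op_norm H (\<pi> d) | (H :: (nat \<Rightarrow> 'a \<Rightarrow> complex) hilbert) \<pi>. star_representation CG H \<pi>}"
  have "\<exists>r\<in>?S. universal_norm CG d - e < r"
    unfolding universal_norm_def
  proof (rule less_cSupD)
    show "?S \<noteq> {}" using BA.trivial_representation by blast
  qed (use e in simp)
  then obtain H :: "(nat \<Rightarrow> 'a \<Rightarrow> complex) hilbert" and \<pi> where
    rep: "star_representation CG H \<pi>" and lt: "universal_norm CG d - e < op_norm H (\<pi> d)" by blast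
  interpret H: hilbert_space H using rep by (simp add: star_representation_def)
  have "\<exists>x\<in>carrier H. universal_norm CG d - e < vnorm H (\<pi> d x) / vnorm H x"
  proof (rule ccontr)
    assume "\<not> ?thesis"
    then have "op_norm H (\<pi> d) \<le> universal_norm CG d - e"
      unfolding op_norm_def by (intro cSUP_least) (auto simp: not_less)
    then show False using lt by simp
  qed
  then obtain x where x: "x \<in> carrier H" "universal_norm CG d - e < vnorm H (\<pi> d x) / vnorm H x" by blast
  then have vx: "vnorm H x > 0" using False H.vnorm_ge_0[OF x(1)] by (cases "vnorm H x = 0") auto
  then have xz: "x \<noteq> \<zero>\<^bsub>H\<^esub>" by auto
  obtain A :: "(nat \<Rightarrow> 'a \<Rightarrow> complex) set" and R \<eta> where
    A: "countable A" "A \<noteq> {}" "unitary_action G A R" "\<eta> \<in> L2 A" "\<eta> \<noteq> (\<lambda>i. 0)" "nrm A \<eta> = vnorm H x"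
    "\<And>f. f \<in> carrier CG \<Longrightarrow> nrm A (algebra_action R f \<eta>) = vnorm H (\<pi> f x)"
    using cyclic_action[OF co rep x(1) xz] by blast
  have "(universal_norm CG d - e) * nrm A \<eta> \<le> nrm A (algebra_action R d \<eta>)"
    using x(2) vx A(6) A(7)[OF d] by (simp add: pos_less_divide_eq less_imp_le)
  then show ?thesis using A by blast
qed

text \<open>Finitely supported functions with values in \<open>\<rat> + \<i>\<rat>\<close>, indexed by lists, form a countable
  dense subset of the group algebra.\<close>

fun rational_comb :: "('a \<times> rat \<times> rat) list \<Rightarrow> 'a \<Rightarrow> complex" where
  "rational_comb [] = \<zero>\<^bsub>CG\<^esub>"
| "rational_comb ((g, a, b) # l) =
    rational_comb l \<oplus>\<^bsub>CG\<^esub> (Complex (of_rat a) (of_rat b) \<odot>\<^bsub>CG\<^esub> delta g)"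

definition rational_lists :: "('a \<times> rat \<times> rat) list set" where
  "rational_lists = lists (carrier G \<times> UNIV)"

lemma rational_comb_closed: "l \<in> rational_lists \<Longrightarrow> rational_comb l \<in> carrier CG"
  unfolding rational_lists_def
  by (induction l rule: rational_comb.induct) (auto intro: CG_closed delta_closed zero_closed_CG)

lemma countable_rational_lists: "countable (carrier G) \<Longrightarrow> countable rational_lists"
  unfolding rational_lists_def by (intro countable_lists countable_SIGMA) auto

lemma universal_norm_delta: "g \<in> carrier G \<Longrightarrow> universal_norm CG (delta g) \<le> 1"
proof -
  interpret BA: star_algebra_bounded CG by (rule star_algebra_bounded_CG)
  assume "g \<in> carrier G"
  then show ?thesis by (intro BA.u_least) (simp_all add: delta_isometry)
qed

lemma rational_approximation:
  fixes c :: complex assumes e: "e > 0"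
  obtains a b :: rat where "cmod (c - Complex (of_rat a) (of_rat b)) < e"
proof -
  obtain a where a: "Re c - e / 2 < of_rat a" "of_rat a < Re c" using of_rat_dense[of "Re c - e / 2" "Re c"] e by auto
  obtain b where b: "Im c - e / 2 < of_rat b" "of_rat b < Im c" using of_rat_dense[of "Im c - e / 2" "Im c"] e by auto
  have "cmod (c - Complex (of_rat a) (of_rat b)) \<le> \<bar>Re c - of_rat a\<bar> + \<bar>Im c - of_rat b\<bar>"
    using cmod_le[of "c - Complex (of_rat a) (of_rat b)"] by simp
  also have "\<dots> < e" using a b by auto
  finally show ?thesis by (rule that)
qed

lemma rational_comb_dense:
  assumes "f \<in> carrier CG" "e > 0"
  shows "\<exists>l\<in>rational_lists. universal_norm CG (f \<ominus>\<^bsub>CG\<^esub> rational_comb l) < e"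
  using assms
proof (induction arbitrary: e rule: CG_induct)
  interpret SS: star_seminorm CG "universal_norm CG"
    by (rule star_algebra_bounded.star_seminorm_u[OF star_algebra_bounded_CG])
  case zero
  then show ?case
    by (intro bexI[of _ "[]"]) (auto simp: rational_lists_def SS.minus_eq)
next
  interpret SS: star_seminorm CG "universal_norm CG"
    by (rule star_algebra_bounded.star_seminorm_u[OF star_algebra_bounded_CG])
  case (add f c g)
  obtain l where l: "l \<in> rational_lists" "universal_norm CG (f \<ominus>\<^bsub>CG\<^esub> rational_comb l) < e / 2"
    using add.IH[of "e / 2"] add.prems by auto
  obtain a b where ab: "cmod (c - Complex (of_rat a) (of_rat b)) < e / 2"
    using rational_approximation[of "e / 2" c] add.prems by auto
  let ?c = "Complex (of_rat a) (of_rat b)"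
  note cl = delta_closed[OF add.hyps(2)] rational_comb_closed[OF l(1)]
  have "universal_norm CG ((c \<odot>\<^bsub>CG\<^esub> delta g) \<ominus>\<^bsub>CG\<^esub> (?c \<odot>\<^bsub>CG\<^esub> delta g)) = cmod (c - ?c) * universal_norm CG (delta g)"
  proof -
    have "(c \<odot>\<^bsub>CG\<^esub> delta g) \<ominus>\<^bsub>CG\<^esub> (?c \<odot>\<^bsub>CG\<^esub> delta g) = (c - ?c) \<odot>\<^bsub>CG\<^esub> delta g"
    proof -
      have "\<ominus>\<^bsub>CG\<^esub> (?c \<odot>\<^bsub>CG\<^esub> delta g) = (-1) \<odot>\<^bsub>CG\<^esub> (?c \<odot>\<^bsub>CG\<^esub> delta g)"
        by (rule SS.a_inv_eq[OF smult_closed_CG[OF cl(1)]])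
      then show ?thesis unfolding SS.minus_eq by (simp only:) (simp add: CG_simps algebra_simps)
    qed
    then show ?thesis using SS.p_smult[OF cl(1)] by simp
  qed
  also have "\<dots> \<le> cmod (c - ?c) * 1"
    by (intro mult_left_mono universal_norm_delta add.hyps) simp
  finally have "universal_norm CG ((c \<odot>\<^bsub>CG\<^esub> delta g) \<ominus>\<^bsub>CG\<^esub> (?c \<odot>\<^bsub>CG\<^esub> delta g)) < e / 2" using ab by simp
  then have "universal_norm CG ((f \<oplus>\<^bsub>CG\<^esub> (c \<odot>\<^bsub>CG\<^esub> delta g)) \<ominus>\<^bsub>CG\<^esub> (rational_comb l \<oplus>\<^bsub>CG\<^esub> (?c \<odot>\<^bsub>CG\<^esub> delta g))) < e"
    using SS.p_minus_add[OF add.hyps(1) smult_closed_CG[OF cl(1), of c] cl(2) smult_closed_CG[OF cl(1), of ?c]] l(2)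
    by simp
  then show ?case
    using l(1) add.hyps by (intro bexI[of _ "(g, a, b) # l"]) (auto simp: rational_lists_def)
qed

text \<open>The error \<open>2 * e2\<close> arises because replacing \<open>f\<close> by \<open>d\<close> changes both the universal norm and the norm of
  the image.\<close>

lemma algebra_action_lower_bound:
  fixes S :: "'s set"
  assumes S: "countable S" "S \<noteq> {}" and U: "unitary_action G S U" and v: "v \<in> L2 S"
    and f: "f \<in> carrier CG" and d: "d \<in> carrier CG" and close: "universal_norm CG (f \<ominus>\<^bsub>CG\<^esub> d) \<le> e2"
    and lower: "(universal_norm CG d - e1) * nrm S v \<le> nrm S (algebra_action U d v)"
  shows "(universal_norm CG f - (e1 + 2 * e2)) * nrm S v \<le> nrm S (algebra_action U f v)"
proof -
  interpret SS: star_seminorm CG "universal_norm CG"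
    by (rule star_algebra_bounded.star_seminorm_u[OF star_algebra_bounded_CG])
  let ?h = "f \<ominus>\<^bsub>CG\<^esub> d"
  have h: "?h \<in> carrier CG" using f d by simp
  let ?Uf = "algebra_action U f v" and ?Ud = "algebra_action U d v" and ?Uh = "algebra_action U ?h v"
  note cl = algebra_action_closed[OF U f v] algebra_action_closed[OF U h v]
  have "f = ?h \<oplus>\<^bsub>CG\<^esub> d" using f d by (simp add: SS.minus_eq SS.a_assoc SS.l_neg)
  then have "?Uf = algebra_action U (?h \<oplus>\<^bsub>CG\<^esub> d) v" by (rule arg_cong)
  also have "\<dots> = (\<lambda>i. ?Uh i + ?Ud i)"
    unfolding algebra_action_pair using h d by (simp only: pair_CG(1))
  finally have "?Ud = (\<lambda>i. ?Uf i - ?Uh i)" by simp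
  then have "nrm S ?Ud \<le> nrm S ?Uf + nrm S ?Uh" using nrm_minus_le[OF cl] by simp
  moreover have "nrm S ?Uh \<le> e2 * nrm S v"
    by (rule order_trans[OF algebra_action_le_universal_norm[OF S U h v] mult_right_mono[OF close]]) simp
  moreover have "(universal_norm CG f - (e1 + 2 * e2)) * nrm S v \<le> (universal_norm CG d - e1 - e2) * nrm S v"
    using SS.p_diff[OF f d] close by (intro mult_right_mono) auto
  ultimately show ?thesis using lower by (simp add: left_diff_distrib)
qed

end

section \<open>Approximate containment of pairs of actions\<close>

text \<open>A uniform form of weak containment: one isometry of the whole space almost intertwines the actions of
  finitely many elements of each group, and no element of the free product has to be mentioned.\<close>

definition approx_contains ::
  "('a, 'm) monoid_scheme \<Rightarrow> ('b, 'n) monoid_scheme \<Rightarrow>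
   's set \<Rightarrow> ('a \<Rightarrow> ('s \<Rightarrow> complex) \<Rightarrow> 's \<Rightarrow> complex) \<Rightarrow> ('b \<Rightarrow> ('s \<Rightarrow> complex) \<Rightarrow> 's \<Rightarrow> complex) \<Rightarrow>
   'j set \<Rightarrow> ('a \<Rightarrow> ('j \<Rightarrow> complex) \<Rightarrow> 'j \<Rightarrow> complex) \<Rightarrow> ('b \<Rightarrow> ('j \<Rightarrow> complex) \<Rightarrow> 'j \<Rightarrow> complex) \<Rightarrow> bool" where
  "approx_contains G1 G2 S U1 U2 A R1 R2 \<longleftrightarrow>
     (\<forall>F1 F2 e. finite F1 \<and> F1 \<subseteq> carrier G1 \<and> finite F2 \<and> F2 \<subseteq> carrier G2 \<and> e > 0 \<longrightarrow>
       (\<exists>T. isometry A S T \<and>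
         (\<forall>g\<in>F1. \<forall>\<xi>\<in>L2 A. nrm S (\<lambda>i. U1 g (T \<xi>) i - T (R1 g \<xi>) i) \<le> e * nrm A \<xi>) \<and>
         (\<forall>g\<in>F2. \<forall>\<xi>\<in>L2 A. nrm S (\<lambda>i. U2 g (T \<xi>) i - T (R2 g \<xi>) i) \<le> e * nrm A \<xi>)))"

lemma approx_contains_swap:
  "approx_contains G1 G2 S U1 U2 A R1 R2 \<Longrightarrow> approx_contains G2 G1 S U2 U1 A R2 R1"
  unfolding approx_contains_def by meson

text \<open>The errors of the letters of a word add up, since all letters act isometrically.\<close>

lemma approx_contains_word:
  assumes U1: "unitary_action G1 S U1" and U2: "unitary_action G2 S U2"
    and R1: "unitary_action G1 A R1" and R2: "unitary_action G2 A R2"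
    and G: "group G1" "group G2"
    and T: "isometry A S T" and e: "(e :: real) \<ge> 0"
    and F1: "\<And>g \<xi>. g \<in> F1 \<Longrightarrow> \<xi> \<in> L2 A \<Longrightarrow> nrm S (\<lambda>i. U1 g (T \<xi>) i - T (R1 g \<xi>) i) \<le> e * nrm A \<xi>"
    and F2: "\<And>g \<xi>. g \<in> F2 \<Longrightarrow> \<xi> \<in> L2 A \<Longrightarrow> nrm S (\<lambda>i. U2 g (T \<xi>) i - T (R2 g \<xi>) i) \<le> e * nrm A \<xi>"
    and w: "reduced_word G1 G2 w" "set w \<subseteq> Inl ` F1 \<union> Inr ` F2" and xi: "\<xi> \<in> L2 A"
  shows "nrm S (\<lambda>i. word_action U1 U2 w (T \<xi>) i - T (word_action R1 R2 w \<xi>) i) \<le> real (length w) * e * nrm A \<xi>"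
  using w
proof (induction w)
  case Nil
  then show ?case by simp
next
  case (Cons l w)
  note UW = unitary_action_free_product[OF G U1 U2] and RW = unitary_action_free_product[OF G R1 R2]
  have w: "reduced_word G1 G2 w" "letter G1 G2 l" using Cons.prems by (auto simp: reduced_word_Cons)
  then have wc: "w \<in> carrier (free_product G1 G2)" by (simp add: free_product_simps)
  let ?x = "word_action U1 U2 w (T \<xi>)" and ?y = "word_action R1 R2 w \<xi>"
  have x: "?x \<in> L2 S" and y: "?y \<in> L2 A" "nrm A ?y = nrm A \<xi>"
    using unitary_actionD(4)[OF UW wc isometryD(1)[OF T xi]] unitary_actionD(4,5)[OF RW wc xi] by auto
  have IH: "nrm S (\<lambda>i. ?x i - T ?y i) \<le> real (length w) * e * nrm A \<xi>"
    using Cons w by auto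
  have step: "nrm S (\<lambda>i. V ?x i - T (V' ?y) i) \<le> real (length (l # w)) * e * nrm A \<xi>"
    if V: "unitary S V" and V': "unitary A V'"
      and le: "nrm S (\<lambda>i. V (T ?y) i - T (V' ?y) i) \<le> e * nrm A ?y" for V V'
  proof -
    note Ty = isometryD(1)[OF T y(1)]
    have "nrm S (\<lambda>i. V ?x i - T (V' ?y) i) \<le> nrm S (\<lambda>i. V ?x i - V (T ?y) i) + nrm S (\<lambda>i. V (T ?y) i - T (V' ?y) i)"
      using unitaryD(1)[OF V] x Ty isometryD(1)[OF T unitaryD(1)[OF V' y(1)]] by (intro nrm_diff_triangle)
    also have "nrm S (\<lambda>i. V ?x i - V (T ?y) i) = nrm S (\<lambda>i. ?x i - T ?y i)"
      using isometry_minus[OF unitary_isometry[OF V] x Ty] unitaryD(4)[OF V L2_minus[OF x Ty]] by simp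
    finally show ?thesis using IH le y(2) by (simp add: algebra_simps)
  qed
  show ?case
  proof (cases l)
    case (Inl a)
    then have a: "a \<in> carrier G1" "a \<in> F1" using w Cons.prems by auto
    show ?thesis using step[OF unitary_actionD(1)[OF U1 a(1)] unitary_actionD(1)[OF R1 a(1)] F1[OF a(2) y(1)]]
      by (simp add: Inl)
  next
    case (Inr b)
    then have b: "b \<in> carrier G2" "b \<in> F2" using w Cons.prems by auto
    show ?thesis using step[OF unitary_actionD(1)[OF U2 b(1)] unitary_actionD(1)[OF R2 b(1)] F2[OF b(2) y(1)]]
      by (simp add: Inr)
  qed
qed

lemma approx_contains_algebra:
  assumes G: "group G1" "group G2"
    and U1: "unitary_action G1 S U1" and U2: "unitary_action G2 S U2"
    and R1: "unitary_action G1 A R1" and R2: "unitary_action G2 A R2"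
    and ac: "approx_contains G1 G2 S U1 U2 A R1 R2"
    and f: "f \<in> carrier (group_algebra (free_product G1 G2))" and e: "e > 0"
  obtains T where "isometry A S T"
    "\<And>\<xi>. \<xi> \<in> L2 A \<Longrightarrow>
      nrm S (\<lambda>i. complex_group_algebra.algebra_action (word_action U1 U2) f (T \<xi>) i -
        T (complex_group_algebra.algebra_action (word_action R1 R2) f \<xi>) i) \<le> e * nrm A \<xi>"
proof -
  interpret CGA: complex_group_algebra "free_product G1 G2"
    by (intro complex_group_algebra.intro group_free_product G)
  note UW = unitary_action_free_product[OF G U1 U2] and RW = unitary_action_free_product[OF G R1 R2]
  let ?F = "{w. f w \<noteq> 0}"
  have F: "finite ?F" "\<And>w. w \<in> ?F \<Longrightarrow> w \<in> carrier (free_product G1 G2)" using CGA.supp[OF f] by auto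
  let ?L = "\<Union>w\<in>?F. set w"
  define F1 where "F1 = {x. Inl x \<in> ?L}"
  define F2 where "F2 = {y. Inr y \<in> ?L}"
  have "finite ?L" using F by simp
  then have fin: "finite F1" "finite F2"
    using finite_vimageI[of ?L Inl] finite_vimageI[of ?L Inr] by (auto simp: F1_def F2_def vimage_def)
  have let_: "letter G1 G2 l" if "l \<in> ?L" for l
    using that F(2) by (auto simp: free_product_simps reduced_word_def)
  have sub: "F1 \<subseteq> carrier G1" "F2 \<subseteq> carrier G2"
    using let_ by (fastforce simp: F1_def F2_def)+
  \<comment> \<open>By \<open>approx_contains_word\<close> the error at \<open>f\<close> is at most \<open>C\<close> times the error at single letters.\<close>
  define C where "C = (\<Sum>w\<in>?F. cmod (f w) * length w)"
  have C: "C \<ge> 0" by (auto simp: C_def intro!: sum_nonneg)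
  define d where "d = e / (C + 1)"
  have d: "d > 0" using e C by (simp add: d_def)
  obtain T where T: "isometry A S T"
    "\<And>g \<xi>. g \<in> F1 \<Longrightarrow> \<xi> \<in> L2 A \<Longrightarrow> nrm S (\<lambda>i. U1 g (T \<xi>) i - T (R1 g \<xi>) i) \<le> d * nrm A \<xi>"
    "\<And>g \<xi>. g \<in> F2 \<Longrightarrow> \<xi> \<in> L2 A \<Longrightarrow> nrm S (\<lambda>i. U2 g (T \<xi>) i - T (R2 g \<xi>) i) \<le> d * nrm A \<xi>"
  proof -
    have "\<exists>T. isometry A S T \<and>
        (\<forall>g\<in>F1. \<forall>\<xi>\<in>L2 A. nrm S (\<lambda>i. U1 g (T \<xi>) i - T (R1 g \<xi>) i) \<le> d * nrm A \<xi>) \<and>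
        (\<forall>g\<in>F2. \<forall>\<xi>\<in>L2 A. nrm S (\<lambda>i. U2 g (T \<xi>) i - T (R2 g \<xi>) i) \<le> d * nrm A \<xi>)"
      using ac[unfolded approx_contains_def, rule_format, of F1 F2 d] fin sub d by simp
    then show thesis using that by blast
  qed
  show thesis
  proof (rule that[OF T(1)])
    fix \<xi> assume xi: "\<xi> \<in> L2 A"
    let ?U = "word_action U1 U2" and ?R = "word_action R1 R2"
    have Uc: "?U w (T \<xi>) \<in> L2 S" and Rc: "?R w \<xi> \<in> L2 A" if "w \<in> ?F" for w
      using unitary_actionD(4)[OF UW F(2)[OF that] isometryD(1)[OF T(1) xi]]
        unitary_actionD(4)[OF RW F(2)[OF that] xi] by auto
    have "T (CGA.algebra_action ?R f \<xi>) = (\<lambda>i. \<Sum>w\<in>?F. f w * T (?R w \<xi>) i)"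
      unfolding CGA.algebra_action_def by (rule isometry_sum[OF T(1) Rc])
    then have eq: "(\<lambda>i. CGA.algebra_action ?U f (T \<xi>) i - T (CGA.algebra_action ?R f \<xi>) i) =
        (\<lambda>i. \<Sum>w\<in>?F. f w * (?U w (T \<xi>) i - T (?R w \<xi>) i))"
      by (simp add: CGA.algebra_action_def sum_subtractf right_diff_distrib)
    have "nrm S (\<lambda>i. \<Sum>w\<in>?F. f w * (?U w (T \<xi>) i - T (?R w \<xi>) i)) \<le> (\<Sum>w\<in>?F. nrm S (\<lambda>i. f w * (?U w (T \<xi>) i - T (?R w \<xi>) i)))"
      using Uc Rc isometryD(1)[OF T(1)] by (intro nrm_sum_le L2_scale L2_minus) auto
    also have "\<dots> \<le> (\<Sum>w\<in>?F. cmod (f w) * (length w * d * nrm A \<xi>))"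
    proof (rule sum_mono)
      fix w assume w: "w \<in> ?F"
      have "set w \<subseteq> Inl ` F1 \<union> Inr ` F2"
      proof
        fix l assume "l \<in> set w"
        then have "l \<in> ?L" using w by blast
        then show "l \<in> Inl ` F1 \<union> Inr ` F2" by (cases l) (simp_all add: F1_def F2_def)
      qed
      then have "nrm S (\<lambda>i. ?U w (T \<xi>) i - T (?R w \<xi>) i) \<le> length w * d * nrm A \<xi>"
        using F(2)[OF w] d xi by (intro approx_contains_word[OF U1 U2 R1 R2 G T(1) _ T(2,3)])
          (auto simp: free_product_simps)
      then show "nrm S (\<lambda>i. f w * (?U w (T \<xi>) i - T (?R w \<xi>) i)) \<le> cmod (f w) * (length w * d * nrm A \<xi>)"
        unfolding nrm_scale by (intro mult_left_mono) auto
    qed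
    also have "\<dots> = C * d * nrm A \<xi>" by (simp add: C_def sum_distrib_right mult.assoc)
    also have "\<dots> \<le> e * nrm A \<xi>"
    proof (rule mult_right_mono)
      have "C * d \<le> (C + 1) * d" using d by simp
      also have "\<dots> = e" using C by (simp add: d_def)
      finally show "C * d \<le> e" .
    qed simp
    finally show "nrm S (\<lambda>i. CGA.algebra_action ?U f (T \<xi>) i - T (CGA.algebra_action ?R f \<xi>) i) \<le> e * nrm A \<xi>"
      unfolding eq .
  qed
qed

section \<open>Pairs of actions twisted by block diagonal unitaries\<close>

definition reindex :: "'i set \<Rightarrow> ('i \<Rightarrow> 'i) \<Rightarrow> ('i \<Rightarrow> complex) \<Rightarrow> 'i \<Rightarrow> complex" where
  "reindex S g f = (\<lambda>i. if i \<in> S then f (g i) else 0)"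

lemma unitary_action_reindex:
  assumes G: "group G" and cl: "\<And>g i. g \<in> carrier G \<Longrightarrow> i \<in> S \<Longrightarrow> \<sigma> g i \<in> S"
    and one: "\<And>i. i \<in> S \<Longrightarrow> \<sigma> \<one>\<^bsub>G\<^esub> i = i"
    and mult: "\<And>g h i. g \<in> carrier G \<Longrightarrow> h \<in> carrier G \<Longrightarrow> i \<in> S \<Longrightarrow> \<sigma> (g \<otimes>\<^bsub>G\<^esub> h) i = \<sigma> h (\<sigma> g i)"
  shows "unitary_action G S (\<lambda>g. reindex S (\<sigma> g))"
proof -
  interpret group G by (rule G)
  have inv: "\<sigma> (inv\<^bsub>G\<^esub> g) (\<sigma> g i) = i" "\<sigma> g (\<sigma> (inv\<^bsub>G\<^esub> g) i) = i" if "g \<in> carrier G" "i \<in> S" for g i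
    using that one[of i] mult[of g "inv\<^bsub>G\<^esub> g" i] mult[of "inv\<^bsub>G\<^esub> g" g i] by simp_all
  have "unitary S (reindex S (\<sigma> g))" if g: "g \<in> carrier G" for g
  proof -
    have "bij_betw (\<sigma> g) S S"
      by (rule bij_betwI[where g = "\<sigma> (inv\<^bsub>G\<^esub> g)"]) (use g cl inv in auto)
    then show ?thesis unfolding reindex_def[abs_def] by (rule unitary_reindex)
  qed
  then show ?thesis
    unfolding unitary_action_def using one mult cl
    by (auto simp: reindex_def fun_eq_iff dest: L2_out)
qed

lemma unitary_action_conj:
  assumes U: "unitary_action G S U" and W: "unitary S W"
  shows "unitary_action G S (\<lambda>g f. W (U g (uinv S W f)))"
proof -
  have "unitary S (\<lambda>f. W (U g (uinv S W f)))" if "g \<in> carrier G" for g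
    using unitary_comp[OF W unitary_comp[OF unitary_actionD(1)[OF U that] unitary_uinv[OF W]]] .
  then show ?thesis
    using W unfolding unitary_action_def
    by (simp add: unitary_actionD[OF U] unitary_uinv_closed)
qed

text \<open>The projection of the eigenvector to \<open>W\<close> is again in its eigenspace, because \<open>W\<close> and its orthogonal
  complement are both invariant. Hence it is a multiple of the eigenvector.\<close>

lemma eigenvector_dichotomy:
  assumes W: "closed_subspace (ell2 S) W" and Y: "unitary S Y"
    and inv: "\<And>x. x \<in> W \<Longrightarrow> Y x \<in> W" "\<And>x. x \<in> W \<Longrightarrow> uinv S Y x \<in> W"
    and s: "s \<in> S" and ev: "Y (unit_vec s) = (\<lambda>i. \<mu> * unit_vec s i)"
    and simple: "\<And>f. f \<in> L2 S \<Longrightarrow> Y f = (\<lambda>i. \<mu> * f i) \<Longrightarrow> \<exists>c. f = (\<lambda>i. c * unit_vec s i)"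
  shows "unit_vec s \<in> W \<or> (\<forall>x\<in>W. x s = 0)"
proof -
  interpret hilbert_space "ell2 S" by (rule hilbert_space_ell2)
  note [simp del] = ell2_simps(5)
  have inL: "x \<in> W \<Longrightarrow> x \<in> L2 S" for x using closed_subspace_subset[OF W] by auto
  have u: "unit_vec s \<in> L2 S" using s by simp
  obtain w where w: "w \<in> W" "\<And>x. x \<in> W \<Longrightarrow> ip (ell2 S) (unit_vec s \<ominus>\<^bsub>ell2 S\<^esub> w) x = 0"
    using orthogonal_projection[OF W, of "unit_vec s"] u by auto
  define r where "r = (\<lambda>i. unit_vec s i - w i)"
  have wL: "w \<in> L2 S" by (rule inL[OF w(1)])
  have rL: "r \<in> L2 S" using u wL by (simp add: r_def)
  have r0: "ip (ell2 S) r x = 0" if "x \<in> W" for x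
    using w(2)[OF that] u wL by (simp add: r_def)
  have Yr0: "ip (ell2 S) (Y r) x = 0" if "x \<in> W" for x
    using unitary_ip_adjoint[OF Y rL inL[OF that]] r0[OF inv(2)[OF that]] by simp
  have YL: "Y w \<in> L2 S" "Y r \<in> L2 S" using unitaryD(1)[OF Y] wL rL by auto
  let ?d = "\<lambda>i. Y w i - \<mu> * w i"
  have dW: "?d \<in> W"
    using closed_subspace_minus[OF W inv(1)[OF w(1)] closed_subspace_smult[OF W w(1), of \<mu>]] YL wL by simp
  have Yu: "Y (unit_vec s) = (\<lambda>i. Y w i + Y r i)"
    using unitaryD(2)[OF Y wL rL] by (simp add: r_def)
  \<comment> \<open>The same vector is orthogonal to \<open>W\<close>, hence \<open>0\<close>.\<close>
  have d_eq: "?d = (\<lambda>i. \<mu> * r i - Y r i)"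
  proof
    fix i show "?d i = \<mu> * r i - Y r i"
      using fun_cong[OF Yu, of i] fun_cong[OF ev, of i] by (simp add: r_def algebra_simps)
  qed
  have "ip (ell2 S) ?d ?d = ip (ell2 S) ((\<mu> \<odot>\<^bsub>ell2 S\<^esub> r) \<ominus>\<^bsub>ell2 S\<^esub> Y r) ?d"
    using rL YL by (simp add: d_eq)
  also have "\<dots> = \<mu> * ip (ell2 S) r ?d - ip (ell2 S) (Y r) ?d"
    using rL YL inL[OF dW] ip_minus_left[of "\<mu> \<odot>\<^bsub>ell2 S\<^esub> r" "Y r" ?d] ip_smult_left[of r ?d \<mu>] by simp
  also have "\<dots> = 0" using r0[OF dW] Yr0[OF dW] by simp
  finally have "?d = (\<lambda>i. 0)" using ip_eq_0[of ?d] inL[OF dW] by simp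
  then have "Y w = (\<lambda>i. \<mu> * w i)" by (auto simp: fun_eq_iff)
  then obtain c where c: "w = (\<lambda>i. c * unit_vec s i)" using simple[OF wL] by blast
  show ?thesis
  proof (cases "c = 0")
    case True
    then have r: "r = unit_vec s" using c by (simp add: r_def)
    have "x s = 0" if "x \<in> W" for x
      using r0[OF that] ip_cnj[of x "unit_vec s"] ip_unit_vec[OF s, of x] inL[OF that] u r by simp
    then show ?thesis by simp
  next
    case False
    have "(\<lambda>i. inverse c * w i) \<in> W" using closed_subspace_smult[OF W w(1), of "inverse c"] by simp
    moreover have "(\<lambda>i. inverse c * w i) = unit_vec s" using c False by (simp add: fun_eq_iff)
    ultimately show ?thesis by simp
  qed
qed

text \<open>The space is a sum of copies of the functions on \<open>K\<close>, indexed by pairs of group elements. The left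
  regular action of \<open>G1\<close> on the first coordinate is left alone, that of \<open>G2\<close> on the second coordinate is
  conjugated by the block diagonal unitary with blocks \<open>V a b\<close>. The normalization \<open>V_one_left\<close>,
  \<open>V_one_right\<close> keeps the vectors of the block \<open>(1, 1)\<close> from being moved by more than a translation.\<close>

locale twisted_pair = G1: group G1 + G2: group G2
  for G1 :: "('a, 'm) monoid_scheme" and G2 :: "('b, 'n) monoid_scheme" +
  fixes K :: "'k set" and V :: "'a \<Rightarrow> 'b \<Rightarrow> ('k \<Rightarrow> complex) \<Rightarrow> 'k \<Rightarrow> complex"
  assumes V: "\<lbrakk>a \<in> carrier G1; b \<in> carrier G2\<rbrakk> \<Longrightarrow> unitary K (V a b)"
    and V_one_left: "\<lbrakk>b \<in> carrier G2; f \<in> L2 K\<rbrakk> \<Longrightarrow> V \<one>\<^bsub>G1\<^esub> b f = f"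
    and V_one_right: "\<lbrakk>a \<in> carrier G1; f \<in> L2 K\<rbrakk> \<Longrightarrow> V a \<one>\<^bsub>G2\<^esub> f = f"
begin

abbreviation "C1 \<equiv> carrier G1"
abbreviation "C2 \<equiv> carrier G2"
abbreviation "one1 \<equiv> \<one>\<^bsub>G1\<^esub>"
abbreviation "one2 \<equiv> \<one>\<^bsub>G2\<^esub>"
abbreviation "S \<equiv> (C1 \<times> C2) \<times> K"
abbreviation "Vi a b \<equiv> uinv K (V a b)"

definition U1 :: "'a \<Rightarrow> (('a \<times> 'b) \<times> 'k \<Rightarrow> complex) \<Rightarrow> ('a \<times> 'b) \<times> 'k \<Rightarrow> complex" where
  "U1 g = reindex S (\<lambda>((a, b), k). ((inv\<^bsub>G1\<^esub> g \<otimes>\<^bsub>G1\<^esub> a, b), k))"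

definition shift2 :: "'b \<Rightarrow> (('a \<times> 'b) \<times> 'k \<Rightarrow> complex) \<Rightarrow> ('a \<times> 'b) \<times> 'k \<Rightarrow> complex" where
  "shift2 h = reindex S (\<lambda>((a, b), k). ((a, inv\<^bsub>G2\<^esub> h \<otimes>\<^bsub>G2\<^esub> b), k))"

definition VV :: "(('a \<times> 'b) \<times> 'k \<Rightarrow> complex) \<Rightarrow> ('a \<times> 'b) \<times> 'k \<Rightarrow> complex" where
  "VV = blk (C1 \<times> C2) (\<lambda>(a, b). V a b)"

definition U2 :: "'b \<Rightarrow> (('a \<times> 'b) \<times> 'k \<Rightarrow> complex) \<Rightarrow> ('a \<times> 'b) \<times> 'k \<Rightarrow> complex" where
  "U2 h f = VV (shift2 h (uinv S VV f))"

abbreviation slice :: "(('a \<times> 'b) \<times> 'k \<Rightarrow> complex) \<Rightarrow> 'a \<Rightarrow> 'b \<Rightarrow> 'k \<Rightarrow> complex" where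
  "slice f a b \<equiv> (\<lambda>k. f ((a, b), k))"

lemma VV: "unitary S VV"
  unfolding VV_def by (rule unitary_blk) (use V in auto)

lemma U1: "unitary_action G1 S U1"
  unfolding U1_def
  by (rule unitary_action_reindex) (auto simp: G1.inv_mult_group G1.m_assoc)

lemma shift2: "unitary_action G2 S shift2"
  unfolding shift2_def
  by (rule unitary_action_reindex) (auto simp: G2.inv_mult_group G2.m_assoc)

lemma U2: "unitary_action G2 S U2"
  unfolding U2_def by (rule unitary_action_conj[OF shift2 VV])

lemma slice_closed: "f \<in> L2 S \<Longrightarrow> a \<in> C1 \<Longrightarrow> b \<in> C2 \<Longrightarrow> slice f a b \<in> L2 K"
  using L2_slice(1)[of f "C1 \<times> C2" "\<lambda>_. K" "(a, b)"] by simp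

lemma slice_ext:
  assumes "f \<in> L2 S" "g \<in> L2 S" "\<And>a b. a \<in> C1 \<Longrightarrow> b \<in> C2 \<Longrightarrow> slice f a b = slice g a b" shows "f = g"
  by (rule L2_ext[OF assms(1,2)]) (use assms(3) in \<open>auto dest: fun_cong\<close>)

lemma Vi_closed: "a \<in> C1 \<Longrightarrow> b \<in> C2 \<Longrightarrow> f \<in> L2 K \<Longrightarrow> Vi a b f \<in> L2 K"
  by (rule unitary_uinv_closed[OF V])

lemma V_closed: "a \<in> C1 \<Longrightarrow> b \<in> C2 \<Longrightarrow> f \<in> L2 K \<Longrightarrow> V a b f \<in> L2 K"
  by (rule unitaryD(1)[OF V])

lemma Vi_one: "b \<in> C2 \<Longrightarrow> f \<in> L2 K \<Longrightarrow> Vi one1 b f = f" "a \<in> C1 \<Longrightarrow> f \<in> L2 K \<Longrightarrow> Vi a one2 f = f"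
  by (rule uinv_eqI[OF V]; simp add: V_one_left V_one_right)+

lemma slice_U1:
  assumes "f \<in> L2 S" "g \<in> C1" "a \<in> C1" "b \<in> C2"
  shows "slice (U1 g f) a b = slice f (inv\<^bsub>G1\<^esub> g \<otimes>\<^bsub>G1\<^esub> a) b"
  using assms L2_out[OF assms(1)] by (auto simp: U1_def reindex_def)

lemma slice_VV: "a \<in> C1 \<Longrightarrow> b \<in> C2 \<Longrightarrow> slice (VV f) a b = V a b (slice f a b)"
  by (simp add: VV_def blk_def)

lemma slice_U2:
  assumes f: "f \<in> L2 S" and h: "h \<in> C2" "a \<in> C1" "b \<in> C2"
  shows "slice (U2 h f) a b = V a b (Vi a (inv\<^bsub>G2\<^esub> h \<otimes>\<^bsub>G2\<^esub> b) (slice f a (inv\<^bsub>G2\<^esub> h \<otimes>\<^bsub>G2\<^esub> b)))"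
proof -
  let ?g = "uinv S VV f" and ?b = "inv\<^bsub>G2\<^esub> h \<otimes>\<^bsub>G2\<^esub> b"
  have g: "?g \<in> L2 S" by (rule unitary_uinv_closed[OF VV f])
  have sg: "slice ?g a b = Vi a b (slice f a b)" if "a \<in> C1" "b \<in> C2" for a b
  proof -
    have "?g = blk (C1 \<times> C2) (\<lambda>q. uinv K (case q of (a, b) \<Rightarrow> V a b)) f"
      unfolding VV_def using V f by (subst uinv_blk) auto
    then show ?thesis using that by (simp add: blk_def)
  qed
  have "slice (U2 h f) a b = slice (VV (shift2 h ?g)) a b" by (simp only: U2_def)
  also have "\<dots> = V a b (slice (shift2 h ?g) a b)"
    by (rule slice_VV[OF h(2,3)])
  also have "slice (shift2 h ?g) a b = slice ?g a ?b"
    using h L2_out[OF g] by (auto simp: shift2_def reindex_def)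
  also have "\<dots> = Vi a ?b (slice f a ?b)" using h by (intro sg) auto
  finally show ?thesis .
qed

text \<open>The commutator of \<open>a0\<inverse>\<close> and \<open>b0\<inverse>\<close>. The translations cancel, so that it is block diagonal; its
  block at \<open>(a, b)\<close> is \<open>cblock a0 b0 a b\<close>.\<close>

definition commut :: "'a \<Rightarrow> 'b \<Rightarrow> (('a \<times> 'b) \<times> 'k \<Rightarrow> complex) \<Rightarrow> ('a \<times> 'b) \<times> 'k \<Rightarrow> complex" where
  "commut a0 b0 f = U1 (inv\<^bsub>G1\<^esub> a0) (U2 (inv\<^bsub>G2\<^esub> b0) (U1 a0 (U2 b0 f)))"

definition cblock :: "'a \<Rightarrow> 'b \<Rightarrow> 'a \<Rightarrow> 'b \<Rightarrow> ('k \<Rightarrow> complex) \<Rightarrow> 'k \<Rightarrow> complex" where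
  "cblock a0 b0 a b f = V (a0 \<otimes>\<^bsub>G1\<^esub> a) b (Vi (a0 \<otimes>\<^bsub>G1\<^esub> a) (b0 \<otimes>\<^bsub>G2\<^esub> b) (V a (b0 \<otimes>\<^bsub>G2\<^esub> b) (Vi a b f)))"

lemma unitary_commut:
  assumes "a0 \<in> C1" "b0 \<in> C2" shows "unitary S (commut a0 b0)"
proof -
  have "unitary S (U1 (inv\<^bsub>G1\<^esub> a0))" "unitary S (U1 a0)" "unitary S (U2 (inv\<^bsub>G2\<^esub> b0))" "unitary S (U2 b0)"
    using assms unitary_actionD(1)[OF U1] unitary_actionD(1)[OF U2] by auto
  from unitary_comp[OF this(1) unitary_comp[OF this(3) unitary_comp[OF this(2,4)]]]
  show ?thesis unfolding commut_def[abs_def] .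
qed

lemma slice_commut:
  assumes f: "f \<in> L2 S" and a0: "a0 \<in> C1" and b0: "b0 \<in> C2" and ab: "a \<in> C1" "b \<in> C2"
  shows "slice (commut a0 b0 f) a b = cblock a0 b0 a b (slice f a b)"
proof -
  have 1: "U2 b0 f \<in> L2 S" "U1 a0 (U2 b0 f) \<in> L2 S" "U2 (inv\<^bsub>G2\<^esub> b0) (U1 a0 (U2 b0 f)) \<in> L2 S"
    using f a0 b0 unitary_actionD(4)[OF U1] unitary_actionD(4)[OF U2] by auto
  have e: "inv\<^bsub>G1\<^esub> a0 \<otimes>\<^bsub>G1\<^esub> (a0 \<otimes>\<^bsub>G1\<^esub> a) = a" "inv\<^bsub>G2\<^esub> b0 \<otimes>\<^bsub>G2\<^esub> (b0 \<otimes>\<^bsub>G2\<^esub> b) = b"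
    using a0 b0 ab by (simp_all add: G1.m_assoc[symmetric] G2.m_assoc[symmetric])
  show ?thesis
  proof -
    let ?a = "a0 \<otimes>\<^bsub>G1\<^esub> a" and ?b = "b0 \<otimes>\<^bsub>G2\<^esub> b"
    have cl: "?a \<in> C1" "?b \<in> C2" using a0 b0 ab by auto
    have "slice (commut a0 b0 f) a b = slice (U2 (inv\<^bsub>G2\<^esub> b0) (U1 a0 (U2 b0 f))) ?a b"
      unfolding commut_def using slice_U1[OF 1(3) _ ab, of "inv\<^bsub>G1\<^esub> a0"] a0 by simp
    also have "\<dots> = V ?a b (Vi ?a ?b (slice (U1 a0 (U2 b0 f)) ?a ?b))"
      using slice_U2[OF 1(2) _ cl(1) ab(2), of "inv\<^bsub>G2\<^esub> b0"] b0 by simp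
    also have "slice (U1 a0 (U2 b0 f)) ?a ?b = slice (U2 b0 f) a ?b"
      using slice_U1[OF 1(1) a0 cl] unfolding e .
    also have "\<dots> = V a ?b (Vi a b (slice f a b))"
      using slice_U2[OF f b0 ab(1) cl(2)] unfolding e .
    finally show ?thesis unfolding cblock_def .
  qed
qed

lemma cblock_one:
  assumes "a0 \<in> C1" "b0 \<in> C2" "f \<in> L2 K"
  shows "cblock a0 b0 one1 one2 f = Vi a0 b0 f"
  using assms by (simp add: cblock_def V_one_left V_one_right Vi_one Vi_closed)

definition emb :: "('k \<Rightarrow> complex) \<Rightarrow> ('a \<times> 'b) \<times> 'k \<Rightarrow> complex" where
  "emb f = (\<lambda>(q, k). if q = (one1, one2) then f k else 0)"

lemma emb_unit_vec: "emb (unit_vec k) = unit_vec ((one1, one2), k)"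
  by (auto simp: emb_def unit_vec_def fun_eq_iff)

lemma emb_closed: assumes f: "f \<in> L2 K" shows "emb f \<in> L2 S"
proof (rule L2_SigmaI)
  show "(\<lambda>q. (nrm K (\<lambda>k. emb f (q, k)))\<^sup>2) summable_on C1 \<times> C2"
  proof (rule finite_nonzero_values_imp_summable_on)
    have "nrm K (\<lambda>k. emb f (q, k)) = 0" if "q \<noteq> (one1, one2)" for q
      using that by (simp add: emb_def)
    then have "{q \<in> C1 \<times> C2. (nrm K (\<lambda>k. emb f (q, k)))\<^sup>2 \<noteq> 0} \<subseteq> {(one1, one2)}" by auto
    then show "finite {q \<in> C1 \<times> C2. (nrm K (\<lambda>k. emb f (q, k)))\<^sup>2 \<noteq> 0}"
      by (rule finite_subset) simp
  qed
  show "(\<lambda>k. emb f (q, k)) \<in> L2 K" for q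
    using f by (cases "q = (one1, one2)") (simp_all add: emb_def)
qed (auto simp: emb_def)

lemma slice_emb: "slice (emb f) a b = (if a = one1 \<and> b = one2 then f else (\<lambda>k. 0))"
  by (auto simp: emb_def)

lemma zero_maps: "a \<in> C1 \<Longrightarrow> b \<in> C2 \<Longrightarrow> V a b (\<lambda>k. 0) = (\<lambda>k. 0)" "a \<in> C1 \<Longrightarrow> b \<in> C2 \<Longrightarrow> Vi a b (\<lambda>k. 0) = (\<lambda>k. 0)"
  using isometry_zero[OF unitary_isometry[OF V]] isometry_zero[OF unitary_isometry[OF unitary_uinv[OF V]]] by auto

lemma commut_emb:
  assumes a0: "a0 \<in> C1" and b0: "b0 \<in> C2" and f: "f \<in> L2 K"
  shows "commut a0 b0 (emb f) = emb (Vi a0 b0 f)" "uinv S (commut a0 b0) (emb f) = emb (V a0 b0 f)"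
proof -
  have *: "commut a0 b0 (emb f) = emb (Vi a0 b0 f)" if f: "f \<in> L2 K" for f
  proof (rule slice_ext)
    fix a b assume ab: "a \<in> C1" "b \<in> C2"
    have "cblock a0 b0 a b (\<lambda>k. 0) = (\<lambda>k. 0)" using a0 b0 ab by (simp add: cblock_def zero_maps)
    then show "slice (commut a0 b0 (emb f)) a b = slice (emb (Vi a0 b0 f)) a b"
      unfolding slice_commut[OF emb_closed[OF f] a0 b0 ab] slice_emb
      using cblock_one[OF a0 b0 f] by simp
  qed (use unitaryD(1)[OF unitary_commut[OF a0 b0] emb_closed[OF f]] emb_closed[OF Vi_closed[OF a0 b0 f]] in auto)
  then show "commut a0 b0 (emb f) = emb (Vi a0 b0 f)" by (simp add: f)
  show "uinv S (commut a0 b0) (emb f) = emb (V a0 b0 f)"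
    using *[OF V_closed[OF a0 b0 f]] emb_closed[OF V_closed[OF a0 b0 f]] V[OF a0 b0] f
    by (intro uinv_eqI[OF unitary_commut[OF a0 b0]]) simp_all
qed

text \<open>The normalization of \<open>V\<close> makes the blocks that occur here trivial: \<open>G2\<close> moves the unit vector from
  \<open>(1, 1)\<close> to \<open>(1, b)\<close>, where the first coordinate is \<open>1\<close>.\<close>

lemma move_emb:
  assumes a: "a \<in> C1" and b: "b \<in> C2" and k: "k \<in> K"
  shows "U1 a (U2 b (unit_vec ((one1, one2), k))) = unit_vec ((a, b), k)"
proof (rule slice_ext)
  have u: "unit_vec ((one1, one2), k) \<in> L2 S" using k by simp
  show "unit_vec ((a, b), k) \<in> L2 S" using a b k by simp
  have c: "U2 b (unit_vec ((one1, one2), k)) \<in> L2 S" by (rule unitary_actionD(4)[OF U2 b u])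
  then show "U1 a (U2 b (unit_vec ((one1, one2), k))) \<in> L2 S" by (rule unitary_actionD(4)[OF U1 a])
  fix a' b' assume ab: "a' \<in> C1" "b' \<in> C2"
  let ?a = "inv\<^bsub>G1\<^esub> a \<otimes>\<^bsub>G1\<^esub> a'" and ?b = "inv\<^bsub>G2\<^esub> b \<otimes>\<^bsub>G2\<^esub> b'"
  have cl: "?a \<in> C1" "?b \<in> C2" using a b ab by auto
  have e: "?a = one1 \<longleftrightarrow> a' = a" "?b = one2 \<longleftrightarrow> b' = b"
    using a b ab G1.inv_solve_left[of one1 a a'] G2.inv_solve_left[of one2 b b'] by auto
  have su: "slice (unit_vec ((one1, one2), k)) x y = (if x = one1 \<and> y = one2 then unit_vec k else (\<lambda>k. 0))" for x y
    by (auto simp: unit_vec_def)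
  have su': "slice (unit_vec ((a, b), k)) a' b' = (if a' = a \<and> b' = b then unit_vec k else (\<lambda>k. 0))"
    by (auto simp: unit_vec_def)
  have "slice (U1 a (U2 b (unit_vec ((one1, one2), k)))) a' b' =
      V ?a b' (Vi ?a ?b (slice (unit_vec ((one1, one2), k)) ?a ?b))"
    using slice_U1[OF c a ab] slice_U2[OF u b cl(1) ab(2)] by simp
  also have "\<dots> = slice (unit_vec ((a, b), k)) a' b'"
  proof (cases "a' = a \<and> b' = b")
    case True
    then have ab1: "?a = one1" "?b = one2" using e by auto
    have uk: "unit_vec k \<in> L2 K" using k by simp
    show ?thesis unfolding su su' ab1 using True uk ab by (simp add: V_one_left Vi_one)
  next
    case False
    then have "\<not> (?a = one1 \<and> ?b = one2)" using e by auto
    then show ?thesis unfolding su su' using False zero_maps cl ab by (simp only: if_False)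
  qed
  finally show "slice (U1 a (U2 b (unit_vec ((one1, one2), k)))) a' b' = slice (unit_vec ((a, b), k)) a' b'" .
qed

lemma spread:
  assumes M: "\<And>g f. g \<in> C1 \<Longrightarrow> f \<in> M \<Longrightarrow> U1 g f \<in> M" "\<And>h f. h \<in> C2 \<Longrightarrow> f \<in> M \<Longrightarrow> U2 h f \<in> M"
    and base: "\<And>k. k \<in> K \<Longrightarrow> unit_vec ((one1, one2), k) \<in> M" and x: "x \<in> S"
  shows "unit_vec x \<in> M"
proof -
  obtain a b k where [simp]: "x = ((a, b), k)" and abk: "a \<in> C1" "b \<in> C2" "k \<in> K" using x by auto
  show ?thesis using M(1)[OF abk(1) M(2)[OF abk(2) base[OF abk(3)]]] move_emb[OF abk] by simp
qed

end

text \<open>Each vector \<open>(True, i)\<close> of the block \<open>(1, 1)\<close> spans an eigenspace of the product of the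
  commutators with \<open>b0\<close> and \<open>b1\<close> (\<open>ev_eigen\<close>, \<open>ev_simple\<close>). The commutator with \<open>b0\<close> links these vectors
  to each other along \<open>\<sigma>\<close> and to the vectors \<open>(False, i)\<close> (\<open>link\<close>, \<open>link'\<close>).\<close>

locale irreducible_twist = twisted_pair G1 G2 "UNIV \<times> I" V
  for G1 :: "('a, 'm) monoid_scheme" and G2 :: "('b, 'n) monoid_scheme" and I :: "'i set"
    and V :: "'a \<Rightarrow> 'b \<Rightarrow> (bool \<times> 'i \<Rightarrow> complex) \<Rightarrow> bool \<times> 'i \<Rightarrow> complex" +
  fixes a0 :: 'a and b0 b1 :: 'b and \<mu> :: "'i \<Rightarrow> complex" and \<sigma> :: "'i \<Rightarrow> 'i" and \<alpha> \<beta> :: "'i \<Rightarrow> complex"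
  assumes ab: "a0 \<in> carrier G1" "b0 \<in> carrier G2" "b1 \<in> carrier G2" and I_ne: "I \<noteq> {}"
    and \<sigma>: "i \<in> I \<Longrightarrow> \<sigma> i \<in> I"
    and transitive: "\<lbrakk>N \<subseteq> I; N \<noteq> {}; \<And>i. i \<in> I \<Longrightarrow> i \<in> N \<longleftrightarrow> \<sigma> i \<in> N\<rbrakk> \<Longrightarrow> N = I"
    and link: "i \<in> I \<Longrightarrow> uinv (UNIV \<times> I) (V a0 b0) (unit_vec (True, \<sigma> i)) =
        (\<lambda>k. \<alpha> i * unit_vec (True, i) k + \<beta> i * unit_vec (False, i) k)"
    and link': "i \<in> I \<Longrightarrow> V a0 b0 (unit_vec (True, i)) (True, \<sigma> i) \<noteq> 0"
    and nonzero: "i \<in> I \<Longrightarrow> \<alpha> i \<noteq> 0" "i \<in> I \<Longrightarrow> \<beta> i \<noteq> 0"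
    and ev_eigen: "i \<in> I \<Longrightarrow> commut a0 b0 (commut a0 b1 (unit_vec ((\<one>\<^bsub>G1\<^esub>, \<one>\<^bsub>G2\<^esub>), (True, i)))) =
        (\<lambda>x. \<mu> i * unit_vec ((\<one>\<^bsub>G1\<^esub>, \<one>\<^bsub>G2\<^esub>), (True, i)) x)"
    and ev_simple: "\<lbrakk>i \<in> I; f \<in> L2 S; commut a0 b0 (commut a0 b1 f) = (\<lambda>x. \<mu> i * f x)\<rbrakk> \<Longrightarrow>
        \<exists>c. f = (\<lambda>x. c * unit_vec ((\<one>\<^bsub>G1\<^esub>, \<one>\<^bsub>G2\<^esub>), (True, i)) x)"
begin

abbreviation "ev i \<equiv> unit_vec ((one1, one2), (True, i))"
abbreviation "kv i \<equiv> unit_vec ((one1, one2), (False, i))"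

lemma ev_kv: "i \<in> I \<Longrightarrow> ev i \<in> L2 S" "i \<in> I \<Longrightarrow> kv i \<in> L2 S" by auto

lemma commut_invariant:
  assumes M: "\<And>g f. g \<in> C1 \<Longrightarrow> f \<in> M \<Longrightarrow> U1 g f \<in> M" "\<And>h f. h \<in> C2 \<Longrightarrow> f \<in> M \<Longrightarrow> U2 h f \<in> M"
    and M_L2: "M \<subseteq> L2 S" and b: "b \<in> C2" and f: "f \<in> M"
  shows "commut a0 b f \<in> M" "uinv S (commut a0 b) f \<in> M"
proof -
  show "commut a0 b f \<in> M" unfolding commut_def using M ab b f by simp
  let ?g = "U2 (inv\<^bsub>G2\<^esub> b) (U1 (inv\<^bsub>G1\<^esub> a0) (U2 b (U1 a0 f)))"
  have fL: "f \<in> L2 S" using f M_L2 by auto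
  have c1: "U1 g x \<in> L2 S" if "g \<in> C1" "x \<in> L2 S" for g x using unitary_actionD(4)[OF U1 that] .
  have c2: "U2 g x \<in> L2 S" if "g \<in> C2" "x \<in> L2 S" for g x using unitary_actionD(4)[OF U2 that] .
  have i1: "U1 g (U1 (inv\<^bsub>G1\<^esub> g) x) = x" "U1 (inv\<^bsub>G1\<^esub> g) (U1 g x) = x" if "g \<in> C1" "x \<in> L2 S" for g x
    using unitary_action_inv[OF G1.is_group U1 that] by auto
  have i2: "U2 g (U2 (inv\<^bsub>G2\<^esub> g) x) = x" "U2 (inv\<^bsub>G2\<^esub> g) (U2 g x) = x" if "g \<in> C2" "x \<in> L2 S" for g x
    using unitary_action_inv[OF G2.is_group U2 that] by auto
  have "uinv S (commut a0 b) f = ?g"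
  proof (rule uinv_eqI[OF unitary_commut[OF ab(1) b]])
    show "?g \<in> L2 S" using fL ab b by (simp add: c1 c2)
    show "commut a0 b ?g = f" unfolding commut_def using fL ab b by (simp add: c1 c2 i1 i2)
  qed
  then show "uinv S (commut a0 b) f \<in> M" using M ab b f by simp
qed

text \<open>Subtracting the known multiple of \<open>(True, i)\<close> from the image of \<open>(True, \<sigma> i)\<close> under the commutator leaves
  a nonzero multiple of \<open>(False, i)\<close>; translations then reach all other blocks.\<close>

lemma all_from_ev:
  assumes M: "\<And>g f. g \<in> C1 \<Longrightarrow> f \<in> M \<Longrightarrow> U1 g f \<in> M" "\<And>h f. h \<in> C2 \<Longrightarrow> f \<in> M \<Longrightarrow> U2 h f \<in> M"
    and lin: "\<And>f g. f \<in> M \<Longrightarrow> g \<in> M \<Longrightarrow> (\<lambda>x. f x + g x) \<in> M" "\<And>c f. f \<in> M \<Longrightarrow> (\<lambda>x. c * f x) \<in> M"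
    and M_L2: "M \<subseteq> L2 S" and e: "\<And>i. i \<in> I \<Longrightarrow> ev i \<in> M" and x: "x \<in> S"
  shows "unit_vec x \<in> M"
proof (rule spread[OF M _ x])
  fix k :: "bool \<times> 'i" assume "k \<in> UNIV \<times> I"
  then obtain t i where k: "k = (t, i)" and i: "i \<in> I" by auto
  have "kv i \<in> M"
  proof -
    have u: "unit_vec (True, \<sigma> i) \<in> L2 (UNIV \<times> I)" using \<sigma>[OF i] by simp
    have "commut a0 b0 (ev (\<sigma> i)) = emb (\<lambda>k. \<alpha> i * unit_vec (True, i) k + \<beta> i * unit_vec (False, i) k)"
      using commut_emb(1)[OF ab(1,2) u] link[OF i] by (simp add: emb_unit_vec)
    also have "\<dots> = (\<lambda>x. \<alpha> i * ev i x + \<beta> i * kv i x)"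
      by (auto simp: emb_def unit_vec_def fun_eq_iff)
    finally have "(\<lambda>x. \<alpha> i * ev i x + \<beta> i * kv i x) \<in> M"
      using commut_invariant(1)[of M b0 "ev (\<sigma> i)"] M M_L2 ab(2) e[OF \<sigma>[OF i]] by simp
    from lin(2)[OF lin(1)[OF this lin(2)[OF e[OF i], of "- \<alpha> i"]], of "inverse (\<beta> i)"]
    moreover have "(\<lambda>x. inverse (\<beta> i) * ((\<alpha> i * ev i x + \<beta> i * kv i x) + - \<alpha> i * ev i x)) = kv i"
      using nonzero(2)[OF i] by (simp add: fun_eq_iff)
    ultimately show ?thesis by simp
  qed
  then show "unit_vec ((one1, one2), k) \<in> M" using k e[OF i] by (cases t) auto
qed

text \<open>By \<open>eigenvector_dichotomy\<close> and transitivity of \<open>\<sigma>\<close>, the invariant subspace contains all the eigenvectors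
  or is orthogonal to all of them. Then it contains all unit vectors or is orthogonal to all of them.\<close>

theorem irreducible:
  assumes W: "closed_subspace (ell2 S) W"
    and inv1: "\<And>g f. g \<in> C1 \<Longrightarrow> f \<in> W \<Longrightarrow> U1 g f \<in> W" and inv2: "\<And>h f. h \<in> C2 \<Longrightarrow> f \<in> W \<Longrightarrow> U2 h f \<in> W"
  shows "W = {\<lambda>x. 0} \<or> W = L2 S"
proof -
  interpret hilbert_space "ell2 S" by (rule hilbert_space_ell2)
  note [simp del] = ell2_simps(5)
  have WL: "W \<subseteq> L2 S" using closed_subspace_subset[OF W] by simp
  have ci: "commut a0 b f \<in> W" "uinv S (commut a0 b) f \<in> W" if "b \<in> C2" "f \<in> W" for b f
    by (rule commut_invariant[of W b f], fact inv1, fact inv2, fact WL, fact that(1), fact that(2))+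
  have lin: "\<And>f g. f \<in> W \<Longrightarrow> g \<in> W \<Longrightarrow> (\<lambda>x. f x + g x) \<in> W" "\<And>c f. f \<in> W \<Longrightarrow> (\<lambda>x. c * f x) \<in> W"
    using closed_subspace_add[OF W] closed_subspace_smult[OF W] by auto
  let ?Y = "\<lambda>f. commut a0 b0 (commut a0 b1 f)"
  have uc: "unitary S (commut a0 b0)" "unitary S (commut a0 b1)" using unitary_commut ab by auto
  have Y: "unitary S ?Y" by (rule unitary_comp[OF uc])
  have dich: "ev i \<in> W \<or> (\<forall>w\<in>W. w ((one1, one2), (True, i)) = 0)" if i: "i \<in> I" for i
  proof (rule eigenvector_dichotomy[OF W Y])
    fix f assume f: "f \<in> W"
    then show "?Y f \<in> W" using ci(1) ab by blast
    have fL: "f \<in> L2 S" using f WL by auto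
    have "uinv S ?Y f = uinv S (commut a0 b1) (uinv S (commut a0 b0) f)"
      using fL uc by (intro uinv_eqI[OF Y]) (simp_all add: unitary_uinv_closed)
    then show "uinv S ?Y f \<in> W" using ci(2)[OF ab(3) ci(2)[OF ab(2) f]] by simp
  qed (use i ev_eigen ev_simple in auto)
  define N where "N = {i\<in>I. ev i \<in> W}"
  have "i \<in> N \<longleftrightarrow> \<sigma> i \<in> N" if i: "i \<in> I" for i
  proof
    assume "i \<in> N"
    then have "uinv S (commut a0 b0) (ev i) \<in> W" using ci(2)[OF ab(2)] by (simp add: N_def)
    then have "emb (V a0 b0 (unit_vec (True, i))) \<in> W"
      using commut_emb(2)[OF ab(1,2), of "unit_vec (True, i)"] i by (simp add: emb_unit_vec)
    then have "ev (\<sigma> i) \<in> W" using dich[OF \<sigma>[OF i]] link'[OF i] by (force simp: emb_def)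
    then show "\<sigma> i \<in> N" using \<sigma>[OF i] by (simp add: N_def)
  next
    assume "\<sigma> i \<in> N"
    then have "commut a0 b0 (ev (\<sigma> i)) \<in> W" using ci(1)[OF ab(2)] by (simp add: N_def)
    moreover have "commut a0 b0 (ev (\<sigma> i)) ((one1, one2), (True, i)) = \<alpha> i"
      using commut_emb(1)[OF ab(1,2), of "unit_vec (True, \<sigma> i)"] \<sigma>[OF i] link[OF i]
      by (simp add: emb_unit_vec) (simp add: emb_def unit_vec_def)
    ultimately have "ev i \<in> W" using dich[OF i] nonzero(1)[OF i] by metis
    then show "i \<in> N" using i by (simp add: N_def)
  qed
  then consider "N = {}" | "N = I" using transitive[of N] by (auto simp: N_def)
  then show ?thesis
  proof cases
    case 2
    have "unit_vec x \<in> W" if "x \<in> S" for x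
    proof (rule all_from_ev[OF _ _ _ _ WL _ that])
      show "ev i \<in> W" if "i \<in> I" for i using 2 that by (auto simp: N_def)
    qed (fact inv1 inv2 lin)+
    then show ?thesis using closed_subspace_eq_L2[OF W] by blast
  next
    case 1
    \<comment> \<open>The orthogonal complement of \<open>W\<close> is invariant as well, and in this case contains all the eigenvectors.\<close>
    define M where "M = {f\<in>L2 S. \<forall>w\<in>W. ip (ell2 S) w f = 0}"
    have "unit_vec x \<in> M" if x: "x \<in> S" for x
    proof (rule all_from_ev[OF _ _ _ _ _ _ x])
      fix g f assume g: "g \<in> C1" and f: "f \<in> M"
      have "ip (ell2 S) w (U1 g f) = 0" if w: "w \<in> W" for w
      proof -
        have wL: "w \<in> L2 S" and fL: "f \<in> L2 S" using w WL f by (auto simp: M_def)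
        have w': "U1 (inv\<^bsub>G1\<^esub> g) w \<in> W" using inv1 g w by simp
        have "ip (ell2 S) w (U1 g f) = ip (ell2 S) (U1 g (U1 (inv\<^bsub>G1\<^esub> g) w)) (U1 g f)"
          using unitary_action_inv(1)[OF G1.is_group U1 g wL] by simp
        also have "\<dots> = ip (ell2 S) (U1 (inv\<^bsub>G1\<^esub> g) w) f"
          using w' WL fL by (intro isometry_ip[OF unitary_isometry[OF unitary_actionD(1)[OF U1 g]]]) auto
        finally show ?thesis using w' f by (simp add: M_def)
      qed
      then show "U1 g f \<in> M" using f unitary_actionD(4)[OF U1 g] by (simp add: M_def)
    next
      fix g f assume g: "g \<in> C2" and f: "f \<in> M"
      have "ip (ell2 S) w (U2 g f) = 0" if w: "w \<in> W" for w
      proof -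
        have wL: "w \<in> L2 S" and fL: "f \<in> L2 S" using w WL f by (auto simp: M_def)
        have w': "U2 (inv\<^bsub>G2\<^esub> g) w \<in> W" using inv2 g w by simp
        have "ip (ell2 S) w (U2 g f) = ip (ell2 S) (U2 g (U2 (inv\<^bsub>G2\<^esub> g) w)) (U2 g f)"
          using unitary_action_inv(1)[OF G2.is_group U2 g wL] by simp
        also have "\<dots> = ip (ell2 S) (U2 (inv\<^bsub>G2\<^esub> g) w) f"
          using w' WL fL by (intro isometry_ip[OF unitary_isometry[OF unitary_actionD(1)[OF U2 g]]]) auto
        finally show ?thesis using w' f by (simp add: M_def)
      qed
      then show "U2 g f \<in> M" using f unitary_actionD(4)[OF U2 g] by (simp add: M_def)
    next
      fix f g assume "f \<in> M" "g \<in> M"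
      then have fg: "f \<in> L2 S" "g \<in> L2 S" and 0: "\<And>w. w \<in> W \<Longrightarrow> ip (ell2 S) w f = 0" "\<And>w. w \<in> W \<Longrightarrow> ip (ell2 S) w g = 0"
        by (auto simp: M_def)
      have "ip (ell2 S) w (\<lambda>x. f x + g x) = 0" if w: "w \<in> W" for w
        using ip_add_right[of f g w] fg 0[OF w] subsetD[OF WL w] by simp
      then show "(\<lambda>x. f x + g x) \<in> M" using fg by (simp add: M_def)
    next
      fix c f assume "f \<in> M"
      then have f: "f \<in> L2 S" and 0: "\<And>w. w \<in> W \<Longrightarrow> ip (ell2 S) w f = 0" by (auto simp: M_def)
      have "ip (ell2 S) w (\<lambda>x. c * f x) = 0" if w: "w \<in> W" for w
        using ip_smult_right[of w f c] f 0[OF w] subsetD[OF WL w] by simp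
      then show "(\<lambda>x. c * f x) \<in> M" using f by (simp add: M_def)
    next
      fix i assume i: "i \<in> I"
      then have "ev i \<notin> W" using 1 by (auto simp: N_def)
      then have "w ((one1, one2), (True, i)) = 0" if "w \<in> W" for w using dich[OF i] that by blast
      then have "ip (ell2 S) w (ev i) = 0" if "w \<in> W" for w
        using that i by (subst ip_unit_vec) auto
      then show "ev i \<in> M" using ev_kv(1)[OF i] by (simp add: M_def)
    qed (auto simp: M_def)
    note uM = this
    have "w = (\<lambda>x. 0)" if w: "w \<in> W" for w
    proof (rule L2_ext[of w S])
      fix x assume x: "x \<in> S"
      then have "ip (ell2 S) w (unit_vec x) = 0" using uM[OF x] w unfolding M_def by blast
      then show "w x = 0" using ip_unit_vec[OF x, of w] by simp
    qed (use w WL in auto)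
    then have "W \<subseteq> {\<lambda>x. 0}" by blast
    moreover have "(\<lambda>x. 0) \<in> W" using closed_subspace_zero[OF W] by simp
    ultimately have "W = {\<lambda>x. 0}" by blast
    then show ?thesis by blast
  qed
qed

end

section \<open>The perturbed twist\<close>

definition dsum :: "(('i \<Rightarrow> complex) \<Rightarrow> 'i \<Rightarrow> complex) \<Rightarrow> (('i \<Rightarrow> complex) \<Rightarrow> 'i \<Rightarrow> complex) \<Rightarrow>
    (bool \<times> 'i \<Rightarrow> complex) \<Rightarrow> bool \<times> 'i \<Rightarrow> complex" where
  "dsum F G = blk UNIV (\<lambda>t. if t then F else G)"

lemma dsum_apply: "dsum F G f (True, i) = F (\<lambda>i. f (True, i)) i" "dsum F G f (False, i) = G (\<lambda>i. f (False, i)) i"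
  by (simp_all add: dsum_def blk_def)

lemma unitary_dsum: "unitary I F \<Longrightarrow> unitary I G \<Longrightarrow> unitary (UNIV \<times> I) (dsum F G)"
  unfolding dsum_def by (rule unitary_blk) simp

lemma L2_bool_iff:
  "f \<in> L2 (UNIV \<times> I) \<longleftrightarrow> (\<lambda>i. f (True, i)) \<in> L2 I \<and> (\<lambda>i. f (False, i)) \<in> L2 I"
proof
  assume f: "f \<in> L2 (UNIV \<times> I)"
  show "(\<lambda>i. f (True, i)) \<in> L2 I \<and> (\<lambda>i. f (False, i)) \<in> L2 I"
    using L2_slice(1)[OF f, of True] L2_slice(1)[OF f, of False] by simp
next
  assume "(\<lambda>i. f (True, i)) \<in> L2 I \<and> (\<lambda>i. f (False, i)) \<in> L2 I"
  then have "(\<lambda>i. f (t, i)) \<in> L2 I" for t by (cases t) auto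
  then show "f \<in> L2 (UNIV \<times> I)" by (intro L2_SigmaI) auto
qed

lemma nrm_bool:
  assumes "f \<in> L2 (UNIV \<times> I)"
  shows "(nrm (UNIV \<times> I) f)\<^sup>2 = (nrm I (\<lambda>i. f (True, i)))\<^sup>2 + (nrm I (\<lambda>i. f (False, i)))\<^sup>2"
  using L2_slice(3)[OF assms] by (simp add: UNIV_bool add.commute)

text \<open>The rotation of the plane spanned by \<open>(True, i)\<close> and \<open>(False, i)\<close> with cosine \<open>c i\<close> and sine \<open>s i\<close>.\<close>

definition rot :: "('i \<Rightarrow> real) \<Rightarrow> ('i \<Rightarrow> real) \<Rightarrow> (bool \<times> 'i \<Rightarrow> complex) \<Rightarrow> bool \<times> 'i \<Rightarrow> complex" where
  "rot c s f = (\<lambda>(t, i). if t then c i * f (True, i) - s i * f (False, i)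
                         else s i * f (True, i) + c i * f (False, i))"

lemma unitary_rot:
  assumes cs: "\<And>i. (c i)\<^sup>2 + (s i)\<^sup>2 = 1" shows "unitary (UNIV \<times> I) (rot c s)"
proof -
  have pt: "(cmod (c * x - s * y))\<^sup>2 + (cmod (s * x + c * y))\<^sup>2 = (cmod x)\<^sup>2 + (cmod y)\<^sup>2"
    if cs: "c\<^sup>2 + s\<^sup>2 = 1" for c s :: real and x y :: complex
  proof -
    have "(cmod (c * x - s * y))\<^sup>2 + (cmod (s * x + c * y))\<^sup>2 =
        (c\<^sup>2 + s\<^sup>2) * ((Re x)\<^sup>2 + (Im x)\<^sup>2 + (Re y)\<^sup>2 + (Im y)\<^sup>2)"
      unfolding cmod_power2 by (simp add: power2_eq_square algebra_simps)
    then show ?thesis using cs by (simp add: cmod_power2)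
  qed
  have main: "rot c s f \<in> L2 (UNIV \<times> I) \<and> nrm (UNIV \<times> I) (rot c s f) = nrm (UNIV \<times> I) f"
    if cs: "\<And>i. (c i)\<^sup>2 + (s i)\<^sup>2 = 1" and f: "f \<in> L2 (UNIV \<times> I)" for c s :: "'a \<Rightarrow> real" and f
  proof -
    let ?T = "\<lambda>i. f (True, i)" and ?F = "\<lambda>i. f (False, i)"
    let ?T' = "\<lambda>i. c i * f (True, i) - s i * f (False, i)" and ?F' = "\<lambda>i. s i * f (True, i) + c i * f (False, i)"
    have TF: "?T \<in> L2 I" "?F \<in> L2 I" using f by (auto simp: L2_bool_iff)
    have sm: "(\<lambda>i. (cmod (?T i))\<^sup>2 + (cmod (?F i))\<^sup>2) summable_on I"
      by (intro summable_on_add L2_summable TF)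
    have eq: "(cmod (?T' i))\<^sup>2 + (cmod (?F' i))\<^sup>2 = (cmod (?T i))\<^sup>2 + (cmod (?F i))\<^sup>2" for i
      by (rule pt[OF cs])
    have le: "(cmod (?T' i))\<^sup>2 \<le> (cmod (?T i))\<^sup>2 + (cmod (?F i))\<^sup>2"
      "(cmod (?F' i))\<^sup>2 \<le> (cmod (?T i))\<^sup>2 + (cmod (?F i))\<^sup>2" for i
      using eq[of i] zero_le_power2[of "cmod (?T' i)"] zero_le_power2[of "cmod (?F' i)"] by linarith+
    have L: "?T' \<in> L2 I" "?F' \<in> L2 I"
      by (rule L2_dominated[OF _ sm le(1)], use L2_out[OF TF(1)] L2_out[OF TF(2)] in simp)
        (rule L2_dominated[OF _ sm le(2)], use L2_out[OF TF(1)] L2_out[OF TF(2)] in simp)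
    then have rL: "rot c s f \<in> L2 (UNIV \<times> I)" by (simp add: L2_bool_iff rot_def)
    have "(nrm (UNIV \<times> I) (rot c s f))\<^sup>2 = (nrm I ?T')\<^sup>2 + (nrm I ?F')\<^sup>2"
      by (subst nrm_bool[OF rL]) (simp add: rot_def)
    also have "\<dots> = (\<Sum>\<^sub>\<infinity>i\<in>I. (cmod (?T' i))\<^sup>2 + (cmod (?F' i))\<^sup>2)"
      unfolding nrm_sq by (rule infsum_add[symmetric]) (use L in \<open>auto intro: L2_summable\<close>)
    also have "\<dots> = (\<Sum>\<^sub>\<infinity>i\<in>I. (cmod (?T i))\<^sup>2 + (cmod (?F i))\<^sup>2)" by (simp only: eq)
    also have "\<dots> = (nrm I ?T)\<^sup>2 + (nrm I ?F)\<^sup>2"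
      unfolding nrm_sq by (rule infsum_add) (use TF in \<open>auto intro: L2_summable\<close>)
    also have "\<dots> = (nrm (UNIV \<times> I) f)\<^sup>2" by (rule nrm_bool[OF f, symmetric])
    finally show ?thesis using rL by (simp add: power2_eq_iff_nonneg)
  qed
  have inv: "rot c s (rot c (\<lambda>i. - s i) f) = f" for f
  proof -
    have "c i * (c i * x + s i * y) - s i * (- (s i * x) + c i * y) = ((c i)\<^sup>2 + (s i)\<^sup>2) * x" for i and x y :: complex
      by (simp add: power2_eq_square algebra_simps)
    moreover have "s i * (c i * x + s i * y) + c i * (- (s i * x) + c i * y) = ((c i)\<^sup>2 + (s i)\<^sup>2) * y" for i and x y :: complex
      by (simp add: power2_eq_square algebra_simps)
    ultimately show ?thesis
      by (auto simp: rot_def fun_eq_iff of_real_add[symmetric] of_real_power[symmetric] cs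
        simp del: of_real_add of_real_power)
  qed
  show ?thesis
  proof (rule unitaryI[where V = "rot c (\<lambda>i. - s i)"])
    show "isometry (UNIV \<times> I) (UNIV \<times> I) (rot c s)"
    proof (rule isometryI)
      show "rot c s f \<in> L2 (UNIV \<times> I)" "nrm (UNIV \<times> I) (rot c s f) = nrm (UNIV \<times> I) f"
        if "f \<in> L2 (UNIV \<times> I)" for f using main[of c s f] cs that by auto
    qed (auto simp: rot_def fun_eq_iff algebra_simps)
    show "rot c (\<lambda>i. - s i) f \<in> L2 (UNIV \<times> I)" if "f \<in> L2 (UNIV \<times> I)" for f
      using main[of c "\<lambda>i. - s i" f] cs that by simp
  qed (rule inv)
qed

lemma countable_cis_fiber:
  assumes "c \<noteq> 0" shows "countable {t. cis (c * t) = u}"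
proof (cases "{t. cis (c * t) = u} = {}")
  case False
  then obtain t0 where t0: "cis (c * t0) = u" by auto
  have "{t. cis (c * t) = u} \<subseteq> range (\<lambda>n :: int. t0 + 2 * pi * of_int n / c)"
  proof
    fix t assume "t \<in> {t. cis (c * t) = u}"
    then have "cis (c * t) = cis (c * t0)" using t0 by simp
    then have "sin (c * t) = sin (c * t0) \<and> cos (c * t) = cos (c * t0)" by (simp add: complex_eq_iff)
    then obtain n :: int where "c * t = c * t0 + 2 * pi * of_int n" by (auto simp: sin_cos_eq_iff)
    then have "t = t0 + 2 * pi * of_int n / c" using assms by (simp add: field_simps)
    then show "t \<in> range (\<lambda>n :: int. t0 + 2 * pi * of_int n / c)" by blast
  qed
  then show ?thesis by (rule countable_subset) simp
qed simp

text \<open>The unit circle is uncountable, so it stays infinite when a countable set is removed.\<close>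

lemma cis_avoids_countable:
  assumes "countable E" "countable I"
  obtains z :: "'i \<Rightarrow> complex" where "inj_on z I" "\<And>i. i \<in> I \<Longrightarrow> z i \<notin> E" "\<And>i. cmod (z i) = 1"
proof -
  define Z where "Z = {w. cmod w = 1} - E"
  have "infinite Z"
  proof
    assume "finite Z"
    then have "countable (Z \<union> E)" using assms by (simp add: countable_finite)
    then have "countable (\<Union>w\<in>Z \<union> E. {t. cis (1 * t) = w})"
      by (intro countable_UN countable_cis_fiber) auto
    moreover have "(\<Union>w\<in>Z \<union> E. {t. cis (1 * t) = w}) = UNIV" by (auto simp: Z_def)
    ultimately show False using uncountable_UNIV_real by (simp only:)
  qed
  then obtain g :: "nat \<Rightarrow> complex" where g: "inj g" "range g \<subseteq> Z"
    using infinite_countable_subset by blast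
  show thesis
  proof (rule that[of "\<lambda>i. g (to_nat_on I i)"])
    show "inj_on (\<lambda>i. g (to_nat_on I i)) I"
      using inj_on_to_nat_on[OF assms(2)] g(1) by (auto simp: inj_on_def)
  qed (use g(2) in \<open>auto simp: Z_def\<close>)
qed

text \<open>Translation by one, for a numbering of the set by the integers.\<close>

lemma transitive_permutation:
  assumes "countable I" "infinite I"
  obtains \<sigma> \<sigma>' where "\<And>i. i \<in> I \<Longrightarrow> \<sigma> i \<in> I" "\<And>i. i \<in> I \<Longrightarrow> \<sigma>' i \<in> I"
    "\<And>i. i \<in> I \<Longrightarrow> \<sigma>' (\<sigma> i) = i" "\<And>i. i \<in> I \<Longrightarrow> \<sigma> (\<sigma>' i) = i"
    "\<And>N. N \<subseteq> I \<Longrightarrow> N \<noteq> {} \<Longrightarrow> (\<And>i. i \<in> I \<Longrightarrow> i \<in> N \<longleftrightarrow> \<sigma> i \<in> N) \<Longrightarrow> N = I"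
proof -
  have i: "countable (UNIV :: int set)" "infinite (UNIV :: int set)" by (auto simp: infinite_UNIV_int)
  have "bij_betw (from_nat_into (UNIV :: int set) \<circ> to_nat_on I) I UNIV"
    using to_nat_on_infinite[OF assms] bij_betw_from_nat_into[OF i] by (rule bij_betw_trans)
  then obtain \<beta> :: "'a \<Rightarrow> int" where b: "bij_betw \<beta> I UNIV" by blast
  define \<gamma> where "\<gamma> = inv_into I \<beta>"
  have g: "\<gamma> n \<in> I" "\<beta> (\<gamma> n) = n" for n
    using b unfolding \<gamma>_def by (auto simp: bij_betw_def inv_into_into f_inv_into_f)
  have gb: "\<gamma> (\<beta> i) = i" if "i \<in> I" for i using b that unfolding \<gamma>_def by (auto simp: bij_betw_def)
  show thesis
  proof (rule that[of "\<lambda>i. \<gamma> (\<beta> i + 1)" "\<lambda>i. \<gamma> (\<beta> i - 1)"])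
    fix N assume N: "N \<subseteq> I" "N \<noteq> {}" and s: "\<And>i. i \<in> I \<Longrightarrow> i \<in> N \<longleftrightarrow> \<gamma> (\<beta> i + 1) \<in> N"
    have step: "\<gamma> n \<in> N \<longleftrightarrow> \<gamma> (n + 1) \<in> N" for n using s[OF g(1)[of n]] g(2) by simp
    obtain i where iN: "i \<in> N" using N by blast
    have "\<gamma> n \<in> N" for n
    proof (induction n rule: int_induct[where k = "\<beta> i"])
      case base
      show ?case using gb iN N by auto
    next
      case (step1 n)
      then show ?case using step by simp
    next
      case (step2 n)
      then show ?case using step[of "n - 1"] by simp
    qed
    then show "N = I" using N gb by (metis subsetI subset_antisym)
  qed (use g gb in auto)
qed

lemma L2_tensor:
  assumes f: "f \<in> L2 A" and g: "g \<in> L2 B"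
  shows "(\<lambda>(a, b). f a * g b) \<in> L2 (A \<times> B)" "nrm (A \<times> B) (\<lambda>(a, b). f a * g b) = nrm A f * nrm B g"
proof -
  have n: "nrm B (\<lambda>b. f a * g b) = nrm B g * cmod (f a)" for a by (simp add: nrm_scale mult.commute)
  show L: "(\<lambda>(a, b). f a * g b) \<in> L2 (A \<times> B)"
    by (rule L2_Sigma_le(1)[OF _ _ f, of _ _ "nrm B g"]) (use L2_out[OF f] g n in auto)
  have "(nrm (A \<times> B) (\<lambda>(a, b). f a * g b))\<^sup>2 = (\<Sum>\<^sub>\<infinity>a\<in>A. (nrm B g)\<^sup>2 * (cmod (f a))\<^sup>2)"
    unfolding L2_slice(3)[OF L] by (simp add: n power_mult_distrib)
  also have "\<dots> = (nrm A f * nrm B g)\<^sup>2"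
    by (simp add: infsum_cmult_right' nrm_sq power_mult_distrib)
  finally show "nrm (A \<times> B) (\<lambda>(a, b). f a * g b) = nrm A f * nrm B g"
    by (simp add: power2_eq_iff_nonneg)
qed

text \<open>The given family is indexed by \<open>P\<close>. Its member \<open>p\<close> is used once for each natural number \<open>m\<close>, which
  controls the size of the perturbation on that copy, and for each rational number \<open>r\<close>, which
  compensates the scalar \<open>cis t\<close> there if \<open>r\<close> is close to \<open>-t\<close>. The parameters \<open>\<sigma>\<close>, \<open>\<sigma>'\<close> and \<open>z\<close> serve the
  new summand: a transitive permutation of its index set with its inverse, and the planted eigenvalues.\<close>

locale perturbed_family = G1: group G1 + G2: group G2
  for G1 :: "('a, 'm) monoid_scheme" and G2 :: "('b, 'n) monoid_scheme" +
  fixes P :: "'p set" and A :: "'p \<Rightarrow> 'j set" and R1 R2 and a0 :: 'a and b0 b1 :: 'b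
    and \<sigma> \<sigma>' :: "('p \<times> nat \<times> rat) \<times> 'j \<Rightarrow> ('p \<times> nat \<times> rat) \<times> 'j" and z :: "('p \<times> nat \<times> rat) \<times> 'j \<Rightarrow> complex"
  assumes R1: "p \<in> P \<Longrightarrow> unitary_action G1 (A p) (R1 p)" and R2: "p \<in> P \<Longrightarrow> unitary_action G2 (A p) (R2 p)"
    and a0: "a0 \<in> carrier G1" "a0 \<noteq> \<one>\<^bsub>G1\<^esub>"
    and b0: "b0 \<in> carrier G2" "b0 \<noteq> \<one>\<^bsub>G2\<^esub>" and b1: "b1 \<in> carrier G2" "b1 \<noteq> \<one>\<^bsub>G2\<^esub>" "b0 \<noteq> b1"
begin

abbreviation "C1 \<equiv> carrier G1"
abbreviation "C2 \<equiv> carrier G2"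
abbreviation "one1 \<equiv> \<one>\<^bsub>G1\<^esub>"
abbreviation "one2 \<equiv> \<one>\<^bsub>G2\<^esub>"

definition "P' = P \<times> (UNIV :: nat set) \<times> (UNIV :: rat set)"
definition "I = Sigma P' (\<lambda>(p, m, r). A p)"
abbreviation "K \<equiv> (UNIV :: bool set) \<times> I"

text \<open>The exponent of \<open>cis t\<close> in the block \<open>V t a b\<close>.\<close>

definition tau :: "'a \<Rightarrow> 'b \<Rightarrow> real" where "tau a b = (if a = a0 \<and> b \<noteq> one2 then 1 else 0)"

text \<open>The commutator blocks of the unperturbed pair \<open>p\<close>.\<close>

definition v :: "'p \<Rightarrow> 'a \<Rightarrow> 'b \<Rightarrow> ('j \<Rightarrow> complex) \<Rightarrow> 'j \<Rightarrow> complex" where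
  "v p a b f = R2 p (inv\<^bsub>G2\<^esub> b) (R1 p (inv\<^bsub>G1\<^esub> a) (R2 p b (R1 p a f)))"

definition V0 :: "'a \<Rightarrow> 'b \<Rightarrow> (('p \<times> nat \<times> rat) \<times> 'j \<Rightarrow> complex) \<Rightarrow> ('p \<times> nat \<times> rat) \<times> 'j \<Rightarrow> complex" where
  "V0 a b = blk P' (\<lambda>(p, m, r) f j. cis (tau a b * of_rat r) * v p a b f j)"

text \<open>The sine of the angle of the perturbation is arbitrarily small on suitable copies, but never \<open>0\<close>: the
  rotation has to mix the two summands everywhere.\<close>

definition sn :: "('p \<times> nat \<times> rat) \<times> 'j \<Rightarrow> real" where "sn = (\<lambda>((p, m, r), j). 1 / (real m + 2))"
definition cs :: "('p \<times> nat \<times> rat) \<times> 'j \<Rightarrow> real" where "cs i = sqrt (1 - (sn i)\<^sup>2)"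

text \<open>The block at \<open>(a0, b0)\<close>: the old block \<open>V0 a0 b0\<close> and the permutation \<open>\<sigma>\<close> of the new summand \<open>True\<close>, mixed
  by a small rotation.\<close>

definition X :: "(bool \<times> ('p \<times> nat \<times> rat) \<times> 'j \<Rightarrow> complex) \<Rightarrow> bool \<times> ('p \<times> nat \<times> rat) \<times> 'j \<Rightarrow> complex" where
  "X f = dsum (reindex I \<sigma>') (V0 a0 b0) (rot cs sn f)"

text \<open>The product of the blocks at \<open>(a0, b1)\<close> and \<open>(a0, b0)\<close>. It is diagonal on the new summand and unperturbed
  on the old one.\<close>

definition Dg :: "(bool \<times> ('p \<times> nat \<times> rat) \<times> 'j \<Rightarrow> complex) \<Rightarrow> bool \<times> ('p \<times> nat \<times> rat) \<times> 'j \<Rightarrow> complex" where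
  "Dg = dsum (\<lambda>f i. z i * f i) (\<lambda>f. V0 a0 b1 (V0 a0 b0 f))"

definition V' :: "'a \<Rightarrow> 'b \<Rightarrow> (bool \<times> ('p \<times> nat \<times> rat) \<times> 'j \<Rightarrow> complex) \<Rightarrow> bool \<times> ('p \<times> nat \<times> rat) \<times> 'j \<Rightarrow> complex" where
  "V' a b f = (if a = a0 \<and> b = b0 then X f else if a = a0 \<and> b = b1 then Dg (uinv K X f)
     else dsum (\<lambda>f. f) (V0 a b) f)"

definition V :: "real \<Rightarrow> 'a \<Rightarrow> 'b \<Rightarrow> (bool \<times> ('p \<times> nat \<times> rat) \<times> 'j \<Rightarrow> complex) \<Rightarrow> bool \<times> ('p \<times> nat \<times> rat) \<times> 'j \<Rightarrow> complex" where
  "V t a b f = (\<lambda>k. cis (t * tau a b) * V' a b f k)"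

lemma sn_bounds: "0 < sn i" "sn i < 1"
  by (cases i; simp add: sn_def split: prod.split)+

lemma cs_sn: "(cs i)\<^sup>2 + (sn i)\<^sup>2 = 1" "0 < cs i" "1 - cs i \<le> sn i"
proof -
  have s: "0 < sn i" "sn i < 1" by (rule sn_bounds)+
  then have "(sn i)\<^sup>2 < 1" by (simp add: power_less_one_iff abs_square_less_1)
  then show "(cs i)\<^sup>2 + (sn i)\<^sup>2 = 1" "0 < cs i" by (simp_all add: cs_def)
  have "(1 - sn i)\<^sup>2 \<le> 1 - (sn i)\<^sup>2" using s by (simp add: power2_eq_square algebra_simps mult_left_le)
  then have "1 - sn i \<le> cs i" unfolding cs_def by (rule real_le_rsqrt)
  then show "1 - cs i \<le> sn i" by simp
qed

lemma unitary_v: assumes "p \<in> P" "a \<in> C1" "b \<in> C2" shows "unitary (A p) (v p a b)"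
proof -
  have "unitary (A p) (R1 p a)" "unitary (A p) (R1 p (inv\<^bsub>G1\<^esub> a))" "unitary (A p) (R2 p b)" "unitary (A p) (R2 p (inv\<^bsub>G2\<^esub> b))"
    using assms unitary_actionD(1)[OF R1[OF assms(1)]] unitary_actionD(1)[OF R2[OF assms(1)]] by auto
  from unitary_comp[OF this(4) unitary_comp[OF this(2) unitary_comp[OF this(3,1)]]]
  show ?thesis unfolding v_def[abs_def] .
qed

lemma v_one:
  assumes "p \<in> P" "f \<in> L2 (A p)"
  shows "b \<in> C2 \<Longrightarrow> v p one1 b f = f" "a \<in> C1 \<Longrightarrow> v p a one2 f = f"
  using assms unitary_actionD[OF R1[OF assms(1)]] unitary_actionD[OF R2[OF assms(1)]]
    unitary_action_inv[OF G1.is_group R1[OF assms(1)]] unitary_action_inv[OF G2.is_group R2[OF assms(1)]]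
  by (simp_all add: v_def)

lemma unitary_V0: assumes "a \<in> C1" "b \<in> C2" shows "unitary I (V0 a b)"
  unfolding I_def V0_def
proof (rule unitary_blk)
  fix p' assume "p' \<in> P'"
  then obtain p m r where p': "p' = (p, m, r)" "p \<in> P" by (auto simp: P'_def)
  show "unitary (case p' of (p, m, r) \<Rightarrow> A p) (case p' of (p, m, r) \<Rightarrow> \<lambda>f j. cis (tau a b * of_rat r) * v p a b f j)"
    unfolding p'(1) prod.case by (rule unitary_scale[OF unitary_v[OF p'(2) assms]]) simp
qed

lemma V0_one:
  assumes f: "f \<in> L2 I" shows "b \<in> C2 \<Longrightarrow> V0 one1 b f = f" "a \<in> C1 \<Longrightarrow> V0 a one2 f = f"
proof -
  have t: "tau one1 b = 0" "tau a one2 = 0" for a b using a0 by (auto simp: tau_def)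
  have *: "V0 a b f = f" if "tau a b = 0" "\<And>p f. p \<in> P \<Longrightarrow> f \<in> L2 (A p) \<Longrightarrow> v p a b f = f" for a b
  proof (rule ext, clarify)
    fix p m r j
    show "V0 a b f ((p, m, r), j) = f ((p, m, r), j)"
    proof (cases "(p, m, r) \<in> P'")
      case True
      then have "(\<lambda>j. f ((p, m, r), j)) \<in> L2 (A p)" using L2_slice(1)[OF f[unfolded I_def], of "(p, m, r)"] by simp
      then show ?thesis using True that by (simp add: V0_def blk_def P'_def)
    qed (use L2_out[OF f] in \<open>simp add: V0_def blk_def I_def\<close>)
  qed
  show "b \<in> C2 \<Longrightarrow> V0 one1 b f = f" "a \<in> C1 \<Longrightarrow> V0 a one2 f = f" by (intro * t v_one; assumption)+
qed

lemma dsum_id: "f \<in> L2 K \<Longrightarrow> (\<And>f. f \<in> L2 I \<Longrightarrow> G f = f) \<Longrightarrow> dsum (\<lambda>f. f) G f = f"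
proof (rule ext, clarify)
  fix t p m r j assume f: "f \<in> L2 K" and G: "\<And>f. f \<in> L2 I \<Longrightarrow> G f = f"
  show "dsum (\<lambda>f. f) G f (t, (p, m, r), j) = f (t, (p, m, r), j)"
    using f G[of "\<lambda>i. f (False, i)"] by (cases t) (auto simp: dsum_apply L2_bool_iff)
qed

end

text \<open>The conditions on the new parameters that make the perturbed blocks unitary.\<close>

locale perturbation = perturbed_family +
  assumes \<sigma>: "i \<in> I \<Longrightarrow> \<sigma> i \<in> I" "i \<in> I \<Longrightarrow> \<sigma>' i \<in> I" "i \<in> I \<Longrightarrow> \<sigma>' (\<sigma> i) = i" "i \<in> I \<Longrightarrow> \<sigma> (\<sigma>' i) = i"
    and z: "cmod (z i) = 1"
begin

lemma unitary_X: "unitary K X"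
proof -
  have "bij_betw \<sigma>' I I" by (rule bij_betwI[where g = \<sigma>]) (use \<sigma> in auto)
  then have "unitary I (reindex I \<sigma>')" unfolding reindex_def[abs_def] by (rule unitary_reindex)
  from unitary_comp[OF unitary_dsum[OF this unitary_V0[OF a0(1) b0(1)]] unitary_rot[OF cs_sn(1)]]
  show ?thesis unfolding X_def[abs_def] .
qed

lemma unitary_Dg: "unitary K Dg"
  unfolding Dg_def
  by (rule unitary_dsum[OF unitary_diag unitary_comp[OF unitary_V0[OF a0(1) b1(1)] unitary_V0[OF a0(1) b0(1)]]])
    (rule z)

lemma unitary_V': assumes ab: "a \<in> C1" "b \<in> C2" shows "unitary K (V' a b)"
proof -
  consider "a = a0 \<and> b = b0" | "a = a0 \<and> b = b1" "\<not> (a = a0 \<and> b = b0)" | "\<not> (a = a0 \<and> b = b0)" "\<not> (a = a0 \<and> b = b1)" by blast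
  then show ?thesis
  proof cases
    case 1
    then show ?thesis using unitary_X by (simp add: V'_def[abs_def])
  next
    case 2
    then have "V' a b = (\<lambda>f. Dg (uinv K X f))" by (auto simp: V'_def[abs_def])
    then show ?thesis using unitary_comp[OF unitary_Dg unitary_uinv[OF unitary_X]] by simp
  next
    case 3
    then have "V' a b = dsum (\<lambda>f. f) (V0 a b)" by (auto simp: V'_def[abs_def])
    then show ?thesis using unitary_dsum[OF unitary_id unitary_V0[OF ab]] by simp
  qed
qed

lemma unitary_V: assumes "a \<in> C1" "b \<in> C2" shows "unitary K (V t a b)"
  unfolding V_def[abs_def] by (rule unitary_scale[OF unitary_V'[OF assms]]) simp

lemma twisted_pair_V': "twisted_pair G1 G2 K V'"
proof (intro twisted_pair.intro twisted_pair_axioms.intro G1.is_group G2.is_group unitary_V')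
  show "V' one1 b f = f" if "b \<in> C2" "f \<in> L2 K" for b f
    using that a0 V0_one by (simp add: V'_def dsum_id)
  show "V' a one2 f = f" if "a \<in> C1" "f \<in> L2 K" for a f
    using that b0 b1 V0_one by (simp add: V'_def dsum_id)
qed

lemma twisted_pair_V: "twisted_pair G1 G2 K (V t)"
proof (intro twisted_pair.intro twisted_pair_axioms.intro G1.is_group G2.is_group unitary_V)
  interpret T': twisted_pair G1 G2 K V' by (rule twisted_pair_V')
  show "V t one1 b f = f" if "b \<in> C2" "f \<in> L2 K" for b f
    using that a0 T'.V_one_left by (simp add: V_def tau_def)
  show "V t a one2 f = f" if "a \<in> C1" "f \<in> L2 K" for a f
    using that T'.V_one_right by (simp add: V_def tau_def)
qed

lemma V'_scale: "a \<in> C1 \<Longrightarrow> b \<in> C2 \<Longrightarrow> f \<in> L2 K \<Longrightarrow> V' a b (\<lambda>k. c * f k) = (\<lambda>k. c * V' a b f k)"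
  by (rule unitaryD(3)[OF unitary_V'])

lemma V'i_scale: "a \<in> C1 \<Longrightarrow> b \<in> C2 \<Longrightarrow> f \<in> L2 K \<Longrightarrow>
    uinv K (V' a b) (\<lambda>k. c * f k) = (\<lambda>k. c * uinv K (V' a b) f k)"
  by (rule unitaryD(3)[OF unitary_uinv[OF unitary_V']])

lemma uinv_V:
  assumes ab: "a \<in> C1" "b \<in> C2" and f: "f \<in> L2 K"
  shows "uinv K (V t a b) f = (\<lambda>k. cis (- t * tau a b) * uinv K (V' a b) f k)"
proof (rule uinv_eqI[OF unitary_V[OF ab]])
  have i: "uinv K (V' a b) f \<in> L2 K" by (rule unitary_uinv_closed[OF unitary_V'[OF ab] f])
  show "(\<lambda>k. cis (- t * tau a b) * uinv K (V' a b) f k) \<in> L2 K" by (rule L2_scale[OF i])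
  show "V t a b (\<lambda>k. cis (- t * tau a b) * uinv K (V' a b) f k) = f"
    unfolding V_def V'_scale[OF ab i] uinv_right[OF unitary_V'[OF ab] f]
    by (simp add: mult.assoc[symmetric] cis_mult)
qed

text \<open>The exponent of \<open>cis t\<close> in the block at \<open>(a, b)\<close> of the commutator of \<open>a0\<inverse>\<close> and \<open>c\<inverse>\<close>.\<close>

definition expo where
  "expo a b c = tau (a0 \<otimes>\<^bsub>G1\<^esub> a) b - tau (a0 \<otimes>\<^bsub>G1\<^esub> a) (c \<otimes>\<^bsub>G2\<^esub> b) + tau a (c \<otimes>\<^bsub>G2\<^esub> b) - tau a b"

lemma cblock_V:
  assumes ab: "a \<in> C1" "b \<in> C2" and c: "c \<in> C2" and f: "f \<in> L2 K"
  shows "twisted_pair.cblock G1 G2 K (V t) a0 c a b f =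
    (\<lambda>k. cis (t * expo a b c) * twisted_pair.cblock G1 G2 K V' a0 c a b f k)"
proof -
  interpret T: twisted_pair G1 G2 K "V t" by (rule twisted_pair_V)
  interpret T': twisted_pair G1 G2 K V' by (rule twisted_pair_V')
  let ?a = "a0 \<otimes>\<^bsub>G1\<^esub> a" and ?c = "c \<otimes>\<^bsub>G2\<^esub> b"
  have cl: "?a \<in> C1" "?c \<in> C2" using ab c a0 by auto
  let ?f1 = "uinv K (V' a b) f"
  let ?f2 = "V' a ?c ?f1"
  let ?f3 = "uinv K (V' ?a ?c) ?f2"
  have L: "?f1 \<in> L2 K" "?f2 \<in> L2 K" "?f3 \<in> L2 K"
    using ab cl f by (auto intro: T'.V_closed T'.Vi_closed)
  have "T.cblock a0 c a b f = V t ?a b (uinv K (V t ?a ?c) (V t a ?c (\<lambda>k. cis (- t * tau a b) * ?f1 k)))"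
    unfolding T.cblock_def uinv_V[OF ab f] ..
  also have "V t a ?c (\<lambda>k. cis (- t * tau a b) * ?f1 k) = (\<lambda>k. cis (t * tau a ?c) * (cis (- t * tau a b) * ?f2 k))"
    unfolding V_def V'_scale[OF ab(1) cl(2) L(1)] ..
  also have "uinv K (V t ?a ?c) \<dots> = (\<lambda>k. cis (- t * tau ?a ?c) * (cis (t * tau a ?c) * (cis (- t * tau a b) * ?f3 k)))"
    unfolding uinv_V[OF cl L2_scale[OF L2_scale[OF L(2)]]] V'i_scale[OF cl L2_scale[OF L(2)]] V'i_scale[OF cl L(2)] ..
  also have "V t ?a b \<dots> = (\<lambda>k. cis (t * tau ?a b) * (cis (- t * tau ?a ?c) * (cis (t * tau a ?c) * (cis (- t * tau a b) * V' ?a b ?f3 k))))"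
    unfolding V_def V'_scale[OF cl(1) ab(2) L2_scale[OF L2_scale[OF L(3)]]]
      V'_scale[OF cl(1) ab(2) L2_scale[OF L(3)]] V'_scale[OF cl(1) ab(2) L(3)] ..
  also have "\<dots> = (\<lambda>k. cis (t * expo a b c) * V' ?a b ?f3 k)"
    by (simp add: mult.assoc[symmetric] cis_mult expo_def algebra_simps)
  finally show ?thesis unfolding T'.cblock_def .
qed

text \<open>The sum vanishes unless \<open>a = 1\<close> or \<open>a = a0\<close>. For \<open>a = 1\<close> and \<open>b \<noteq> 1\<close> the positive terms \<open>tau a0 b\<close>
  compensate the negative ones. For \<open>a = a0\<close> the negative terms are compensated at least in part, since
  \<open>tau a0 (c b)\<close> vanishes for at most one of \<open>c = b0\<close> and \<open>c = b1\<close>.\<close>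

lemma expo_other:
  assumes ab: "a \<in> C1" "b \<in> C2" and ne: "(a, b) \<noteq> (one1, one2)"
  shows "expo a b b0 + expo a b b1 \<noteq> - 2"
proof -
  have 1: "a0 \<otimes>\<^bsub>G1\<^esub> a = a0 \<longleftrightarrow> a = one1" using a0 ab by simp
  have 2: "\<not> (b0 \<otimes>\<^bsub>G2\<^esub> b = one2 \<and> b1 \<otimes>\<^bsub>G2\<^esub> b = one2)"
    using ab b0 b1 by (metis G2.right_cancel)
  show ?thesis using 1 2 ne a0 b0 b1 ab by (cases "a = one1"; cases "a = a0"; auto simp: expo_def tau_def)
qed

section \<open>Irreducibility for generic parameters\<close>

lemma tau_x: "tau a0 b0 = 1" "tau a0 b1 = 1" using b0 b1 by (simp_all add: tau_def)

text \<open>The vector on the left is rotated to \<open>(True, i)\<close>, which \<open>\<sigma>\<close> moves to \<open>(True, \<sigma> i)\<close>.\<close>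

lemma X_link:
  assumes i: "i \<in> I"
  shows "X (\<lambda>k. cs i * unit_vec (True, i) k - sn i * unit_vec (False, i) k) = unit_vec (True, \<sigma> i)"
proof -
  let ?f = "\<lambda>k. cs i * unit_vec (True, i) k - sn i * unit_vec (False, i) k"
  have 1: "complex_of_real (cs i) * cs i + complex_of_real (sn i) * sn i = 1"
    using arg_cong[OF cs_sn(1)[of i], of complex_of_real] by (simp add: power2_eq_square)
  have rot: "rot cs sn ?f = unit_vec (True, i)"
    using 1 by (auto simp: rot_def unit_vec_def fun_eq_iff)
  have "dsum (reindex I \<sigma>') (V0 a0 b0) (unit_vec (True, i)) (s, j) = unit_vec (True, \<sigma> i) (s, j)" for s j
  proof (cases s)
    case True
    have "\<sigma>' j = i \<longleftrightarrow> j = \<sigma> i" if "j \<in> I" using \<sigma> that i by metis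
    then show ?thesis using True \<sigma>(1)[OF i] by (auto simp: dsum_apply reindex_def unit_vec_def)
  next
    case False
    have "V0 a0 b0 (\<lambda>i. 0) = (\<lambda>i. 0)"
      by (rule isometry_zero[OF unitary_isometry[OF unitary_V0[OF a0(1) b0(1)]]])
    then show ?thesis using False by (simp add: dsum_apply unit_vec_def)
  qed
  then show ?thesis unfolding X_def rot by auto
qed

lemma X_top: "i \<in> I \<Longrightarrow> X (unit_vec (True, i)) (True, \<sigma> i) = cs i"
  using \<sigma> by (simp add: X_def dsum_apply reindex_def rot_def unit_vec_def)

lemma V_V: "f \<in> L2 K \<Longrightarrow> V t a0 b1 (V t a0 b0 f) = (\<lambda>k. cis (2 * t) * Dg f k)"
proof -
  assume f: "f \<in> L2 K"
  have Xf: "X f \<in> L2 K" by (rule unitaryD(1)[OF unitary_X f])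
  have "V t a0 b1 (V t a0 b0 f) = (\<lambda>k. cis t * V' a0 b1 (\<lambda>k. cis t * X f k) k)"
    by (simp add: V_def V'_def tau_x)
  also have "V' a0 b1 (\<lambda>k. cis t * X f k) = (\<lambda>k. cis t * V' a0 b1 (X f) k)"
    by (rule V'_scale[OF a0(1) b1(1) Xf])
  also have "V' a0 b1 (X f) = Dg f" using b1(3) f unitary_X by (auto simp: V'_def)
  finally show ?thesis by (simp add: mult.assoc[symmetric] cis_mult)
qed

text \<open>The block at \<open>(a, b)\<close> of the product of the two commutators for \<open>t = 0\<close>.\<close>

definition block where
  "block a b f = twisted_pair.cblock G1 G2 K V' a0 b0 a b (twisted_pair.cblock G1 G2 K V' a0 b1 a b f)"

lemma unitary_cblock:
  assumes "twisted_pair G1 G2 K W" "a \<in> C1" "b \<in> C2" "c \<in> C2"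
  shows "unitary K (twisted_pair.cblock G1 G2 K W a0 c a b)"
proof -
  interpret T: twisted_pair G1 G2 K W by (rule assms(1))
  have "a0 \<otimes>\<^bsub>G1\<^esub> a \<in> C1" "c \<otimes>\<^bsub>G2\<^esub> b \<in> C2" using assms a0 by auto
  then have "unitary K (W (a0 \<otimes>\<^bsub>G1\<^esub> a) b)" "unitary K (uinv K (W (a0 \<otimes>\<^bsub>G1\<^esub> a) (c \<otimes>\<^bsub>G2\<^esub> b)))"
    "unitary K (W a (c \<otimes>\<^bsub>G2\<^esub> b))" "unitary K (uinv K (W a b))"
    using assms T.V unitary_uinv by auto
  from unitary_comp[OF this(1) unitary_comp[OF this(2) unitary_comp[OF this(3,4)]]]
  show ?thesis unfolding T.cblock_def[abs_def] .
qed

lemma unitary_block: "a \<in> C1 \<Longrightarrow> b \<in> C2 \<Longrightarrow> unitary K (block a b)"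
  unfolding block_def[abs_def]
  by (rule unitary_comp[OF unitary_cblock[OF twisted_pair_V'] unitary_cblock[OF twisted_pair_V']])
    (simp_all add: b0 b1)

text \<open>The block at \<open>(1, 1)\<close> of the product of the commutators is \<open>cis (- 2 * t)\<close> times the inverse of \<open>Dg\<close>. The
  eigenvectors of \<open>Dg\<close> for \<open>z i\<close> are the multiples of \<open>(True, i)\<close>: the other \<open>z j\<close> are different, and \<open>z i\<close> is
  not an eigenvalue on the old summand. In any other block, the condition on \<open>t\<close> excludes the
  eigenvalue.\<close>

lemma irreducible_twist_V:
  assumes I: "I \<noteq> {}" and inj: "inj_on z I"
    and avoid: "\<And>i. i \<in> I \<Longrightarrow> \<not> eigenvalue I (\<lambda>f. V0 a0 b1 (V0 a0 b0 f)) (z i)"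
    and transit: "\<And>N. N \<subseteq> I \<Longrightarrow> N \<noteq> {} \<Longrightarrow> (\<And>i. i \<in> I \<Longrightarrow> i \<in> N \<longleftrightarrow> \<sigma> i \<in> N) \<Longrightarrow> N = I"
    and t: "\<And>a b i. a \<in> C1 \<Longrightarrow> b \<in> C2 \<Longrightarrow> (a, b) \<noteq> (one1, one2) \<Longrightarrow> i \<in> I \<Longrightarrow>
      \<not> eigenvalue K (block a b) (cis (- (expo a b b0 + expo a b b1 + 2) * t) * cnj (z i))"
  shows "irreducible_twist G1 G2 I (V t) a0 b0 b1 (\<lambda>i. cis (- 2 * t) * cnj (z i)) \<sigma>
    (\<lambda>i. cis (- t) * cs i) (\<lambda>i. - cis (- t) * sn i)"
proof -
  interpret T: twisted_pair G1 G2 K "V t" by (rule twisted_pair_V)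
  interpret T': twisted_pair G1 G2 K V' by (rule twisted_pair_V')
  let ?\<mu> = "\<lambda>i. cis (- 2 * t) * cnj (z i)"
  have zz: "z i * cnj (z i) = 1" for i using z[of i] complex_norm_square[of "z i"] by simp
  have X0: "V t a0 b0 f = (\<lambda>k. cis t * X f k)" for f by (simp add: V_def V'_def tau_x)
  show ?thesis
  proof (intro irreducible_twist.intro irreducible_twist_axioms.intro T.twisted_pair_axioms)
    fix i assume i: "i \<in> I"
    have ue: "unit_vec (True, i) \<in> L2 K" "unit_vec (False, i) \<in> L2 K" using i by auto
    let ?g = "\<lambda>k. cs i * unit_vec (True, i) k - sn i * unit_vec (False, i) k"
    have g: "?g \<in> L2 K" using ue by (intro L2_minus L2_scale)
    show "uinv (UNIV \<times> I) (V t a0 b0) (unit_vec (True, \<sigma> i)) =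
        (\<lambda>k. cis (- t) * cs i * unit_vec (True, i) k + - cis (- t) * sn i * unit_vec (False, i) k)"
    proof (rule uinv_eqI[OF unitary_V[OF a0(1) b0(1)]])
      have eq: "(\<lambda>k. cis (- t) * cs i * unit_vec (True, i) k + - cis (- t) * sn i * unit_vec (False, i) k) =
          (\<lambda>k. cis (- t) * ?g k)" by (simp add: fun_eq_iff algebra_simps)
      show "(\<lambda>k. cis (- t) * cs i * unit_vec (True, i) k + - cis (- t) * sn i * unit_vec (False, i) k) \<in> L2 K"
        unfolding eq by (rule L2_scale[OF g])
      show "V t a0 b0 (\<lambda>k. cis (- t) * cs i * unit_vec (True, i) k + - cis (- t) * sn i * unit_vec (False, i) k) =
          unit_vec (True, \<sigma> i)"
        unfolding eq X0 unitaryD(3)[OF unitary_X g] X_link[OF i]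
        by (simp add: mult.assoc[symmetric] cis_mult)
    qed
    show "V t a0 b0 (unit_vec (True, i)) (True, \<sigma> i) \<noteq> 0"
      unfolding X0 using X_top[OF i] cs_sn(2)[of i] by simp
    show "cis (- t) * complex_of_real (cs i) \<noteq> 0" "- cis (- t) * complex_of_real (sn i) \<noteq> 0"
      using cs_sn(2)[of i] sn_bounds(1)[of i] by auto
    have De: "Dg (unit_vec (True, i)) = (\<lambda>k. z i * unit_vec (True, i) k)"
    proof -
      have "V0 a0 b1 (V0 a0 b0 (\<lambda>i. 0)) = (\<lambda>i. 0)"
        using isometry_zero[OF unitary_isometry[OF unitary_V0[OF a0(1)]]] b0 b1 by simp
      then have "Dg (unit_vec (True, i)) (s, j) = z i * unit_vec (True, i) (s, j)" for s j
        by (cases s) (auto simp: Dg_def dsum_apply unit_vec_def)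
      then show ?thesis by auto
    qed
    let ?\<chi> = "\<lambda>k. ?\<mu> i * unit_vec (True, i) k"
    have chi: "?\<chi> \<in> L2 K" by (rule L2_scale[OF ue(1)])
    have "V t a0 b1 (V t a0 b0 ?\<chi>) = unit_vec (True, i)"
    proof -
      have "V t a0 b1 (V t a0 b0 ?\<chi>) = (\<lambda>k. cis (2 * t) * (?\<mu> i * (z i * unit_vec (True, i) k)))"
        unfolding V_V[OF chi] unitaryD(3)[OF unitary_Dg ue(1)] De ..
      also have "\<dots> = (\<lambda>k. (cis (2 * t) * cis (- 2 * t)) * (z i * cnj (z i)) * unit_vec (True, i) k)"
        by (simp add: mult_ac)
      finally show ?thesis unfolding zz cis_mult by simp
    qed
    then have "uinv K (V t a0 b1) (unit_vec (True, i)) = V t a0 b0 ?\<chi>"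
      using T.V_closed[OF a0(1) b0(1) chi] by (intro uinv_eqI[OF unitary_V[OF a0(1) b1(1)]])
    then have Vi: "uinv K (V t a0 b0) (uinv K (V t a0 b1) (unit_vec (True, i))) = ?\<chi>"
      using uinv_left[OF unitary_V[OF a0(1) b0(1)] chi] by simp
    have "T.commut a0 b0 (T.commut a0 b1 (T.emb (unit_vec (True, i)))) = T.emb ?\<chi>"
      unfolding T.commut_emb(1)[OF a0(1) b1(1) ue(1)]
        T.commut_emb(1)[OF a0(1) b0(1) T.Vi_closed[OF a0(1) b1(1) ue(1)]] Vi ..
    then show "T.commut a0 b0 (T.commut a0 b1 (unit_vec ((one1, one2), (True, i)))) =
        (\<lambda>x. ?\<mu> i * unit_vec ((one1, one2), (True, i)) x)"
      unfolding T.emb_unit_vec by (simp add: T.emb_def unit_vec_def fun_eq_iff)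
  next
    fix i f assume i: "i \<in> I" and f: "f \<in> L2 T.S"
      and ev: "T.commut a0 b0 (T.commut a0 b1 f) = (\<lambda>x. ?\<mu> i * f x)"
    let ?s = "\<lambda>a b k. f ((a, b), k)"
    have Cf: "T.commut a0 b1 f \<in> L2 T.S" by (rule unitaryD(1)[OF T.unitary_commut[OF a0(1) b1(1)] f])
    have sl: "T.cblock a0 b0 a b (T.cblock a0 b1 a b (?s a b)) = (\<lambda>k. ?\<mu> i * ?s a b k)"
      if ab: "a \<in> C1" "b \<in> C2" for a b
    proof -
      have "T.cblock a0 b0 a b (T.cblock a0 b1 a b (?s a b)) = (\<lambda>k. T.commut a0 b0 (T.commut a0 b1 f) ((a, b), k))"
        unfolding T.slice_commut[OF Cf a0(1) b0(1) ab] T.slice_commut[OF f a0(1) b1(1) ab] ..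
      then show ?thesis unfolding ev .
    qed
    have off: "?s a b = (\<lambda>k. 0)" if ab: "a \<in> C1" "b \<in> C2" "(a, b) \<noteq> (one1, one2)" for a b
    proof (rule ccontr)
      assume nz: "?s a b \<noteq> (\<lambda>k. 0)"
      have s: "?s a b \<in> L2 K" by (rule T.slice_closed[OF f ab(1,2)])
      note un = unitary_cblock[OF twisted_pair_V' ab(1,2)]
      have c1: "T'.cblock a0 b1 a b (?s a b) \<in> L2 K" by (rule unitaryD(1)[OF un[OF b1(1)] s])
      let ?e = "expo a b b0" and ?e' = "expo a b b1"
      have "T.cblock a0 b0 a b (T.cblock a0 b1 a b (?s a b)) =
          (\<lambda>k. cis (t * ?e) * (cis (t * ?e') * block a b (?s a b) k))"
        unfolding cblock_V[OF ab(1,2) b1(1) s] cblock_V[OF ab(1,2) b0(1) L2_scale[OF c1]]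
          unitaryD(3)[OF un[OF b0(1)] c1] block_def ..
      then have eq: "cis (t * ?e) * (cis (t * ?e') * block a b (?s a b) k) = ?\<mu> i * ?s a b k" for k
        by (rule fun_cong[OF trans[OF sym sl[OF ab(1,2)]]])
      have "block a b (?s a b) k = (cis (- (?e + ?e' + 2) * t) * cnj (z i)) * ?s a b k" for k
      proof -
        have "block a b (?s a b) k = cis (- (?e + ?e') * t) * (cis (t * ?e) * (cis (t * ?e') * block a b (?s a b) k))"
          by (simp add: mult.assoc[symmetric] cis_mult algebra_simps)
        also have "\<dots> = (cis (- (?e + ?e') * t) * cis (- 2 * t)) * cnj (z i) * ?s a b k"
          unfolding eq by (simp only: mult.assoc)
        finally show ?thesis unfolding cis_mult by (simp add: algebra_simps)
      qed
      then have "eigenvalue K (block a b) (cis (- (?e + ?e' + 2) * t) * cnj (z i))"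
        unfolding eigenvalue_def using s nz by (intro bexI[of _ "?s a b"]) auto
      then show False using t[OF ab i] by simp
    qed
    let ?p = "?s one1 one2"
    have p: "?p \<in> L2 K" by (rule T.slice_closed[OF f]) auto
    have c1: "uinv K (V t a0 b1) ?p \<in> L2 K" by (rule T.Vi_closed[OF a0(1) b1(1) p])
    have pe: "uinv K (V t a0 b0) (uinv K (V t a0 b1) ?p) = (\<lambda>k. ?\<mu> i * ?p k)"
      using sl[of one1 one2] unfolding T.cblock_one[OF a0(1) b1(1) p] T.cblock_one[OF a0(1) b0(1) c1] by simp
    have "V t a0 b0 (\<lambda>k. ?\<mu> i * ?p k) = uinv K (V t a0 b1) ?p"
      unfolding pe[symmetric] by (rule uinv_right[OF unitary_V[OF a0(1) b0(1)] c1])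
    then have "V t a0 b1 (V t a0 b0 (\<lambda>k. ?\<mu> i * ?p k)) = ?p"
      using uinv_right[OF unitary_V[OF a0(1) b1(1)] p] by (simp only:)
    then have pD: "(\<lambda>k. cis (2 * t) * (?\<mu> i * Dg ?p k)) = ?p"
      unfolding V_V[OF L2_scale[OF p]] unitaryD(3)[OF unitary_Dg p] .
    have Dp: "Dg ?p k = z i * ?p k" for k
    proof -
      have "?p k = cis (2 * t) * (?\<mu> i * Dg ?p k)" using fun_cong[OF pD, of k] by simp
      then have "z i * ?p k = (cis (2 * t) * cis (- 2 * t)) * (z i * cnj (z i)) * Dg ?p k"
        by (simp only: mult_ac)
      then show ?thesis unfolding zz cis_mult by simp
    qed
    have lo: "(\<lambda>j. ?p (False, j)) = (\<lambda>j. 0)"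
    proof (rule ccontr)
      assume nz: "(\<lambda>j. ?p (False, j)) \<noteq> (\<lambda>j. 0)"
      have "V0 a0 b1 (V0 a0 b0 (\<lambda>j. ?p (False, j))) = (\<lambda>j. z i * ?p (False, j))"
        using Dp[of "(False, _)"] by (auto simp: Dg_def dsum_apply fun_eq_iff)
      moreover have "(\<lambda>j. ?p (False, j)) \<in> L2 I" using p by (simp add: L2_bool_iff)
      ultimately have "eigenvalue I (\<lambda>f. V0 a0 b1 (V0 a0 b0 f)) (z i)"
        unfolding eigenvalue_def using nz by (intro bexI[of _ "\<lambda>j. ?p (False, j)"]) auto
      then show False using avoid[OF i] by simp
    qed
    have hi: "?p (True, j) = (if j = i then ?p (True, i) else 0)" for j
    proof (cases "j \<in> I")
      case True
      have "z j * ?p (True, j) = z i * ?p (True, j)" using Dp[of "(True, j)"] by (simp add: Dg_def dsum_apply)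
      then have "z j = z i \<or> ?p (True, j) = 0" by (simp add: disj_commute)
      then show ?thesis using inj i True by (auto dest: inj_onD)
    next
      case False
      then show ?thesis using L2_out[OF p, of "(True, j)"] i by auto
    qed
    have "f x = ?p (True, i) * unit_vec ((one1, one2), (True, i)) x" for x
    proof -
      obtain a b s j where x: "x = ((a, b), (s, j))" by (metis prod.exhaust)
      show ?thesis
      proof (cases "(a, b) = (one1, one2)")
        case True
        then show ?thesis using hi[of j] fun_cong[OF lo, of j] x by (cases s) (auto simp: unit_vec_def)
      next
        case False
        have "f x = 0"
        proof (cases "a \<in> C1 \<and> b \<in> C2")
          case True
          then show ?thesis using fun_cong[OF off[of a b], of "(s, j)"] False x by simp
        qed (use L2_out[OF f, of x] x in auto)
        then show ?thesis using False x by (auto simp: unit_vec_def)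
      qed
    qed
    then show "\<exists>c. f = (\<lambda>x. c * unit_vec ((one1, one2), (True, i)) x)" by blast
  qed (use I \<sigma> a0 b0 b1 transit in auto)
qed

section \<open>Approximate containment in the perturbed pair\<close>

text \<open>The inclusion of the copy \<open>q\<close> of a pair of the family into the old (\<open>False\<close>) or the new (\<open>True\<close>) summand.\<close>

definition inc :: "_ \<Rightarrow> bool \<Rightarrow> (_ \<Rightarrow> complex) \<Rightarrow> _ \<Rightarrow> complex" where
  "inc q t f = (\<lambda>(t', (q', j)). if t' = t \<and> q' = q then f j else 0)"

lemma inc_scale: "inc q t (\<lambda>j. c * f j) = (\<lambda>k. c * inc q t f k)"
  and inc_add: "inc q t (\<lambda>j. f j + g j) = (\<lambda>k. inc q t f k + inc q t g k)"
  by (auto simp: inc_def fun_eq_iff)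

lemma inc_L2:
  assumes q: "q = (p, m, r)" "p \<in> P" and f: "f \<in> L2 (A p)"
  shows "inc q t f \<in> L2 K" "nrm K (inc q t f) = nrm (A p) f"
proof -
  let ?g = "\<lambda>(q', j). if q' = q then f j else 0"
  have qP: "q \<in> P'" using q by (simp add: P'_def)
  have nz: "nrm B (\<lambda>j. ?g (q', j)) = 0" if "q' \<noteq> q" for q' B using that by simp
  have gL: "?g \<in> L2 I"
    unfolding I_def
  proof (rule L2_SigmaI)
    show "(\<lambda>j. ?g (q', j)) \<in> L2 (case q' of (p, m, r) \<Rightarrow> A p)" for q'
      using f q by (cases "q' = q") simp_all
    have "{q' \<in> P'. (nrm (case q' of (p, m, r) \<Rightarrow> A p) (\<lambda>j. ?g (q', j)))\<^sup>2 \<noteq> 0} \<subseteq> {q}"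
    proof (rule subsetI, rule ccontr)
      fix q' assume "q' \<in> {q' \<in> P'. (nrm (case q' of (p, m, r) \<Rightarrow> A p) (\<lambda>j. ?g (q', j)))\<^sup>2 \<noteq> 0}" "q' \<notin> {q}"
      then show False using nz[of q'] by (simp del: split_paired_All split_paired_Ex)
    qed
    from finite_subset[OF this]
    show "(\<lambda>q'. (nrm (case q' of (p, m, r) \<Rightarrow> A p) (\<lambda>j. ?g (q', j)))\<^sup>2) summable_on P'"
      by (intro finite_nonzero_values_imp_summable_on) blast
  qed (use qP in auto)
  have "(nrm I ?g)\<^sup>2 = (nrm (A p) f)\<^sup>2"
    unfolding I_def L2_slice(3)[OF gL[unfolded I_def]]
    by (subst infsum_single[OF qP]) (use nz q in auto)
  then have gn: "nrm I ?g = nrm (A p) f" by (simp add: power2_eq_iff_nonneg)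
  have s: "(\<lambda>i. inc q t f (s, i)) = (if s = t then ?g else (\<lambda>i. 0))" for s
    by (auto simp: inc_def fun_eq_iff)
  show L: "inc q t f \<in> L2 K" unfolding L2_bool_iff s using gL by simp
  have "(nrm K (inc q t f))\<^sup>2 = (nrm (A p) f)\<^sup>2"
    unfolding nrm_bool[OF L] s using gn by (cases t) simp_all
  then show "nrm K (inc q t f) = nrm (A p) f" by (simp add: power2_eq_iff_nonneg)
qed

lemma dsum_V0_inc:
  assumes q: "q = (p, m, r)" "p \<in> P" and f: "f \<in> L2 (A p)" and ab: "a \<in> C1" "b \<in> C2"
    and F: "F (\<lambda>i. 0) = (\<lambda>i. 0)"
  shows "dsum F (V0 a b) (inc q False f) = inc q False (\<lambda>j. cis (tau a b * of_rat r) * v p a b f j)"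
proof -
  have z: "v p' a b (\<lambda>j. 0) = (\<lambda>j. 0)" if "p' \<in> P" for p'
    by (rule isometry_zero[OF unitary_isometry[OF unitary_v[OF that ab]]])
  have s: "(\<lambda>i. inc q False f (True, i)) = (\<lambda>i. 0)" by (simp add: inc_def fun_eq_iff)
  have "dsum F (V0 a b) (inc q False f) (t, (q', j)) = inc q False (\<lambda>j. cis (tau a b * of_rat r) * v p a b f j) (t, (q', j))" for t q' j
  proof (cases t)
    case True
    then show ?thesis by (simp add: dsum_apply s F) (simp add: inc_def)
  next
    case False
    have "V0 a b (\<lambda>i. inc q False f (False, i)) (q', j) = (if q' = q then cis (tau a b * of_rat r) * v p a b f j else 0)"
    proof (cases "q' \<in> P'")
      case True
      obtain p' m' r' where q': "q' = (p', m', r')" "p' \<in> P" using True by (auto simp: P'_def)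
      show ?thesis
      proof (cases "q' = q")
        case True
        then show ?thesis using q q' \<open>q' \<in> P'\<close> by (simp add: V0_def blk_def inc_def)
      next
        case False
        then have "(\<lambda>j. inc q False f (False, q', j)) = (\<lambda>j. 0)" by (simp add: inc_def)
        then show ?thesis using False q' \<open>q' \<in> P'\<close> z by (simp add: V0_def blk_def)
      qed
    next
      case False
      then show ?thesis using q by (auto simp: V0_def blk_def P'_def)
    qed
    then show ?thesis using False by (simp add: dsum_apply) (simp add: inc_def)
  qed
  then show ?thesis by (auto simp: fun_eq_iff)
qed

text \<open>The error combines the sine and one minus the cosine, each at most \<open>1 / (m + 2)\<close>.\<close>

lemma rot_inc:
  assumes q: "q = (p, m, r)" "p \<in> P" and f: "f \<in> L2 (A p)"
  shows "nrm K (\<lambda>k. rot cs sn (inc q False f) k - inc q False f k) \<le> 2 / (real m + 2) * nrm (A p) f"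
proof -
  let ?s = "1 / (real m + 2)"
  let ?c = "sqrt (1 - ?s\<^sup>2)"
  have sq: "sn (q, j) = ?s" "cs (q, j) = ?c" for j by (simp_all add: sn_def cs_def q)
  have s: "0 < ?s" "1 - ?c \<le> ?s" "?c \<le> 1"
    using cs_sn(3)[of "(q, undefined)"] unfolding sq by auto
  have eq: "rot cs sn (inc q False f) k - inc q False f k =
      complex_of_real (- ?s) * inc q True f k + complex_of_real (?c - 1) * inc q False f k" for k
  proof -
    obtain t q' j where k: "k = (t, (q', j))" by (metis prod.exhaust)
    show ?thesis
    proof (cases "q' = q")
      case True
      then show ?thesis unfolding k True by (cases t) (simp_all add: rot_def inc_def sq algebra_simps)
    next
      case False
      then show ?thesis unfolding k by (simp add: rot_def inc_def)
    qed
  qed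
  have "nrm K (\<lambda>k. rot cs sn (inc q False f) k - inc q False f k) \<le>
      nrm K (\<lambda>k. complex_of_real (- ?s) * inc q True f k) + nrm K (\<lambda>k. complex_of_real (?c - 1) * inc q False f k)"
    unfolding eq by (intro nrm_triangle L2_scale inc_L2[OF q f])
  also have "\<dots> = (\<bar>- ?s\<bar> + \<bar>?c - 1\<bar>) * nrm (A p) f"
    unfolding nrm_scale inc_L2(2)[OF q f] norm_of_real by (simp only: distrib_right)
  also have "\<dots> \<le> (2 / (real m + 2)) * nrm (A p) f"
    using s by (intro mult_right_mono) auto
  finally show ?thesis .
qed

lemma X_inc:
  assumes q: "q = (p, m, r)" "p \<in> P" and f: "f \<in> L2 (A p)"
  shows "nrm K (\<lambda>k. X (inc q False f) k - inc q False (\<lambda>j. cis (of_rat r) * v p a0 b0 f j) k) \<le> 2 / (real m + 2) * nrm (A p) f"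
proof -
  let ?D = "dsum (reindex I \<sigma>') (V0 a0 b0)"
  have "bij_betw \<sigma>' I I" by (rule bij_betwI[where g = \<sigma>]) (use \<sigma> in auto)
  then have "unitary I (reindex I \<sigma>')" unfolding reindex_def[abs_def] by (rule unitary_reindex)
  then have D: "unitary K ?D" by (rule unitary_dsum[OF _ unitary_V0[OF a0(1) b0(1)]])
  have "?D (inc q False f) = inc q False (\<lambda>j. cis (of_rat r) * v p a0 b0 f j)"
    using dsum_V0_inc[OF q f a0(1) b0(1), of "reindex I \<sigma>'"] by (simp add: tau_x reindex_def)
  then have "(\<lambda>k. X (inc q False f) k - inc q False (\<lambda>j. cis (of_rat r) * v p a0 b0 f j) k) =
      ?D (\<lambda>k. rot cs sn (inc q False f) k - inc q False f k)"
    unfolding X_def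
    using isometry_minus[OF unitary_isometry[OF D] unitaryD(1)[OF unitary_rot[OF cs_sn(1)] inc_L2(1)[OF q f]] inc_L2(1)[OF q f]]
    by simp
  then show ?thesis
    using rot_inc[OF q f] unitaryD(4)[OF D L2_minus[OF unitaryD(1)[OF unitary_rot[OF cs_sn(1)] inc_L2(1)[OF q f]] inc_L2(1)[OF q f]]]
    by simp
qed

text \<open>Only the blocks at \<open>(a0, b0)\<close> and \<open>(a0, b1)\<close> are perturbed. The second one is \<open>Dg\<close> composed with the inverse
  of \<open>X\<close>, where \<open>Dg\<close> is unperturbed on the old summand and \<open>X\<close> is treated by \<open>X_inc\<close>.\<close>

lemma V'_inc:
  assumes q: "q = (p, m, r)" "p \<in> P" and f: "f \<in> L2 (A p)" and ab: "a \<in> C1" "b \<in> C2"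
  shows "nrm K (\<lambda>k. V' a b (inc q False f) k - inc q False (\<lambda>j. cis (tau a b * of_rat r) * v p a b f j) k)
    \<le> 2 / (real m + 2) * nrm (A p) f"
proof -
  consider "a = a0 \<and> b = b0" | "a = a0 \<and> b = b1" "\<not> (a = a0 \<and> b = b0)"
    | "\<not> (a = a0 \<and> b = b0)" "\<not> (a = a0 \<and> b = b1)" by blast
  then show ?thesis
  proof cases
    case 1
    then show ?thesis using X_inc[OF q f] by (simp add: V'_def tau_x)
  next
    case 3
    then have "V' a b (inc q False f) = inc q False (\<lambda>j. cis (tau a b * of_rat r) * v p a b f j)"
      using dsum_V0_inc[OF q f ab, of "\<lambda>f. f"] by (auto simp: V'_def)
    then show ?thesis by simp
  next
    case 2
    let ?k = "cis (of_rat r)"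
    define f' where "f' = uinv (A p) (v p a0 b0) f"
    note uv = unitary_v[OF q(2) a0(1) b0(1)]
    have f': "f' \<in> L2 (A p)" "v p a0 b0 f' = f" "nrm (A p) f' = nrm (A p) f"
      using unitary_uinv_closed[OF uv f] uinv_right[OF uv f] unitaryD(4)[OF unitary_uinv[OF uv] f]
      by (simp_all add: f'_def)
    note L = inc_L2(1)[OF q f] inc_L2(1)[OF q f'(1)]
    have XL: "uinv K X (inc q False f) \<in> L2 K" by (rule unitary_uinv_closed[OF unitary_X L(1)])
    have "nrm K (\<lambda>k. inc q False f' k - ?k * uinv K X (inc q False f) k) =
        nrm K (X (\<lambda>k. inc q False f' k - ?k * uinv K X (inc q False f) k))"
      using unitaryD(4)[OF unitary_X L2_minus[OF L(2) L2_scale[OF XL]]] by simp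
    also have "X (\<lambda>k. inc q False f' k - ?k * uinv K X (inc q False f) k) = (\<lambda>k. X (inc q False f') k - ?k * inc q False f k)"
      unfolding isometry_minus[OF unitary_isometry[OF unitary_X] L(2) L2_scale[OF XL]] unitaryD(3)[OF unitary_X XL]
        uinv_right[OF unitary_X L(1)] ..
    also have "nrm K \<dots> \<le> 2 / (real m + 2) * nrm (A p) f"
      using X_inc[OF q f'(1)] unfolding f'(2,3) inc_scale .
    finally have le: "nrm K (\<lambda>k. inc q False f' k - ?k * uinv K X (inc q False f) k) \<le> 2 / (real m + 2) * nrm (A p) f" .
    have z: "(\<lambda>i. z i * 0) = (\<lambda>i. 0)" by simp
    have "Dg (inc q False f') = inc q False (\<lambda>j. (?k * ?k) * v p a0 b1 f j)"
    proof -
      have kf: "(\<lambda>j. ?k * f j) \<in> L2 (A p)" by (rule L2_scale[OF f])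
      have "Dg (inc q False f') = dsum (\<lambda>f i. z i * f i) (V0 a0 b1) (dsum (\<lambda>f. f) (V0 a0 b0) (inc q False f'))"
        by (auto simp: Dg_def dsum_def blk_def fun_eq_iff)
      also have "dsum (\<lambda>f. f) (V0 a0 b0) (inc q False f') = inc q False (\<lambda>j. ?k * f j)"
        using dsum_V0_inc[OF q f'(1) a0(1) b0(1), of "\<lambda>f. f"] by (simp add: tau_x f'(2))
      also have "dsum (\<lambda>f i. z i * f i) (V0 a0 b1) \<dots> = inc q False (\<lambda>j. ?k * v p a0 b1 (\<lambda>j. ?k * f j) j)"
        using dsum_V0_inc[OF q kf a0(1) b1(1), of "\<lambda>f i. z i * f i"] by (simp add: tau_x)
      also have "v p a0 b1 (\<lambda>j. ?k * f j) = (\<lambda>j. ?k * v p a0 b1 f j)"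
        by (rule unitaryD(3)[OF unitary_v[OF q(2) a0(1) b1(1)] f])
      finally show ?thesis by (simp add: mult.assoc)
    qed
    then have "nrm K (\<lambda>k. inc q False (\<lambda>j. (?k * ?k) * v p a0 b1 f j) k - ?k * Dg (uinv K X (inc q False f)) k) =
        nrm K (Dg (\<lambda>k. inc q False f' k - ?k * uinv K X (inc q False f) k))"
      unfolding isometry_minus[OF unitary_isometry[OF unitary_Dg] L(2) L2_scale[OF XL]] unitaryD(3)[OF unitary_Dg XL]
      by simp
    also have "\<dots> \<le> 2 / (real m + 2) * nrm (A p) f"
      unfolding unitaryD(4)[OF unitary_Dg L2_minus[OF L(2) L2_scale[OF XL]]] by (rule le)
    also have "(\<lambda>k. inc q False (\<lambda>j. (?k * ?k) * v p a0 b1 f j) k - ?k * Dg (uinv K X (inc q False f)) k) =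
        (\<lambda>k. ?k * (inc q False (\<lambda>j. ?k * v p a0 b1 f j) k - V' a b (inc q False f) k))"
    proof -
      have "V' a b (inc q False f) = Dg (uinv K X (inc q False f))" using 2 by (auto simp: V'_def)
      then show ?thesis by (simp add: inc_scale algebra_simps)
    qed
    finally have "nrm K (\<lambda>k. inc q False (\<lambda>j. ?k * v p a0 b1 f j) k - V' a b (inc q False f) k) \<le> 2 / (real m + 2) * nrm (A p) f"
      unfolding nrm_scale by simp
    then show ?thesis using 2 by (subst nrm_minus_commute) (simp add: tau_x)
  qed
qed

lemma V_inc:
  assumes q: "q = (p, m, r)" "p \<in> P" and f: "f \<in> L2 (A p)" and ab: "a \<in> C1" "b \<in> C2"
  shows "nrm K (\<lambda>k. V t a b (inc q False f) k - inc q False (v p a b f) k)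
    \<le> (2 / (real m + 2) + cmod (cis (t + of_rat r) - 1)) * nrm (A p) f"
proof -
  let ?c = "cis (t * tau a b)" and ?k = "cis (tau a b * of_rat r)"
  have vf: "v p a b f \<in> L2 (A p)" "nrm (A p) (v p a b f) = nrm (A p) f"
    using unitaryD(1,4)[OF unitary_v[OF q(2) ab] f] by auto
  let ?g = "\<lambda>k. V' a b (inc q False f) k - inc q False (\<lambda>j. ?k * v p a b f j) k"
  have gL: "?g \<in> L2 K"
    by (intro L2_minus unitaryD(1)[OF unitary_V'[OF ab]] inc_L2[OF q] f L2_scale vf)
  have eq: "V t a b (inc q False f) k - inc q False (v p a b f) k =
      ?c * ?g k + (?c * ?k - 1) * inc q False (v p a b f) k" for k
    by (simp add: V_def inc_scale algebra_simps)
  have "nrm K (\<lambda>k. V t a b (inc q False f) k - inc q False (v p a b f) k) \<le>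
      nrm K (\<lambda>k. ?c * ?g k) + nrm K (\<lambda>k. (?c * ?k - 1) * inc q False (v p a b f) k)"
    unfolding eq by (intro nrm_triangle L2_scale gL inc_L2[OF q] vf)
  also have "\<dots> = nrm K ?g + cmod (?c * ?k - 1) * nrm (A p) f"
    unfolding nrm_scale inc_L2(2)[OF q vf(1)] vf(2) by simp
  also have "\<dots> \<le> 2 / (real m + 2) * nrm (A p) f + cmod (cis (t + of_rat r) - 1) * nrm (A p) f"
  proof (intro add_mono V'_inc q f ab mult_right_mono)
    show "cmod (?c * ?k - 1) \<le> cmod (cis (t + of_rat r) - 1)" by (simp add: tau_def cis_mult)
  qed simp
  finally show ?thesis by (simp add: distrib_right)
qed

lemma Vi_inc:
  assumes q: "q = (p, m, r)" "p \<in> P" and f: "f \<in> L2 (A p)" and ab: "a \<in> C1" "b \<in> C2"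
  shows "nrm K (\<lambda>k. uinv K (V t a b) (inc q False f) k - inc q False (uinv (A p) (v p a b) f) k)
    \<le> (2 / (real m + 2) + cmod (cis (t + of_rat r) - 1)) * nrm (A p) f"
proof -
  note uv = unitary_v[OF q(2) ab] and uV = unitary_V[OF ab, of t]
  let ?f = "uinv (A p) (v p a b) f"
  have f': "?f \<in> L2 (A p)" "nrm (A p) ?f = nrm (A p) f"
    using unitary_uinv_closed[OF uv f] unitaryD(4)[OF unitary_uinv[OF uv] f] by auto
  note L = unitary_uinv_closed[OF uV inc_L2(1)[OF q f]] inc_L2(1)[OF q f'(1)]
  have "nrm K (\<lambda>k. uinv K (V t a b) (inc q False f) k - inc q False ?f k) =
      nrm K (\<lambda>k. inc q False f k - V t a b (inc q False ?f) k)"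
    using unitaryD(4)[OF uV L2_minus[OF L]] isometry_minus[OF unitary_isometry[OF uV] L]
      uinv_right[OF uV inc_L2(1)[OF q f]] by simp
  also have "\<dots> = nrm K (\<lambda>k. V t a b (inc q False ?f) k - inc q False (v p a b ?f) k)"
    unfolding uinv_right[OF uv f] by (rule nrm_minus_commute)
  finally show ?thesis using V_inc[OF q f'(1) ab, of t] f'(2) by simp
qed

text \<open>The intertwining isometry is the tensor product of almost invariant vectors of the two groups with
  the operators \<open>R2 b\<inverse> R1 a\<inverse>\<close>. It intertwines exactly if the vectors are invariant and the blocks are
  the unperturbed ones.\<close>

lemma approx_contains_twisted:
  assumes co: "countable C1" "countable C2" and am: "amenable G1" "amenable G2" and p: "p \<in> P"
  shows "approx_contains G1 G2 ((C1 \<times> C2) \<times> K) (twisted_pair.U1 G1 G2 K) (twisted_pair.U2 G1 G2 K (V t))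
    (A p) (R1 p) (R2 p)"
  unfolding approx_contains_def
proof (intro allI impI)
  interpret T: twisted_pair G1 G2 K "V t" by (rule twisted_pair_V)
  fix F1 F2 and e :: real
  assume *: "finite F1 \<and> F1 \<subseteq> C1 \<and> finite F2 \<and> F2 \<subseteq> C2 \<and> e > 0"
  note A1 = unitary_actionD[OF R1[OF p]] and A2 = unitary_actionD[OF R2[OF p]]
  have e: "e > 0" "e / 6 > 0" "e / 12 > 0" "e / 3 > 0" and F: "finite F1" "F1 \<subseteq> C1" "finite F2" "F2 \<subseteq> C2" using * by auto
  obtain x where x: "x \<in> L2 C1" "nrm C1 x = 1"
    "\<And>g. g \<in> F1 \<Longrightarrow> nrm C1 (\<lambda>a. (if a \<in> C1 then x (inv\<^bsub>G1\<^esub> g \<otimes>\<^bsub>G1\<^esub> a) else 0) - x a) \<le> e / 3"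
    using G1.almost_invariant_vector[OF am(1) co(1) F(1,2) e(4)] by blast
  obtain y where y: "y \<in> L2 C2" "nrm C2 y = 1"
    "\<And>g. g \<in> F2 \<Longrightarrow> nrm C2 (\<lambda>b. (if b \<in> C2 then y (inv\<^bsub>G2\<^esub> g \<otimes>\<^bsub>G2\<^esub> b) else 0) - y b) \<le> e / 3"
    using G2.almost_invariant_vector[OF am(2) co(2) F(3,4) e(4)] by blast
  \<comment> \<open>A summand on which \<open>V t\<close> differs little from the untwisted, unperturbed unitaries.\<close>
  obtain m where m: "1 / real (Suc m) < e / 12" using nat_approx_posE[OF e(3)] by blast
  have m2: "2 / (real m + 2) \<le> e / 6"
  proof -
    have "2 / (real m + 2) \<le> 2 * (1 / real (Suc m))" by (simp add: field_simps)
    then show ?thesis using m by simp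
  qed
  have "(cis \<longlongrightarrow> cis 0) (at 0)" by (intro tendsto_intros)
  then obtain d where d: "d > 0" "\<And>s. s \<noteq> 0 \<Longrightarrow> \<bar>s\<bar> < d \<Longrightarrow> cmod (cis s - 1) < e / 6"
    using e(2) unfolding LIM_def dist_norm by (auto simp: cis_zero dest: spec[of _ "e / 6"])
  obtain r where r: "- t - d < of_rat r" "of_rat r < - t" using of_rat_dense[of "- t - d" "- t"] d by auto
  have r2: "cmod (cis (t + of_rat r) - 1) \<le> e / 6" using d(2)[of "t + of_rat r"] r by simp
  define q where "q = (p, m, r)"
  define \<delta> where "\<delta> = 2 / (real m + 2) + cmod (cis (t + of_rat r) - 1)"
  have \<delta>: "\<delta> \<le> e / 3" "\<delta> \<ge> 0" using m2 r2 by (auto simp: \<delta>_def)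
  note qq = q_def p
  note Vq = V_inc[OF qq, of _ _ _ t, folded \<delta>_def] and Viq = Vi_inc[OF qq, of _ _ _ t, folded \<delta>_def]
  \<comment> \<open>Applying \<open>V a b\<close> after the inverse of \<open>V a b'\<close> to \<open>\<eta> a b' f\<close> turns it into \<open>\<eta> a b (R2 p (b b'\<inverse>) f)\<close>, up to \<open>2 * \<delta>\<close>.\<close>
  define \<eta> where "\<eta> a b f = R2 p (inv\<^bsub>G2\<^esub> b) (R1 p (inv\<^bsub>G1\<^esub> a) f)" for a b f
  have eta: "\<eta> a b f \<in> L2 (A p)" "nrm (A p) (\<eta> a b f) = nrm (A p) f" if "a \<in> C1" "b \<in> C2" "f \<in> L2 (A p)" for a b f
    using that A1 A2 by (simp_all add: \<eta>_def)
  have eta_lin: "\<eta> a b (\<lambda>i. f i + g i) = (\<lambda>i. \<eta> a b f i + \<eta> a b g i)" "\<eta> a b (\<lambda>i. c * f i) = (\<lambda>i. c * \<eta> a b f i)"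
    if "a \<in> C1" "b \<in> C2" "f \<in> L2 (A p)" "g \<in> L2 (A p)" for a b f g c
  proof -
    have i: "inv\<^bsub>G1\<^esub> a \<in> C1" "inv\<^bsub>G2\<^esub> b \<in> C2" using that by auto
    note u = A1(1)[OF i(1)] A2(1)[OF i(2)]
    note L = unitaryD(1)[OF u(1) that(3)] unitaryD(1)[OF u(1) that(4)]
    show "\<eta> a b (\<lambda>i. f i + g i) = (\<lambda>i. \<eta> a b f i + \<eta> a b g i)"
      unfolding \<eta>_def unitaryD(2)[OF u(1) that(3,4)] unitaryD(2)[OF u(2) L] ..
    show "\<eta> a b (\<lambda>i. c * f i) = (\<lambda>i. c * \<eta> a b f i)"
      unfolding \<eta>_def unitaryD(3)[OF u(1) that(3)] unitaryD(3)[OF u(2) L(1)] ..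
  qed
  define w where "w = (\<lambda>(a, b). x a * y b)"
  have w: "w \<in> L2 (C1 \<times> C2)" "nrm (C1 \<times> C2) w = 1"
    using L2_tensor[OF x(1) y(1)] x(2) y(2) by (simp_all add: w_def)
  define T where "T f = (\<lambda>((a, b), k). w (a, b) * inc q False (\<eta> a b f) k)" for f
  have sl: "(\<lambda>k. T f ((a, b), k)) = (\<lambda>k. w (a, b) * inc q False (\<eta> a b f) k)" for f a b by (simp add: T_def)
  have out: "w (a, b) = 0" if "(a, b) \<notin> C1 \<times> C2" for a b using L2_out[OF w(1) that] .
  have slL: "(\<lambda>k. c * inc q False (\<eta> a b f) k) \<in> L2 K" "nrm K (\<lambda>k. c * inc q False (\<eta> a b f) k) = nrm (A p) f * cmod c"
    if "f \<in> L2 (A p)" "a \<in> C1" "b \<in> C2" for f a b c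
    using that inc_L2[OF qq eta(1)[OF that(2,3,1)]] eta(2)[OF that(2,3,1)] by (simp_all add: nrm_scale mult.commute)
  have TL: "T f \<in> L2 T.S" if f: "f \<in> L2 (A p)" for f
  proof (rule L2_Sigma_le(1)[OF _ _ w(1), of _ _ "nrm (A p) f"])
    fix qa assume "qa \<in> C1 \<times> C2"
    then obtain a b where ab: "qa = (a, b)" "a \<in> C1" "b \<in> C2" by auto
    show "(\<lambda>k. T f (qa, k)) \<in> L2 K" "nrm K (\<lambda>k. T f (qa, k)) \<le> nrm (A p) f * cmod (w qa)"
      unfolding ab(1) sl using slL[OF f ab(2,3)] by simp_all
  next
    fix qa k assume "qa \<notin> C1 \<times> C2"
    then show "T f (qa, k) = 0" using out by (cases qa) (auto simp: T_def)
  qed simp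
  have Tn: "nrm T.S (T f) = nrm (A p) f" if f: "f \<in> L2 (A p)" for f
  proof -
    have "(nrm T.S (T f))\<^sup>2 = (\<Sum>\<^sub>\<infinity>qa\<in>C1 \<times> C2. (nrm (A p) f)\<^sup>2 * (cmod (w qa))\<^sup>2)"
      unfolding L2_slice(3)[OF TL[OF f]]
    proof (rule infsum_cong)
      fix qa assume "qa \<in> C1 \<times> C2"
      then obtain a b where ab: "qa = (a, b)" "a \<in> C1" "b \<in> C2" by auto
      show "(nrm K (\<lambda>k. T f (qa, k)))\<^sup>2 = (nrm (A p) f)\<^sup>2 * (cmod (w qa))\<^sup>2"
        unfolding ab(1) sl slL(2)[OF f ab(2,3)] by (simp add: power_mult_distrib)
    qed
    also have "\<dots> = (nrm (A p) f)\<^sup>2" using w(2) by (simp add: infsum_cmult_right' nrm_sq[symmetric])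
    finally show ?thesis by (simp add: power2_eq_iff_nonneg)
  qed
  have iso: "isometry (A p) T.S T"
  proof (rule isometryI)
    fix f g assume fg: "f \<in> L2 (A p)" "g \<in> L2 (A p)"
    show "T (\<lambda>i. f i + g i) = (\<lambda>i. T f i + T g i)"
    proof (rule ext, clarify)
      fix a b s q' j
      show "T (\<lambda>i. f i + g i) ((a, b), s, q', j) = T f ((a, b), s, q', j) + T g ((a, b), s, q', j)"
        using eta_lin(1)[OF _ _ fg] out[of a b] by (cases "(a, b) \<in> C1 \<times> C2") (auto simp: T_def inc_add distrib_left)
    qed
  next
    fix c f assume f: "f \<in> L2 (A p)"
    show "T (\<lambda>i. c * f i) = (\<lambda>i. c * T f i)"
    proof (rule ext, clarify)
      fix a b s q' j
      show "T (\<lambda>i. c * f i) ((a, b), s, q', j) = c * T f ((a, b), s, q', j)"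
        using eta_lin(2)[OF _ _ f f] out[of a b] by (cases "(a, b) \<in> C1 \<times> C2") (auto simp: T_def inc_scale)
    qed
  qed (rule TL, assumption, rule Tn, assumption)
  have est1: "nrm T.S (\<lambda>i. T.U1 g (T f) i - T (R1 p g f) i) \<le> e * nrm (A p) f" if g: "g \<in> F1" and f: "f \<in> L2 (A p)" for g f
  proof -
    have gC: "g \<in> C1" using g * by auto
    have Rf: "R1 p g f \<in> L2 (A p)" "nrm (A p) (R1 p g f) = nrm (A p) f" using A1 gC f by auto
    let ?h = "\<lambda>(a, b). ((if a \<in> C1 then x (inv\<^bsub>G1\<^esub> g \<otimes>\<^bsub>G1\<^esub> a) else 0) - x a) * y b"
    have xL: "(\<lambda>a. (if a \<in> C1 then x (inv\<^bsub>G1\<^esub> g \<otimes>\<^bsub>G1\<^esub> a) else 0) - x a) \<in> L2 C1"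
    proof (rule L2_minus[OF _ x(1)])
      have "unitary_action G1 C1 (\<lambda>g. reindex C1 (\<lambda>a. inv\<^bsub>G1\<^esub> g \<otimes>\<^bsub>G1\<^esub> a))"
        by (rule unitary_action_reindex) (auto simp: G1.inv_mult_group G1.m_assoc)
      from unitary_actionD(4)[OF this gC x(1)]
      show "(\<lambda>a. if a \<in> C1 then x (inv\<^bsub>G1\<^esub> g \<otimes>\<^bsub>G1\<^esub> a) else 0) \<in> L2 C1" by (simp add: reindex_def)
    qed
    have h: "?h \<in> L2 (C1 \<times> C2)" "nrm (C1 \<times> C2) ?h \<le> e / 3"
      using L2_tensor[OF xL y(1)] x(3)[OF g] y(2) by simp_all
    let ?d = "\<lambda>i. T.U1 g (T f) i - T (R1 p g f) i"
    have UT: "T.U1 g (T f) \<in> L2 T.S" by (rule unitary_actionD(4)[OF T.U1 gC TL[OF f]])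
    have ds: "(\<lambda>k. ?d ((a, b), k)) = (\<lambda>k. ?h (a, b) * inc q False (\<eta> a b (R1 p g f)) k)" if ab: "a \<in> C1" "b \<in> C2" for a b
    proof -
      have "(\<lambda>k. T.U1 g (T f) ((a, b), k)) = (\<lambda>k. w (inv\<^bsub>G1\<^esub> g \<otimes>\<^bsub>G1\<^esub> a, b) * inc q False (\<eta> (inv\<^bsub>G1\<^esub> g \<otimes>\<^bsub>G1\<^esub> a) b f) k)"
        unfolding T.slice_U1[OF TL[OF f] gC ab] sl ..
      then have U: "T.U1 g (T f) ((a, b), k) = w (inv\<^bsub>G1\<^esub> g \<otimes>\<^bsub>G1\<^esub> a, b) * inc q False (\<eta> (inv\<^bsub>G1\<^esub> g \<otimes>\<^bsub>G1\<^esub> a) b f) k" for k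
        by (rule fun_cong)
      have e: "\<eta> (inv\<^bsub>G1\<^esub> g \<otimes>\<^bsub>G1\<^esub> a) b f = \<eta> a b (R1 p g f)"
        unfolding \<eta>_def using gC ab f A1(3)[of "inv\<^bsub>G1\<^esub> a" g f] by (simp add: G1.inv_mult_group)
      show ?thesis unfolding U e using ab by (auto simp: T_def w_def fun_eq_iff algebra_simps)
    qed
    have "nrm T.S ?d \<le> nrm (A p) f * nrm (C1 \<times> C2) ?h"
    proof (rule L2_Sigma_le(2)[OF _ _ h(1)])
      fix qa assume "qa \<in> C1 \<times> C2"
      then obtain a b where ab: "qa = (a, b)" "a \<in> C1" "b \<in> C2" by auto
      show "(\<lambda>k. ?d (qa, k)) \<in> L2 K" "nrm K (\<lambda>k. ?d (qa, k)) \<le> nrm (A p) f * cmod (?h qa)"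
        unfolding ab(1) ds[OF ab(2,3)] using slL[OF Rf(1) ab(2,3), of "?h (a, b)"] Rf(2) by simp_all
    next
      fix qa k assume "qa \<notin> C1 \<times> C2"
      then show "?d (qa, k) = 0" using L2_out[OF UT, of "(qa, k)"] L2_out[OF TL[OF Rf(1)], of "(qa, k)"] by auto
    qed simp
    also have "\<dots> \<le> nrm (A p) f * (e / 3)" using h(2) by (intro mult_left_mono) auto
    also have "\<dots> \<le> e * nrm (A p) f" using * by (simp add: mult.commute mult_right_mono)
    finally show ?thesis .
  qed
  have est2: "nrm T.S (\<lambda>i. T.U2 g (T f) i - T (R2 p g f) i) \<le> e * nrm (A p) f" if g: "g \<in> F2" and f: "f \<in> L2 (A p)" for g f
  proof -
    have gC: "g \<in> C2" using g * by auto
    have Rf: "R2 p g f \<in> L2 (A p)" "nrm (A p) (R2 p g f) = nrm (A p) f" using A2 gC f by auto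
    let ?y = "\<lambda>b. if b \<in> C2 then y (inv\<^bsub>G2\<^esub> g \<otimes>\<^bsub>G2\<^esub> b) else 0"
    have reg: "unitary_action G2 C2 (\<lambda>g. reindex C2 (\<lambda>a. inv\<^bsub>G2\<^esub> g \<otimes>\<^bsub>G2\<^esub> a))"
      by (rule unitary_action_reindex) (auto simp: G2.inv_mult_group G2.m_assoc)
    have yL: "?y \<in> L2 C2" "nrm C2 ?y = 1"
      using unitary_actionD(4,5)[OF reg gC y(1)] y(2) by (simp_all add: reindex_def)
    let ?h = "\<lambda>(a, b). x a * (?y b - y b)" and ?w = "\<lambda>(a, b). x a * ?y b"
    have h: "?h \<in> L2 (C1 \<times> C2)" "nrm (C1 \<times> C2) ?h \<le> e / 3"
      using L2_tensor[OF x(1) L2_minus[OF yL(1) y(1)]] y(3)[OF g] x(2) by simp_all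
    have wL: "?w \<in> L2 (C1 \<times> C2)" "nrm (C1 \<times> C2) ?w = 1"
      using L2_tensor[OF x(1) yL(1)] x(2) yL(2) by simp_all
    \<comment> \<open>The difference splits into the error of \<open>y\<close> (\<open>?d1\<close>) and the error of the blocks (\<open>?d2\<close>).\<close>
    let ?d1 = "\<lambda>((a, b), k). ?h (a, b) * inc q False (\<eta> a b (R2 p g f)) k"
    let ?d = "\<lambda>i. T.U2 g (T f) i - T (R2 p g f) i"
    let ?d2 = "\<lambda>i. ?d i - ?d1 i"
    have UT: "T.U2 g (T f) \<in> L2 T.S" by (rule unitary_actionD(4)[OF T.U2 gC TL[OF f]])
    have h0: "?h qa = 0" if "qa \<notin> C1 \<times> C2" for qa using L2_out[OF h(1) that] .
    have d1: "?d1 \<in> L2 T.S" "nrm T.S ?d1 \<le> nrm (A p) f * nrm (C1 \<times> C2) ?h"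
    proof -
      have le: "(\<lambda>k. ?d1 (qa, k)) \<in> L2 K \<and> nrm K (\<lambda>k. ?d1 (qa, k)) \<le> nrm (A p) f * cmod (?h qa)"
        if qa: "qa \<in> C1 \<times> C2" for qa
      proof -
        obtain a b where ab: "qa = (a, b)" "a \<in> C1" "b \<in> C2" using qa by auto
        show ?thesis
          unfolding ab(1) using slL[OF Rf(1) ab(2,3), of "?h (a, b)"] Rf(2) by simp
      qed
      have zero: "?d1 (qa, k) = 0" if "qa \<notin> C1 \<times> C2" for qa k using h0[OF that] by (cases qa) simp
      show "?d1 \<in> L2 T.S"
        by (rule L2_Sigma_le(1)[OF _ _ h(1), of _ _ "nrm (A p) f"]) (use le zero in auto)
      show "nrm T.S ?d1 \<le> nrm (A p) f * nrm (C1 \<times> C2) ?h"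
        by (rule L2_Sigma_le(2)[OF _ _ h(1)]) (use le zero in auto)
    qed
    have dL: "?d \<in> L2 T.S" by (rule L2_minus[OF UT TL[OF Rf(1)]])
    have d2L: "?d2 \<in> L2 T.S" by (rule L2_minus[OF dL d1(1)])
    have d2: "nrm T.S ?d2 \<le> (2 * \<delta> * nrm (A p) f) * nrm (C1 \<times> C2) ?w"
    proof (rule L2_Sigma_le(2)[OF _ _ wL(1)])
      fix qa assume "qa \<in> C1 \<times> C2"
      then obtain a b where ab: "qa = (a, b)" "a \<in> C1" "b \<in> C2" by auto
      show "(\<lambda>k. ?d2 (qa, k)) \<in> L2 K" using L2_slice(1)[OF d2L] \<open>qa \<in> C1 \<times> C2\<close> by simp
      let ?b = "inv\<^bsub>G2\<^esub> g \<otimes>\<^bsub>G2\<^esub> b"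
      have b': "?b \<in> C2" using gC ab by simp
      let ?f = "\<eta> a ?b f" and ?c = "w (a, ?b)"
      have fL: "?f \<in> L2 (A p)" "nrm (A p) ?f = nrm (A p) f" using eta ab b' f by auto
      note iL = inc_L2(1)[OF qq fL(1)]
      note uv = unitary_v[OF p ab(2) b']
      let ?f1 = "uinv (A p) (v p a ?b) ?f"
      have f1: "?f1 \<in> L2 (A p)" "nrm (A p) ?f1 = nrm (A p) f" "v p a ?b ?f1 = ?f"
        using unitary_uinv_closed[OF uv fL(1)] unitaryD(4)[OF unitary_uinv[OF uv] fL(1)] fL(2) uinv_right[OF uv fL(1)] by auto
      have v1: "v p a b ?f1 = \<eta> a b (R2 p g f)"
      proof -
        have "?f1 = R1 p (inv\<^bsub>G1\<^esub> a) (R2 p (inv\<^bsub>G2\<^esub> ?b) (R1 p a (R2 p ?b ?f)))"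
          by (rule uinv_eqI[OF uv])
            (use fL(1) ab b' A1 A2 unitary_action_inv[OF G1.is_group R1[OF p]] unitary_action_inv[OF G2.is_group R2[OF p]] in
              \<open>simp_all add: v_def\<close>)
        also have "R1 p a (R2 p ?b ?f) = f"
          using f ab b' A1 A2 unitary_action_inv[OF G1.is_group R1[OF p]] unitary_action_inv[OF G2.is_group R2[OF p]]
          by (simp add: \<eta>_def)
        finally have f1e: "?f1 = R1 p (inv\<^bsub>G1\<^esub> a) (R2 p (inv\<^bsub>G2\<^esub> ?b) f)" .
        have "v p a b ?f1 = R2 p (inv\<^bsub>G2\<^esub> b) (R1 p (inv\<^bsub>G1\<^esub> a) (R2 p b (R2 p (inv\<^bsub>G2\<^esub> ?b) f)))"
          unfolding f1e using f ab b' A1 A2 unitary_action_inv[OF G1.is_group R1[OF p]] by (simp add: v_def)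
        also have "R2 p b (R2 p (inv\<^bsub>G2\<^esub> ?b) f) = R2 p g f"
          using A2(3)[of b "inv\<^bsub>G2\<^esub> ?b" f] ab b' f gC by (simp add: G2.inv_mult_group G2.m_assoc[symmetric])
        finally show ?thesis by (simp add: \<eta>_def)
      qed
      let ?u = "V t a b (uinv K (V t a ?b) (inc q False ?f))"
      have "(\<lambda>k. T.U2 g (T f) ((a, b), k)) = V t a b (uinv K (V t a ?b) (\<lambda>k. ?c * inc q False ?f k))"
        unfolding T.slice_U2[OF TL[OF f] gC ab(2,3)] sl ..
      also have "\<dots> = (\<lambda>k. ?c * ?u k)"
        unfolding unitaryD(3)[OF unitary_uinv[OF unitary_V[OF ab(2) b']] iL]
          unitaryD(3)[OF unitary_V[OF ab(2,3)] T.Vi_closed[OF ab(2) b' iL]] ..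
      finally have U: "T.U2 g (T f) ((a, b), k) = ?c * ?u k" for k by (rule fun_cong)
      have c_eq: "?c = x a * ?y b" "w (a, b) = x a * y b" using ab by (simp_all add: w_def)
      have "?d2 ((a, b), k) = (x a * ?y b) * (?u k - inc q False (\<eta> a b (R2 p g f)) k)" for k
        unfolding U c_eq by (simp add: T_def w_def algebra_simps)
      then have "nrm K (\<lambda>k. ?d2 (qa, k)) = nrm K (\<lambda>k. (x a * ?y b) * (?u k - inc q False (\<eta> a b (R2 p g f)) k))"
        unfolding ab(1) by (simp only:)
      also have "\<dots> = cmod (x a * ?y b) * nrm K (\<lambda>k. ?u k - inc q False (\<eta> a b (R2 p g f)) k)" by (rule nrm_scale)
      also have "\<dots> \<le> cmod (x a * ?y b) * (2 * \<delta> * nrm (A p) f)"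
      proof (rule mult_left_mono)
        note L1 = T.Vi_closed[OF ab(2) b' iL] and L2' = inc_L2(1)[OF qq f1(1)]
        note uV = unitary_V[OF ab(2,3), of t]
        have "nrm K (\<lambda>k. ?u k - inc q False (\<eta> a b (R2 p g f)) k) \<le>
            nrm K (\<lambda>k. ?u k - V t a b (inc q False ?f1) k) + nrm K (\<lambda>k. V t a b (inc q False ?f1) k - inc q False (\<eta> a b (R2 p g f)) k)"
          by (intro nrm_diff_triangle unitaryD(1)[OF uV] L1 L2' inc_L2(1)[OF qq] eta Rf ab)
        also have "nrm K (\<lambda>k. ?u k - V t a b (inc q False ?f1) k) = nrm K (\<lambda>k. uinv K (V t a ?b) (inc q False ?f) k - inc q False ?f1 k)"
          using unitaryD(4)[OF uV L2_minus[OF L1 L2']] isometry_minus[OF unitary_isometry[OF uV] L1 L2'] by simp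
        also have "\<dots> \<le> \<delta> * nrm (A p) f" using Viq[OF fL(1) ab(2) b'] fL(2) by simp
        also have "nrm K (\<lambda>k. V t a b (inc q False ?f1) k - inc q False (\<eta> a b (R2 p g f)) k) \<le> \<delta> * nrm (A p) f"
          using Vq[OF f1(1) ab(2,3)] f1(2) v1 by simp
        finally show "nrm K (\<lambda>k. ?u k - inc q False (\<eta> a b (R2 p g f)) k) \<le> 2 * \<delta> * nrm (A p) f" by simp
      qed simp
      finally show "nrm K (\<lambda>k. ?d2 (qa, k)) \<le> 2 * \<delta> * nrm (A p) f * cmod (?w qa)"
        unfolding ab(1) by (simp add: mult.commute)
    next
      fix qa k assume "qa \<notin> C1 \<times> C2"
      then show "?d2 (qa, k) = 0" using L2_out[OF d2L, of "(qa, k)"] by auto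
    qed (use \<delta> in simp)
    have "nrm T.S ?d = nrm T.S (\<lambda>i. ?d1 i + ?d2 i)" by simp
    also have "\<dots> \<le> nrm T.S ?d1 + nrm T.S ?d2" by (rule nrm_triangle[OF d1(1) d2L])
    also have "\<dots> \<le> nrm (A p) f * (e / 3) + 2 * (e / 3) * nrm (A p) f"
    proof (rule add_mono)
      show "nrm T.S ?d1 \<le> nrm (A p) f * (e / 3)"
        using d1(2) h(2) by (intro order_trans[OF d1(2)] mult_left_mono) auto
      have "nrm T.S ?d2 \<le> 2 * \<delta> * nrm (A p) f" using d2 wL(2) by simp
      also have "\<dots> \<le> 2 * (e / 3) * nrm (A p) f" using \<delta>(1) by (intro mult_right_mono) auto
      finally show "nrm T.S ?d2 \<le> 2 * (e / 3) * nrm (A p) f" .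
    qed
    also have "\<dots> = e * nrm (A p) f" by (simp add: field_simps)
    finally show ?thesis .
  qed
  show "\<exists>T. isometry (A p) T.S T \<and>
      (\<forall>g\<in>F1. \<forall>\<xi>\<in>L2 (A p). nrm T.S (\<lambda>i. T.U1 g (T \<xi>) i - T (R1 p g \<xi>) i) \<le> e * nrm (A p) \<xi>) \<and>
      (\<forall>g\<in>F2. \<forall>\<xi>\<in>L2 (A p). nrm T.S (\<lambda>i. T.U2 g (T \<xi>) i - T (R2 p g \<xi>) i) \<le> e * nrm (A p) \<xi>)"
    using iso est1 est2 by blast
qed

end

section \<open>Primitivity\<close>

definition irreducible_pair ::
  "('a, 'm) monoid_scheme \<Rightarrow> ('b, 'n) monoid_scheme \<Rightarrow> 's set \<Rightarrow>
   ('a \<Rightarrow> ('s \<Rightarrow> complex) \<Rightarrow> 's \<Rightarrow> complex) \<Rightarrow> ('b \<Rightarrow> ('s \<Rightarrow> complex) \<Rightarrow> 's \<Rightarrow> complex) \<Rightarrow> bool" where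
  "irreducible_pair G1 G2 S U1 U2 \<longleftrightarrow> unitary_action G1 S U1 \<and> unitary_action G2 S U2 \<and>
     (\<forall>W. closed_subspace (ell2 S) W \<and> (\<forall>g\<in>carrier G1. \<forall>f\<in>W. U1 g f \<in> W) \<and>
        (\<forall>h\<in>carrier G2. \<forall>f\<in>W. U2 h f \<in> W) \<longrightarrow> W = {\<lambda>x. 0} \<or> W = L2 S)"

lemma irreducible_pair_swap: "irreducible_pair G1 G2 S U1 U2 \<Longrightarrow> irreducible_pair G2 G1 S U2 U1"
  unfolding irreducible_pair_def by blast

text \<open>The planted eigenvalues avoid the countably many eigenvalues of the old summand. Then \<open>t\<close> avoids, for each
  block other than \<open>(1, 1)\<close>, each planted eigenvalue and each eigenvalue of the block, the countable set of
  solutions of one equation for a nontrivial power of \<open>cis t\<close>.\<close>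

lemma irreducible_pair_exists:
  fixes G1 :: "('a, 'm) monoid_scheme" and G2 :: "('b, 'n) monoid_scheme"
    and P :: "'p set" and A :: "'p \<Rightarrow> 'j set"
  assumes G: "group G1" "group G2" and co: "countable (carrier G1)" "countable (carrier G2)"
    and am: "amenable G1" "amenable G2"
    and a0: "a0 \<in> carrier G1" "a0 \<noteq> \<one>\<^bsub>G1\<^esub>" and b0: "b0 \<in> carrier G2" "b0 \<noteq> \<one>\<^bsub>G2\<^esub>"
    and b1: "b1 \<in> carrier G2" "b1 \<noteq> \<one>\<^bsub>G2\<^esub>" "b0 \<noteq> b1"
    and P: "countable P" "P \<noteq> {}" and A: "\<And>p. p \<in> P \<Longrightarrow> countable (A p)" "\<And>p. p \<in> P \<Longrightarrow> A p \<noteq> {}"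
    and R1: "\<And>p. p \<in> P \<Longrightarrow> unitary_action G1 (A p) (R1 p)"
    and R2: "\<And>p. p \<in> P \<Longrightarrow> unitary_action G2 (A p) (R2 p)"
  obtains S :: "(('a \<times> 'b) \<times> bool \<times> ('p \<times> nat \<times> rat) \<times> 'j) set" and U1 U2
  where "countable S" "S \<noteq> {}" "irreducible_pair G1 G2 S U1 U2"
    "\<forall>p\<in>P. approx_contains G1 G2 S U1 U2 (A p) (R1 p) (R2 p)"
proof -
  have pf: "perturbed_family G1 G2 P A R1 R2 a0 b0 b1"
    by (intro perturbed_family.intro perturbed_family_axioms.intro G R1 R2 a0 b0 b1)
  let ?I = "perturbed_family.I P A" and ?V0 = "perturbed_family.V0 G1 G2 P R1 R2 a0"
  note I_def = perturbed_family.I_def[OF pf] perturbed_family.P'_def[OF pf]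
  have cI: "countable ?I"
    unfolding I_def using P A by (intro countable_SIGMA) auto
  have iI: "infinite ?I"
  proof
    assume fin: "finite ?I"
    obtain p j where pj: "p \<in> P" "j \<in> A p" using P A by blast
    have "range (\<lambda>m. ((p, m, 0), j)) \<subseteq> ?I" using pj by (auto simp: I_def)
    from finite_subset[OF this fin] have "finite (UNIV :: nat set)"
      by (rule finite_imageD) (auto simp: inj_on_def)
    then show False by simp
  qed
  obtain \<sigma> \<sigma>' where \<sigma>: "\<And>i. i \<in> ?I \<Longrightarrow> \<sigma> i \<in> ?I" "\<And>i. i \<in> ?I \<Longrightarrow> \<sigma>' i \<in> ?I"
    "\<And>i. i \<in> ?I \<Longrightarrow> \<sigma>' (\<sigma> i) = i" "\<And>i. i \<in> ?I \<Longrightarrow> \<sigma> (\<sigma>' i) = i"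
    and transit: "\<And>N. N \<subseteq> ?I \<Longrightarrow> N \<noteq> {} \<Longrightarrow> (\<And>i. i \<in> ?I \<Longrightarrow> i \<in> N \<longleftrightarrow> \<sigma> i \<in> N) \<Longrightarrow> N = ?I"
    using transitive_permutation[OF cI iI] by blast
  have "unitary ?I (\<lambda>f. ?V0 a0 b1 (?V0 a0 b0 f))"
    using unitary_comp[OF perturbed_family.unitary_V0[OF pf a0(1) b1(1)] perturbed_family.unitary_V0[OF pf a0(1) b0(1)]] .
  from countable_eigenvalues[OF cI this]
  obtain z where z: "inj_on z ?I" "\<And>i. i \<in> ?I \<Longrightarrow> z i \<notin> {c. eigenvalue ?I (\<lambda>f. ?V0 a0 b1 (?V0 a0 b0 f)) c}"
    "\<And>i. cmod (z i) = 1"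
    using cis_avoids_countable[OF _ cI] by blast
  interpret Q: perturbation G1 G2 P A R1 R2 a0 b0 b1 \<sigma> \<sigma>' z
    by (intro perturbation.intro pf perturbation_axioms.intro \<sigma> z(3))
  have cK: "countable (UNIV \<times> ?I :: (bool \<times> _) set)" using cI by (intro countable_SIGMA) auto
  define N where "N a b = - (Q.expo a b b0 + Q.expo a b b1 + 2)" for a b
  have N: "N a b \<noteq> 0" if "a \<in> carrier G1" "b \<in> carrier G2" "(a, b) \<noteq> (\<one>\<^bsub>G1\<^esub>, \<one>\<^bsub>G2\<^esub>)" for a b
    using Q.expo_other[OF that] by (simp add: N_def)
  define bad where "bad = (\<Union>(a, b)\<in>carrier G1 \<times> carrier G2 - {(\<one>\<^bsub>G1\<^esub>, \<one>\<^bsub>G2\<^esub>)}. \<Union>i\<in>?I.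
      \<Union>c\<in>{c. eigenvalue (UNIV \<times> ?I) (Q.block a b) c}. {t. cis (N a b * t) = c * z i})"
  have "countable bad"
    unfolding bad_def
  proof (intro countable_UN)
    show "countable (carrier G1 \<times> carrier G2 - {(\<one>\<^bsub>G1\<^esub>, \<one>\<^bsub>G2\<^esub>)})"
      using co by (intro countable_Diff countable_SIGMA)
    fix q assume "q \<in> carrier G1 \<times> carrier G2 - {(\<one>\<^bsub>G1\<^esub>, \<one>\<^bsub>G2\<^esub>)}"
    then obtain a b where q: "q = (a, b)" "a \<in> carrier G1" "b \<in> carrier G2" "(a, b) \<noteq> (\<one>\<^bsub>G1\<^esub>, \<one>\<^bsub>G2\<^esub>)" by blast
    show "countable (case q of (a, b) \<Rightarrow> \<Union>i\<in>?I.
      \<Union>c\<in>{c. eigenvalue (UNIV \<times> ?I) (Q.block a b) c}. {t. cis (N a b * t) = c * z i})"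
      unfolding q(1) prod.case
      by (intro countable_UN cI countable_eigenvalues[OF cK Q.unitary_block[OF q(2,3)]] countable_cis_fiber N q)
  qed
  then have "bad \<noteq> UNIV" using uncountable_UNIV_real by auto
  then obtain t where t: "t \<notin> bad" by blast
  have "irreducible_twist G1 G2 ?I (Q.V t) a0 b0 b1 (\<lambda>i. cis (- 2 * t) * cnj (z i)) \<sigma>
    (\<lambda>i. cis (- t) * Q.cs i) (\<lambda>i. - cis (- t) * Q.sn i)"
  proof (rule Q.irreducible_twist_V)
    show "?I \<noteq> {}" using iI by auto
    show "\<not> eigenvalue ?I (\<lambda>f. ?V0 a0 b1 (?V0 a0 b0 f)) (z i)" if "i \<in> ?I" for i
      using z(2)[OF that] by simp
    fix a b i assume ab: "a \<in> carrier G1" "b \<in> carrier G2" "(a, b) \<noteq> (\<one>\<^bsub>G1\<^esub>, \<one>\<^bsub>G2\<^esub>)" and i: "i \<in> ?I"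
    show "\<not> eigenvalue (UNIV \<times> ?I) (Q.block a b) (cis (- (Q.expo a b b0 + Q.expo a b b1 + 2) * t) * cnj (z i))"
    proof
      let ?c = "cis (- (Q.expo a b b0 + Q.expo a b b1 + 2) * t) * cnj (z i)"
      assume "eigenvalue (UNIV \<times> ?I) (Q.block a b) ?c"
      moreover have "cis (N a b * t) = ?c * z i"
        using z(3)[of i] complex_norm_square[of "z i"] by (simp add: N_def mult.assoc mult.commute[of "cnj _"])
      ultimately have "t \<in> bad"
        unfolding bad_def using ab i by (intro UN_I[of "(a, b)"]) auto
      then show False using t by simp
    qed
  qed (use z transit in auto)
  then interpret T: irreducible_twist G1 G2 ?I "Q.V t" a0 b0 b1 "\<lambda>i. cis (- 2 * t) * cnj (z i)" \<sigma>
    "\<lambda>i. cis (- t) * Q.cs i" "\<lambda>i. - cis (- t) * Q.sn i" .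
  show thesis
  proof (rule that[of T.S T.U1 T.U2])
    show "countable T.S" using co by (intro countable_SIGMA cI) auto
    show "T.S \<noteq> {}" using iI a0 b0 by fastforce
    show "irreducible_pair G1 G2 T.S T.U1 T.U2"
      unfolding irreducible_pair_def using T.U1 T.U2 T.irreducible by blast
    show "\<forall>p\<in>P. approx_contains G1 G2 T.S T.U1 T.U2 (A p) (R1 p) (R2 p)"
      using Q.approx_contains_twisted[OF co am] by blast
  qed
qed

text \<open>An isometry that almost intertwines the actions carries a vector at which \<open>f\<close> almost attains its
  universal norm to another such vector.\<close>

lemma primitive_free_productI:
  fixes G1 :: "('a, 'm) monoid_scheme" and G2 :: "('b, 'n) monoid_scheme" and S :: "'s set"
    and P :: "'p set" and A :: "'p \<Rightarrow> 'j set"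
  assumes G: "group G1" "group G2" and S: "countable S" "S \<noteq> {}"
    and irr: "irreducible_pair G1 G2 S U1 U2"
    and R: "\<And>p. p \<in> P \<Longrightarrow> unitary_action G1 (A p) (R1 p)" "\<And>p. p \<in> P \<Longrightarrow> unitary_action G2 (A p) (R2 p)"
    and norming: "\<And>f e. f \<in> carrier (group_algebra (free_product G1 G2)) \<Longrightarrow> e > 0 \<Longrightarrow>
      \<exists>p\<in>P. \<exists>\<eta>\<in>L2 (A p). \<eta> \<noteq> (\<lambda>i. 0) \<and>
        (universal_norm (group_algebra (free_product G1 G2)) f - e) * nrm (A p) \<eta> \<le>
        nrm (A p) (complex_group_algebra.algebra_action (word_action (R1 p) (R2 p)) f \<eta>)"
    and contained: "\<And>p. p \<in> P \<Longrightarrow> approx_contains G1 G2 S U1 U2 (A p) (R1 p) (R2 p)"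
  shows "primitive_c_star_algebra (full_group_c_star_algebra (free_product G1 G2))"
proof -
  let ?F = "free_product G1 G2" and ?U = "word_action U1 U2"
  interpret CGA: complex_group_algebra ?F
    by (intro complex_group_algebra.intro group_free_product G)
  have U1: "unitary_action G1 S U1" and U2: "unitary_action G2 S U2"
    using irr by (simp_all add: irreducible_pair_def)
  note U = unitary_action_free_product[OF G U1 U2]
  show ?thesis
  proof (rule CGA.primitive_full_group_c_star_algebraI[OF S U])
    fix W assume W: "closed_subspace (ell2 S) W" and inv: "\<And>g x. g \<in> carrier ?F \<Longrightarrow> x \<in> W \<Longrightarrow> ?U g x \<in> W"
    have WL: "W \<subseteq> L2 S" using hilbert_space.closed_subspace_subset[OF hilbert_space_ell2 W] by simp
    show "W = {\<lambda>i. 0} \<or> W = L2 S"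
    proof -
      have "U1 g f \<in> W" if g: "g \<in> carrier G1" and f: "f \<in> W" for g f
      proof (cases "g = \<one>\<^bsub>G1\<^esub>")
        case True
        then show ?thesis using unitary_actionD(2)[OF U1] f WL by auto
      next
        case False
        then show ?thesis using inv[OF _ f, of "[Inl g]"] g by (simp add: free_product_simps reduced_word_Cons)
      qed
      moreover have "U2 g f \<in> W" if g: "g \<in> carrier G2" and f: "f \<in> W" for g f
      proof (cases "g = \<one>\<^bsub>G2\<^esub>")
        case True
        then show ?thesis using unitary_actionD(2)[OF U2] f WL by auto
      next
        case False
        then show ?thesis using inv[OF _ f, of "[Inr g]"] g by (simp add: free_product_simps reduced_word_Cons)
      qed
      ultimately show ?thesis using irr W unfolding irreducible_pair_def by blast
    qed
  next
    fix f and e :: real assume f: "f \<in> carrier (group_algebra ?F)" and e: "e > 0"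
    then have e2: "e / 2 > 0" by simp
    let ?N = "universal_norm (group_algebra ?F)"
    obtain p \<eta> where p: "p \<in> P" and \<eta>: "\<eta> \<in> L2 (A p)" "\<eta> \<noteq> (\<lambda>i. 0)"
      and att: "(?N f - e / 2) * nrm (A p) \<eta> \<le> nrm (A p) (CGA.algebra_action (word_action (R1 p) (R2 p)) f \<eta>)"
      using norming[OF f e2] by blast
    note RP = unitary_action_free_product[OF G R(1)[OF p] R(2)[OF p]]
    let ?R = "word_action (R1 p) (R2 p)"
    obtain T where T: "isometry (A p) S T" and close: "\<And>\<xi>. \<xi> \<in> L2 (A p) \<Longrightarrow>
        nrm S (\<lambda>i. CGA.algebra_action ?U f (T \<xi>) i - T (CGA.algebra_action ?R f \<xi>) i) \<le> e / 2 * nrm (A p) \<xi>"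
      using approx_contains_algebra[OF G U1 U2 R(1)[OF p] R(2)[OF p] contained[OF p] f e2] by blast
    have v: "T \<eta> \<in> L2 S" "nrm S (T \<eta>) = nrm (A p) \<eta>" using isometryD(1,4)[OF T \<eta>(1)] by auto
    let ?Uf = "CGA.algebra_action ?U f (T \<eta>)" and ?Rf = "CGA.algebra_action ?R f \<eta>"
    have Rf: "?Rf \<in> L2 (A p)" by (rule CGA.algebra_action_closed[OF RP f \<eta>(1)])
    have TRf: "T ?Rf \<in> L2 S" "nrm S (T ?Rf) = nrm (A p) ?Rf" using isometryD(1,4)[OF T Rf] by auto
    have Uf: "?Uf \<in> L2 S" by (rule CGA.algebra_action_closed[OF U f v(1)])
    have "T ?Rf = (\<lambda>i. ?Uf i - (?Uf i - T ?Rf i))" by simp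
    then have "nrm S (T ?Rf) \<le> nrm S ?Uf + nrm S (\<lambda>i. ?Uf i - T ?Rf i)"
      using nrm_minus_le[OF Uf L2_minus[OF Uf TRf(1)]] by simp
    then have "(?N f - e / 2) * nrm (A p) \<eta> \<le> nrm S ?Uf + e / 2 * nrm (A p) \<eta>"
      using att close[OF \<eta>(1)] TRf(2) by linarith
    then have "(?N f - e) * nrm S (T \<eta>) \<le> nrm S ?Uf" by (simp add: v(2) algebra_simps)
    moreover have "T \<eta> \<noteq> (\<lambda>i. 0)"
    proof
      assume "T \<eta> = (\<lambda>i. 0)"
      then have "nrm (A p) \<eta> = 0" using v(2) by simp
      then show False using nrm_eq_0D[OF \<eta>(1)] \<eta>(2) by simp
    qed
    ultimately show "\<exists>v\<in>L2 S. v \<noteq> (\<lambda>i. 0) \<and> (?N f - e) * nrm S v \<le> nrm S (CGA.algebra_action ?U f v)"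
      using v(1) by blast
  qed
qed

text \<open>One pair for each element of a countable dense subset of the group algebra and each accuracy
  \<open>1 / (m + 1)\<close> suffices.\<close>

lemma norming_family_exists:
  fixes G1 :: "('a, 'm) monoid_scheme" and G2 :: "('b, 'n) monoid_scheme"
  defines "F \<equiv> free_product G1 G2"
  assumes G: "group G1" "group G2" and co: "countable (carrier G1)" "countable (carrier G2)"
  obtains P :: "((('a + 'b) list \<times> rat \<times> rat) list \<times> nat) set"
    and A :: "(('a + 'b) list \<times> rat \<times> rat) list \<times> nat \<Rightarrow> (nat \<Rightarrow> ('a + 'b) list \<Rightarrow> complex) set" and R1 R2
  where "countable P" "P \<noteq> {}" "\<And>p. p \<in> P \<Longrightarrow> countable (A p)" "\<And>p. p \<in> P \<Longrightarrow> A p \<noteq> {}"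
    "\<And>p. p \<in> P \<Longrightarrow> unitary_action G1 (A p) (R1 p)" "\<And>p. p \<in> P \<Longrightarrow> unitary_action G2 (A p) (R2 p)"
    "\<And>f e. f \<in> carrier (group_algebra F) \<Longrightarrow> e > 0 \<Longrightarrow>
      \<exists>p\<in>P. \<exists>\<eta>\<in>L2 (A p). \<eta> \<noteq> (\<lambda>i. 0) \<and> (universal_norm (group_algebra F) f - e) * nrm (A p) \<eta> \<le>
        nrm (A p) (complex_group_algebra.algebra_action (word_action (R1 p) (R2 p)) f \<eta>)"
proof -
  interpret CGA: complex_group_algebra F
    unfolding F_def by (intro complex_group_algebra.intro group_free_product G)
  let ?N = "universal_norm (group_algebra F)"
  define P where "P = CGA.rational_lists \<times> (UNIV :: nat set)"
  have coF: "countable (carrier F)" unfolding F_def by (rule countable_free_product[OF co])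
  have "\<forall>p. \<exists>t. p \<in> P \<longrightarrow> (case t of (A :: (nat \<Rightarrow> ('a + 'b) list \<Rightarrow> complex) set, R, \<eta>) \<Rightarrow>
      countable A \<and> A \<noteq> {} \<and> unitary_action F A R \<and> \<eta> \<in> L2 A \<and> \<eta> \<noteq> (\<lambda>i. 0) \<and>
      (?N (CGA.rational_comb (fst p)) - 1 / real (Suc (snd p))) * nrm A \<eta> \<le>
        nrm A (CGA.algebra_action R (CGA.rational_comb (fst p)) \<eta>))"
  proof (intro allI)
    fix p
    show "\<exists>t. p \<in> P \<longrightarrow> (case t of (A :: (nat \<Rightarrow> ('a + 'b) list \<Rightarrow> complex) set, R, \<eta>) \<Rightarrow>
      countable A \<and> A \<noteq> {} \<and> unitary_action F A R \<and> \<eta> \<in> L2 A \<and> \<eta> \<noteq> (\<lambda>i. 0) \<and>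
      (?N (CGA.rational_comb (fst p)) - 1 / real (Suc (snd p))) * nrm A \<eta> \<le>
        nrm A (CGA.algebra_action R (CGA.rational_comb (fst p)) \<eta>))"
    proof (cases "p \<in> P")
      case True
      then have "CGA.rational_comb (fst p) \<in> carrier (group_algebra F)"
        by (intro CGA.rational_comb_closed) (auto simp: P_def)
      from CGA.universal_norm_almost_attained[OF coF this, of "1 / real (Suc (snd p))"]
      show ?thesis by auto
    qed simp
  qed
  from choice[OF this] obtain t where t: "\<forall>p. p \<in> P \<longrightarrow> (case t p of (A :: (nat \<Rightarrow> ('a + 'b) list \<Rightarrow> complex) set, R, \<eta>) \<Rightarrow>
      countable A \<and> A \<noteq> {} \<and> unitary_action F A R \<and> \<eta> \<in> L2 A \<and> \<eta> \<noteq> (\<lambda>i. 0) \<and>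
      (?N (CGA.rational_comb (fst p)) - 1 / real (Suc (snd p))) * nrm A \<eta> \<le>
        nrm A (CGA.algebra_action R (CGA.rational_comb (fst p)) \<eta>))" by blast
  define A where "A p = fst (t p)" for p
  define R where "R p = fst (snd (t p))" for p
  define \<eta> where "\<eta> p = snd (snd (t p))" for p
  have tp: "countable (A p)" "A p \<noteq> {}" "unitary_action F (A p) (R p)" "\<eta> p \<in> L2 (A p)" "\<eta> p \<noteq> (\<lambda>i. 0)"
    "(?N (CGA.rational_comb (fst p)) - 1 / real (Suc (snd p))) * nrm (A p) (\<eta> p) \<le>
        nrm (A p) (CGA.algebra_action (R p) (CGA.rational_comb (fst p)) (\<eta> p))" if "p \<in> P" for p
    using t[rule_format, OF that] by (simp_all add: A_def R_def \<eta>_def case_prod_beta)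
  define R1 where "R1 p x = R p (emb_left G1 x)" for p x
  define R2 where "R2 p y = R p (emb_right G2 y)" for p y
  have act: "unitary_action G1 (A p) (R1 p)" "unitary_action G2 (A p) (R2 p)" if "p \<in> P" for p
    using unitary_action_restrict(1,2)[OF G, of "A p" "R p"] tp(3)[OF that]
    unfolding F_def R1_def[abs_def] R2_def[abs_def] by auto
  have word: "CGA.algebra_action (word_action (R1 p) (R2 p)) f \<xi> = CGA.algebra_action (R p) f \<xi>"
    if p: "p \<in> P" and f: "f \<in> carrier (group_algebra F)" and xi: "\<xi> \<in> L2 (A p)" for p f \<xi>
  proof -
    have "word_action (R1 p) (R2 p) w \<xi> = R p w \<xi>" if "f w \<noteq> 0" for w
    proof -
      have "reduced_word G1 G2 w" using CGA.supp(2)[OF f that] by (simp add: F_def free_product_simps)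
      from unitary_action_restrict(3)[OF G _ this xi, of "R p"] tp(3)[OF p]
      show ?thesis unfolding F_def R1_def[abs_def] R2_def[abs_def] by auto
    qed
    then show ?thesis unfolding CGA.algebra_action_def by (intro ext sum.cong) auto
  qed
  show thesis
  proof (rule that[of P A R1 R2])
    show "countable P" unfolding P_def
      by (intro countable_SIGMA CGA.countable_rational_lists coF) auto
    show "P \<noteq> {}" by (auto simp: P_def CGA.rational_lists_def)
    fix f and e :: real assume f: "f \<in> carrier (group_algebra F)" and e: "e > 0"
    then have e4: "e / 4 > 0" "e / 2 > 0" by auto
    obtain l where l: "l \<in> CGA.rational_lists" "?N (f \<ominus>\<^bsub>group_algebra F\<^esub> CGA.rational_comb l) < e / 4"
      using CGA.rational_comb_dense[OF f e4(1)] by blast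
    obtain m where m: "1 / real (Suc m) < e / 2" using nat_approx_posE[OF e4(2)] by blast
    let ?p = "(l, m)"
    have p: "?p \<in> P" using l by (simp add: P_def)
    note t' = tp[OF p]
    have "(?N f - e) * nrm (A ?p) (\<eta> ?p) \<le> (?N f - (1 / real (Suc m) + 2 * (e / 4))) * nrm (A ?p) (\<eta> ?p)"
      using m by (intro mult_right_mono) auto
    also have "\<dots> \<le> nrm (A ?p) (CGA.algebra_action (R ?p) f (\<eta> ?p))"
      using l t'(6) by (intro CGA.algebra_action_lower_bound[OF t'(1,2,3,4) f CGA.rational_comb_closed[OF l(1)]]) auto
    finally show "\<exists>p\<in>P. \<exists>\<eta>\<in>L2 (A p). \<eta> \<noteq> (\<lambda>i. 0) \<and> (?N f - e) * nrm (A p) \<eta> \<le>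
        nrm (A p) (CGA.algebra_action (word_action (R1 p) (R2 p)) f \<eta>)"
      using p t'(4,5) word[OF p f t'(4)] by (intro bexI[of _ ?p] bexI[of _ "\<eta> ?p"]) auto
  qed (use tp act in auto)
qed

lemma (in group) two_nontrivial_elements:
  assumes "infinite (carrier G) \<or> card (carrier G) > 2"
  obtains x y where "x \<in> carrier G" "x \<noteq> \<one>" "y \<in> carrier G" "y \<noteq> \<one>" "x \<noteq> y"
proof -
  have big: "\<not> carrier G \<subseteq> X" if "finite X" "card X \<le> 2" for X
    using assms that finite_subset[of "carrier G" X] card_mono[of X "carrier G"] by fastforce
  obtain x where x: "x \<in> carrier G" "x \<noteq> \<one>" using big[of "{\<one>}"] by auto
  obtain y where "y \<in> carrier G" "y \<notin> {\<one>, x}" using big[of "{\<one>, x}"] x(2)[symmetric] by auto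
  then show thesis using that[of x y] x by auto
qed

theorem theorem2:
  fixes G1 :: "('a, 'm) monoid_scheme" and G2 :: "('b, 'n) monoid_scheme"
  assumes "group G1" and "group G2"
    and "countable (carrier G1)" and "countable (carrier G2)"
    and "carrier G1 \<noteq> {\<one>\<^bsub>G1\<^esub>}" and "carrier G2 \<noteq> {\<one>\<^bsub>G2\<^esub>}"
    and "infinite (carrier G1) \<or> card (carrier G1) > 2 \<or>
         infinite (carrier G2) \<or> card (carrier G2) > 2"
    and "amenable G1" and "amenable G2"
  shows "primitive_c_star_algebra (full_group_c_star_algebra (free_product G1 G2))"
proof -
  note G = assms(1,2) and co = assms(3,4) and am = assms(8,9)
  obtain P :: "((('a + 'b) list \<times> rat \<times> rat) list \<times> nat) set"
    and A :: "(('a + 'b) list \<times> rat \<times> rat) list \<times> nat \<Rightarrow> (nat \<Rightarrow> ('a + 'b) list \<Rightarrow> complex) set" and R1 R2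
    where P: "countable P" "P \<noteq> {}" and A: "\<And>p. p \<in> P \<Longrightarrow> countable (A p)" "\<And>p. p \<in> P \<Longrightarrow> A p \<noteq> {}"
    and R: "\<And>p. p \<in> P \<Longrightarrow> unitary_action G1 (A p) (R1 p)" "\<And>p. p \<in> P \<Longrightarrow> unitary_action G2 (A p) (R2 p)"
    and norming: "\<And>f e. f \<in> carrier (group_algebra (free_product G1 G2)) \<Longrightarrow> e > 0 \<Longrightarrow>
      \<exists>p\<in>P. \<exists>\<eta>\<in>L2 (A p). \<eta> \<noteq> (\<lambda>i. 0) \<and>
        (universal_norm (group_algebra (free_product G1 G2)) f - e) * nrm (A p) \<eta> \<le>
        nrm (A p) (complex_group_algebra.algebra_action (word_action (R1 p) (R2 p)) f \<eta>)"
    using norming_family_exists[OF G co] by blast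
  have one: "\<one>\<^bsub>G1\<^esub> \<in> carrier G1" "\<one>\<^bsub>G2\<^esub> \<in> carrier G2"
    using G by (auto intro: group.is_monoid monoid.one_closed)
  obtain x y where x: "x \<in> carrier G1" "x \<noteq> \<one>\<^bsub>G1\<^esub>" and y: "y \<in> carrier G2" "y \<noteq> \<one>\<^bsub>G2\<^esub>"
    using assms(5,6) one by blast
  show ?thesis
  proof (cases "infinite (carrier G2) \<or> card (carrier G2) > 2")
    case True
    obtain b0 b1 where b: "b0 \<in> carrier G2" "b0 \<noteq> \<one>\<^bsub>G2\<^esub>" "b1 \<in> carrier G2" "b1 \<noteq> \<one>\<^bsub>G2\<^esub>" "b0 \<noteq> b1"
      by (rule group.two_nontrivial_elements[OF G(2) True])
    obtain S :: "(('a \<times> 'b) \<times> bool \<times> (((('a + 'b) list \<times> rat \<times> rat) list \<times> nat) \<times> nat \<times> rat) \<times>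
        (nat \<Rightarrow> ('a + 'b) list \<Rightarrow> complex)) set" and U1 U2
      where S: "countable S" "S \<noteq> {}" "irreducible_pair G1 G2 S U1 U2"
      and contained: "\<forall>p\<in>P. approx_contains G1 G2 S U1 U2 (A p) (R1 p) (R2 p)"
      by (rule irreducible_pair_exists[where A = A and ?R1.0 = R1 and ?R2.0 = R2, OF G co am x b P]) (erule A R | blast)+
    show ?thesis
      by (rule primitive_free_productI[OF G S R norming bspec[OF contained]])
  next
    case False
    then have "infinite (carrier G1) \<or> card (carrier G1) > 2" using assms(7) by blast
    then obtain b0 b1 where b: "b0 \<in> carrier G1" "b0 \<noteq> \<one>\<^bsub>G1\<^esub>" "b1 \<in> carrier G1" "b1 \<noteq> \<one>\<^bsub>G1\<^esub>" "b0 \<noteq> b1"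
      by (rule group.two_nontrivial_elements[OF G(1)])
    obtain S :: "(('b \<times> 'a) \<times> bool \<times> (((('a + 'b) list \<times> rat \<times> rat) list \<times> nat) \<times> nat \<times> rat) \<times>
        (nat \<Rightarrow> ('a + 'b) list \<Rightarrow> complex)) set" and U2 U1
      where S: "countable S" "S \<noteq> {}" "irreducible_pair G2 G1 S U2 U1"
      and contained: "\<forall>p\<in>P. approx_contains G2 G1 S U2 U1 (A p) (R2 p) (R1 p)"
      by (rule irreducible_pair_exists[where A = A and ?R1.0 = R2 and ?R2.0 = R1, OF G(2,1) co(2,1) am(2,1) y b P]) (erule A R | blast)+
    show ?thesis
      by (rule primitive_free_productI[OF G S(1,2) irreducible_pair_swap[OF S(3)] R norming
          approx_contains_swap[OF bspec[OF contained]]])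
  qed
qed

end
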